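(* Assume $A$ is symmetrizable and even. Let $\lambda\in P^+$ and $S\subset I$, and put $\tilde S=\{(i,1)\}_{i\in S\cap I^{re}}\sqcup\{(i,m)\}_{i\in S\cap I^{im},m\in\mathbb Z_{\ge1}}$. Then, as $\mathfrak g_S$-crystals, $$\mathbb B(\lambda)\ \cong\ \bigsqcup_{\substack{\pi\in\mathbb B(\lambda)\\ \tilde\pi\ \tilde{\mathfrak g}_{\tilde S}\text{-dominant}}}\mathbb B_S\bigl(\pi(1)\bigr),$$ where $\tilde\pi$ is the image of $\pi$ under $\mathbb B(\lambda)\to\tilde{\mathbb B}(\tilde\lambda)$, $F_{\mathbf i}\pi_\lambda\mapsto F_{(\mathbf i,\mathbf m)}\pi_{\tilde\lambda}$, and $\tilde\pi$ is $\tilde{\mathfrak g}_{\tilde S}$-dominant if $\tilde\alpha^\vee_{(i,m)}(\tilde\pi(t))\ge0$ for all $(i,m)\in\tilde S$ and $t\in[0,1]$.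
   Context: Same setting as follows. Borcherds–Cartan datum $(A,\{\alpha_i\}_{i\in I},\{\alpha_i^\vee\}_{i\in I},P,P^\vee)$: $I$ countable; $a_{ii}=2$ or $a_{ii}\in\mathbb Z_{\le0}$, $a_{ij}\in\mathbb Z_{\le0}$ ($i\neq j$), $a_{ij}=0\iff a_{ji}=0$; symmetrizable and even ($a_{ii}\in2\mathbb Z$); $\alpha_i^\vee(\alpha_j)=a_{ij}$; simple roots, coroots linearly independent; $I^{re}=\{a_{ii}=2\}$, $I^{im}=I\setminus I^{re}$. $r_i(\mu)=\mu-\alpha_i^\vee(\mu)\alpha_i$; $\mathcal W_{re}=\langle r_i:i\in I^{re}\rangle$; $\Delta^+_{re}$ positive real roots; $\Delta_{im}=\mathcal W_{re}\{\alpha_i\}_{i\in I^{im}}$; $\beta^\vee=w\alpha_i^\vee$, $r_\beta=wr_iw^{-1}$. Monoid $\mathcal W$ generated by $r_i$ with $r_i^2=1$ (real $i$), $(r_ir_j)^m=(r_jr_i)^m=1$ for real $i\ne j$ with $\mathrm{ord}(r_ir_j)=m\in\{2,3,4,6\}$, $r_ir_j=r_jr_i$ for $i\in I^{im},j\neq i,a_{ij}=0$. Order $\ge$ on $\mathcal W\lambda$, covering arrows $\xleftarrow\beta$, $a$-chains, GLS paths of shape $\lambda$ and the set $\mathbb B(\lambda)$ of them, root operators $f_i,e_i$ on piecewise-linear paths, the monoid $\mathcal F$ of the $f_i$, $F_{\mathbf i}=f_{i_k}\cdots f_{i_1}$, $\pi_\lambda(t)=t\lambda$ ($\mathbb B(\lambda)=\mathcal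 F\pi_\lambda\setminus\{\mathbf 0\}$), and the crystal structure on $\mathbb B(\lambda)$ ($\mathrm{wt}=\pi(1)$; $\varepsilon_i=-m_i^\pi$, $\varphi_i=H_i^\pi(1)-m_i^\pi$ for real $i$, where $H_i^\pi=\alpha_i^\vee\circ\pi$ and $m_i^\pi$ is the minimum of its integer values; $\varepsilon_i=0$, $\varphi_i=\alpha_i^\vee(\pi(1))$ for imaginary $i$; $f_i$ and real $e_i$ the root operators; imaginary $e_i$ the root operator cut off to $\mathbf0$ when leaving $\mathbb B(\lambda)$) are as in Joseph–Lamprou's path model: $f_i\pi$ is $\mathbf0$ if $f_+^i:=\max\{t:H_i^\pi(t)=m_i^\pi\}=1$, else it equals $\pi$ on $[0,f_+^i]$, $\pi-(H_i^\pi-m_i^\pi)\alpha_i$ on $[f_+^i,f_-^i]$ with $f_-^i=\min\{t\ge f_+^i:H_i^\pi=m_i^\pi+1\}$, $\pi-\alpha_i$ after; real $e_i$ is defined symmetrically from $e_+^i=\min\{t:H_i^\pi=m_i^\pi\}$ (zero if $e_+^i=0$), $e_-^i=\max\{t\le e_+^i:H_i^\pi=m_i^\pi+1\}$, adding $-(H_i^\pi-m_i^\pi-1)\alpha_i$ on $[e_-^i,e_+^i]$ and $\alpha_i$ after; imaginary $e_i$: $e_-^i=f_+^i$, zero if $e_-^i=1$ or $H_i^\pi<m_i^\pi+1-a_{ii}$ on $[e_-^i,1]$, else $e_+^i=\min\{t\ge e_-^i:H_i^\pi=m_i^\pi+1-a_{ii}\}$, zero if $H_i^\pi(s)\le m_i^\pi-a_{ii}$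 for some $s\ge e_+^i$, else add $\frac{1}{1-a_{ii}}(H_i^\pi-m_i^\pi)\alpha_i$ on $[e_-^i,e_+^i]$ and $\alpha_i$ after. A GLS path $(\lambda_1>\dots>\lambda_k;0=a_0<\dots<a_k=1)$ requires $\lambda_s\in\mathcal W\lambda$, an $a_s$-chain for $(\lambda_s,\lambda_{s+1})$ and a 1-chain for $(\lambda_k,\lambda)$, where an $a$-chain $\mu=\nu_0\xleftarrow{\beta_1}\cdots\xleftarrow{\beta_k}\nu_k=\nu$ consists of covering relations $\nu_{s-1}=r_{\beta_s}\nu_s$, $\beta_s^\vee(\nu_s)>0$ for the order generated by such relations, with $a\beta_s^\vee(\nu_s)\in\mathbb Z_{>0}$ (real) or $=1$ (imaginary). Levi part: $\mathfrak g_S$ is the generalized Kac–Moody algebra of the datum $((a_{ij})_{i,j\in S},\{\alpha_i\}_{i\in S},\{\alpha_i^\vee\}_{i\in S},P,P^\vee)$; $\mathbb B_S(\mu)$ is the set of GLS paths of shape $\mu$ for this datum (defined for $\mu$ with $\alpha_i^\vee(\mu)\ge0$, $i\in S$); "as $\mathfrak g_S$-crystals" means only $e_i,f_i,\varepsilon_i,\varphi_i$ for $i\in S$ and $\mathrm{wt}$ are considered. Kac–Moody side: $\tilde I=\{(i,1)\}_{i\in I^{re}}\sqcup\{(i,m)\}_{i\in I^{im},m\ge1}$, $\tilde A$ with $2$ on the diagonal and $\tilde a_{(i,m),(j,n)}=a_{ij}$ otherwise, a Cartan datum $(\tilde A,\{\tilde\alpha_{(i,m)}\},\{\tilde\alpha^\vee_{(i,m)}\},\tilde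 P,\tilde P^\vee)$, Kac–Moody algebra $\tilde{\mathfrak g}$ with Levi subalgebra $\tilde{\mathfrak g}_{\tilde S}$; $\tilde\lambda\in\tilde P$ fixed with $\tilde\alpha^\vee_{(i,m)}(\tilde\lambda)=\alpha_i^\vee(\lambda)$; $\tilde{\mathbb B}(\tilde\lambda)$ LS paths for $\tilde{\mathfrak g}$, root operators $f_{(i,m)}$. For $\mathbf i=(i_k,\ldots,i_1)$, $m_s=1$ if $i_s$ real and $m_s=\#\{t\le s:i_t=i_s\}$ if $i_s$ imaginary; $F_{(\mathbf i,\mathbf m)}=f_{(i_k,m_k)}\cdots f_{(i_1,m_1)}$. The map $F_{\mathbf i}\pi_\lambda\mapsto F_{(\mathbf i,\mathbf m)}\pi_{\tilde\lambda}$ is well defined and injective. *)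

theory Defs
  imports Complex_Main "HOL-Library.Countable_Set"
begin

text \<open>Weights live in a real vector space 'v (playing the role of the real span of P);
  simple coroots are linear functionals 'v => real.  An index i is real iff A i i = 2.\<close>

definition BC_datum ::
  "'i set \<Rightarrow> ('i \<Rightarrow> 'i \<Rightarrow> int) \<Rightarrow> ('i \<Rightarrow> 'v::real_vector) \<Rightarrow> ('i \<Rightarrow> 'v \<Rightarrow> real) \<Rightarrow> 'v set \<Rightarrow> bool" where
  "BC_datum I A alpha cor P \<longleftrightarrow>
     countable I \<and>
     (\<forall>i\<in>I. A i i = 2 \<or> A i i \<le> 0) \<and>
     (\<forall>i\<in>I. \<forall>j\<in>I. i \<noteq> j \<longrightarrow> A i j \<le> 0) \<and>
     (\<forall>i\<in>I. \<forall>j\<in>I. A i j = 0 \<longleftrightarrow> A j i = 0) \<and>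
     (\<forall>i\<in>I. linear (cor i)) \<and>
     (\<forall>i\<in>I. \<forall>j\<in>I. cor i (alpha j) = of_int (A i j)) \<and>
     (\<forall>F c. finite F \<longrightarrow> F \<subseteq> I \<longrightarrow> (\<Sum>i\<in>F. c i *\<^sub>R alpha i) = 0 \<longrightarrow> (\<forall>i\<in>F. c i = 0)) \<and>
     (\<forall>F c. finite F \<longrightarrow> F \<subseteq> I \<longrightarrow> (\<forall>v. (\<Sum>i\<in>F. c i * cor i v) = 0) \<longrightarrow> (\<forall>i\<in>F. c i = 0)) \<and>
     0 \<in> P \<and> (\<forall>x\<in>P. \<forall>y\<in>P. x + y \<in> P \<and> - x \<in> P) \<and>
     (\<forall>i\<in>I. alpha i \<in> P) \<and>
     (\<forall>i\<in>I. \<forall>x\<in>P. cor i x \<in> \<int>)"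

definition symmetrizable :: "'i set \<Rightarrow> ('i \<Rightarrow> 'i \<Rightarrow> int) \<Rightarrow> bool" where
  "symmetrizable I A \<longleftrightarrow>
     (\<exists>d::'i \<Rightarrow> real. (\<forall>i\<in>I. d i > 0) \<and> (\<forall>i\<in>I. \<forall>j\<in>I. d i * A i j = d j * A j i))"

definition even_datum :: "'i set \<Rightarrow> ('i \<Rightarrow> 'i \<Rightarrow> int) \<Rightarrow> bool" where
  "even_datum I A \<longleftrightarrow> (\<forall>i\<in>I. even (A i i))"

definition Pplus :: "'i set \<Rightarrow> ('i \<Rightarrow> 'v \<Rightarrow> real) \<Rightarrow> 'v set \<Rightarrow> 'v set" where
  "Pplus I cor P = {x \<in> P. \<forall>i\<in>I. cor i x \<ge> 0}"

definition refl :: "('i \<Rightarrow> 'v::real_vector) \<Rightarrow> ('i \<Rightarrow> 'v \<Rightarrow> real) \<Rightarrow> 'i \<Rightarrow> 'v \<Rightarrow> 'v" where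
  "refl alpha cor i x = x - cor i x *\<^sub>R alpha i"

text \<open>The word [j1,...,jn] acts as r_j1 ... r_jn; its inverse (for real words) is the reversed word.\<close>
definition wact :: "('i \<Rightarrow> 'v::real_vector) \<Rightarrow> ('i \<Rightarrow> 'v \<Rightarrow> real) \<Rightarrow> 'i list \<Rightarrow> 'v \<Rightarrow> 'v" where
  "wact alpha cor w x = foldr (refl alpha cor) w x"

inductive_set Worbit :: "'i set \<Rightarrow> ('i \<Rightarrow> 'v::real_vector) \<Rightarrow> ('i \<Rightarrow> 'v \<Rightarrow> real) \<Rightarrow> 'v \<Rightarrow> 'v set"
  for I alpha cor lam where
  base: "lam \<in> Worbit I alpha cor lam"
| step: "x \<in> Worbit I alpha cor lam \<Longrightarrow> i \<in> I \<Longrightarrow> refl alpha cor i x \<in> Worbit I alpha cor lam"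

definition posQ :: "'i set \<Rightarrow> ('i \<Rightarrow> 'v::real_vector) \<Rightarrow> 'v set" where
  "posQ I alpha = {x. \<exists>F (c::'i \<Rightarrow> nat). finite F \<and> F \<subseteq> I \<and> x = (\<Sum>i\<in>F. real (c i) *\<^sub>R alpha i)}"

text \<open>rrel x' x c im: x' = r_beta x with beta = w alpha_i (w in W_re), beta a positive real root
  (im = False) or an imaginary root (im = True), c = beta^vee(x) > 0, where
  beta^vee = w alpha_i^vee and r_beta = w r_i w^{-1}.\<close>
definition rrel :: "'i set \<Rightarrow> ('i \<Rightarrow> 'i \<Rightarrow> int) \<Rightarrow> ('i \<Rightarrow> 'v::real_vector) \<Rightarrow> ('i \<Rightarrow> 'v \<Rightarrow> real)
    \<Rightarrow> 'v \<Rightarrow> 'v \<Rightarrow> real \<Rightarrow> bool \<Rightarrow> bool" where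
  "rrel I A alpha cor x' x c im \<longleftrightarrow>
     (\<exists>w i. set w \<subseteq> {j\<in>I. A j j = 2} \<and> i \<in> I \<and> (im \<longleftrightarrow> A i i \<noteq> 2) \<and>
        (A i i = 2 \<longrightarrow> wact alpha cor w (alpha i) \<in> posQ I alpha) \<and>
        c = cor i (wact alpha cor (rev w) x) \<and> c > 0 \<and>
        x' = wact alpha cor w (refl alpha cor i (wact alpha cor (rev w) x)))"

definition gtW :: "'i set \<Rightarrow> ('i \<Rightarrow> 'i \<Rightarrow> int) \<Rightarrow> ('i \<Rightarrow> 'v::real_vector) \<Rightarrow> ('i \<Rightarrow> 'v \<Rightarrow> real)
    \<Rightarrow> 'v \<Rightarrow> 'v \<Rightarrow> 'v \<Rightarrow> bool" where
  "gtW I A alpha cor lam = (\<lambda>x' x. x' \<in> Worbit I alpha cor lam \<and> x \<in> Worbit I alpha cor lam \<and>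
       (\<exists>c im. rrel I A alpha cor x' x c im))\<^sup>+\<^sup>+"

definition cstep :: "'i set \<Rightarrow> ('i \<Rightarrow> 'i \<Rightarrow> int) \<Rightarrow> ('i \<Rightarrow> 'v::real_vector) \<Rightarrow> ('i \<Rightarrow> 'v \<Rightarrow> real)
    \<Rightarrow> 'v \<Rightarrow> 'v \<Rightarrow> 'v \<Rightarrow> real \<Rightarrow> bool \<Rightarrow> bool" where
  "cstep I A alpha cor lam x' x c im \<longleftrightarrow>
     x' \<in> Worbit I alpha cor lam \<and> x \<in> Worbit I alpha cor lam \<and>
     rrel I A alpha cor x' x c im \<and> gtW I A alpha cor lam x' x \<and>
     \<not> (\<exists>z. gtW I A alpha cor lam x' z \<and> gtW I A alpha cor lam z x)"

definition achain :: "'i set \<Rightarrow> ('i \<Rightarrow> 'i \<Rightarrow> int) \<Rightarrow> ('i \<Rightarrow> 'v::real_vector) \<Rightarrow> ('i \<Rightarrow> 'v \<Rightarrow> real)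
    \<Rightarrow> 'v \<Rightarrow> real \<Rightarrow> 'v \<Rightarrow> 'v \<Rightarrow> bool" where
  "achain I A alpha cor lam a x y \<longleftrightarrow>
     (\<exists>ns. ns \<noteq> [] \<and> hd ns = x \<and> last ns = y \<and>
        (\<forall>s < length ns - 1. \<exists>c im. cstep I A alpha cor lam (ns ! s) (ns ! Suc s) c im \<and>
            (if im then a * c = 1 else a * c \<in> \<int> \<and> a * c > 0)))"

text \<open>Paths are functions real => 'v; only the values on [0,1] matter, and all paths are
  normalised to be constant outside [0,1] (via clamp).\<close>
definition clamp :: "real \<Rightarrow> real" where
  "clamp t = max 0 (min 1 t)"

definition pi_lam :: "'v::real_vector \<Rightarrow> real \<Rightarrow> 'v" where
  "pi_lam lam t = clamp t *\<^sub>R lam"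

definition gls_fun :: "'v::real_vector list \<Rightarrow> real list \<Rightarrow> real \<Rightarrow> 'v" where
  "gls_fun ls as t = (\<Sum>j<length ls. min (max (clamp t - as ! j) 0) (as ! Suc j - as ! j) *\<^sub>R ls ! j)"

text \<open>GLS path (lambda_1 > ... > lambda_k ; 0 = a_0 < ... < a_k = 1), 0-based lists.\<close>
definition GLS_data :: "'i set \<Rightarrow> ('i \<Rightarrow> 'i \<Rightarrow> int) \<Rightarrow> ('i \<Rightarrow> 'v::real_vector) \<Rightarrow> ('i \<Rightarrow> 'v \<Rightarrow> real)
    \<Rightarrow> 'v \<Rightarrow> 'v list \<Rightarrow> real list \<Rightarrow> bool" where
  "GLS_data I A alpha cor lam ls as \<longleftrightarrow>
     ls \<noteq> [] \<and> length as = Suc (length ls) \<and> as ! 0 = 0 \<and> as ! length ls = 1 \<and>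
     (\<forall>s < length ls. as ! s < as ! Suc s) \<and>
     (\<forall>s < length ls. ls ! s \<in> Worbit I alpha cor lam) \<and>
     (\<forall>s. Suc s < length ls \<longrightarrow> gtW I A alpha cor lam (ls ! s) (ls ! Suc s) \<and>
          achain I A alpha cor lam (as ! Suc s) (ls ! s) (ls ! Suc s)) \<and>
     achain I A alpha cor lam 1 (last ls) lam"

definition GLS :: "'i set \<Rightarrow> ('i \<Rightarrow> 'i \<Rightarrow> int) \<Rightarrow> ('i \<Rightarrow> 'v::real_vector) \<Rightarrow> ('i \<Rightarrow> 'v \<Rightarrow> real)
    \<Rightarrow> 'v \<Rightarrow> (real \<Rightarrow> 'v) set" where
  "GLS I A alpha cor lam = {gls_fun ls as | ls as. GLS_data I A alpha cor lam ls as}"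

section \<open>Root operators (None = the zero element)\<close>

definition mval :: "('i \<Rightarrow> 'v \<Rightarrow> real) \<Rightarrow> 'i \<Rightarrow> (real \<Rightarrow> 'v) \<Rightarrow> real" where
  "mval cor i p = Inf ({cor i (p t) | t. t \<in> {0..1}} \<inter> \<int>)"

definition f_root :: "('i \<Rightarrow> 'v::real_vector) \<Rightarrow> ('i \<Rightarrow> 'v \<Rightarrow> real) \<Rightarrow> 'i
    \<Rightarrow> (real \<Rightarrow> 'v) \<Rightarrow> (real \<Rightarrow> 'v) option" where
  "f_root alpha cor i p =
     (let H = (\<lambda>t. cor i (p t)); m = mval cor i p;
          fp = Sup {t \<in> {0..1}. H t = m};
          fm = Inf {t \<in> {fp..1}. H t = m + 1}
      in if fp = 1 then None else
         Some (\<lambda>t0. let t = clamp t0 in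
            if t \<le> fp then p t
            else if t \<le> fm then p t - (H t - m) *\<^sub>R alpha i
            else p t - alpha i))"

definition e_root_re :: "('i \<Rightarrow> 'v::real_vector) \<Rightarrow> ('i \<Rightarrow> 'v \<Rightarrow> real) \<Rightarrow> 'i
    \<Rightarrow> (real \<Rightarrow> 'v) \<Rightarrow> (real \<Rightarrow> 'v) option" where
  "e_root_re alpha cor i p =
     (let H = (\<lambda>t. cor i (p t)); m = mval cor i p;
          ep = Inf {t \<in> {0..1}. H t = m};
          em = Sup {t \<in> {0..ep}. H t = m + 1}
      in if ep = 0 then None else
         Some (\<lambda>t0. let t = clamp t0 in
            if t \<le> em then p t
            else if t \<le> ep then p t - (H t - m - 1) *\<^sub>R alpha i
            else p t + alpha i))"

definition e_root_im :: "('i \<Rightarrow> 'i \<Rightarrow> int) \<Rightarrow> ('i \<Rightarrow> 'v::real_vector) \<Rightarrow> ('i \<Rightarrow> 'v \<Rightarrow> real) \<Rightarrow> 'i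
    \<Rightarrow> (real \<Rightarrow> 'v) \<Rightarrow> (real \<Rightarrow> 'v) option" where
  "e_root_im A alpha cor i p =
     (let H = (\<lambda>t. cor i (p t)); m = mval cor i p; a = real_of_int (A i i);
          em = Sup {t \<in> {0..1}. H t = m}
      in if em = 1 \<or> (\<forall>t \<in> {em..1}. H t < m + 1 - a) then None else
         (let ep = Inf {t \<in> {em..1}. H t = m + 1 - a}
          in if (\<exists>s \<in> {ep..1}. H s \<le> m - a) then None else
             Some (\<lambda>t0. let t = clamp t0 in
               if t \<le> em then p t
               else if t \<le> ep then p t + ((H t - m) / (1 - a)) *\<^sub>R alpha i
               else p t + alpha i)))"

definition cr_wt :: "(real \<Rightarrow> 'v) \<Rightarrow> 'v" where
  "cr_wt p = p 1"

definition cr_eps :: "('i \<Rightarrow> 'i \<Rightarrow> int) \<Rightarrow> ('i \<Rightarrow> 'v \<Rightarrow> real) \<Rightarrow> 'i \<Rightarrow> (real \<Rightarrow> 'v) \<Rightarrow> real" where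
  "cr_eps A cor i p = (if A i i = 2 then - mval cor i p else 0)"

definition cr_phi :: "('i \<Rightarrow> 'i \<Rightarrow> int) \<Rightarrow> ('i \<Rightarrow> 'v \<Rightarrow> real) \<Rightarrow> 'i \<Rightarrow> (real \<Rightarrow> 'v) \<Rightarrow> real" where
  "cr_phi A cor i p = (if A i i = 2 then cor i (p 1) - mval cor i p else cor i (p 1))"

definition cr_f :: "('i \<Rightarrow> 'v::real_vector) \<Rightarrow> ('i \<Rightarrow> 'v \<Rightarrow> real) \<Rightarrow> 'i
    \<Rightarrow> (real \<Rightarrow> 'v) \<Rightarrow> (real \<Rightarrow> 'v) option" where
  "cr_f alpha cor i p = f_root alpha cor i p"

definition cr_e :: "('i \<Rightarrow> 'i \<Rightarrow> int) \<Rightarrow> ('i \<Rightarrow> 'v::real_vector) \<Rightarrow> ('i \<Rightarrow> 'v \<Rightarrow> real)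
    \<Rightarrow> (real \<Rightarrow> 'v) set \<Rightarrow> 'i \<Rightarrow> (real \<Rightarrow> 'v) \<Rightarrow> (real \<Rightarrow> 'v) option" where
  "cr_e A alpha cor B i p =
     (if A i i = 2 then e_root_re alpha cor i p
      else (case e_root_im A alpha cor i p of None \<Rightarrow> None
            | Some q \<Rightarrow> if q \<in> B then Some q else None))"

definition crystal_iso_on ::
  "'i set \<Rightarrow> 'a set \<Rightarrow> ('i \<Rightarrow> 'a \<Rightarrow> 'a option) \<Rightarrow> ('i \<Rightarrow> 'a \<Rightarrow> 'a option)
     \<Rightarrow> ('i \<Rightarrow> 'a \<Rightarrow> real) \<Rightarrow> ('i \<Rightarrow> 'a \<Rightarrow> real) \<Rightarrow> ('a \<Rightarrow> 'v)
   \<Rightarrow> 'b set \<Rightarrow> ('i \<Rightarrow> 'b \<Rightarrow> 'b option) \<Rightarrow> ('i \<Rightarrow> 'b \<Rightarrow> 'b option)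
     \<Rightarrow> ('i \<Rightarrow> 'b \<Rightarrow> real) \<Rightarrow> ('i \<Rightarrow> 'b \<Rightarrow> real) \<Rightarrow> ('b \<Rightarrow> 'v) \<Rightarrow> bool" where
  "crystal_iso_on S B1 e1 f1 eps1 phi1 wt1 B2 e2 f2 eps2 phi2 wt2 \<longleftrightarrow>
     (\<exists>\<Phi>. bij_betw \<Phi> B1 B2 \<and>
        (\<forall>b\<in>B1. wt2 (\<Phi> b) = wt1 b \<and>
           (\<forall>i\<in>S. eps2 i (\<Phi> b) = eps1 i b \<and> phi2 i (\<Phi> b) = phi1 i b \<and>
                   e2 i (\<Phi> b) = map_option \<Phi> (e1 i b) \<and>
                   f2 i (\<Phi> b) = map_option \<Phi> (f1 i b))))"

definition Itilde :: "'i set \<Rightarrow> ('i \<Rightarrow> 'i \<Rightarrow> int) \<Rightarrow> ('i \<times> nat) set" where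
  "Itilde I A = {(i, 1) | i. i \<in> I \<and> A i i = 2} \<union> {(i, m) | i m. i \<in> I \<and> A i i \<noteq> 2 \<and> m \<ge> 1}"

definition Atilde :: "('i \<Rightarrow> 'i \<Rightarrow> int) \<Rightarrow> ('i \<times> nat) \<Rightarrow> ('i \<times> nat) \<Rightarrow> int" where
  "Atilde A x y = (if x = y then 2 else A (fst x) (fst y))"

text \<open>Words are listed in order of application: [i_1, ..., i_k] gives f_{i_k} ... f_{i_1}.\<close>
definition Fw :: "('j \<Rightarrow> 'v::real_vector) \<Rightarrow> ('j \<Rightarrow> 'v \<Rightarrow> real) \<Rightarrow> 'j list
    \<Rightarrow> (real \<Rightarrow> 'v) \<Rightarrow> (real \<Rightarrow> 'v) option" where
  "Fw alpha cor ws p = fold (\<lambda>i q. Option.bind q (f_root alpha cor i)) ws (Some p)"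

definition mseq :: "('i \<Rightarrow> 'i \<Rightarrow> int) \<Rightarrow> 'i list \<Rightarrow> ('i \<times> nat) list" where
  "mseq A ws = map (\<lambda>s. (ws ! s, if A (ws ! s) (ws ! s) = 2 then 1
                                else count_list (take (Suc s) ws) (ws ! s))) [0..<length ws]"

definition tmap :: "'i set \<Rightarrow> ('i \<Rightarrow> 'i \<Rightarrow> int) \<Rightarrow> ('i \<Rightarrow> 'v::real_vector) \<Rightarrow> ('i \<Rightarrow> 'v \<Rightarrow> real) \<Rightarrow> 'v
    \<Rightarrow> ('i \<times> nat \<Rightarrow> 'w::real_vector) \<Rightarrow> ('i \<times> nat \<Rightarrow> 'w \<Rightarrow> real) \<Rightarrow> 'w
    \<Rightarrow> (real \<Rightarrow> 'v) \<Rightarrow> (real \<Rightarrow> 'w)" where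
  "tmap I A alpha cor lam alphat cort lamt p =
     (SOME q. \<exists>ws. set ws \<subseteq> I \<and> Fw alpha cor ws (pi_lam lam) = Some p \<and>
                   Fw alphat cort (mseq A ws) (pi_lam lamt) = Some q)"

definition Stilde :: "'i set \<Rightarrow> ('i \<Rightarrow> 'i \<Rightarrow> int) \<Rightarrow> ('i \<times> nat) set" where
  "Stilde S A = {(i, 1) | i. i \<in> S \<and> A i i = 2} \<union> {(i, m) | i m. i \<in> S \<and> A i i \<noteq> 2 \<and> m \<ge> 1}"

definition tdominant :: "('i \<times> nat) set \<Rightarrow> ('i \<times> nat \<Rightarrow> 'w \<Rightarrow> real) \<Rightarrow> (real \<Rightarrow> 'w) \<Rightarrow> bool" where
  "tdominant St cort q \<longleftrightarrow> (\<forall>x\<in>St. \<forall>t\<in>{0..1}. cort x (q t) \<ge> 0)"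

definition Uset :: "'i set \<Rightarrow> 'i set \<Rightarrow> ('i \<Rightarrow> 'i \<Rightarrow> int) \<Rightarrow> ('i \<Rightarrow> 'v::real_vector) \<Rightarrow> ('i \<Rightarrow> 'v \<Rightarrow> real) \<Rightarrow> 'v
    \<Rightarrow> ('i \<times> nat \<Rightarrow> 'w::real_vector) \<Rightarrow> ('i \<times> nat \<Rightarrow> 'w \<Rightarrow> real) \<Rightarrow> 'w
    \<Rightarrow> ((real \<Rightarrow> 'v) \<times> (real \<Rightarrow> 'v)) set" where
  "Uset I S A alpha cor lam alphat cort lamt =
     {(p, q). p \<in> GLS I A alpha cor lam \<and>
              tdominant (Stilde S A) cort (tmap I A alpha cor lam alphat cort lamt p) \<and>
              q \<in> GLS S A alpha cor (p 1)}"

definition U_e :: "'i set \<Rightarrow> ('i \<Rightarrow> 'i \<Rightarrow> int) \<Rightarrow> ('i \<Rightarrow> 'v::real_vector) \<Rightarrow> ('i \<Rightarrow> 'v \<Rightarrow> real)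
    \<Rightarrow> 'i \<Rightarrow> (real \<Rightarrow> 'v) \<times> (real \<Rightarrow> 'v) \<Rightarrow> ((real \<Rightarrow> 'v) \<times> (real \<Rightarrow> 'v)) option" where
  "U_e S A alpha cor i x = map_option (Pair (fst x)) (cr_e A alpha cor (GLS S A alpha cor (fst x 1)) i (snd x))"

definition U_f :: "('i \<Rightarrow> 'v::real_vector) \<Rightarrow> ('i \<Rightarrow> 'v \<Rightarrow> real)
    \<Rightarrow> 'i \<Rightarrow> (real \<Rightarrow> 'v) \<times> (real \<Rightarrow> 'v) \<Rightarrow> ((real \<Rightarrow> 'v) \<times> (real \<Rightarrow> 'v)) option" where
  "U_f alpha cor i x = map_option (Pair (fst x)) (cr_f alpha cor i (snd x))"

end

theory Submission
  imports Defs "HOL-Analysis.Product_Vector"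
begin

text \<open>
  The letters (i,1), (i,2), ... of the Kac--Moody datum replace the successive imaginary letters i of a word, and
  the lifted path is pi_lamt minus, for each such letter, a function t \<mapsto> min (n t) 1. The slopes n
  increase along a word, so they can be read off the original path and off the lifted one: each determines the other.
  On the Kac--Moody side a path that is dominant for the Levi part is isomorphic to the straight path to its
  endpoint, by deforming the one into the other through integral paths, along which the root operators move
  continuously and hence can neither vanish nor identify two paths. Transporting this back through the lift, both for
  I and for S, the map taking F_ws p to F_ws (pi_lam (p 1)), for p with dominant lift and ws a word in S, is the
  required isomorphism.
\<close>

text \<open>A deformation runs through all real parameters x, and at each of them every word of root
  operators must yield integral paths. The paths met there come from GLS paths of a datum with one
  more imaginary index, whose shape has the generally non-integral pairing 1/x with the new coroot.
  This is why the ground layer \<open>rdat\<close> imposes integrality, signs and symmetry only on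
  coroots of real indices. A dominant path may have many corners, but they sit at rational times; a
  multiple of the path is then a concatenation of integral straight pieces, absorbed one after the
  other by one deformation each. That two paths generate isomorphic crystals is expressed by words
  alone: which words vanish and which lead back to the start. In this form it passes through
  concatenation, stretching and deformation. That a path on which no e_i with i in S acts inside
  B(lambda) has a dominant lift rests on one commutation: an imaginary letter at which the lift is
  negative commutes with all later letters and can be taken out again.\<close>

section \<open>The positive cone of the root lattice\<close>

lemma posQ_alpha: "i \<in> I ==> alpha i \<in> posQ I alpha"
  unfolding posQ_def by (auto intro!: exI[of _ "{i}"] exI[of _ "%_. 1"])

lemma posQ_zero: "0 \<in> posQ I alpha"
  unfolding posQ_def by (auto intro!: exI[of _ "{}"])

lemma posQ_add:
  assumes "x \<in> posQ I alpha" "y \<in> posQ I alpha"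
  shows "x + y \<in> posQ I alpha"
proof -
  obtain F c where F: "finite F" "F \<subseteq> I" "x = (\<Sum>i\<in>F. real (c i) *\<^sub>R alpha i)"
    using assms(1) unfolding posQ_def by auto
  obtain G e where G: "finite G" "G \<subseteq> I" "y = (\<Sum>i\<in>G. real (e i) *\<^sub>R alpha i)"
    using assms(2) unfolding posQ_def by auto
  define c' where "c' i = (if i \<in> F then c i else 0)" for i
  define e' where "e' i = (if i \<in> G then e i else 0)" for i
  have "x = (\<Sum>i\<in>F \<union> G. real (c' i) *\<^sub>R alpha i)"
    unfolding F(3) by (rule sum.mono_neutral_cong_left) (use F G in \<open>auto simp: c'_def\<close>)
  moreover have "y = (\<Sum>i\<in>F \<union> G. real (e' i) *\<^sub>R alpha i)"
    unfolding G(3) by (rule sum.mono_neutral_cong_left) (use F G in \<open>auto simp: e'_def\<close>)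
  ultimately have "x + y = (\<Sum>i\<in>F \<union> G. real (c' i + e' i) *\<^sub>R alpha i)"
    by (simp add: sum.distrib scaleR_left_distrib)
  thus ?thesis unfolding posQ_def using F G by (auto intro!: exI[of _ "F \<union> G"] exI[of _ "%i. c' i + e' i"])
qed

lemma posQ_scale: "x \<in> posQ I alpha ==> real n *\<^sub>R x \<in> posQ I alpha"
  by (induction n) (auto simp: scaleR_left_distrib posQ_zero intro: posQ_add)

lemma wact_Nil [simp]: "wact alpha cor [] x = x"
  and wact_Cons [simp]: "wact alpha cor (i # w) x = refl alpha cor i (wact alpha cor w x)"
  and wact_append [simp]: "wact alpha cor (v @ w) x = wact alpha cor v (wact alpha cor w x)"
  by (simp_all add: wact_def)

lemma Worbit_wact: "set w \<subseteq> I ==> x \<in> Worbit I alpha cor lam ==> wact alpha cor w x \<in> Worbit I alpha cor lam"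
  by (induction w) (auto intro: Worbit.step)

text \<open>co and ht extend the coordinate and height functionals of the root lattice linearly to the whole space.\<close>
locale rdat =
  fixes I :: "'i set" and A :: "'i => 'i => int"
    and alpha :: "'i => 'v::real_vector" and cor :: "'i => 'v => real"
    and co :: "'i => 'v => real" and ht :: "'v => real" and d :: "'i => real"
  assumes lin_cor: "i \<in> I ==> linear (cor i)"
    and lin_co: "i \<in> I ==> linear (co i)"
    and lin_ht: "linear ht"
    and co_alpha: "i \<in> I ==> j \<in> I ==> co i (alpha j) = (if i = j then 1 else 0)"
    and ht_alpha: "i \<in> I ==> ht (alpha i) = 1"
    and cor2: "i \<in> I ==> A i i = 2 ==> cor i (alpha i) = 2"
    and corZ: "i \<in> I ==> A i i = 2 ==> j \<in> I ==> cor i (alpha j) \<in> \<int>"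
    and corneg: "i \<in> I ==> A i i = 2 ==> j \<in> I ==> i \<noteq> j ==> cor i (alpha j) <= 0"
    and d_pos: "i \<in> I ==> A i i = 2 ==> d i > 0"
    and d_sym: "i \<in> I ==> A i i = 2 ==> j \<in> I ==> A j j = 2 ==> d i * cor i (alpha j) = d j * cor j (alpha i)"
begin

definition R :: "'i set" where "R = {i \<in> I. A i i = 2}"

abbreviation s :: "'i => 'v => 'v" where "s \<equiv> refl alpha cor"
abbreviation W :: "'i list => 'v => 'v" where "W \<equiv> wact alpha cor"

lemma RI: "i \<in> R ==> i \<in> I" by (simp add: R_def)

lemma cor_simps [simp]:
  assumes "i \<in> I"
  shows "cor i (x + y) = cor i x + cor i y" "cor i (x - y) = cor i x - cor i y"
    "cor i (r *\<^sub>R x) = r * cor i x" "cor i (- x) = - cor i x" "cor i 0 = 0"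
  using lin_cor[OF assms] by (simp_all add: linear_add linear_diff linear_scale linear_neg linear_0)

lemma co_simps [simp]:
  assumes "i \<in> I"
  shows "co i (x + y) = co i x + co i y" "co i (x - y) = co i x - co i y"
    "co i (r *\<^sub>R x) = r * co i x" "co i (- x) = - co i x" "co i 0 = 0"
  using lin_co[OF assms] by (simp_all add: linear_add linear_diff linear_scale linear_neg linear_0)

lemma ht_simps [simp]:
  "ht (x + y) = ht x + ht y" "ht (x - y) = ht x - ht y"
    "ht (r *\<^sub>R x) = r * ht x" "ht (- x) = - ht x" "ht 0 = 0"
  using lin_ht by (simp_all add: linear_add linear_diff linear_scale linear_neg linear_0)

lemma s_lin: "i \<in> I ==> s i (x + y) = s i x + s i y" "i \<in> I ==> s i (r *\<^sub>R x) = r *\<^sub>R s i x"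
    "i \<in> I ==> s i (x - y) = s i x - s i y" "i \<in> I ==> s i (- x) = - s i x"
  by (simp_all add: refl_def algebra_simps)

lemma W_lin: "set w \<subseteq> I ==> W w (x + y) = W w x + W w y" "set w \<subseteq> I ==> W w (r *\<^sub>R x) = r *\<^sub>R W w x"
    "set w \<subseteq> I ==> W w (x - y) = W w x - W w y" "set w \<subseteq> I ==> W w (- x) = - W w x"
  by (induction w) (auto simp: s_lin)

lemma cor_aa: "i \<in> R ==> cor i (alpha i) = 2"
  by (simp add: R_def cor2)

lemma cor_s: "i \<in> R ==> cor i (s i x) = - cor i x"
  by (simp add: refl_def cor_aa RI)

lemma s_s: "i \<in> R ==> s i (s i x) = x"
  by (simp add: refl_def cor_aa RI algebra_simps scaleR_2)

lemma s_alpha: "i \<in> R ==> s i (alpha i) = - alpha i"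
  by (simp add: refl_def cor_aa scaleR_2)

lemma W_rev: "set w \<subseteq> R ==> W (rev w) (W w x) = x"
  by (induction w arbitrary: x) (auto simp: s_s)

lemma W_rev': "set w \<subseteq> R ==> W w (W (rev w) x) = x"
  using W_rev[of "rev w"] by simp

lemma R_subI: "set w \<subseteq> R ==> set w \<subseteq> I" by (auto simp: R_def)

lemma posQ_co: "x \<in> posQ I alpha ==> i \<in> I ==> 0 <= co i x"
proof -
  assume "x \<in> posQ I alpha" "i \<in> I"
  then obtain F c where F: "finite F" "F \<subseteq> I" "x = (\<Sum>i\<in>F. real (c i) *\<^sub>R alpha i)"
    unfolding posQ_def by auto
  have "co i x = (\<Sum>j\<in>F. real (c j) * co i (alpha j))"
    unfolding F(3) using lin_co[OF \<open>i \<in> I\<close>] \<open>i \<in> I\<close> by (simp add: linear_sum)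
  also have "... >= 0" using F(2) \<open>i \<in> I\<close> by (intro sum_nonneg) (auto simp: co_alpha)
  finally show ?thesis .
qed

text \<open>Real coefficients instead of natural ones, because one step in the order lowers a weight
  by c times a positive root, and c = beta^vee(x) is only a real number for a general shape.\<close>

definition cone :: "'v set" where
  "cone = {x. \<exists>F c. finite F & F \<subseteq> I & (\<forall>i\<in>F. (0::real) <= c i) & x = (\<Sum>i\<in>F. c i *\<^sub>R alpha i)}"

lemma posQ_cone: "x \<in> posQ I alpha ==> x \<in> cone"
proof -
  assume "x \<in> posQ I alpha"
  then obtain F c where "finite F" "F \<subseteq> I" "x = (\<Sum>i\<in>F. real (c i) *\<^sub>R alpha i)"
    unfolding posQ_def by auto
  thus ?thesis unfolding cone_def
    by (intro CollectI exI[of _ F] exI[of _ "%i. real (c i)"]) auto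
qed

lemma cone_zero: "0 \<in> cone"
  unfolding cone_def by (auto intro!: exI[of _ "{}"])

lemma cone_scale: "x \<in> cone ==> 0 <= r ==> r *\<^sub>R x \<in> cone"
proof -
  assume "x \<in> cone" "0 <= r"
  then obtain F c where F: "finite F" "F \<subseteq> I" "\<forall>i\<in>F. (0::real) <= c i" "x = (\<Sum>i\<in>F. c i *\<^sub>R alpha i)"
    unfolding cone_def by auto
  thus ?thesis unfolding cone_def using \<open>0 <= r\<close>
    by (auto intro!: exI[of _ F] exI[of _ "%i. r * c i"] simp: scaleR_sum_right)
qed

lemma cone_add: "x \<in> cone ==> y \<in> cone ==> x + y \<in> cone"
proof -
  assume "x \<in> cone" "y \<in> cone"
  then obtain F c G e where F: "finite F" "F \<subseteq> I" "\<forall>i\<in>F. (0::real) <= c i" "x = (\<Sum>i\<in>F. c i *\<^sub>R alpha i)"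
   and G: "finite G" "G \<subseteq> I" "\<forall>i\<in>G. (0::real) <= e i" "y = (\<Sum>i\<in>G. e i *\<^sub>R alpha i)"
    unfolding cone_def by auto
  define c' where "c' i = (if i \<in> F then c i else 0)" for i
  define e' where "e' i = (if i \<in> G then e i else 0)" for i
  have "x = (\<Sum>i\<in>F \<union> G. (c' i) *\<^sub>R alpha i)"
    unfolding F(4) by (rule sum.mono_neutral_cong_left) (use F G in \<open>auto simp: c'_def\<close>)
  moreover have "y = (\<Sum>i\<in>F \<union> G. (e' i) *\<^sub>R alpha i)"
    unfolding G(4) by (rule sum.mono_neutral_cong_left) (use F G in \<open>auto simp: e'_def\<close>)
  ultimately have "x + y = (\<Sum>i\<in>F \<union> G. (c' i + e' i) *\<^sub>R alpha i)"
    by (simp add: sum.distrib scaleR_left_distrib)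
  thus ?thesis unfolding cone_def using F G
    by (auto intro!: exI[of _ "F \<union> G"] exI[of _ "%i. c' i + e' i"] simp: c'_def e'_def)
qed

lemma cone_coords:
  assumes "x \<in> cone"
  obtains F where "finite F" "F \<subseteq> I" "x = (\<Sum>i\<in>F. co i x *\<^sub>R alpha i)" "!!i. i \<in> I ==> 0 <= co i x"
    "ht x = (\<Sum>i\<in>F. co i x)"
proof -
  obtain F c where F: "finite F" "F \<subseteq> I" "\<forall>i\<in>F. (0::real) <= c i" "x = (\<Sum>i\<in>F. c i *\<^sub>R alpha i)"
    using assms unfolding cone_def by auto
  have co: "co i x = (if i \<in> F then c i else 0)" if "i \<in> I" for i
  proof -
    have "co i x = (\<Sum>j\<in>F. c j * co i (alpha j))"
      unfolding F(4) using lin_co[OF that] that by (simp add: linear_sum)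
    also have "... = (\<Sum>j\<in>F. if i = j then c j else 0)"
      using F(2) that by (intro sum.cong) (auto simp: co_alpha)
    finally show ?thesis using F(1) by simp
  qed
  have "x = (\<Sum>i\<in>F. co i x *\<^sub>R alpha i)"
    using F co by (simp add: subset_eq)
  moreover have "ht x = (\<Sum>i\<in>F. co i x)"
  proof -
    have "ht x = (\<Sum>i\<in>F. c i * ht (alpha i))" unfolding F(4) using lin_ht by (simp add: linear_sum)
    also have "... = (\<Sum>i\<in>F. co i x)" using F(2) co by (intro sum.cong) (auto simp: ht_alpha)
    finally show ?thesis .
  qed
  ultimately show ?thesis using that[OF F(1,2)] co F(3) by simp
qed

lemma cone_ht: "x \<in> cone ==> 0 <= ht x"
  by (elim cone_coords) (simp add: sum_nonneg subset_eq)

lemma cone_ht_0: "x \<in> cone ==> ht x = 0 ==> x = 0"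
proof -
  assume "x \<in> cone" "ht x = 0"
  from this(1) obtain F where F: "finite F" "F \<subseteq> I" "x = (\<Sum>i\<in>F. co i x *\<^sub>R alpha i)" "!!i. i \<in> I ==> 0 <= co i x"
    "ht x = (\<Sum>i\<in>F. co i x)" by (elim cone_coords) auto
  have "\<forall>i\<in>F. co i x = 0"
    using F \<open>ht x = 0\<close> by (subst sum_nonneg_eq_0_iff[symmetric]) (auto simp: subset_eq)
  hence "(\<Sum>i\<in>F. co i x *\<^sub>R alpha i) = 0" by simp
  thus ?thesis using F(3) by simp
qed

subsection \<open>Positive roots\<close>

text \<open>Roots reached from simple ones by reflections that raise the height. With
  \<open>Bs\<close> the set of real indices these are the positive real roots; with
  \<open>Bs\<close> = {j} for an imaginary j they form the orbit of alpha_j under the real Weyl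
  group. Positivity is built in; that lowering reflections do not leave the set is
  \<open>Phi_closed\<close>.\<close>

inductive_set Phi :: "'i set => 'v set" for Bs where
  Phi_base: "b \<in> Bs ==> alpha b \<in> Phi Bs"
| Phi_step: "\<beta> \<in> Phi Bs ==> i \<in> R ==> cor i \<beta> < 0 ==> s i \<beta> \<in> Phi Bs"

lemma Phi_int: "\<beta> \<in> Phi Bs ==> Bs \<subseteq> I ==> (\<forall>i\<in>R. cor i \<beta> \<in> \<int>) & \<beta> \<in> posQ I alpha & ht \<beta> \<in> \<int> & 1 <= ht \<beta>"
proof (induction rule: Phi.induct)
  case (Phi_base b)
  thus ?case by (auto simp: R_def corZ posQ_alpha ht_alpha)
next
  case (Phi_step \<beta> i)
  then obtain k where k: "cor i \<beta> = of_int k" using Ints_cases by blast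
  have k0: "k < 0" using Phi_step k by simp
  have eq: "s i \<beta> = \<beta> + real (nat (- k)) *\<^sub>R alpha i" using k k0 by (simp add: refl_def)
  have iI: "i \<in> I" using Phi_step RI by auto
  have "\<forall>l\<in>R. cor l (s i \<beta>) \<in> \<int>"
  proof
    fix l assume l: "l \<in> R"
    have "cor l (s i \<beta>) = cor l \<beta> - cor i \<beta> * cor l (alpha i)" using l RI by (simp add: refl_def)
    thus "cor l (s i \<beta>) \<in> \<int>" using Phi_step l iI by (auto simp: R_def corZ)
  qed
  moreover have "s i \<beta> \<in> posQ I alpha"
    unfolding eq using Phi_step iI by (auto intro!: posQ_add posQ_scale posQ_alpha)
  moreover have "ht (s i \<beta>) = ht \<beta> + of_int (- k)" using eq k0 iI by (simp add: ht_alpha)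
  ultimately show ?case using Phi_step k0 by auto
qed

text \<open>Only multiples of real simple roots are added, so the coefficient 1 at j survives. It
  serves to tell the orbit of an imaginary root from real roots.\<close>

lemma Phi_im_co: "\<beta> \<in> Phi {j} ==> j \<in> I ==> j \<notin> R ==> co j \<beta> = 1"
proof (induction rule: Phi.induct)
  case (Phi_step \<beta> i)
  thus ?case using RI[of i] by (auto simp: refl_def co_alpha)
qed (auto simp: co_alpha)

text \<open>Write S = - \<open>cor j \<gamma>\<close>, T = \<open>cor i \<gamma>\<close>, a = -
  \<open>cor i (alpha j)\<close> and b = - \<open>cor j (alpha i)\<close>. The condition b T > 2 S
  reproduces itself under s_i with the letters exchanged, because a b >= 4 gives a (b T - S) > a b T
  / 2 >= 2 T. So the lowering reflections never stop, while heights in \<open>Phi\<close> are at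
  least 1.\<close>

lemma Phi_descent:
  assumes Bs: "Bs \<subseteq> I"
    and cl: "!!\<gamma> i. \<gamma> \<in> Phi Bs ==> ht \<gamma> < N ==> i \<in> R ==> \<gamma> \<noteq> alpha i ==> s i \<gamma> \<in> Phi Bs"
    and "i \<in> R" "j \<in> R" "i \<noteq> j" "cor i (alpha j) * cor j (alpha i) >= 4"
    and "\<gamma> \<in> Phi Bs" "ht \<gamma> < N" "cor j \<gamma> < 0" "cor i \<gamma> > 0" "- cor j (alpha i) * cor i \<gamma> > - 2 * cor j \<gamma>"
  shows False
  using assms(3-)
proof (induction "nat \<lfloor>ht \<gamma>\<rfloor>" arbitrary: \<gamma> i j rule: less_induct)
  case less
  have I: "i \<in> I" "j \<in> I" using less.prems RI by auto
  have ne: "\<gamma> \<noteq> alpha i" using less.prems cor_aa[of i] by auto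
  have P: "s i \<gamma> \<in> Phi Bs" using cl less.prems ne by blast
  have h: "ht (s i \<gamma>) = ht \<gamma> - cor i \<gamma>" using I by (simp add: refl_def ht_alpha)
  have i1: "cor i (s i \<gamma>) = - cor i \<gamma>" using cor_s less.prems by blast
  have j1: "cor j (s i \<gamma>) = cor j \<gamma> - cor i \<gamma> * cor j (alpha i)" using I by (simp add: refl_def)
  define T where "T = cor i \<gamma>"
  define S where "S = - cor j \<gamma>"
  define a where "a = - cor i (alpha j)"
  define b where "b = - cor j (alpha i)"
  have ab: "a * b >= 4" "b * T > 2 * S" "T > 0" "S > 0" using less.prems by (simp_all add: a_def b_def S_def T_def)
  have a0: "a >= 0" using corneg[of i j] less.prems I unfolding a_def R_def by auto
  have T': "b * T - S > b * T / 2" "b * T - S > 0" using ab by linarith+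
  have "a \<noteq> 0" using ab by auto
  hence "a > 0" using a0 by simp
  hence "a * (b * T - S) > a * (b * T / 2)" using T' by (intro mult_strict_left_mono)
  hence "a * (b * T - S) > a * b * T / 2" by simp
  moreover have "a * b * T / 2 >= 2 * T" using ab by simp
  ultimately have "a * (b * T - S) > 2 * T" by linarith
  hence c: "- cor i (alpha j) * cor j (s i \<gamma>) > - 2 * cor i (s i \<gamma>)"
    unfolding j1 i1 by (simp add: a_def b_def S_def T_def algebra_simps)
  have lt: "nat \<lfloor>ht (s i \<gamma>)\<rfloor> < nat \<lfloor>ht \<gamma>\<rfloor>"
  proof -
    obtain k where k: "cor i \<gamma> = of_int k" using Phi_int[OF \<open>\<gamma> \<in> Phi Bs\<close> Bs] less.prems(1) Ints_cases by blast
    obtain n where n: "ht \<gamma> = of_int n" using Phi_int[OF \<open>\<gamma> \<in> Phi Bs\<close> Bs] Ints_cases by blast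
    have "n >= 1" using Phi_int[OF \<open>\<gamma> \<in> Phi Bs\<close> Bs] n by auto
    moreover have "k > 0" using k less.prems by auto
    moreover have "\<lfloor>ht (s i \<gamma>)\<rfloor> = n - k" using h k n by (metis floor_of_int of_int_diff)
    ultimately show ?thesis using n by simp
  qed
  show False
    by (rule less.hyps[OF lt, of j i])
      (use less.prems P h c i1 j1 T' in \<open>auto simp: mult.commute S_def T_def b_def\<close>)
qed

text \<open>Induction on the height. Only a lowering reflection s_i beta is in question, where beta
  = s_j gamma with gamma lower. It is reached from gamma inside the plane of i and j, using the
  induction hypothesis at points below beta. If \<open>a * b >= 4\<close> this would lead down
  forever, so the plane is of type A1 x A1, A2, B2 or G2.\<close>

lemma Phi_closed:
  assumes Bs: "Bs = R \<or> (\<exists>j\<in>I - R. Bs = {j})"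
    and "\<beta> \<in> Phi Bs" "i \<in> R" "\<beta> \<noteq> alpha i"
  shows "s i \<beta> \<in> Phi Bs"
  using assms(2-)
proof (induction "nat \<lfloor>ht \<beta>\<rfloor>" arbitrary: \<beta> i rule: less_induct)
  case less
  have BsI: "Bs \<subseteq> I" using Bs by (auto simp: R_def)
  have iI: "i \<in> I" using less.prems RI by auto
  have cl: "s k \<gamma> \<in> Phi Bs" if "\<gamma> \<in> Phi Bs" "ht \<gamma> < ht \<beta>" "k \<in> R" "\<gamma> \<noteq> alpha k" for \<gamma> k
  proof -
    have "nat \<lfloor>ht \<gamma>\<rfloor> < nat \<lfloor>ht \<beta>\<rfloor>"
      using Phi_int[OF that(1) BsI] Phi_int[OF less.prems(1) BsI] that(2) by (auto elim!: Ints_cases)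
    thus ?thesis using less.hyps that by blast
  qed
  consider "cor i \<beta> < 0" | "cor i \<beta> = 0" | "cor i \<beta> > 0" by linarith
  thus ?case
  proof cases
    case 1 thus ?thesis using Phi_step less.prems by auto
  next
    case 2 thus ?thesis using less.prems by (simp add: refl_def)
  next
    case 3
    from less.prems(1) show ?thesis
    proof (cases rule: Phi.cases)
      case (Phi_base l)
      hence "l \<noteq> i" "l \<in> I" using less.prems BsI by auto
      hence False using 3 Phi_base less.prems corneg[of i l] by (auto simp: R_def)
      thus ?thesis ..
    next
      case (Phi_step \<gamma> j)
      have jI: "j \<in> I" using Phi_step RI by auto
      show ?thesis
      proof (cases "i = j")
        case True thus ?thesis using Phi_step s_s by auto
      next
        case False
        define AA where "AA = cor i \<beta>"
        define BB where "BB = cor j \<beta>"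
        have B0: "BB > 0" using Phi_step cor_s[of j \<gamma>] by (auto simp: BB_def)
        have A0: "AA > 0" using 3 AA_def by simp
        have ints: "AA \<in> \<int>" "BB \<in> \<int>" using Phi_int[OF less.prems(1) BsI] less.prems(2) Phi_step
          by (auto simp: AA_def BB_def)
        have AB1: "AA >= 1" "BB >= 1" using ints A0 B0 by (auto elim!: Ints_cases)
        define a where "a = - cor i (alpha j)"
        define b where "b = - cor j (alpha i)"
        have ca: "cor i (alpha j) = - a" "cor j (alpha i) = - b" by (auto simp: a_def b_def)
        have c2: "cor i (alpha i) = 2" "cor j (alpha j) = 2" using cor_aa less.prems Phi_step by auto
        have abI: "a \<in> \<int>" "b \<in> \<int>" using corZ[of i j] corZ[of j i] less.prems Phi_step iI jI by (auto simp: a_def b_def R_def)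
        have ab0: "a >= 0" "b >= 0" using corneg[of i j] corneg[of j i] less.prems Phi_step iI jI False
          by (auto simp: a_def b_def R_def)
        have dd: "d i * a = d j * b" "d i > 0" "d j > 0"
          using d_sym[of i j] d_pos less.prems Phi_step iI jI by (auto simp: a_def b_def R_def)
        \<comment> \<open>The dihedral orbit of beta stays in this plane. \<open>ui\<close> and
          \<open>uj\<close> are raising reflections, available by \<open>Phi_step\<close>;
          \<open>di\<close> and \<open>dj\<close> are arbitrary reflections at points lower than
          beta that are not the simple root itself, available by induction.\<close>
        define vec where "vec p q = \<beta> - p *\<^sub>R alpha i - q *\<^sub>R alpha j" for p q
        have ci: "cor i (vec p q) = AA - 2 * p + a * q" for p q
          using iI by (simp add: vec_def ca c2 AA_def)
        have cj: "cor j (vec p q) = BB + b * p - 2 * q" for p q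
          using jI by (simp add: vec_def ca c2 BB_def)
        have hv: "ht (vec p q) = ht \<beta> - p - q" for p q using iI jI by (simp add: vec_def ht_alpha)
        have si: "s i (vec p q) = vec (AA - p + a * q) q" for p q
          unfolding refl_def ci by (simp add: vec_def scaleR_left_distrib scaleR_left_diff_distrib algebra_simps scaleR_2 flip: scaleR_add_left)
        have sj: "s j (vec p q) = vec p (BB - q + b * p)" for p q
          unfolding refl_def cj by (simp add: vec_def scaleR_left_distrib scaleR_left_diff_distrib algebra_simps scaleR_2 flip: scaleR_add_left)
        have ui: "vec (AA - p + a * q) q \<in> Phi Bs" if "vec p q \<in> Phi Bs" "AA - 2 * p + a * q < 0" for p q
          using Phi.Phi_step[OF that(1) less.prems(2)] that(2) by (simp add: si ci)
        have uj: "vec p (BB - q + b * p) \<in> Phi Bs" if "vec p q \<in> Phi Bs" "BB + b * p - 2 * q < 0" for p q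
          using Phi.Phi_step[OF that(1) Phi_step(3)] that(2) by (simp add: sj cj)
        have di: "vec (AA - p + a * q) q \<in> Phi Bs" if "vec p q \<in> Phi Bs" "p + q > 0" "AA - 2 * p + a * q \<noteq> 2 \<or> BB + b * p - 2 * q \<noteq> - b" for p q
        proof -
          have "vec p q \<noteq> alpha i" using that(3) ci[of p q] cj[of p q] c2 ca by metis
          thus ?thesis using cl[OF that(1) _ less.prems(2)] that(2) hv[of p q] si by simp
        qed
        have dj: "vec p (BB - q + b * p) \<in> Phi Bs" if "vec p q \<in> Phi Bs" "p + q > 0" "BB + b * p - 2 * q \<noteq> 2 \<or> AA - 2 * p + a * q \<noteq> - a" for p q
        proof -
          have "vec p q \<noteq> alpha j" using that(3) ci[of p q] cj[of p q] c2 ca by metis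
          thus ?thesis using cl[OF that(1) _ Phi_step(3)] that(2) hv[of p q] sj by simp
        qed
        have goal: "s i \<beta> = vec AA 0" by (simp add: vec_def refl_def AA_def)
        have v1: "vec 0 BB \<in> Phi Bs"
        proof -
          have "vec 0 BB = s j \<beta>" by (simp add: vec_def refl_def BB_def)
          thus ?thesis using Phi_step s_s by simp
        qed
        show ?thesis
        proof (cases "a * b >= 4")
          case True
          have g: "vec 0 BB = \<beta> - BB *\<^sub>R alpha j" by (simp add: vec_def)
          have "b \<noteq> 0" using True by auto
          hence bpos: "b > 0" using ab0 by simp
          have "b * (a * BB) >= 4 * BB" using True B0 by (simp add: mult.assoc[symmetric] mult.commute[of b a])
          hence ineq: "b * (AA + a * BB) > 2 * BB" using B0 mult_pos_pos[OF bpos A0] unfolding distrib_left by linarith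
          have False
            by (rule Phi_descent[OF BsI, of "ht \<beta>" i j "vec 0 BB"])
              (use cl less.prems Phi_step False True ca v1 hv[of 0 BB] ci[of 0 BB] cj[of 0 BB] A0 B0 ab0 ineq
                in \<open>auto simp: add_pos_nonneg\<close>)
          thus ?thesis ..
        next
          case False
          obtain a' b' where ab': "a = of_int a'" "b = of_int b'" using abI by (auto elim!: Ints_cases)
          have "a' >= 0" "b' >= 0" "a' * b' < 4"
            using ab0 False ab' by (simp_all flip: of_int_mult)
          moreover have "a' = 0 \<longleftrightarrow> b' = 0" using dd ab' by auto
          ultimately have "(a', b') \<in> {(0,0),(1,1),(1,2),(2,1),(1,3),(3,1)}"
          proof -
            have *: "a' <= 3" "b' <= 3" if "a' > 0"
            proof -
              have "b' > 0" using that \<open>a' = 0 \<longleftrightarrow> b' = 0\<close> \<open>b' >= 0\<close> by auto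
              hence "a' * 1 <= a' * b'" "1 * b' <= a' * b'" using that by (auto intro!: mult_mono)
              thus "a' <= 3" "b' <= 3" using \<open>a' * b' < 4\<close> by auto
            qed
            show ?thesis
            proof (cases "a' = 0")
              case False
              hence "a' \<in> {1,2,3}" "b' \<in> {1,2,3}" using * \<open>a' >= 0\<close> \<open>b' >= 0\<close> \<open>a' = 0 \<longleftrightarrow> b' = 0\<close> by auto
              thus ?thesis using \<open>a' * b' < 4\<close> by auto
            qed (use \<open>a' = 0 \<longleftrightarrow> b' = 0\<close> in auto)
          qed
          then consider "a = 0" "b = 0" | "a = 1" "b = 1" | "a = 1" "b = 2" | "a = 2" "b = 1" | "a = 1" "b = 3" | "a = 3" "b = 1"
            using ab' by auto
          \<comment> \<open>The orbit has 2m points with m = 2, 3, 4 or 6. The neighbours of beta in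
            it are s_j beta, known to lie in the set, and s_i beta; going round the other way takes
            2m - 2 reflections, listed below by their coordinates.\<close>
          thus ?thesis
          proof cases
            case 1
            show ?thesis using di[of 0 BB] uj[of "AA" BB] v1 1 AB1 unfolding goal by auto
          next
            case 2
            \<comment> \<open>The way round meets an excluded simple root only when beta = alpha_i +
              alpha_j. Then s_i beta = alpha_j, which is in the set unless \<open>Bs\<close> is a
              single imaginary index, and the coefficient at that index rules this out.\<close>
            show ?thesis
            proof (cases "AA = 1 & BB = 1")
              case True
              have "vec 0 BB = alpha i \<or> vec (AA + BB) BB \<in> Phi Bs"
                using cl[OF v1 _ less.prems(2)] hv[of 0 BB] si[of 0 BB] AB1 2 by auto
              thus ?thesis
              proof
                assume h: "vec 0 BB = alpha i"
                have "Bs = R"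
                proof (rule ccontr)
                  assume "Bs \<noteq> R"
                  then obtain l where l: "l \<in> I" "l \<notin> R" "Bs = {l}" using Bs by auto
                  hence "co l (alpha i) = 1" using Phi_im_co[of "vec 0 BB" l] v1 h by simp
                  hence "l = i" using co_alpha[OF l(1) iI] by (auto split: if_splits)
                  thus False using l less.prems(2) by simp
                qed
                moreover have "vec AA 0 = alpha j"
                  using h True by (simp add: vec_def algebra_simps)
                ultimately show ?thesis unfolding goal using Phi.Phi_base[of j R] Phi_step(3) by simp
              next
                assume "vec (AA + BB) BB \<in> Phi Bs"
                thus ?thesis using dj[of "AA+BB" BB] ui[of "AA+BB" "AA+BB"] uj[of "BB" "AA + BB"] 2 True
                    uj[of AA "AA + BB"] unfolding goal by (auto simp: algebra_simps)
              qed
            next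
              case False
              have 1: "vec (AA + BB) BB \<in> Phi Bs" using di[of 0 BB] v1 2 AB1 False by auto
              have 2: "vec (AA + BB) (AA + BB) \<in> Phi Bs" using dj[of "AA + BB" BB] 1 2 AB1 by auto
              have 3: "vec AA (AA + BB) \<in> Phi Bs" using ui[of "AA + BB" "AA + BB"] 2 \<open>a = 1\<close> AB1 by auto
              show ?thesis using uj[of AA "AA + BB"] 3 \<open>b = 1\<close> AB1 unfolding goal by auto
            qed
          next
            case 3
            have 1: "vec (AA + BB) BB \<in> Phi Bs" using di[of 0 BB] v1 3 AB1 by auto
            have 2: "vec (AA + BB) (2 * AA + 2 * BB) \<in> Phi Bs" using dj[of "AA + BB" BB] 1 3 AB1 by auto
            have 4: "vec (2 * AA + BB) (2 * AA + 2 * BB) \<in> Phi Bs" using di[of "AA + BB" "2 * AA + 2 * BB"] 2 3 AB1 by (auto simp: algebra_simps)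
            have 5: "vec (2 * AA + BB) (2 * AA + BB) \<in> Phi Bs" using uj[of "2 * AA + BB" "2 * AA + 2 * BB"] 4 3 AB1 by (auto simp: algebra_simps)
            have 6: "vec AA (2 * AA + BB) \<in> Phi Bs" using ui[of "2 * AA + BB" "2 * AA + BB"] 5 3 AB1 by (auto simp: algebra_simps)
            show ?thesis using uj[of AA "2 * AA + BB"] 6 3 AB1 unfolding goal by (auto simp: algebra_simps)
          next
            case 4
            have 1: "vec (AA + 2 * BB) BB \<in> Phi Bs" using di[of 0 BB] v1 4 AB1 by auto
            have 2: "vec (AA + 2 * BB) (AA + 2 * BB) \<in> Phi Bs" using dj[of "AA + 2 * BB" BB] 1 4 AB1 by auto
            have 3: "vec (2 * AA + 2 * BB) (AA + 2 * BB) \<in> Phi Bs" using di[of "AA + 2 * BB" "AA + 2 * BB"] 2 4 AB1 by (auto simp: algebra_simps)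
            have 5: "vec (2 * AA + 2 * BB) (AA + BB) \<in> Phi Bs" using uj[of "2 * AA + 2 * BB" "AA + 2 * BB"] 3 4 AB1 by (auto simp: algebra_simps)
            have 6: "vec AA (AA + BB) \<in> Phi Bs" using ui[of "2 * AA + 2 * BB" "AA + BB"] 5 4 AB1 by (auto simp: algebra_simps)
            show ?thesis using uj[of AA "AA + BB"] 6 4 AB1 unfolding goal by (auto simp: algebra_simps)
          next
            case 5
            have 1: "vec (AA + BB) BB \<in> Phi Bs" using di[of 0 BB] v1 5 AB1 by auto
            have 2: "vec (AA + BB) (3 * AA + 3 * BB) \<in> Phi Bs" using dj[of "AA + BB" BB] 1 5 AB1 by auto
            have 3: "vec (3 * AA + 2 * BB) (3 * AA + 3 * BB) \<in> Phi Bs" using di[of "AA + BB" "3 * AA + 3 * BB"] 2 5 AB1 by (auto simp: algebra_simps)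
            have 4: "vec (3 * AA + 2 * BB) (6 * AA + 4 * BB) \<in> Phi Bs" using dj[of "3 * AA + 2 * BB" "3 * AA + 3 * BB"] 3 5 AB1 by (auto simp: algebra_simps)
            have 6: "vec (4 * AA + 2 * BB) (6 * AA + 4 * BB) \<in> Phi Bs" using di[of "3 * AA + 2 * BB" "6 * AA + 4 * BB"] 4 5 AB1 by (auto simp: algebra_simps)
            have 7: "vec (4 * AA + 2 * BB) (6 * AA + 3 * BB) \<in> Phi Bs" using uj[of "4 * AA + 2 * BB" "6 * AA + 4 * BB"] 6 5 AB1 by (auto simp: algebra_simps)
            have 8: "vec (3 * AA + BB) (6 * AA + 3 * BB) \<in> Phi Bs" using ui[of "4 * AA + 2 * BB" "6 * AA + 3 * BB"] 7 5 AB1 by (auto simp: algebra_simps)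
            have 9: "vec (3 * AA + BB) (3 * AA + BB) \<in> Phi Bs" using uj[of "3 * AA + BB" "6 * AA + 3 * BB"] 8 5 AB1 by (auto simp: algebra_simps)
            have 10: "vec AA (3 * AA + BB) \<in> Phi Bs" using ui[of "3 * AA + BB" "3 * AA + BB"] 9 5 AB1 by (auto simp: algebra_simps)
            show ?thesis using uj[of AA "3 * AA + BB"] 10 5 AB1 unfolding goal by (auto simp: algebra_simps)
          next
            case 6
            have 1: "vec (AA + 3 * BB) BB \<in> Phi Bs" using di[of 0 BB] v1 6 AB1 by auto
            have 2: "vec (AA + 3 * BB) (AA + 3 * BB) \<in> Phi Bs" using dj[of "AA + 3 * BB" BB] 1 6 AB1 by auto
            have 3: "vec (3 * AA + 6 * BB) (AA + 3 * BB) \<in> Phi Bs" using di[of "AA + 3 * BB" "AA + 3 * BB"] 2 6 AB1 by (auto simp: algebra_simps)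
            have 4: "vec (3 * AA + 6 * BB) (2 * AA + 4 * BB) \<in> Phi Bs" using dj[of "3 * AA + 6 * BB" "AA + 3 * BB"] 3 6 AB1 by (auto simp: algebra_simps)
            have 5: "vec (4 * AA + 6 * BB) (2 * AA + 4 * BB) \<in> Phi Bs" using di[of "3 * AA + 6 * BB" "2 * AA + 4 * BB"] 4 6 AB1 by (auto simp: algebra_simps)
            have 7: "vec (4 * AA + 6 * BB) (2 * AA + 3 * BB) \<in> Phi Bs" using uj[of "4 * AA + 6 * BB" "2 * AA + 4 * BB"] 5 6 AB1 by (auto simp: algebra_simps)
            have 8: "vec (3 * AA + 3 * BB) (2 * AA + 3 * BB) \<in> Phi Bs" using ui[of "4 * AA + 6 * BB" "2 * AA + 3 * BB"] 7 6 AB1 by (auto simp: algebra_simps)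
            have 9: "vec (3 * AA + 3 * BB) (AA + BB) \<in> Phi Bs" using uj[of "3 * AA + 3 * BB" "2 * AA + 3 * BB"] 8 6 AB1 by (auto simp: algebra_simps)
            have 10: "vec AA (AA + BB) \<in> Phi Bs" using ui[of "3 * AA + 3 * BB" "AA + BB"] 9 6 AB1 by (auto simp: algebra_simps)
            show ?thesis using uj[of AA "AA + BB"] 10 6 AB1 unfolding goal by (auto simp: algebra_simps)
          qed
        qed
      qed
    qed
  qed
qed

text \<open>A real s_i permutes the positive real roots other than alpha_i and negates alpha_i, so
  the sign can be followed letter by letter along w.\<close>

lemma root_real: "set w \<subseteq> R ==> j \<in> R ==> W w (alpha j) \<in> Phi R \<or> - W w (alpha j) \<in> Phi R"
proof (induction w)
  case (Cons i w)
  hence i: "i \<in> R" "i \<in> I" using RI by auto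
  from Cons consider "W w (alpha j) \<in> Phi R" | "- W w (alpha j) \<in> Phi R" by auto
  thus ?case
  proof cases
    case 1
    thus ?thesis
      using Phi_closed[of R "W w (alpha j)" i] i s_alpha[of i] Phi_base[of i R] by (cases "W w (alpha j) = alpha i") auto
  next
    case 2
    have e: "- W (i # w) (alpha j) = s i (- W w (alpha j))" using s_lin(4)[OF i(2)] by simp
    show ?thesis
    proof (cases "- W w (alpha j) = alpha i")
      case True
      hence "- W (i # w) (alpha j) = - alpha i" using e s_alpha[OF i(1)] by simp
      hence "W (i # w) (alpha j) = alpha i" by (metis minus_minus)
      thus ?thesis using Phi_base[OF i(1)] by simp
    next
      case False
      thus ?thesis using e Phi_closed[of R "- W w (alpha j)" i] i 2 by simp
    qed
  qed
qed (auto intro: Phi_base)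

lemma root_im: "set w \<subseteq> R ==> j \<in> I ==> j \<notin> R ==> W w (alpha j) \<in> Phi {j}"
proof (induction w)
  case (Cons i w)
  hence "W w (alpha j) \<in> Phi {j}" "i \<in> R" "i \<in> I" by (auto simp: R_def)
  moreover have "W w (alpha j) \<noteq> alpha i"
    using Phi_im_co[OF calculation(1)] Cons.prems calculation(2,3) by (auto simp: co_alpha split: if_splits)
  ultimately show ?case using Phi_closed[of "{j}"] Cons by auto
qed (auto intro: Phi_base)

lemma root_real_pos:
  assumes "set w \<subseteq> R" "j \<in> R" "W w (alpha j) \<in> posQ I alpha"
  shows "W w (alpha j) \<in> Phi R"
proof (rule ccontr)
  assume "\<not> ?thesis"
  hence "- W w (alpha j) \<in> Phi R" using root_real assms by blast
  hence "1 <= ht (- W w (alpha j))" using Phi_int[of "- W w (alpha j)" R] RI by blast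
  moreover have "0 <= ht (W w (alpha j))" using cone_ht posQ_cone assms by blast
  ultimately show False by simp
qed

subsection \<open>Coroots\<close>

text \<open>The map alpha_l -> d_l alpha_l^vee commutes with the real reflections, so d_j beta^vee
  has the same coefficients in the d_l alpha_l^vee as beta has in the alpha_l. For imaginary j the
  symmetry \<open>sym\<close> has to be supplied, since \<open>rdat\<close> only symmetrizes pairs
  of real indices.\<close>

lemma coroot_expand:
  assumes j: "j \<in> I" and sym: "!!l. l \<in> R ==> d j * cor j (alpha l) = d l * cor l (alpha j)"
    and "set w \<subseteq> R"
  shows "\<exists>F y. finite F & F \<subseteq> insert j R & W w (alpha j) = (\<Sum>l\<in>F. y l *\<^sub>R alpha l) &
    (\<forall>x. d j * cor j (W (rev w) x) = (\<Sum>l\<in>F. y l * (d l * cor l x)))"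
  using assms(3)
proof (induction w)
  case Nil
  show ?case by (auto intro!: exI[of _ "{j}"] exI[of _ "%_. 1"])
next
  case (Cons i w)
  hence i: "i \<in> R" "i \<in> I" using RI by auto
  from Cons obtain F y where F: "finite F" "F \<subseteq> insert j R" "W w (alpha j) = (\<Sum>l\<in>F. y l *\<^sub>R alpha l)"
    and c: "!!x. d j * cor j (W (rev w) x) = (\<Sum>l\<in>F. y l * (d l * cor l x))" by auto
  define y0 where "y0 l = (if l \<in> F then y l else 0)" for l
  define k where "k = cor i (W w (alpha j))"
  define y' where "y' l = y0 l - (if l = i then k else 0)" for l
  have I: "insert j R \<subseteq> I" using j by (auto simp: R_def)
  have F0: "(\<Sum>l\<in>insert i F. y0 l *\<^sub>R g l) = (\<Sum>l\<in>F. y l *\<^sub>R g l)" for g :: "'i => 'v"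
    by (rule sum.mono_neutral_cong_right) (use F in \<open>auto simp: y0_def\<close>)
  have F1: "(\<Sum>l\<in>insert i F. y0 l * g l) = (\<Sum>l\<in>F. y l * g l)" for g :: "'i => real"
    by (rule sum.mono_neutral_cong_right) (use F in \<open>auto simp: y0_def\<close>)
  have d1: "(\<Sum>l\<in>insert i F. (if l = i then k else 0) *\<^sub>R g l) = k *\<^sub>R g i" for g :: "'i => 'v"
  proof -
    have "(\<Sum>l\<in>insert i F. (if l = i then k else 0) *\<^sub>R g l) = (\<Sum>l\<in>insert i F. if l = i then k *\<^sub>R g l else 0)"
      by (intro sum.cong) auto
    thus ?thesis using F(1) by simp
  qed
  have d2: "(\<Sum>l\<in>insert i F. (if l = i then k else 0) * g l) = k * g i" for g :: "'i => real"
  proof -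
    have "(\<Sum>l\<in>insert i F. (if l = i then k else 0) * g l) = (\<Sum>l\<in>insert i F. if l = i then k * g l else 0)"
      by (intro sum.cong) auto
    thus ?thesis using F(1) by simp
  qed
  have "W (i # w) (alpha j) = (\<Sum>l\<in>insert i F. y' l *\<^sub>R alpha l)"
    by (simp only: y'_def scaleR_left_diff_distrib sum_subtractf F0 d1) (simp add: refl_def k_def F(3))
  moreover have "d j * cor j (W (rev (i # w)) x) = (\<Sum>l\<in>insert i F. y' l * (d l * cor l x))" for x
  proof -
    have "d j * cor j (W (rev (i # w)) x) = (\<Sum>l\<in>F. y l * (d l * cor l (s i x)))" using c[of "s i x"] by simp
    also have "... = (\<Sum>l\<in>F. y l * (d l * cor l x) - cor i x * (y l * (d l * cor l (alpha i))))"
      using F(2) I by (intro sum.cong) (auto simp: refl_def algebra_simps subset_eq)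
    also have "... = (\<Sum>l\<in>F. y l * (d l * cor l x)) - cor i x * (\<Sum>l\<in>F. y l * (d l * cor l (alpha i)))"
      by (simp add: sum_subtractf sum_distrib_left)
    also have "(\<Sum>l\<in>F. y l * (d l * cor l (alpha i))) = (\<Sum>l\<in>F. y l * (d i * cor i (alpha l)))"
    proof (intro sum.cong refl)
      fix l assume "l \<in> F"
      hence "l = j \<or> l \<in> R" using F(2) by auto
      hence "d l * cor l (alpha i) = d i * cor i (alpha l)"
        using sym[OF i(1)] d_sym[of l i] i by (auto simp: R_def)
      thus "y l * (d l * cor l (alpha i)) = y l * (d i * cor i (alpha l))" by simp
    qed
    also have "... = d i * k"
      unfolding k_def F(3) using lin_cor[OF i(2)] i by (simp add: linear_sum sum_distrib_left algebra_simps)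
    finally show ?thesis
      by (simp only: y'_def left_diff_distrib sum_subtractf F1 d2) (simp add: algebra_simps)
  qed
  ultimately show ?case using F i by (intro exI[of _ "insert i F"] exI[of _ y']) auto
qed

lemma coroot_expand_co:
  assumes j: "j \<in> I" and sym: "!!l. l \<in> R ==> d j * cor j (alpha l) = d l * cor l (alpha j)"
    and w: "set w \<subseteq> R"
  shows "\<exists>F. finite F & F \<subseteq> insert j R & W w (alpha j) = (\<Sum>l\<in>F. co l (W w (alpha j)) *\<^sub>R alpha l) &
    (\<forall>x. d j * cor j (W (rev w) x) = (\<Sum>l\<in>F. co l (W w (alpha j)) * (d l * cor l x))) &
    (\<forall>l\<in>I. l \<notin> F --> co l (W w (alpha j)) = 0)"
proof -
  obtain F y where F: "finite F" "F \<subseteq> insert j R" "W w (alpha j) = (\<Sum>l\<in>F. y l *\<^sub>R alpha l)"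
    and c: "!!x. d j * cor j (W (rev w) x) = (\<Sum>l\<in>F. y l * (d l * cor l x))"
    using coroot_expand[OF j sym w] by auto
  have FI: "F \<subseteq> I" using F(2) j by (auto simp: R_def)
  have co: "co i (W w (alpha j)) = (if i \<in> F then y i else 0)" if "i \<in> I" for i
  proof -
    have "co i (W w (alpha j)) = (\<Sum>l\<in>F. y l * co i (alpha l))"
      unfolding F(3) using lin_co[OF that] that by (simp add: linear_sum)
    also have "... = (\<Sum>l\<in>F. if i = l then y l else 0)"
      using FI that by (intro sum.cong) (auto simp: co_alpha)
    finally show ?thesis using F(1) by simp
  qed
  hence co': "!!i. i \<in> F ==> co i (W w (alpha j)) = y i" using FI by auto
  show ?thesis
    by (intro exI[of _ F]) (use F c co co' in auto)
qed

lemma d_sym_R: "j \<in> R ==> l \<in> R ==> d j * cor j (alpha l) = d l * cor l (alpha j)"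
  using d_sym by (auto simp: R_def)

lemma coroot_simple:
  assumes j: "j \<in> I" and sym: "!!l. l \<in> R ==> d j * cor j (alpha l) = d l * cor l (alpha j)"
    and w: "set w \<subseteq> R" and i: "i \<in> I" and eq: "W w (alpha j) = alpha i"
  shows "d j * cor j (W (rev w) x) = d i * cor i x"
proof -
  obtain F where F: "finite F" "F \<subseteq> insert j R" "W w (alpha j) = (\<Sum>l\<in>F. co l (W w (alpha j)) *\<^sub>R alpha l)"
    "!!x. d j * cor j (W (rev w) x) = (\<Sum>l\<in>F. co l (W w (alpha j)) * (d l * cor l x))"
    "!!l. l \<in> I ==> l \<notin> F ==> co l (W w (alpha j)) = 0"
    using coroot_expand_co[OF j sym w] by auto
  have iF: "i \<in> F" using F(5)[of i] i by (auto simp: eq co_alpha)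
  have FI: "F \<subseteq> I" using F(2) j by (auto simp: R_def)
  have "(\<Sum>l\<in>F. co l (W w (alpha j)) * (d l * cor l x)) = (\<Sum>l\<in>F. if l = i then d l * cor l x else 0)"
  proof (intro sum.cong HOL.refl)
    fix l assume "l \<in> F"
    thus "co l (W w (alpha j)) * (d l * cor l x) = (if l = i then d l * cor l x else 0)"
      unfolding eq using FI i co_alpha[of l i] by auto
  qed
  also have "... = d i * cor i x" using F(1) iF by simp
  finally show ?thesis unfolding F(4) .
qed

text \<open>Evaluating both coroots at alpha_i gives 2 d_j = 2 d_i, so the factors of
  \<open>coroot_simple\<close> cancel: the coroot of a real simple root does not depend on the word
  that presents the root.\<close>

lemma coroot_simple_real:
  assumes j: "j \<in> R" and w: "set w \<subseteq> R" and i: "i \<in> R" and eq: "W w (alpha j) = alpha i"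
  shows "cor j (W (rev w) x) = cor i x"
proof -
  have 1: "d j * cor j (W (rev w) x) = d i * cor i x" for x
    using coroot_simple[OF RI[OF j] _ w RI[OF i] eq] d_sym_R[OF j] by blast
  have "W (rev w) (alpha i) = alpha j" using W_rev[OF w, of "alpha j"] eq by simp
  hence "d j * 2 = d i * 2" using 1[of "alpha i"] cor_aa i j by simp
  hence "d i = d j" by simp
  moreover have "d j > 0" using d_pos j by (auto simp: R_def)
  ultimately show ?thesis using 1[of x] by simp
qed

text \<open>Up to the positive factors d, the coroot is a nonnegative combination of real simple
  coroots.\<close>

lemma coroot_nonneg:
  assumes j: "j \<in> R" and w: "set w \<subseteq> R" and pos: "W w (alpha j) \<in> posQ I alpha"
    and x: "!!l. l \<in> R ==> cor l x >= 0"
  shows "cor j (W (rev w) x) >= 0"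
proof -
  obtain F where F: "finite F" "F \<subseteq> insert j R" "W w (alpha j) = (\<Sum>l\<in>F. co l (W w (alpha j)) *\<^sub>R alpha l)"
    "!!x. d j * cor j (W (rev w) x) = (\<Sum>l\<in>F. co l (W w (alpha j)) * (d l * cor l x))"
    "!!l. l \<in> I ==> l \<notin> F ==> co l (W w (alpha j)) = 0"
    using coroot_expand_co[OF RI[OF j] d_sym_R[OF j] w] by auto
  have "d j * cor j (W (rev w) x) >= 0"
    unfolding F(4)
  proof (rule sum_nonneg)
    fix l assume "l \<in> F"
    hence l: "l \<in> R" using F(2) j by auto
    hence "0 <= co l (W w (alpha j))" "0 < d l" "0 <= cor l x"
      using posQ_co[OF pos RI] x d_pos by (auto simp: R_def)
    thus "0 <= co l (W w (alpha j)) * (d l * cor l x)" by simp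
  qed
  thus ?thesis using d_pos[of j] j by (auto simp: R_def zero_le_mult_iff)
qed

end

section \<open>The order on an orbit\<close>

context rdat
begin

abbreviation orb :: "'v => 'v set" where "orb \<equiv> Worbit I alpha cor"
abbreviation rr :: "'v => 'v => real => bool => bool" where "rr \<equiv> rrel I A alpha cor"
abbreviation gt :: "'v => 'v => 'v => bool" where "gt \<equiv> gtW I A alpha cor"
abbreviation cs :: "'v => 'v => 'v => real => bool => bool" where "cs \<equiv> cstep I A alpha cor"
abbreviation ach :: "'v => real => 'v => 'v => bool" where "ach \<equiv> achain I A alpha cor"

definition isroot :: "'i list => 'i => bool" where
  "isroot w j \<longleftrightarrow> set w \<subseteq> R & j \<in> I & (j \<in> R --> W w (alpha j) \<in> posQ I alpha)"

lemma rr_iff: "rr x' x c im \<longleftrightarrow> (\<exists>w j. isroot w j & (im \<longleftrightarrow> j \<notin> R) & c = cor j (W (rev w) x) & 0 < c &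
    x' = x - c *\<^sub>R W w (alpha j))"
proof -
  have *: "W w (s j (W (rev w) x)) = x - cor j (W (rev w) x) *\<^sub>R W w (alpha j)" if "set w \<subseteq> R" for w j
    using that R_subI[OF that] by (simp add: refl_def W_lin W_rev')
  have R2: "A j j = 2 \<longleftrightarrow> j \<in> R" if "j \<in> I" for j using that by (simp add: R_def)
  show ?thesis unfolding rrel_def isroot_def R_def[symmetric]
  proof (intro iffI; elim exE conjE)
    fix w j assume a: "set w \<subseteq> R" "j \<in> I" "im = (A j j \<noteq> 2)" "A j j = 2 --> W w (alpha j) \<in> posQ I alpha"
      "c = cor j (W (rev w) x)" "0 < c" "x' = W w (s j (W (rev w) x))"
    thus "\<exists>w j. (set w \<subseteq> R & j \<in> I & (j \<in> R --> W w (alpha j) \<in> posQ I alpha)) & im = (j \<notin> R) &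
       c = cor j (W (rev w) x) & 0 < c & x' = x - c *\<^sub>R W w (alpha j)"
      by (intro exI[of _ w] exI[of _ j]) (auto simp: * R2)
  next
    fix w j assume a: "set w \<subseteq> R" "j \<in> I" "j \<in> R --> W w (alpha j) \<in> posQ I alpha" "im = (j \<notin> R)"
      "c = cor j (W (rev w) x)" "0 < c" "x' = x - c *\<^sub>R W w (alpha j)"
    thus "\<exists>w i. set w \<subseteq> R & i \<in> I & im = (A i i \<noteq> 2) & (A i i = 2 --> W w (alpha i) \<in> posQ I alpha) &
        c = cor i (W (rev w) x) & 0 < c & x' = W w (s i (W (rev w) x))"
      by (intro exI[of _ w] exI[of _ j]) (auto simp: * R2)
  qed
qed

lemma isroot_Phi: "isroot w j ==> W w (alpha j) \<in> (if j \<in> R then Phi R else Phi {j})"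
  unfolding isroot_def using root_real_pos root_im by auto

lemma isroot_int:
  assumes "isroot w j"
  shows "W w (alpha j) \<in> posQ I alpha" "1 <= ht (W w (alpha j))" "!!i. i \<in> R ==> cor i (W w (alpha j)) \<in> \<int>"
proof -
  have "W w (alpha j) \<in> Phi R \<or> W w (alpha j) \<in> Phi {j}" using isroot_Phi[OF assms] by (auto split: if_splits)
  moreover have "R \<subseteq> I" "{j} \<subseteq> I" using assms by (auto simp: isroot_def R_def)
  ultimately show "W w (alpha j) \<in> posQ I alpha" "1 <= ht (W w (alpha j))" "!!i. i \<in> R ==> cor i (W w (alpha j)) \<in> \<int>"
    using Phi_int by blast+
qed

lemma isroot_refl:
  assumes r: "isroot w j" and i: "i \<in> R" and ne: "W w (alpha j) \<noteq> alpha i"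
  shows "isroot (i # w) j"
proof (cases "j \<in> R")
  case True
  have "W w (alpha j) \<in> Phi R" using isroot_Phi[OF r] True by simp
  hence "s i (W w (alpha j)) \<in> Phi R" using Phi_closed i ne by blast
  hence "s i (W w (alpha j)) \<in> posQ I alpha" using Phi_int[of _ R] RI by blast
  thus ?thesis using r i by (simp add: isroot_def)
next
  case False
  thus ?thesis using r i by (simp add: isroot_def)
qed

lemma rr_ht: "rr x' x c im ==> ht x' < ht x"
proof -
  assume "rr x' x c im"
  then obtain w j where w: "isroot w j" "0 < c" "x' = x - c *\<^sub>R W w (alpha j)" unfolding rr_iff by auto
  have "0 < c * ht (W w (alpha j))" using w(2) isroot_int(2)[OF w(1)] by simp
  thus ?thesis using w(3) by simp
qed

lemma rr_cone: "rr x' x c im ==> x - x' \<in> cone"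
  unfolding rr_iff using isroot_int(1) posQ_cone cone_scale by fastforce

text \<open>s_i carries the reflection in beta to the one in s_i beta, again an admissible root
  unless beta = alpha_i; in that case the relation is the simple reflection itself.\<close>

lemma rr_refl:
  assumes "rr x' x c im" "i \<in> R"
  shows "(x' = s i x & c = cor i x & \<not> im) \<or> rr (s i x') (s i x) c im"
proof -
  from assms obtain w j where w: "isroot w j" "im \<longleftrightarrow> j \<notin> R" "c = cor j (W (rev w) x)" "0 < c" "x' = x - c *\<^sub>R W w (alpha j)"
    unfolding rr_iff by auto
  show ?thesis
  proof (cases "W w (alpha j) = alpha i")
    case True
    have jR: "j \<in> R"
    proof (rule ccontr)
      assume "j \<notin> R"
      moreover have "j \<in> I" using w(1) by (simp add: isroot_def)
      ultimately have "co j (alpha i) = 1" using Phi_im_co[of "alpha i" j] isroot_Phi[OF w(1)] True by simp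
      hence "j = i" using co_alpha \<open>j \<in> I\<close> RI[OF assms(2)] by (auto split: if_splits)
      thus False using \<open>j \<notin> R\<close> assms by simp
    qed
    hence "c = cor i x" using w coroot_simple_real[OF jR _ assms(2) True] by (auto simp: isroot_def)
    thus ?thesis using w True jR by (simp add: refl_def)
  next
    case False
    have wR: "set w \<subseteq> R" using w by (simp add: isroot_def)
    have "isroot (i # w) j" using isroot_refl w assms False by blast
    moreover have "W (rev (i # w)) (s i x) = W (rev w) x" using s_s assms by simp
    moreover have "s i x' = s i x - c *\<^sub>R W (i # w) (alpha j)"
      using w assms RI by (simp add: s_lin)
    ultimately show ?thesis unfolding rr_iff using w by (metis)
  qed
qed

lemma rr_simple: "i \<in> R ==> 0 < cor i x ==> rr (s i x) x (cor i x) False"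
  unfolding rr_iff using posQ_alpha[of i I alpha] RI
  by (intro exI[of _ "[]"] exI[of _ i]) (auto simp: isroot_def refl_def)

definition g1 :: "'v => 'v => 'v => bool" where
  "g1 lam x' x \<longleftrightarrow> x' \<in> orb lam & x \<in> orb lam & (\<exists>c im. rr x' x c im)"

lemma gt_g1: "gt lam = (g1 lam)\<^sup>+\<^sup>+"
  unfolding gtW_def g1_def by simp

definition ge :: "'v => 'v => 'v => bool" where "ge lam x y \<longleftrightarrow> x = y \<or> gt lam x y"

lemma g1_gt: "g1 lam x y ==> gt lam x y" unfolding gt_g1 by blast
lemma gt_trans: "gt lam x y ==> gt lam y z ==> gt lam x z" unfolding gt_g1 by (rule tranclp_trans)
lemma ge_gt: "ge lam x y ==> gt lam y z ==> gt lam x z" "gt lam x y ==> ge lam y z ==> gt lam x z"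
  by (auto simp: ge_def intro: gt_trans)
lemma ge_trans: "ge lam x y ==> ge lam y z ==> ge lam x z"
  by (auto simp: ge_def intro: gt_trans)
lemma ge_refl: "ge lam x x" by (simp add: ge_def)
lemma gt_ge: "gt lam x y ==> ge lam x y" by (simp add: ge_def)

lemma gt_ht: "gt lam x y ==> ht x < ht y"
  unfolding gt_g1 by (induction rule: tranclp.induct) (auto simp: g1_def dest: rr_ht)

lemma gt_orb: "gt lam x y ==> x \<in> orb lam & y \<in> orb lam"
  unfolding gt_g1 by (induction rule: tranclp.induct) (auto simp: g1_def)

lemma gt_cone: "gt lam x y ==> y - x \<in> cone"
  unfolding gt_g1
proof (induction rule: tranclp.induct)
  case (r_into_trancl a b)
  thus ?case using rr_cone by (auto simp: g1_def)
next
  case (trancl_into_trancl a b c)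
  hence "c - b \<in> cone" using rr_cone by (auto simp: g1_def)
  thus ?case using cone_add[of "c - b" "b - a"] trancl_into_trancl by simp
qed

lemma ge_cone: "ge lam x y ==> y - x \<in> cone"
  using gt_cone cone_zero by (auto simp: ge_def)

lemma gt_irrefl: "\<not> gt lam x x" using gt_ht by fastforce
lemma gt_asym: "gt lam x y ==> ge lam y x ==> False"
  using gt_ht[of lam x y] gt_ht[of lam y x] by (auto simp: ge_def)

lemma orb_s: "x \<in> orb lam ==> i \<in> R ==> s i x \<in> orb lam"
  by (auto intro: Worbit.step RI)

lemma g1_simple: "x \<in> orb lam ==> i \<in> R ==> 0 < cor i x ==> g1 lam (s i x) x"
  using rr_simple orb_s by (auto simp: g1_def)

lemma ge_simple: "x \<in> orb lam ==> i \<in> R ==> 0 <= cor i x ==> ge lam (s i x) x"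
proof -
  assume a: "x \<in> orb lam" "i \<in> R" "0 <= cor i x"
  show ?thesis
  proof (cases "cor i x = 0")
    case True thus ?thesis by (simp add: ge_def refl_def)
  next
    case False thus ?thesis using a g1_simple g1_gt gt_ge by simp
  qed
qed

lemma ge_simple': "x \<in> orb lam ==> i \<in> R ==> cor i x <= 0 ==> ge lam x (s i x)"
  using ge_simple[of "s i x" lam i] orb_s cor_s s_s by simp

text \<open>Of x and s_i x, \<open>dn\<close> takes the lower and \<open>up\<close> the higher
  element of the order, in which greater elements have smaller height.\<close>

definition dn :: "'i => 'v => 'v" where "dn i x = (if cor i x < 0 then s i x else x)"
definition up :: "'i => 'v => 'v" where "up i x = (if cor i x > 0 then s i x else x)"

text \<open>The lifting property. If x = s_i y, the two pairs coincide; otherwise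
  \<open>rr_refl\<close> relates s_i x to s_i y as well, and the four elements are compared by
  transitivity for each choice of signs.\<close>

lemma g1_dn_up:
  assumes g: "g1 lam x y" and i: "i \<in> R"
  shows "ge lam (dn i x) (dn i y) & ge lam (up i x) (up i y)"
proof -
  have o: "x \<in> orb lam" "y \<in> orb lam" using g by (auto simp: g1_def)
  obtain c im where r: "rr x y c im" using g by (auto simp: g1_def)
  show ?thesis
  proof (cases "x = s i y")
    case True
    hence "cor i x = - cor i y" "s i x = y" using i by (auto simp: cor_s s_s)
    thus ?thesis using True by (cases "cor i y = 0") (auto simp: dn_def up_def ge_def refl_def)
  next
    case False
    hence "rr (s i x) (s i y) c im" using rr_refl[OF r i] by auto
    hence g': "gt lam (s i x) (s i y)" using o i orb_s by (intro g1_gt) (auto simp: g1_def)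
    have gg: "gt lam x y" using g g1_gt by blast
    have 1: "ge lam x (s i x)" if "cor i x <= 0" using ge_simple' o i that by blast
    have 2: "ge lam (s i x) x" if "cor i x >= 0" using ge_simple o i that by blast
    have 3: "ge lam y (s i y)" if "cor i y <= 0" using ge_simple' o i that by blast
    have 4: "ge lam (s i y) y" if "cor i y >= 0" using ge_simple o i that by blast
    show ?thesis
      using g' gg 1 2 3 4 unfolding dn_def up_def
      by (smt (verit, best) ge_trans gt_ge)
  qed
qed

lemma ge_dn_up:
  assumes "ge lam x y" "i \<in> R"
  shows "ge lam (dn i x) (dn i y)" "ge lam (up i x) (up i y)"
proof -
  have "ge lam (dn i x) (dn i y) & ge lam (up i x) (up i y)" if "gt lam x y"
    using that unfolding gt_g1
  proof (induction rule: tranclp.induct)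
    case (r_into_trancl a b) thus ?case using g1_dn_up assms by blast
  next
    case (trancl_into_trancl a b c) thus ?case using g1_dn_up[OF trancl_into_trancl(2) assms(2)] ge_trans by blast
  qed
  thus "ge lam (dn i x) (dn i y)" "ge lam (up i x) (up i y)"
    using assms by (auto simp: ge_def)
qed

text \<open>\<open>dn i\<close> is monotone and fixes \<open>lam\<close>, which settles the real
  letters. Imaginary letters enter through a hypothesis, because \<open>rdat\<close> puts no sign
  condition on their coroots; it is vacuous when every index is real.\<close>

lemma orb_ge:
  assumes "!!i. i \<in> I ==> i \<notin> R ==> (!!x. x \<in> orb lam ==> ge lam x lam ==> ge lam (s i x) x)" "!!i. i \<in> R ==> cor i lam >= 0"
    and "x \<in> orb lam"
  shows "ge lam x lam"
  using assms(3)
proof (induction rule: Worbit.induct)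
  case base thus ?case by (simp add: ge_refl)
next
  case (step x i)
  show ?case
  proof (cases "i \<in> R")
    case False thus ?thesis using assms(1)[of i x] step ge_trans by blast
  next
    case True
    show ?thesis
    proof (cases "cor i x >= 0")
      case True' : True
      thus ?thesis using ge_trans[OF ge_simple[OF step(1) True True'] step.IH] by blast
    next
      case False
      hence "dn i x = s i x" "dn i lam = lam" using assms(2)[OF True] by (auto simp: dn_def)
      thus ?thesis using ge_dn_up(1)[OF step.IH True] by simp
    qed
  qed
qed

subsection \<open>Covers\<close>

text \<open>\<open>dn i\<close> sends both ends to x, so it squeezes every z in between to x as
  well, and z can only be x or s_i x.\<close>

lemma cs_simple: "x \<in> orb lam ==> i \<in> R ==> 0 < cor i x ==> cs lam (s i x) x (cor i x) False"
proof -
  assume a: "x \<in> orb lam" "i \<in> R" "0 < cor i x"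
  have "False" if z: "gt lam (s i x) z" "gt lam z x" for z
  proof -
    have "dn i (s i x) = x" "dn i x = x" using a by (auto simp: dn_def cor_s s_s)
    hence "ge lam x (dn i z)" "ge lam (dn i z) x"
      using ge_dn_up(1)[OF gt_ge[OF z(1)] a(2)] ge_dn_up(1)[OF gt_ge[OF z(2)] a(2)] by auto
    hence "dn i z = x" using gt_asym by (auto simp: ge_def)
    hence "z = x \<or> z = s i x" using s_s[OF a(2)] by (auto simp: dn_def split: if_splits)
    thus False using z gt_irrefl by auto
  qed
  thus ?thesis unfolding cstep_def using a orb_s rr_simple g1_gt[OF g1_simple] by blast
qed

text \<open>If the root of the covering were not alpha_i, then s_i x' would be above s_i x. Since x'
  is not below s_i x' and s_i x is not below x, with one of the two relations strict, one of the
  reflected elements would lie strictly between x' and x.\<close>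

lemma cs_turn:
  assumes c: "cs lam x' x c im" and i: "i \<in> R" and sg: "cor i x' <= 0" "cor i x >= 0" "cor i x' \<noteq> 0 \<or> cor i x \<noteq> 0"
  shows "x' = s i x & c = cor i x & \<not> im"
proof (rule ccontr)
  assume n: "\<not> ?thesis"
  have o: "x' \<in> orb lam" "x \<in> orb lam" and r: "rr x' x c im" using c by (auto simp: cstep_def)
  have "rr (s i x') (s i x) c im" using rr_refl[OF r i] n by auto
  hence g': "gt lam (s i x') (s i x)" using o i orb_s by (intro g1_gt) (auto simp: g1_def)
  have 1: "ge lam x' (s i x')" "ge lam (s i x) x" using ge_simple ge_simple' o i sg by auto
  consider "cor i x' < 0" | "cor i x > 0" using sg by linarith
  thus False
  proof cases
    case 1
    hence "gt lam x' (s i x')" using g1_gt[OF g1_simple[of "s i x'" lam i]] o i orb_s cor_s s_s by simp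
    moreover have "gt lam (s i x') x" using g' \<open>ge lam (s i x) x\<close> ge_gt by blast
    ultimately show False using c by (auto simp: cstep_def)
  next
    case 2
    hence "gt lam (s i x) x" using g1_gt[OF g1_simple] o i by simp
    moreover have "gt lam x' (s i x)" using g' \<open>ge lam x' (s i x')\<close> ge_gt by blast
    ultimately show False using c by (auto simp: cstep_def)
  qed
qed

text \<open>An element strictly between the reflected ends is moved between x' and x by
  \<open>dn\<close> or \<open>up\<close>, according to the common sign. So it is one of x', x or a
  reflection of them, and each possibility contradicts irreflexivity or the covering.\<close>

lemma cs_flip:
  assumes c: "cs lam x' x c im" and i: "i \<in> R" and sg: "(cor i x' > 0 & cor i x > 0) \<or> (cor i x' < 0 & cor i x < 0)"
  shows "cs lam (s i x') (s i x) c im"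
proof -
  have o: "x' \<in> orb lam" "x \<in> orb lam" and r: "rr x' x c im" and g: "gt lam x' x"
    and cov: "!!z. gt lam x' z ==> gt lam z x ==> False" using c by (auto simp: cstep_def)
  have "x' \<noteq> s i x" using sg cor_s[OF i, of x] by auto
  hence r': "rr (s i x') (s i x) c im" using rr_refl[OF r i] by auto
  hence g': "gt lam (s i x') (s i x)" using o i orb_s by (intro g1_gt) (auto simp: g1_def)
  have "False" if z: "gt lam (s i x') z" "gt lam z (s i x)" for z
  proof (cases "cor i x > 0")
    case True
    hence p: "cor i x' > 0" using sg by auto
    have e: "dn i (s i x') = x'" "dn i (s i x) = x" using True p i by (auto simp: dn_def cor_s s_s)
    have ge: "ge lam x' (dn i z)" "ge lam (dn i z) x"
      using ge_dn_up(1)[OF gt_ge[OF z(1)] i] ge_dn_up(1)[OF gt_ge[OF z(2)] i] e by auto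
    have sx: "gt lam (s i x) x" using g1_gt[OF g1_simple] o i True by blast
    consider "dn i z = x'" | "dn i z = x" using ge cov by (auto simp: ge_def)
    thus False
    proof cases
      case 1
      hence "z = x' \<or> z = s i x'" using s_s[OF i] by (auto simp: dn_def split: if_splits)
      thus False using z gt_irrefl cov[of "s i x"] sx by auto
    next
      case 2
      hence "z = x \<or> z = s i x" using s_s[OF i] by (auto simp: dn_def split: if_splits)
      thus False using z gt_irrefl gt_trans sx by blast
    qed
  next
    case False
    hence p: "cor i x' < 0" "cor i x < 0" using sg by auto
    have e: "up i (s i x') = x'" "up i (s i x) = x" using p i by (auto simp: up_def cor_s s_s)
    have ge: "ge lam x' (up i z)" "ge lam (up i z) x"
      using ge_dn_up(2)[OF gt_ge[OF z(1)] i] ge_dn_up(2)[OF gt_ge[OF z(2)] i] e by auto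
    have sx: "gt lam x' (s i x')" using g1_gt[OF g1_simple[of "s i x'" lam i]] o i orb_s cor_s s_s p by simp
    consider "up i z = x'" | "up i z = x" using ge cov by (auto simp: ge_def)
    thus False
    proof cases
      case 1
      hence "z = x' \<or> z = s i x'" using s_s[OF i] by (auto simp: up_def split: if_splits)
      thus False using z gt_irrefl gt_trans sx by blast
    next
      case 2
      hence "z = x \<or> z = s i x" using s_s[OF i] by (auto simp: up_def split: if_splits)
      thus False using z gt_irrefl cov[of "s i x'"] sx by auto
    qed
  qed
  thus ?thesis unfolding cstep_def using o i orb_s r' g' by blast
qed

subsection \<open>Chains\<close>

definition st :: "'v => real => 'v => 'v => bool" where
  "st lam a x y \<longleftrightarrow> (\<exists>c im. cs lam x y c im & (if im then a * c = 1 else a * c \<in> \<int> & a * c > 0))"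

text \<open>As a closure of single steps, a chain admits induction from either end.\<close>

lemma ach_iff: "ach lam a x y \<longleftrightarrow> (st lam a)\<^sup>*\<^sup>* x y"
proof
  assume "ach lam a x y"
  then obtain ns where ns: "ns \<noteq> []" "hd ns = x" "last ns = y" "\<forall>s < length ns - 1. st lam a (ns ! s) (ns ! Suc s)"
    unfolding achain_def st_def by auto
  have "(st lam a)\<^sup>*\<^sup>* (ns ! 0) (ns ! k)" if "k < length ns" for k
    using that
  proof (induction k)
    case (Suc k)
    hence "st lam a (ns ! k) (ns ! Suc k)" using ns(4) by auto
    thus ?case using Suc by (auto intro: rtranclp.rtrancl_into_rtrancl)
  qed auto
  from this[of "length ns - 1"] ns(1-3) show "(st lam a)\<^sup>*\<^sup>* x y"
    by (simp add: hd_conv_nth last_conv_nth)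
next
  assume "(st lam a)\<^sup>*\<^sup>* x y"
  thus "ach lam a x y"
  proof (induction rule: rtranclp_induct)
    case base
    show ?case unfolding achain_def by (intro exI[of _ "[x]"]) simp
  next
    case (step y z)
    then obtain ns where ns: "ns \<noteq> []" "hd ns = x" "last ns = y" "\<forall>s < length ns - 1. st lam a (ns ! s) (ns ! Suc s)"
      unfolding achain_def st_def by auto
    have "st lam a ((ns @ [z]) ! k) ((ns @ [z]) ! Suc k)" if "k < length (ns @ [z]) - 1" for k
      using that ns step(2) by (cases "k = length ns - 1") (auto simp: nth_append last_conv_nth)
    thus ?case unfolding achain_def st_def[symmetric]
      using ns by (intro exI[of _ "ns @ [z]"]) auto
  qed
qed

lemma ach_refl: "ach lam a x x" by (simp add: ach_iff)
lemma ach_trans: "ach lam a x y ==> ach lam a y z ==> ach lam a x z" unfolding ach_iff by (rule rtranclp_trans)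
lemma st_ach: "st lam a x y ==> ach lam a x y" unfolding ach_iff by blast

lemma st_gt: "st lam a x y ==> gt lam x y" by (auto simp: st_def cstep_def)

lemma ach_ge: "ach lam a x y ==> ge lam x y"
  unfolding ach_iff by (induction rule: rtranclp_induct) (auto simp: ge_refl intro: ge_trans gt_ge st_gt)

lemma st_cong:
  assumes "st lam a x y" "i \<in> R" shows "a * cor i x - a * cor i y \<in> \<int>"
proof -
  obtain c im where c: "cs lam x y c im" "if im then a * c = 1 else a * c \<in> \<int> & a * c > 0" using assms by (auto simp: st_def)
  then obtain w j where w: "isroot w j" "x = y - c *\<^sub>R W w (alpha j)" unfolding cstep_def rr_iff by auto
  have "a * cor i x - a * cor i y = - (a * c) * cor i (W w (alpha j))" unfolding w(2) using RI[OF assms(2)] by (simp add: algebra_simps)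
  moreover have "a * c \<in> \<int>" using c(2) by (auto split: if_splits)
  ultimately show ?thesis using isroot_int(3)[OF w(1) assms(2)] by simp
qed

lemma ach_cong: "ach lam a x y ==> i \<in> R ==> a * cor i x - a * cor i y \<in> \<int>"
  unfolding ach_iff
proof (induction rule: rtranclp_induct)
  case (step y z)
  thus ?case using st_cong[of lam a y z i] Ints_add by fastforce
qed auto

lemma st_turn:
  assumes "st lam a x y" "i \<in> R" "cor i x <= 0" "cor i y >= 0" "cor i x \<noteq> 0 \<or> cor i y \<noteq> 0"
  shows "x = s i y" "a * cor i y \<in> \<int>" "cor i y > 0"
proof -
  obtain c im where c: "cs lam x y c im" "if im then a * c = 1 else a * c \<in> \<int> & a * c > 0" using assms by (auto simp: st_def)
  from cs_turn[OF c(1) assms(2-)] c show *: "x = s i y" "a * cor i y \<in> \<int>" by auto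
  show "cor i y > 0" using assms(4,5) * cor_s[OF assms(2), of y] by auto
qed

lemma st_flip:
  "st lam a x y ==> i \<in> R ==> (cor i x > 0 & cor i y > 0) \<or> (cor i x < 0 & cor i y < 0) ==> st lam a (s i x) (s i y)"
  unfolding st_def using cs_flip by blast

text \<open>The step at which the pairing with i becomes positive is s_i itself, by
  \<open>cs_turn\<close>. Dropping it and reflecting all steps after it gives a chain ending in s_i
  y; integrality at the turn is carried on to y by \<open>st_cong\<close>.\<close>

lemma ach_plus:
  assumes "ach lam a x y" "i \<in> R" "cor i x <= 0" "cor i y > 0"
  shows "ach lam a x (s i y) & a * cor i y \<in> \<int>"
  using assms(1,4) unfolding ach_iff
proof (induction rule: rtranclp_induct)
  case base thus ?case using assms by simp
next
  case (step y z)
  show ?case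
  proof (cases "cor i y <= 0")
    case True
    hence "y = s i z" "a * cor i z \<in> \<int>" using st_turn[OF step(2) assms(2)] step.prems by auto
    thus ?thesis using step by simp
  next
    case False
    hence "(st lam a)\<^sup>*\<^sup>* x (s i y)" "a * cor i y \<in> \<int>" using step by auto
    moreover have "st lam a (s i y) (s i z)" using st_flip[OF step(2) assms(2)] False step.prems by simp
    moreover have "a * cor i z \<in> \<int>" using st_cong[OF step(2) assms(2)] calculation Ints_diff[of "a * cor i y" "a * cor i y - a * cor i z"] by simp
    ultimately show ?thesis by (auto intro: rtranclp.rtrancl_into_rtrancl)
  qed
qed

text \<open>The mirror image of \<open>ach_plus\<close>: the steps before the turn are reflected and
  the turn is dropped.\<close>

lemma ach_minus:
  assumes "ach lam a x y" "i \<in> R" "cor i x < 0" "cor i y >= 0"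
  shows "ach lam a (s i x) y & a * cor i x \<in> \<int>"
  using assms(1,3) unfolding ach_iff
proof (induction rule: converse_rtranclp_induct)
  case base thus ?case using assms by simp
next
  case (step x z)
  show ?case
  proof (cases "cor i z >= 0")
    case True
    hence "x = s i z" "a * cor i z \<in> \<int>" using st_turn[OF step(1) assms(2)] step.prems by auto
    thus ?thesis using step s_s cor_s assms(2) by simp
  next
    case False
    hence "(st lam a)\<^sup>*\<^sup>* (s i z) y" "a * cor i z \<in> \<int>" using step by auto
    moreover have "st lam a (s i x) (s i z)" using st_flip[OF step(1) assms(2)] False step.prems by simp
    moreover have "a * cor i x \<in> \<int>" using st_cong[OF step(1) assms(2)] calculation Ints_add[of "a * cor i z" "a * cor i x - a * cor i z"] by simp
    ultimately show ?thesis by (auto intro: converse_rtranclp_into_rtranclp)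
  qed
qed

text \<open>A change of sign inside the chain would make a times the pairing an integer, so the sign
  is constant and every step can be reflected.\<close>

lemma ach_flip_pos:
  assumes "ach lam a x y" "i \<in> R" "cor i x > 0" "cor i y > 0" "a * cor i y \<notin> \<int>"
  shows "ach lam a (s i x) (s i y)"
  using assms(1,4,5) unfolding ach_iff
proof (induction rule: rtranclp_induct)
  case (step y z)
  have 1: "cor i y > 0" using st_turn(2)[OF step(2) assms(2)] step.prems by force
  have "a * cor i y \<notin> \<int>" using st_cong[OF step(2) assms(2)] step.prems Ints_diff[of "a * cor i y" "a * cor i y - a * cor i z"] by auto
  moreover have "st lam a (s i y) (s i z)" using st_flip[OF step(2) assms(2)] 1 step.prems by simp
  ultimately show ?case using step 1 by (auto intro: rtranclp.rtrancl_into_rtrancl)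
qed auto

lemma ach_flip_neg:
  assumes "ach lam a x y" "i \<in> R" "cor i x < 0" "cor i y < 0" "a * cor i x \<notin> \<int>"
  shows "ach lam a (s i x) (s i y)"
  using assms(1,3,5) unfolding ach_iff
proof (induction rule: converse_rtranclp_induct)
  case (step x z)
  have 1: "cor i z < 0"
  proof (rule ccontr)
    assume "\<not> ?thesis"
    hence "x = s i z" "a * cor i z \<in> \<int>" using st_turn[OF step(1) assms(2)] step.prems by auto
    thus False using step.prems cor_s[OF assms(2), of z] by simp
  qed
  have "a * cor i z \<notin> \<int>" using st_cong[OF step(1) assms(2)] step.prems Ints_add[of "a * cor i z" "a * cor i x - a * cor i z"] by auto
  moreover have "st lam a (s i x) (s i z)" using st_flip[OF step(1) assms(2)] 1 step.prems by simp
  ultimately show ?case using step 1 by (auto intro: converse_rtranclp_into_rtranclp)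
qed auto

lemma st_simple: "x \<in> orb lam ==> i \<in> R ==> 0 < cor i x ==> a * cor i x \<in> \<int> ==> 0 < a ==> st lam a (s i x) x"
  unfolding st_def using cs_simple by force

end

subsection \<open>Integral functions\<close>

text \<open>A local minimum on a plateau is tested at the right or left end of the plateau.\<close>
definition LI :: "(real => real) => bool" where
  "LI H \<longleftrightarrow> continuous_on {0..1} H & H 0 = 0 & H 1 \<in> \<int> &
    (\<forall>r e. 0 < e & 0 <= r - e & r + e <= 1 -->
      (\<forall>t. r - e <= t & t <= r --> H r <= H t) --> (\<forall>t. r < t & t <= r + e --> H r < H t) --> H r \<in> \<int>) &
    (\<forall>r e. 0 < e & 0 <= r - e & r + e <= 1 -->
      (\<forall>t. r - e <= t & t < r --> H r < H t) --> (\<forall>t. r <= t & t <= r + e --> H r <= H t) --> H r \<in> \<int>)"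

text \<open>Here u and v are the points f+ and f- of the root operator.\<close>
definition FS :: "(real => real) => real => real => real => bool" where
  "FS H m u v \<longleftrightarrow> m \<in> \<int> & 0 <= u & u < v & v <= 1 & H u = m & H v = m + 1 &
     (\<forall>t. 0 <= t & t <= u --> m <= H t) & (\<forall>t t'. u <= t & t < t' & t' <= v --> H t < H t') &
     (\<forall>t. v <= t & t <= 1 --> m + 1 <= H t)"

definition ES :: "(real => real) => real => real => real => bool" where
  "ES H m u v \<longleftrightarrow> m \<in> \<int> & 0 <= u & u < v & v <= 1 & H u = m + 1 & H v = m &
     (\<forall>t. 0 <= t & t <= u --> m + 1 <= H t) & (\<forall>t t'. u <= t & t < t' & t' <= v --> H t' < H t) &
     (\<forall>t. v <= t & t <= 1 --> m <= H t)"

lemma compact_level: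
  fixes H :: "real => real"
  assumes "continuous_on {a..b} H"
  shows "compact {t \<in> {a..b}. H t = c}"
proof -
  have "closed (H -` {c} \<inter> {a..b})"
    using assms continuous_on_closed_vimage[of "{a..b}" H] by auto
  hence "compact ({a..b} \<inter> (H -` {c} \<inter> {a..b}))" by (intro compact_Int_closed) auto
  moreover have "{a..b} \<inter> (H -` {c} \<inter> {a..b}) = {t \<in> {a..b}. H t = c}" by auto
  ultimately show ?thesis by simp
qed

lemma last_min:
  fixes H :: "real => real"
  assumes "continuous_on {a..b} H" "a <= b"
  shows "\<exists>r. a <= r & r <= b & (\<forall>t. a <= t & t <= b --> H r <= H t) & (\<forall>t. r < t & t <= b --> H r < H t)"
proof -
  obtain q where q: "q \<in> {a..b}" "\<forall>t\<in>{a..b}. H q <= H t"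
    using continuous_attains_inf[of "{a..b}" H] assms by auto
  define S where "S = {t \<in> {a..b}. H t = H q}"
  have "compact S" unfolding S_def using compact_level[OF assms(1)] .
  moreover have "S \<noteq> {}" using q by (auto simp: S_def)
  ultimately obtain r where r: "r \<in> S" "\<forall>t\<in>S. t <= r" using compact_attains_sup by blast
  have "H r < H t" if "r < t" "t <= b" for t
  proof -
    have t: "t \<in> {a..b}" using r that by (auto simp: S_def)
    hence "H q <= H t" using q by blast
    moreover have "t \<notin> S" using r(2) that by (meson not_le)
    ultimately show ?thesis using r t by (auto simp: S_def)
  qed
  thus ?thesis using r q by (intro exI[of _ r]) (auto simp: S_def)
qed

lemma LI_min:
  assumes "LI H"
  shows "\<exists>m\<in>\<int>. (\<exists>t. 0 <= t & t <= 1 & H t = m) & (\<forall>t. 0 <= t & t <= 1 --> m <= H t)"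
proof -
  have c: "continuous_on {0..1} H" using assms by (auto simp: LI_def)
  obtain r where r: "0 <= r" "r <= 1" "!!t. 0 <= t ==> t <= 1 ==> H r <= H t" "!!t. r < t ==> t <= 1 ==> H r < H t"
    using last_min[OF c] by auto
  have "H r \<in> \<int>"
  proof (cases "r = 0 \<or> r = 1")
    case True thus ?thesis using assms by (auto simp: LI_def)
  next
    case False
    hence e: "0 < min r (1 - r)" using r by auto
    have "0 <= r - min r (1 - r)" "r + min r (1 - r) <= 1" by auto
    moreover have "\<forall>t. r - min r (1 - r) <= t & t <= r --> H r <= H t" using r by auto
    moreover have "\<forall>t. r < t & t <= r + min r (1 - r) --> H r < H t" using r by auto
    ultimately show ?thesis using assms e unfolding LI_def by blast
  qed
  thus ?thesis using r by blast
qed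

lemma LI_no_min:
  assumes "LI H" "0 <= a" "a < r" "r < b" "b <= 1" "H r \<notin> \<int>"
    "!!t. a <= t ==> t <= b ==> H r <= H t" "!!t. r < t ==> t <= b ==> H r < H t"
  shows False
proof -
  define e where "e = min (r - a) (b - r)"
  have e: "0 < e" "0 <= r - e" "r + e <= 1" "a <= r - e" "r + e <= b" using assms by (auto simp: e_def)
  have 1: "\<forall>t. r - e <= t & t <= r --> H r <= H t" using e assms by auto
  have 2: "\<forall>t. r < t & t <= r + e --> H r < H t" using e assms by auto
  show False using assms(1) 1 2 e(1-3) assms(6) unfolding LI_def by blast
qed

text \<open>Take u as the last time at the minimum m and v as the first later time at m + 1. Values
  strictly between m and m + 1 are not integers, so there is no local minimum among them: the
  function cannot dip between u and v, nor fall below m + 1 after v.\<close>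

lemma LI_FS:
  assumes L: "LI H" and m: "m \<in> \<int>" "!!t. 0 <= t ==> t <= 1 ==> m <= H t" "\<exists>t. 0 <= t & t <= 1 & H t = m" and "H 1 \<noteq> m"
  shows "\<exists>u v. FS H m u v"
proof -
  have c: "continuous_on {0..1} H" and H1: "H 1 \<in> \<int>" using L by (auto simp: LI_def)
  obtain u where u: "0 <= u" "u <= 1" "!!t. 0 <= t ==> t <= 1 ==> H u <= H t" "!!t. u < t ==> t <= 1 ==> H u < H t"
    using last_min[OF c] by auto
  have um: "H u = m" using u m by (metis order_antisym)
  have u1: "u < 1" using um \<open>H 1 \<noteq> m\<close> u(2) by (cases "u = 1") auto
  have "H 1 >= m + 1" using H1 m(1) u(4)[of 1] um u1 by (auto elim!: Ints_cases)
  have cu: "continuous_on {u..1} H" using c u by (auto intro: continuous_on_subset)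
  have "\<exists>t. u <= t & t <= 1 & H t = m + 1"
    using IVT'[of H u "m+1" 1] cu um \<open>H 1 >= m + 1\<close> u by auto
  then obtain t0 where t0: "u <= t0" "t0 <= 1" "H t0 = m + 1" by auto
  define S where "S = {t \<in> {u..1}. H t = m + 1}"
  have "compact S" unfolding S_def using compact_level[OF cu] .
  moreover have "S \<noteq> {}" using t0 by (auto simp: S_def)
  ultimately obtain v where v: "v \<in> S" "\<forall>t\<in>S. v <= t" using compact_attains_inf by blast
  have v': "u <= v" "v <= 1" "H v = m + 1" using v by (auto simp: S_def)
  have uv: "u < v" using v' um by (cases "u = v") auto
  have lt: "H t < m + 1" if "u <= t" "t < v" for t
  proof (rule ccontr)
    assume "\<not> ?thesis"
    hence "\<exists>t'. u <= t' & t' <= t & H t' = m + 1"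
      using IVT'[of H u "m+1" t] um that v' continuous_on_subset[OF cu] by auto
    thus False using v that v' by (auto simp: S_def)
  qed
  have gt: "m < H t" if "u < t" "t <= 1" for t using u(4)[OF that] um by simp
  have nz: "x \<notin> \<int>" if "m < x" "x < m + 1" for x using that m(1) by (auto elim!: Ints_cases)
  have inc: "H t < H t'" if t: "u <= t" "t < t'" "t' <= v" for t t'
  proof (rule ccontr)
    assume n: "\<not> ?thesis"
    have "continuous_on {t..v} H" using cu t v' by (auto intro: continuous_on_subset)
    then obtain r where r: "t <= r" "r <= v" "!!x. t <= x ==> x <= v ==> H r <= H x" "!!x. r < x ==> x <= v ==> H r < H x"
      using last_min[of t v H] t by auto
    have "t' < v" using n lt[of t] t v' by (cases "t' = v") auto
    hence "H t' < m + 1" using lt t by auto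
    hence "H r < m + 1" using r(3)[of t'] t by auto
    hence "r < v" using r(2) v' by (cases "r = v") auto
    have "t < r" using r(4)[of t'] n t r(1,3) by (cases "r = t") auto
    have "H r \<notin> \<int>" using nz gt[of r] \<open>H r < m + 1\<close> \<open>t < r\<close> t \<open>r < v\<close> v' by auto
    thus False using LI_no_min[OF L, of t r v] r \<open>t < r\<close> \<open>r < v\<close> t u v' by auto
  qed
  have aft: "m + 1 <= H t" if t: "v <= t" "t <= 1" for t
  proof (rule ccontr)
    assume n: "\<not> ?thesis"
    have "continuous_on {v..1} H" using cu uv by (auto intro: continuous_on_subset)
    then obtain r where r: "v <= r" "r <= 1" "!!x. v <= x ==> x <= 1 ==> H r <= H x" "!!x. r < x ==> x <= 1 ==> H r < H x"
      using last_min[of v 1 H] v' by auto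
    have "H r < m + 1" using r(3)[of t] t n by auto
    moreover have "m < H r" using gt[of r] r uv by auto
    ultimately have nr: "H r \<notin> \<int>" using nz by auto
    hence "r \<noteq> 1" "r \<noteq> v" using H1 v' m(1) by auto
    thus False using LI_no_min[OF L, of v r 1] r nr u uv by auto
  qed
  have "FS H m u v" unfolding FS_def using m u um uv v' inc aft by auto
  thus ?thesis by blast
qed

text \<open>Reversing time exchanges the two plateau conditions of \<open>LI\<close>, which is why
  the definition contains both.\<close>

lemma LI_rev:
  assumes "LI H" shows "LI (%t. H (1 - t) - H 1)"
proof -
  have c: "continuous_on {0..1} H" using assms by (auto simp: LI_def)
  have H0: "H 0 = 0" and H1: "H 1 \<in> \<int>" using assms by (auto simp: LI_def)
  have "continuous_on {0..1} (%t. H (1 - t) - H 1)"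
    by (intro continuous_intros continuous_on_compose2[OF c]) auto
  moreover have "H (1 - r) - H 1 \<in> \<int>" if e: "0 < e" "0 <= r - e" "r + e <= 1"
    and a: "!!t. r - e <= t & t <= r ==> H (1 - r) - H 1 <= H (1 - t) - H 1"
    and b: "!!t. r < t & t <= r + e ==> H (1 - r) - H 1 < H (1 - t) - H 1" for r e
  proof -
    have 1: "\<forall>t. (1-r) - e <= t & t < 1-r --> H (1-r) < H t" using b[of "1 - _"] by (auto simp: algebra_simps)
    have 2: "\<forall>t. 1-r <= t & t <= (1-r) + e --> H (1-r) <= H t" using a[of "1 - _"] by (auto simp: algebra_simps)
    have "0 <= (1-r) - e" "(1-r) + e <= 1" using e by auto
    hence "H (1-r) \<in> \<int>" using assms 1 2 e(1) unfolding LI_def by blast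
    thus ?thesis using H1 by auto
  qed
  moreover have "H (1 - r) - H 1 \<in> \<int>" if e: "0 < e" "0 <= r - e" "r + e <= 1"
    and a: "!!t. r - e <= t & t < r ==> H (1 - r) - H 1 < H (1 - t) - H 1"
    and b: "!!t. r <= t & t <= r + e ==> H (1 - r) - H 1 <= H (1 - t) - H 1" for r e
  proof -
    have 1: "\<forall>t. (1-r) - e <= t & t <= 1-r --> H (1-r) <= H t" using b[of "1 - _"] by (auto simp: algebra_simps)
    have 2: "\<forall>t. 1-r < t & t <= (1-r) + e --> H (1-r) < H t" using a[of "1 - _"] by (auto simp: algebra_simps)
    have "0 <= (1-r) - e" "(1-r) + e <= 1" using e by auto
    hence "H (1-r) \<in> \<int>" using assms 1 2 e(1) unfolding LI_def by blast
    thus ?thesis using H1 by auto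
  qed
  ultimately show ?thesis unfolding LI_def using H0 H1 by (simp) blast
qed

lemma LI_ES:
  assumes L: "LI H" and m: "m \<in> \<int>" "!!t. 0 <= t ==> t <= 1 ==> m <= H t" "\<exists>t. 0 <= t & t <= 1 & H t = m" and "m \<noteq> 0"
  shows "\<exists>u v. ES H m u v"
proof -
  have H0: "H 0 = 0" and H1: "H 1 \<in> \<int>" using L by (auto simp: LI_def)
  define H' where "H' t = H (1 - t) - H 1" for t
  have "LI H'" using LI_rev[OF L] unfolding H'_def[abs_def] .
  moreover have "m - H 1 \<in> \<int>" using m H1 by auto
  moreover have "m - H 1 <= H' t" if "0 <= t" "t <= 1" for t using m(2)[of "1 - t"] that by (simp add: H'_def)
  moreover have "\<exists>t. 0 <= t & t <= 1 & H' t = m - H 1"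
  proof -
    obtain t where "0 <= t" "t <= 1" "H t = m" using m(3) by auto
    thus ?thesis by (intro exI[of _ "1 - t"]) (auto simp: H'_def)
  qed
  moreover have "H' 1 \<noteq> m - H 1" using \<open>m \<noteq> 0\<close> H0 by (simp add: H'_def)
  ultimately obtain u v where FS: "FS H' (m - H 1) u v" using LI_FS[of H' "m - H 1"] by blast
  have "ES H m (1 - v) (1 - u)"
    unfolding ES_def
  proof (intro conjI allI impI)
    show "H (1 - v) = m + 1" "H (1 - u) = m" "m \<in> \<int>" using FS m by (auto simp: FS_def H'_def)
    fix t assume "0 <= t & t <= 1 - v"
    hence "m - H 1 + 1 <= H' (1 - t)" using FS by (auto simp: FS_def)
    thus "m + 1 <= H t" by (simp add: H'_def)
  next
    fix t t' assume "1 - v <= t & t < t' & t' <= 1 - u"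
    hence "H' (1 - t') < H' (1 - t)" using FS by (auto simp: FS_def)
    thus "H t' < H t" by (simp add: H'_def)
  next
    fix t assume "1 - u <= t & t <= 1"
    hence "m - H 1 <= H' (1 - t)" using FS by (auto simp: FS_def)
    thus "m <= H t" by (simp add: H'_def)
  qed (use FS in \<open>auto simp: FS_def\<close>)
  thus ?thesis by blast
qed

subsection \<open>Root operators on integral paths\<close>

definition clamped :: "(real => 'v) => bool" where "clamped p \<longleftrightarrow> (\<forall>t. p (clamp t) = p t)"

lemma clamp_range [simp]: "0 <= clamp t" "clamp t <= 1" by (auto simp: clamp_def)
lemma clamp_id [simp]: "0 <= t ==> t <= 1 ==> clamp t = t" by (auto simp: clamp_def)
lemma clamp_clamp [simp]: "clamp (clamp t) = clamp t" by simp

lemma clamped_eqI: "clamped p ==> clamped q ==> (!!t. 0 <= t ==> t <= 1 ==> p t = q t) ==> p = q"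
  by (rule ext) (metis clamped_def clamp_range)

text \<open>The formulas of the root operators with the minimum and the turning points as arguments,
  so that paths can be modified without evaluating any \<open>Sup\<close> or \<open>Inf\<close>.
  \<open>FS_f_root\<close> and \<open>ES_e_root\<close> identify them with the operators.\<close>

definition Fmod :: "('i => 'v::real_vector) => ('i => 'v => real) => 'i => real => real => real => (real => 'v) => real => 'v" where
  "Fmod alpha cor i m u v p = (%t0. let t = clamp t0 in if t <= u then p t
     else if t <= v then p t - (cor i (p t) - m) *\<^sub>R alpha i else p t - alpha i)"

definition Emod :: "('i => 'v::real_vector) => ('i => 'v => real) => 'i => real => real => real => (real => 'v) => real => 'v" where
  "Emod alpha cor i m u v p = (%t0. let t = clamp t0 in if t <= u then p t
     else if t <= v then p t - (cor i (p t) - m - 1) *\<^sub>R alpha i else p t + alpha i)"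

text \<open>The graph of f_i, and read backwards that of e_i: for real letters by
  \<open>fstep_facts\<close>, for imaginary ones by \<open>im_e_root\<close>.\<close>

definition fstep :: "('i => 'v::real_vector) => ('i => 'v => real) => 'i => (real => 'v) => (real => 'v) => bool" where
  "fstep alpha cor i p q \<longleftrightarrow> clamped p & (\<exists>m u v. FS (%t. cor i (p t)) m u v & q = Fmod alpha cor i m u v p)"

lemma Fmod_clamped: "clamped (Fmod alpha cor i m u v p)" "clamped (Emod alpha cor i m u v p)"
  unfolding clamped_def Fmod_def Emod_def by auto

lemma mval_eq:
  assumes "m \<in> \<int>" "!!t. 0 <= t ==> t <= 1 ==> m <= cor i (p t)" "\<exists>t. 0 <= t & t <= 1 & cor i (p t) = m"
  shows "mval cor i p = m"
  unfolding mval_def by (rule cInf_eq_minimum) (use assms in auto)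

lemma FS_lb: "FS H m u v ==> 0 <= t ==> t <= 1 ==> m <= H t"
proof -
  assume a: "FS H m u v" "0 <= t" "t <= 1"
  consider "t <= u" | "u < t" "t < v" | "v <= t" by linarith
  thus ?thesis
  proof cases
    case 2 hence "H u < H t" using a by (auto simp: FS_def)
    thus ?thesis using a by (auto simp: FS_def)
  next
    case 3 hence "m + 1 <= H t" using a by (auto simp: FS_def)
    thus ?thesis by simp
  qed (use a in \<open>auto simp: FS_def\<close>)
qed

lemma ES_lb: "ES H m u v ==> 0 <= t ==> t <= 1 ==> m <= H t"
proof -
  assume a: "ES H m u v" "0 <= t" "t <= 1"
  consider "t <= u" | "u < t" "t < v" | "v <= t" by linarith
  thus ?thesis
  proof cases
    case 2 hence "H v < H t" using a by (auto simp: ES_def)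
    thus ?thesis using a by (auto simp: ES_def)
  qed (use a in \<open>auto simp: ES_def\<close>)
qed

lemma FS_mval: "FS (%t. cor i (p t)) m u v ==> mval cor i p = m"
  using FS_lb[of "%t. cor i (p t)" m u v] by (intro mval_eq) (auto simp: FS_def intro!: exI[of _ u])

lemma ES_mval: "ES (%t. cor i (p t)) m u v ==> mval cor i p = m"
  using ES_lb[of "%t. cor i (p t)" m u v] by (intro mval_eq) (auto simp: ES_def intro!: exI[of _ v])

lemma FS_f_root:
  assumes F: "FS (%t. cor i (p t)) m u v"
  shows "f_root alpha cor i p = Some (Fmod alpha cor i m u v p)"
proof -
  have mv: "mval cor i p = m" using FS_mval[of cor i p m u v] F by simp
  have u: "Sup {t \<in> {0..1}. cor i (p t) = m} = u"
  proof (rule cSup_eq_maximum)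
    show "u \<in> {t \<in> {0..1}. cor i (p t) = m}" using F by (auto simp: FS_def)
    fix t assume t: "t \<in> {t \<in> {0..1}. cor i (p t) = m}"
    show "t <= u"
    proof (rule ccontr)
      assume "\<not> t <= u"
      then consider "u < t" "t <= v" | "v <= t" by linarith
      thus False
      proof cases
        case 1
        hence "cor i (p u) < cor i (p t)" using F by (auto simp: FS_def)
        thus False using F t by (auto simp: FS_def)
      next
        case 2 hence "m + 1 <= cor i (p t)" using F t by (auto simp: FS_def)
        thus False using t by auto
      qed
    qed
  qed
  have v: "Inf {t \<in> {u..1}. cor i (p t) = m + 1} = v"
  proof (rule cInf_eq_minimum)
    show "v \<in> {t \<in> {u..1}. cor i (p t) = m + 1}" using F by (auto simp: FS_def)
    fix t assume t: "t \<in> {t \<in> {u..1}. cor i (p t) = m + 1}"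
    show "v <= t"
    proof (rule ccontr)
      assume "\<not> v <= t"
      moreover have "u <= t ==> t < v ==> cor i (p t) < cor i (p v)" using F unfolding FS_def by blast
      ultimately have "cor i (p t) < cor i (p v)" using t by auto
      moreover have "cor i (p v) = m + 1" using F by (simp add: FS_def)
      ultimately show False using t by auto
    qed
  qed
  have "u \<noteq> 1" using F by (auto simp: FS_def)
  thus ?thesis unfolding f_root_def Let_def mv u v Fmod_def by simp
qed

lemma ES_e_root:
  assumes F: "ES (%t. cor i (p t)) m u v"
  shows "e_root_re alpha cor i p = Some (Emod alpha cor i m u v p)"
proof -
  have mv: "mval cor i p = m" using ES_mval[of cor i p m u v] F by simp
  have v: "Inf {t \<in> {0..1}. cor i (p t) = m} = v"
  proof (rule cInf_eq_minimum)
    show "v \<in> {t \<in> {0..1}. cor i (p t) = m}" using F by (auto simp: ES_def)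
    fix t assume t: "t \<in> {t \<in> {0..1}. cor i (p t) = m}"
    show "v <= t"
    proof (rule ccontr)
      assume "\<not> v <= t"
      then consider "u <= t" "t < v" | "t <= u" by linarith
      thus False
      proof cases
        case 1
        hence "cor i (p v) < cor i (p t)" using F by (auto simp: ES_def)
        thus False using F t by (auto simp: ES_def)
      next
        case 2 hence "m + 1 <= cor i (p t)" using F t by (auto simp: ES_def)
        thus False using t by auto
      qed
    qed
  qed
  have u: "Sup {t \<in> {0..v}. cor i (p t) = m + 1} = u"
  proof (rule cSup_eq_maximum)
    show "u \<in> {t \<in> {0..v}. cor i (p t) = m + 1}" using F by (auto simp: ES_def)
    fix t assume t: "t \<in> {t \<in> {0..v}. cor i (p t) = m + 1}"
    show "t <= u"
    proof (rule ccontr)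
      assume "\<not> t <= u"
      moreover have "u < t ==> t <= v ==> cor i (p t) < cor i (p u)" using F unfolding ES_def by blast
      ultimately have "cor i (p t) < cor i (p u)" using t by auto
      moreover have "cor i (p u) = m + 1" using F by (simp add: ES_def)
      ultimately show False using t by auto
    qed
  qed
  have "v \<noteq> 0" using F by (auto simp: ES_def)
  thus ?thesis unfolding e_root_re_def Let_def mv v u Emod_def by simp
qed

lemma f_root_None:
  assumes "m \<in> \<int>" "!!t. 0 <= t ==> t <= 1 ==> m <= cor i (p t)" "cor i (p 1) = m"
  shows "f_root alpha cor i p = None"
proof -
  have mv: "mval cor i p = m" by (rule mval_eq) (use assms in \<open>auto intro: exI[of _ 1]\<close>)
  have "Sup {t \<in> {0..1}. cor i (p t) = m} = 1" by (rule cSup_eq_maximum) (use assms in auto)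
  thus ?thesis unfolding f_root_def Let_def mv by simp
qed

lemma e_root_None:
  assumes "!!t. 0 <= t ==> t <= 1 ==> 0 <= cor i (p t)" "cor i (p 0) = 0"
  shows "e_root_re alpha cor i p = None"
proof -
  have mv: "mval cor i p = 0" by (rule mval_eq) (use assms in \<open>auto intro: exI[of _ 0]\<close>)
  have "Inf {t \<in> {0..1}. cor i (p t) = 0} = 0" by (rule cInf_eq_minimum) (use assms in auto)
  thus ?thesis unfolding e_root_re_def Let_def mv by simp
qed

locale letter =
  fixes alpha :: "'i => 'v::real_vector" and cor :: "'i => 'v => real" and i :: 'i
  assumes lin: "linear (cor i)" and two: "cor i (alpha i) = 2"
begin

lemma cor_lin [simp]: "cor i (x + y) = cor i x + cor i y" "cor i (x - y) = cor i x - cor i y"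
    "cor i (r *\<^sub>R x) = r * cor i x" "cor i (- x) = - cor i x" "cor i 0 = 0"
  using lin by (simp_all add: linear_add linear_diff linear_scale linear_neg linear_0)

lemma Fmod_cor:
  assumes "0 <= t" "t <= 1"
  shows "cor i (Fmod alpha cor i m u v p t) = (if t <= u then cor i (p t) else if t <= v then 2 * m - cor i (p t) else cor i (p t) - 2)"
    "cor i (Emod alpha cor i m u v p t) = (if t <= u then cor i (p t) else if t <= v then 2 * m + 2 - cor i (p t) else cor i (p t) + 2)"
  using assms by (auto simp: Fmod_def Emod_def two)

lemma FS_ES:
  assumes F: "FS (%t. cor i (p t)) m u v"
  shows "ES (%t. cor i (Fmod alpha cor i m u v p t)) (m - 1) u v"
proof -
  have m: "m \<in> \<int>" and uv: "0 <= u" "u < v" "v <= 1" and val: "cor i (p u) = m" "cor i (p v) = m + 1"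
    and 1: "!!t. 0 <= t ==> t <= u ==> m <= cor i (p t)" and 2: "!!t t'. u <= t ==> t < t' ==> t' <= v ==> cor i (p t) < cor i (p t')"
    and 3: "!!t. v <= t ==> t <= 1 ==> m + 1 <= cor i (p t)" using F unfolding FS_def by auto
  show ?thesis unfolding ES_def
  proof (intro conjI allI impI)
    show "m - 1 \<in> \<int>" using m by simp
    show "cor i (Fmod alpha cor i m u v p u) = m - 1 + 1" "cor i (Fmod alpha cor i m u v p v) = m - 1"
      using uv val by (auto simp: Fmod_cor)
    fix t assume "0 <= t & t <= u" thus "m - 1 + 1 <= cor i (Fmod alpha cor i m u v p t)"
      using uv 1 by (simp add: Fmod_cor)
  next
    fix t t' assume t: "u <= t & t < t' & t' <= v"
    show "cor i (Fmod alpha cor i m u v p t') < cor i (Fmod alpha cor i m u v p t)"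
      using t uv val 2[of t t'] by (cases "t = u") (auto simp: Fmod_cor)
  next
    fix t assume t: "v <= t & t <= 1" thus "m - 1 <= cor i (Fmod alpha cor i m u v p t)"
      using uv 3[of t] val by (cases "t = v") (auto simp: Fmod_cor)
  qed (use uv in auto)
qed

lemma ES_FS:
  assumes F: "ES (%t. cor i (p t)) m u v"
  shows "FS (%t. cor i (Emod alpha cor i m u v p t)) (m + 1) u v"
proof -
  have m: "m \<in> \<int>" and uv: "0 <= u" "u < v" "v <= 1" and val: "cor i (p u) = m + 1" "cor i (p v) = m"
    and 1: "!!t. 0 <= t ==> t <= u ==> m + 1 <= cor i (p t)" and 2: "!!t t'. u <= t ==> t < t' ==> t' <= v ==> cor i (p t') < cor i (p t)"
    and 3: "!!t. v <= t ==> t <= 1 ==> m <= cor i (p t)" using F unfolding ES_def by auto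
  show ?thesis unfolding FS_def
  proof (intro conjI allI impI)
    show "m + 1 \<in> \<int>" using m by simp
    show "cor i (Emod alpha cor i m u v p u) = m + 1" "cor i (Emod alpha cor i m u v p v) = m + 1 + 1"
      using uv val by (auto simp: Fmod_cor)
    fix t assume "0 <= t & t <= u" thus "m + 1 <= cor i (Emod alpha cor i m u v p t)"
      using uv 1 by (simp add: Fmod_cor)
  next
    fix t t' assume t: "u <= t & t < t' & t' <= v"
    show "cor i (Emod alpha cor i m u v p t) < cor i (Emod alpha cor i m u v p t')"
      using t uv val 2[of t t'] by (cases "t = u") (auto simp: Fmod_cor)
  next
    fix t assume t: "v <= t & t <= 1" thus "m + 1 + 1 <= cor i (Emod alpha cor i m u v p t)"
      using uv 3[of t] val by (cases "t = v") (auto simp: Fmod_cor)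
  qed (use uv in auto)
qed

lemma Emod_Fmod:
  assumes F: "FS (%t. cor i (p t)) m u v" and c: "clamped p"
  shows "Emod alpha cor i (m - 1) u v (Fmod alpha cor i m u v p) = p"
proof (rule clamped_eqI[OF Fmod_clamped(2) c])
  fix t :: real assume t: "0 <= t" "t <= 1"
  show "Emod alpha cor i (m - 1) u v (Fmod alpha cor i m u v p) t = p t"
    using t by (auto simp: Emod_def Fmod_def Let_def two algebra_simps simp flip: scaleR_add_left)
qed

lemma Fmod_Emod:
  assumes F: "ES (%t. cor i (p t)) m u v" and c: "clamped p"
  shows "Fmod alpha cor i (m + 1) u v (Emod alpha cor i m u v p) = p"
proof (rule clamped_eqI[OF Fmod_clamped(1) c])
  fix t :: real assume t: "0 <= t" "t <= 1"
  show "Fmod alpha cor i (m + 1) u v (Emod alpha cor i m u v p) t = p t"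
    using t by (auto simp: Emod_def Fmod_def Let_def two algebra_simps simp flip: scaleR_add_left)
qed

lemma fstep_facts:
  assumes "fstep alpha cor i p q"
  shows "f_root alpha cor i p = Some q" "e_root_re alpha cor i q = Some p" "clamped p" "clamped q"
    "mval cor i q = mval cor i p - 1" "q 1 = p 1 - alpha i" "q 0 = p 0" "mval cor i p + 1 <= cor i (p 1)" "mval cor i p \<in> \<int>"
    "0 <= t ==> t <= 1 ==> mval cor i p <= cor i (p t)"
proof -
  obtain m u v where F: "FS (%t. cor i (p t)) m u v" "q = Fmod alpha cor i m u v p" and c: "clamped p"
    using assms by (auto simp: fstep_def)
  have E: "ES (%t. cor i (q t)) (m-1) u v" using FS_ES[of p m u v] F by simp
  show "f_root alpha cor i p = Some q" using FS_f_root[of cor i p m u v alpha] F(1) F(2) by simp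
  show "e_root_re alpha cor i q = Some p" using ES_e_root[of cor i q "m-1" u v alpha] E Emod_Fmod[of p m u v] F(1) c F(2) by simp
  show "clamped p" "clamped q" using c F(2) Fmod_clamped by auto
  show "mval cor i q = mval cor i p - 1" "mval cor i p \<in> \<int>"
    using FS_mval[of cor i p m u v] ES_mval[of cor i q "m-1" u v] E F(1) by (auto simp: FS_def)
  show "mval cor i p + 1 <= cor i (p 1)" using F(1) FS_mval[of cor i p m u v] by (auto simp: FS_def)
  show "0 <= t ==> t <= 1 ==> mval cor i p <= cor i (p t)" using FS_lb[of "%t. cor i (p t)" m u v] F(1) FS_mval[of cor i p m u v] by auto
  show "q 0 = p 0" using F by (auto simp: Fmod_def FS_def)
  have "u < 1" "v = 1 ==> cor i (p 1) = m + 1" "v <= 1" using F(1) by (auto simp: FS_def)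
  thus "q 1 = p 1 - alpha i" using F(2) by (cases "v = 1") (auto simp: Fmod_def)
qed

lemma LI_mval:
  assumes "LI (%t. cor i (p t))"
  shows "mval cor i p \<in> \<int>" "!!t. 0 <= t ==> t <= 1 ==> mval cor i p <= cor i (p t)" "mval cor i p <= 0"
    "\<exists>t. 0 <= t & t <= 1 & cor i (p t) = mval cor i p"
proof -
  obtain m where m: "m \<in> \<int>" "\<exists>t. 0 <= t & t <= 1 & cor i (p t) = m" "!!t. 0 <= t ==> t <= 1 ==> m <= cor i (p t)"
    using LI_min[OF assms] by auto
  have e: "mval cor i p = m" using mval_eq m by metis
  show "mval cor i p \<in> \<int>" "!!t. 0 <= t ==> t <= 1 ==> mval cor i p <= cor i (p t)"
    "\<exists>t. 0 <= t & t <= 1 & cor i (p t) = mval cor i p" using m e by auto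
  have "cor i (p 0) = 0" using assms by (simp add: LI_def)
  thus "mval cor i p <= 0" using m(3)[of 0] e by simp
qed

lemma LI_f:
  assumes L: "LI (%t. cor i (p t))" and c: "clamped p"
  shows "(f_root alpha cor i p = None & cor i (p 1) = mval cor i p) \<or> (\<exists>q. fstep alpha cor i p q)"
proof (cases "cor i (p 1) = mval cor i p")
  case True
  thus ?thesis using f_root_None[of "mval cor i p" cor i p alpha] LI_mval[OF L] by auto
next
  case False
  then obtain u v where "FS (%t. cor i (p t)) (mval cor i p) u v"
    using LI_FS[OF L LI_mval(1)[OF L] LI_mval(2)[OF L] LI_mval(4)[OF L]] by auto
  thus ?thesis unfolding fstep_def using c by blast
qed

lemma LI_e:
  assumes L: "LI (%t. cor i (p t))" and c: "clamped p"
  shows "(e_root_re alpha cor i p = None & mval cor i p = 0) \<or> (\<exists>q. fstep alpha cor i q p)"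
proof (cases "mval cor i p = 0")
  case True
  moreover have "cor i (p 0) = 0" using L by (simp add: LI_def)
  ultimately show ?thesis using e_root_None[of cor i p alpha] LI_mval[OF L] by auto
next
  case False
  then obtain u v where E: "ES (%t. cor i (p t)) (mval cor i p) u v"
    using LI_ES[OF L LI_mval(1)[OF L] LI_mval(2)[OF L] LI_mval(4)[OF L]] by auto
  have "fstep alpha cor i (Emod alpha cor i (mval cor i p) u v p) p"
    unfolding fstep_def using ES_FS[of p "mval cor i p" u v] E Fmod_Emod[of p "mval cor i p" u v] c Fmod_clamped(2) by metis
  thus ?thesis by blast
qed

end

section \<open>GLS paths as lists of directions and breakpoints\<close>

text \<open>Every entry is a direction together with the time at which it ends; \<open>b\<close> is
  the time at which the list starts, so a tail of a list is again a list of this kind.\<close>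

fun pl :: "real => ('v::real_vector \<times> real) list => real => 'v" where
  "pl b [] t = 0"
| "pl b ((x, a) # r) t = min (max (t - b) 0) (a - b) *\<^sub>R x + pl a r t"

definition path :: "('v::real_vector \<times> real) list => real => 'v" where
  "path xs = (%t. pl 0 xs (clamp t))"

text \<open>\<open>lam\<close> plays the part of the direction after the end. The closing condition
  of a GLS path, a 1-chain from its last direction to \<open>lam\<close>, thereby becomes an
  instance of the condition at inner breakpoints.\<close>

fun nx :: "'v => ('v \<times> real) list => 'v" where
  "nx lam [] = lam" | "nx lam ((x, a) # r) = x"

text \<open>u is not strictly inside a segment, so reflecting on one side of u never cuts a
  segment.\<close>

fun nin :: "real => real => ('v \<times> real) list => bool" where
  "nin u b [] = True" | "nin u b ((x, a) # r) = ((u <= b \<or> a <= u) & nin u a r)"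

fun spl :: "real => real => ('v \<times> real) list => ('v \<times> real) list" where
  "spl c b [] = []"
| "spl c b ((x, a) # r) = (if b < c & c < a then (x, c) # (x, a) # r else (x, a) # spl c a r)"

lemma nx_spl: "nx lam (spl c b xs) = nx lam xs"
  by (cases xs) auto

lemma path_clamped: "clamped (path xs)"
  by (simp add: clamped_def path_def)

context rdat
begin

fun ok :: "'v => real => ('v \<times> real) list => bool" where
  "ok lam b [] = (b = 1)"
| "ok lam b ((x, a) # r) = (b < a & x \<in> orb lam & ach lam a x (nx lam r) & ok lam a r)"

lemma ok_le: "ok lam b xs ==> b <= 1"
proof (induction lam b xs rule: ok.induct)
  case (2 lam b x a r) thus ?case by auto
qed auto

lemma pl_before: "ok lam b xs ==> t <= b ==> pl b xs t = 0"
proof (induction lam b xs rule: ok.induct)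
  case (2 lam b x a r) thus ?case by auto
qed auto

lemma pl_spl: "ok lam b xs ==> pl b (spl c b xs) t = pl b xs t"
proof (induction lam b xs rule: ok.induct)
  case (2 lam b x a r)
  show ?case
  proof (cases "b < c & c < a")
    case True
    hence "min (max (t - b) 0) (a - b) = min (max (t - b) 0) (c - b) + min (max (t - c) 0) (a - c)" by auto
    thus ?thesis using True by (simp add: scaleR_left_distrib)
  qed (use 2 in auto)
qed auto

lemma ok_spl: "ok lam b xs ==> ok lam b (spl c b xs)"
proof (induction lam b xs rule: ok.induct)
  case (2 lam b x a r) thus ?case by (auto simp: nx_spl ach_refl)
qed auto

lemma nin_spl: "ok lam b xs ==> nin c b (spl c b xs) & (nin u b xs --> nin u b (spl c b xs))"
proof (induction lam b xs rule: ok.induct)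
  case (2 lam b x a r)
  have "nin c a r" if "c < a" "ok lam a r"
    using that(2) that(1)
  proof (induction lam a r rule: ok.induct)
    case (2 lam b x a r) thus ?case by auto
  qed auto
  thus ?case using 2 by auto
qed auto

lemma gls_pl:
  "length as = length ls ==> (\<Sum>j<length ls. min (max (t - (b # as) ! j) 0) ((b # as) ! Suc j - (b # as) ! j) *\<^sub>R ls ! j) = pl b (zip ls as) t"
proof (induction ls arbitrary: b as)
  case (Cons x ls)
  then obtain a as' where as: "as = a # as'" by (cases as) auto
  hence l: "length as' = length ls" using Cons.prems by simp
  show ?case using Cons.IH[OF l, of a] unfolding as
    by (simp add: sum.lessThan_Suc_shift del: sum.lessThan_Suc)
qed auto

lemma GLS_data_ok:
  assumes "length as = length ls" "(b # as) ! length ls = 1"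
     "\<forall>s < length ls. (b # as) ! s < (b # as) ! Suc s" "\<forall>s < length ls. ls ! s \<in> orb lam"
     "\<forall>s. Suc s < length ls --> ach lam ((b # as) ! Suc s) (ls ! s) (ls ! Suc s)" "ls \<noteq> [] --> ach lam 1 (last ls) lam"
  shows "ok lam b (zip ls as)"
  using assms
proof (induction ls arbitrary: b as)
  case (Cons x ls)
  then obtain a as' where as: "as = a # as'" by (cases as) auto
  have "ok lam a (zip ls as')"
  proof (rule Cons.IH)
    show "length as' = length ls" "(a # as') ! length ls = 1" using Cons.prems(1,2) as by auto
    show "\<forall>s<length ls. (a # as') ! s < (a # as') ! Suc s"
      using Cons.prems(3) as by (auto dest: spec[of _ "Suc _"])
    show "\<forall>s<length ls. ls ! s \<in> orb lam" using Cons.prems(4) by auto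
    show "\<forall>s. Suc s < length ls --> ach lam ((a # as') ! Suc s) (ls ! s) (ls ! Suc s)"
      using Cons.prems(5) as by (auto dest: spec[of _ "Suc _"])
    show "ls \<noteq> [] --> ach lam 1 (last ls) lam" using Cons.prems(6) by auto
  qed
  moreover have "b < a" "x \<in> orb lam" using Cons.prems(3,4) as by auto
  moreover have "ach lam a x (nx lam (zip ls as'))"
  proof (cases ls)
    case Nil thus ?thesis using Cons.prems as by auto
  next
    case (Cons y ls')
    then obtain a' as'' where "as' = a' # as''" using Cons.prems(1) as by (cases as') auto
    thus ?thesis using Cons.prems(5) as Cons by auto
  qed
  ultimately show ?case using as by simp
qed auto

fun adj :: "('v \<times> real) list => bool" where
  "adj [] = True" | "adj ((x, a) # r) = ((r = [] \<or> nx x r \<noteq> x) & adj r)"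

lemma normalise: "ok lam b xs ==> \<exists>ys. ok lam b ys & adj ys & (\<forall>t. pl b ys t = pl b xs t) & nx lam ys = nx lam xs"
proof (induction lam b xs rule: ok.induct)
  case (1 lam b) thus ?case by (intro exI[of _ "[]"]) auto
next
  case (2 lam b x a r)
  then obtain ys where ys: "ok lam a ys" "adj ys" "\<forall>t. pl a ys t = pl a r t" "nx lam ys = nx lam r" by auto
  show ?case
  proof (cases "ys = [] \<or> nx x ys \<noteq> x")
    case True thus ?thesis using ys 2 by (intro exI[of _ "(x, a) # ys"]) auto
  next
    case False
    then obtain c ys' where y: "ys = (x, c) # ys'" by (cases ys) auto
    have "pl b ((x, c) # ys') t = pl b ((x, a) # r) t" for t
    proof -
      have "pl a r t = pl a ys t" using ys(3) by simp
      moreover have "min (max (t - b) 0) (c - b) = min (max (t - b) 0) (a - b) + min (max (t - a) 0) (c - a)" using ys y 2 by auto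
      ultimately show ?thesis using y by (simp add: scaleR_left_distrib)
    qed
    thus ?thesis using ys y 2 by (intro exI[of _ "(x, c) # ys'"]) auto
  qed
qed

lemma ok_GLS_data:
  assumes "ok lam b ys" "adj ys" "ys \<noteq> []"
  shows "(b # map snd ys) ! length ys = 1"
     "\<forall>s < length ys. (b # map snd ys) ! s < (b # map snd ys) ! Suc s" "\<forall>s < length ys. map fst ys ! s \<in> orb lam"
     "\<forall>s. Suc s < length ys --> gt lam (map fst ys ! s) (map fst ys ! Suc s) & ach lam ((b # map snd ys) ! Suc s) (map fst ys ! s) (map fst ys ! Suc s)"
     "ach lam 1 (last (map fst ys)) lam"
proof -
  have "(b # map snd ys) ! length ys = 1 & (\<forall>s < length ys. (b # map snd ys) ! s < (b # map snd ys) ! Suc s) & (\<forall>s < length ys. map fst ys ! s \<in> orb lam)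
   & (\<forall>s. Suc s < length ys --> gt lam (map fst ys ! s) (map fst ys ! Suc s) & ach lam ((b # map snd ys) ! Suc s) (map fst ys ! s) (map fst ys ! Suc s))
   & (ys \<noteq> [] --> ach lam 1 (last (map fst ys)) lam)"
    using assms(1,2)
  proof (induction lam b ys rule: ok.induct)
    case (2 lam b x a r)
    hence IH: "(a # map snd r) ! length r = 1" "(\<forall>s < length r. (a # map snd r) ! s < (a # map snd r) ! Suc s)" "(\<forall>s < length r. map fst r ! s \<in> orb lam)"
     "(\<forall>s. Suc s < length r --> gt lam (map fst r ! s) (map fst r ! Suc s) & ach lam ((a # map snd r) ! Suc s) (map fst r ! s) (map fst r ! Suc s))"
     "(r \<noteq> [] --> ach lam 1 (last (map fst r)) lam)" by auto
    have first: "gt lam x (map fst r ! 0) & ach lam a x (map fst r ! 0)" if ne: "r \<noteq> []"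
    proof -
      obtain y c r' where r: "r = (y, c) # r'" using ne by (cases r) auto
      have "ach lam a x y" "x \<noteq> y" using 2 r by auto
      thus ?thesis using ach_ge[of lam a x y] r by (auto simp: ge_def)
    qed
    show ?case
    proof (intro conjI allI impI)
      show "(b # map snd ((x, a) # r)) ! length ((x, a) # r) = 1" using IH by auto
      fix k assume k: "k < length ((x, a) # r)"
      show "(b # map snd ((x, a) # r)) ! k < (b # map snd ((x, a) # r)) ! Suc k" using IH(2) 2(2) k by (cases k) auto
      show "map fst ((x, a) # r) ! k \<in> orb lam" using IH(3) 2(2) k by (cases k) auto
    next
      fix k assume k: "Suc k < length ((x, a) # r)"
      show "gt lam (map fst ((x, a) # r) ! k) (map fst ((x, a) # r) ! Suc k)" using IH(4) first k by (cases k) auto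
      show "ach lam ((b # map snd ((x, a) # r)) ! Suc k) (map fst ((x, a) # r) ! k) (map fst ((x, a) # r) ! Suc k)" using IH(4) first k by (cases k) auto
    next
      show "ach lam 1 (last (map fst ((x, a) # r))) lam" using IH(5) 2(2) by (cases "r = []") auto
    qed
  qed auto
  thus "(b # map snd ys) ! length ys = 1"
     "\<forall>s < length ys. (b # map snd ys) ! s < (b # map snd ys) ! Suc s" "\<forall>s < length ys. map fst ys ! s \<in> orb lam"
     "\<forall>s. Suc s < length ys --> gt lam (map fst ys ! s) (map fst ys ! Suc s) & ach lam ((b # map snd ys) ! Suc s) (map fst ys ! s) (map fst ys ! Suc s)"
     "ach lam 1 (last (map fst ys)) lam" using assms(3) by blast+
qed

abbreviation Bp :: "'v => (real => 'v) set" where "Bp \<equiv> GLS I A alpha cor"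

lemma GLS_path: "Bp lam = {path xs | xs. ok lam 0 xs}"
proof (intro equalityI subsetI)
  fix p assume "p \<in> Bp lam"
  then obtain ls as where d: "p = gls_fun ls as" "GLS_data I A alpha cor lam ls as" unfolding GLS_def by auto
  then obtain as' where as: "as = 0 # as'" "length as' = length ls" unfolding GLS_data_def by (cases as) auto
  have "p = path (zip ls as')" unfolding d(1) as gls_fun_def path_def using gls_pl[OF as(2), of _ 0] by auto
  moreover have "ok lam 0 (zip ls as')"
    by (rule GLS_data_ok) (use d(2) as in \<open>auto simp: GLS_data_def\<close>)
  ultimately show "p \<in> {path xs | xs. ok lam 0 xs}" by blast
next
  fix p assume "p \<in> {path xs | xs. ok lam 0 xs}"
  then obtain xs where xs: "p = path xs" "ok lam 0 xs" by auto
  then obtain ys where ys: "ok lam 0 ys" "adj ys" "!!t. pl 0 ys t = pl 0 xs t" using normalise[OF xs(2)] by auto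
  hence ne: "ys \<noteq> []" by auto
  have "GLS_data I A alpha cor lam (map fst ys) (0 # map snd ys)"
    unfolding GLS_data_def using ok_GLS_data[OF ys(1,2) ne] ne by auto
  moreover have "gls_fun (map fst ys) (0 # map snd ys) = p"
  proof
    fix t
    have l: "length (map snd ys) = length (map fst ys)" by simp
    show "gls_fun (map fst ys) (0 # map snd ys) t = p t"
      unfolding gls_fun_def gls_pl[OF l] using ys(3) xs(1) by (simp add: path_def zip_map_fst_snd)
  qed
  ultimately show "p \<in> Bp lam" unfolding GLS_def by blast
qed

lemma GLS_clamped: "p \<in> Bp lam ==> clamped p"
  unfolding GLS_path using path_clamped by auto

lemma GLS_0: "p \<in> Bp lam ==> p 0 = 0"
  unfolding GLS_path using pl_before by (auto simp: path_def)

lemma pi_path: "pi_lam x = path [(x, 1)]"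
  by (auto simp: pi_lam_def path_def fun_eq_iff)

lemma pi_GLS: "x \<in> orb lam ==> ach lam 1 x lam ==> pi_lam x \<in> Bp lam"
  unfolding GLS_path pi_path by auto

lemma pi_lam_GLS: "pi_lam lam \<in> Bp lam"
  using pi_GLS ach_refl Worbit.base by blast

subsection \<open>Integrality\<close>

lemma pl_cont: "i \<in> I ==> continuous_on UNIV (%t. cor i (pl b xs t))"
proof (induction xs arbitrary: b)
  case (Cons p xs)
  obtain x a where p: "p = (x, a)" by (cases p)
  show ?case unfolding p using Cons by (auto intro!: continuous_intros)
qed auto

text \<open>The directions before and after an interior time r are joined by an r-chain, trivial
  inside a segment, and modulo integers the height function at r is r times the pairing of the
  incoming direction. The term with \<open>b\<close> accounts for a list starting at b; the
  congruences telescope by \<open>ach_cong\<close>.\<close>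

lemma ok_local:
  assumes "ok lam b xs" "b < r" "r < 1"
  shows "\<exists>x y e. 0 < e & (\<forall>t. r - e <= t & t <= r --> pl b xs t = pl b xs r + (t - r) *\<^sub>R x) &
    (\<forall>t. r <= t & t <= r + e --> pl b xs t = pl b xs r + (t - r) *\<^sub>R y) & ach lam r x y &
    (\<forall>i\<in>R. cor i (pl b xs r) - r * cor i x + b * cor i (nx lam xs) \<in> \<int>)"
  using assms
proof (induction lam b xs rule: ok.induct)
  case (2 lam b x a r0)
  have okr: "ok lam a r0" "b < a" "ach lam a x (nx lam r0)" using 2 by auto
  have seg: "pl b ((x, a) # r0) t = (t - b) *\<^sub>R x" if "b <= t" "t <= a" for t
    using that pl_before[OF okr(1), of t] by simp
  have aft: "pl b ((x, a) # r0) t = (a - b) *\<^sub>R x + pl a r0 t" if "a <= t" for t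
    using that okr by simp
  have ig: "cor i (pl b ((x, a) # r0) r) - r * cor i x + b * cor i x \<in> \<int>" if "i \<in> R" "r <= a" for i
  proof -
    have "pl b ((x, a) # r0) r = (r - b) *\<^sub>R x" using seg[of r] 2(3) that by simp
    thus ?thesis using RI[OF that(1)] by (simp add: left_diff_distrib del: pl.simps)
  qed
  consider "r < a" | "r = a" | "a < r" by linarith
  thus ?case
  proof cases
    case 1
    define e where "e = min (r - b) (a - r)"
    have e: "0 < e" "b <= r - e" "r + e <= a" using 1 2 by (auto simp: e_def)
    have sq: "pl b ((x, a) # r0) t = pl b ((x, a) # r0) r + (t - r) *\<^sub>R x" if "r - e <= t" "t <= r + e" for t
      using seg[of t] seg[of r] that e by (simp del: pl.simps flip: scaleR_add_left)
    have AB: "(\<forall>t. r - e <= t & t <= r --> pl b ((x, a) # r0) t = pl b ((x, a) # r0) r + (t - r) *\<^sub>R x)"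
      "(\<forall>t. r <= t & t <= r + e --> pl b ((x, a) # r0) t = pl b ((x, a) # r0) r + (t - r) *\<^sub>R x)"
      using e(1) by (intro allI impI sq; simp)+
    have ra: "r <= a" using 1 by simp
    show ?thesis unfolding nx.simps
      by (rule exI[of _ x], rule exI[of _ x], rule exI[of _ e], intro conjI ballI, rule e(1), rule AB(1), rule AB(2), rule ach_refl,
          rule ig, assumption, rule ra)
  next
    case aeq: 2
    then obtain y c r1 where r0: "r0 = (y, c) # r1" using 2 by (cases r0) auto
    hence c: "a < c" "ok lam c r1" using okr by auto
    define e where "e = min (a - b) (c - a)"
    have e: "0 < e" "b <= r - e" "r + e <= c" using aeq c okr by (auto simp: e_def)
    have "pl b ((x, a) # r0) t = pl b ((x, a) # r0) r + (t - r) *\<^sub>R x" if "r - e <= t" "t <= r" for t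
      using seg[of t] seg[of r] that e aeq by (simp del: pl.simps flip: scaleR_add_left)
    moreover have "pl b ((x, a) # r0) t = pl b ((x, a) # r0) r + (t - r) *\<^sub>R y" if "r <= t" "t <= r + e" for t
      using aft[of t] seg[of r] that e aeq pl_before[OF c(2), of t] okr by (simp add: r0)
    ultimately have AB: "(\<forall>t. r - e <= t & t <= r --> pl b ((x, a) # r0) t = pl b ((x, a) # r0) r + (t - r) *\<^sub>R x)"
      "(\<forall>t. r <= t & t <= r + e --> pl b ((x, a) # r0) t = pl b ((x, a) # r0) r + (t - r) *\<^sub>R y)"
      by blast+
    have rxy: "ach lam r x y" using okr r0 aeq by simp
    have ra: "r <= a" using aeq by simp
    show ?thesis unfolding nx.simps
      by (rule exI[of _ x], rule exI[of _ y], rule exI[of _ e], intro conjI ballI, rule e(1), rule AB(1), rule AB(2), rule rxy,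
          rule ig, assumption, rule ra)
  next
    case 3
    obtain x' y e where xy: "0 < e" "(\<forall>t. r - e <= t & t <= r --> pl a r0 t = pl a r0 r + (t - r) *\<^sub>R x')"
      "(\<forall>t. r <= t & t <= r + e --> pl a r0 t = pl a r0 r + (t - r) *\<^sub>R y)" "ach lam r x' y"
      "(\<forall>i\<in>R. cor i (pl a r0 r) - r * cor i x' + a * cor i (nx lam r0) \<in> \<int>)" using 2(1)[OF okr(1) 3 2(4)] by blast
    define e' where "e' = min e (r - a)"
    have e: "0 < e'" "e' <= e" "a <= r - e'" using xy(1) 3 by (auto simp: e'_def)
    have "pl b ((x, a) # r0) t = pl b ((x, a) # r0) r + (t - r) *\<^sub>R x'" if "r - e' <= t" "t <= r" for t
      using aft[of t] aft[of r] xy(2)[rule_format, of t] that e 3 by (simp del: pl.simps)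
    moreover have "pl b ((x, a) # r0) t = pl b ((x, a) # r0) r + (t - r) *\<^sub>R y" if "r <= t" "t <= r + e'" for t
      using aft[of t] aft[of r] xy(3)[rule_format, of t] that e 3 by (simp del: pl.simps)
    moreover have "cor i (pl b ((x, a) # r0) r) - r * cor i x' + b * cor i x \<in> \<int>" if i: "i \<in> R" for i
    proof -
      have "cor i (pl b ((x, a) # r0) r) - r * cor i x' + b * cor i x
        = (cor i (pl a r0 r) - r * cor i x' + a * cor i (nx lam r0)) + (a * cor i x - a * cor i (nx lam r0))"
        unfolding aft[OF less_imp_le[OF 3]] using RI[OF i] by (simp add: algebra_simps)
      thus ?thesis using xy(5)[rule_format, OF i] ach_cong[OF okr(3) i] by (metis Ints_add)
    qed
    ultimately have "(\<forall>t. r - e' <= t & t <= r --> pl b ((x, a) # r0) t = pl b ((x, a) # r0) r + (t - r) *\<^sub>R x')"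
      "(\<forall>t. r <= t & t <= r + e' --> pl b ((x, a) # r0) t = pl b ((x, a) # r0) r + (t - r) *\<^sub>R y)"
      "\<forall>i\<in>R. cor i (pl b ((x, a) # r0) r) - r * cor i x' + b * cor i (nx lam ((x, a) # r0)) \<in> \<int>"
      unfolding nx.simps by blast+
    thus ?thesis using xy(4) e(1) by blast
  qed
qed auto

lemma ok_end:
  assumes "ok lam b xs" "i \<in> R"
  shows "cor i (pl b xs 1) - cor i lam + b * cor i (nx lam xs) \<in> \<int>"
  using assms
proof (induction lam b xs rule: ok.induct)
  case (1 lam b)
  thus ?case using RI by auto
next
  case (2 lam b x a r)
  have okr: "ok lam a r" "b < a" "ach lam a x (nx lam r)" using 2 by auto
  have "a <= 1" using ok_le okr by blast
  hence "cor i (pl b ((x, a) # r) 1) - cor i lam + b * cor i x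
     = (cor i (pl a r 1) - cor i lam + a * cor i (nx lam r)) + (a * cor i x - a * cor i (nx lam r))"
    using okr RI[OF 2(3)] by (simp add: algebra_simps)
  moreover have "cor i (pl a r 1) - cor i lam + a * cor i (nx lam r) \<in> \<int>" using 2 by auto
  ultimately show ?case using ach_cong[OF okr(3) 2(3)] unfolding nx.simps by (metis Ints_add)
qed

text \<open>At a local minimum r the pairing passes from nonpositive to nonnegative and is nonzero
  on one side. So r times it is an integer by \<open>ach_plus\<close> or \<open>ach_minus\<close>,
  and then so is the value at r by \<open>ok_local\<close>.\<close>

lemma GLS_LI:
  assumes "p \<in> Bp lam" "i \<in> R" "cor i lam \<in> \<int>"
  shows "LI (%t. cor i (p t))"
proof -
  obtain xs where xs: "p = path xs" "ok lam 0 xs" using assms(1) unfolding GLS_path by auto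
  note iI = RI[OF assms(2)]
  let ?H = "%t. cor i (p t)"
  have eq: "p t = pl 0 xs t" if "0 <= t" "t <= 1" for t using that by (simp add: xs(1) path_def)
  have "continuous_on {0..1} (%t. cor i (pl 0 xs t))" using pl_cont[OF iI] continuous_on_subset by blast
  hence c: "continuous_on {0..1} ?H" by (rule continuous_on_cong[THEN iffD1, rotated -1]) (auto simp: eq)
  have H0: "?H 0 = 0" using GLS_0[OF assms(1)] iI by simp
  have "?H 1 - cor i lam \<in> \<int>" using ok_end[OF xs(2) assms(2)] eq[of 1] by simp
  hence "?H 1 - cor i lam + cor i lam \<in> \<int>" using assms(3) Ints_add by blast
  hence H1: "?H 1 \<in> \<int>" by simp
  have key: "?H r \<in> \<int>" if r: "0 < e0" "0 <= r - e0" "r + e0 <= 1"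
    and le: "\<forall>t. r - e0 <= t & t < r --> ?H r <= ?H t" "\<forall>t. r < t & t <= r + e0 --> ?H r <= ?H t"
    and st: "(\<forall>t. r < t & t <= r + e0 --> ?H r < ?H t) \<or> (\<forall>t. r - e0 <= t & t < r --> ?H r < ?H t)" for r e0
  proof -
    have "0 < r" "r < 1" using r by auto
    then obtain x y e where xy: "0 < e" "\<forall>t. r - e <= t & t <= r --> pl 0 xs t = pl 0 xs r + (t - r) *\<^sub>R x"
      "\<forall>t. r <= t & t <= r + e --> pl 0 xs t = pl 0 xs r + (t - r) *\<^sub>R y" "ach lam r x y"
      "\<forall>i\<in>R. cor i (pl 0 xs r) - r * cor i x + 0 * cor i (nx lam xs) \<in> \<int>" using ok_local[OF xs(2)] by blast
    define d0 where "d0 = min e e0"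
    have d0: "0 < d0" "d0 <= e" "d0 <= e0" using xy(1) r(1) by (auto simp: d0_def)
    have "pl 0 xs (r - d0) = pl 0 xs r + (r - d0 - r) *\<^sub>R x" using d0 by (intro xy(2)[rule_format]) auto
    hence l: "?H (r - d0) = ?H r - d0 * cor i x" using d0 r iI eq[of "r - d0"] eq[of r] by simp
    have "pl 0 xs (r + d0) = pl 0 xs r + (r + d0 - r) *\<^sub>R y" using d0 by (intro xy(3)[rule_format]) auto
    hence rt: "?H (r + d0) = ?H r + d0 * cor i y" using d0 r iI eq[of "r + d0"] eq[of r] by simp
    have i1: "?H r - r * cor i x \<in> \<int>" using xy(5) assms(2) eq[of r] r by simp
    have i2: "r * cor i x - r * cor i y \<in> \<int>" using ach_cong[OF xy(4) assms(2)] .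
    have "?H r <= ?H (r - d0)" "?H r <= ?H (r + d0)" using le d0 by auto
    hence sg: "cor i x <= 0" "cor i y >= 0" using l rt d0(1) by (auto simp: mult_le_0_iff zero_le_mult_iff)
    have "r * cor i x \<in> \<int>"
      using st
    proof
      assume "\<forall>t. r < t & t <= r + e0 --> ?H r < ?H t"
      hence "?H r < ?H (r + d0)" using d0 by auto
      hence "cor i y > 0" using rt sg by (auto simp: zero_less_mult_iff)
      hence "r * cor i y \<in> \<int>" using ach_plus[OF xy(4) assms(2)] sg by auto
      thus ?thesis using i2 Ints_add[of "r * cor i x - r * cor i y" "r * cor i y"] by simp
    next
      assume "\<forall>t. r - e0 <= t & t < r --> ?H r < ?H t"
      hence "?H r < ?H (r - d0)" using d0 by auto
      hence "cor i x < 0" using l d0 by (auto simp: mult_less_0_iff)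
      thus ?thesis using ach_minus[OF xy(4) assms(2)] sg by auto
    qed
    thus ?thesis using i1 Ints_add[of "?H r - r * cor i x" "r * cor i x"] by simp
  qed
  show ?thesis unfolding LI_def
  proof (intro conjI allI impI c H0 H1)
    fix r e assume a: "0 < e & 0 <= r - e & r + e <= 1" "\<forall>t. r - e <= t & t <= r --> ?H r <= ?H t" "\<forall>t. r < t & t <= r + e --> ?H r < ?H t"
    thus "?H r \<in> \<int>" by (intro key[of e r]) auto
  next
    fix r e assume a: "0 < e & 0 <= r - e & r + e <= 1" "\<forall>t. r - e <= t & t < r --> ?H r < ?H t" "\<forall>t. r <= t & t <= r + e --> ?H r <= ?H t"
    thus "?H r \<in> \<int>" by (intro key[of e r]) auto
  qed
qed

subsection \<open>Stability under the real root operators\<close>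

text \<open>The effect of a root operator on lists: the directions on the segments between u and v
  are reflected and all times stay.\<close>

definition flp :: "'i => real => real => ('v \<times> real) list => ('v \<times> real) list" where
  "flp i u v = map (%(x, a). (if u < a & a <= v then s i x else x, a))"

lemma flp_simps [simp]: "flp i u v [] = []"
  "flp i u v ((x, a) # r) = (if u < a & a <= v then s i x else x, a) # flp i u v r"
  by (auto simp: flp_def)

lemma pl_flp:
  assumes "ok lam b xs" "nin u b xs" "nin v b xs" "u <= v" "i \<in> I"
  shows "pl b (flp i u v xs) t = pl b xs t - cor i (pl b xs (min t v) - pl b xs (min t u)) *\<^sub>R alpha i"
  using assms(1-3)
proof (induction lam b xs rule: ok.induct)
  case (1 lam b) thus ?case using assms(5) by simp
next
  case (2 lam b x a r)
  have iI: "i \<in> I" by fact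
  have IH: "pl a (flp i u v r) t = pl a r t - cor i (pl a r (min t v) - pl a r (min t u)) *\<^sub>R alpha i" and ba: "b < a"
    using 2 by auto
  define M where "M t = min (max (t - b) 0) (a - b)" for t
  have e: "pl b ((x, a) # r) t = M t *\<^sub>R x + pl a r t" for x r t by (simp add: M_def)
  show ?case
  proof (cases "u < a & a <= v")
    case True
    hence "u <= b" using 2 by auto
    hence "M (min t u) = 0" "M (min t v) = M t" using True ba by (auto simp: M_def)
    thus ?thesis using True IH iI unfolding flp_simps e by (simp add: refl_def algebra_simps)
  next
    case False
    hence "M (min t u) = M (min t v)" using 2(2-4) assms(4) ba by (auto simp: M_def)
    thus ?thesis using False IH iI unfolding flp_simps e by (auto simp: algebra_simps)
  qed
qed

lemma nx_flp:
  assumes "ok lam a r" "nin u a r" "nin v a r" "v <= 1"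
  shows "nx lam (flp i u v r) = (if u <= a & a < v then s i (nx lam r) else nx lam r)"
proof (cases r)
  case Nil thus ?thesis using assms by auto
next
  case (Cons p r')
  then obtain y c where "r = (y, c) # r'" by (cases p) auto
  thus ?thesis using assms by auto
qed

text \<open>At u the pairing turns from nonpositive to positive, which is \<open>ach_plus\<close>.
  Strictly between u and v the values of G lie between m and m + 1, hence are not integers, and
  \<open>ach_flip_pos\<close> applies. G is the height function of the whole path, of which the list
  describes only the part after b.\<close>

lemma ok_flp_FS:
  assumes "ok lam b xs" "nin u b xs" "nin v b xs" "i \<in> R" "0 <= b" and FS: "FS G m u v"
    and G: "!!t. b <= t ==> t <= 1 ==> G t = G b + cor i (pl b xs t)" "G b - b * cor i (nx lam xs) \<in> \<int>"
  shows "ok lam b (flp i u v xs)"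
  using assms(1-3,5) G
proof (induction lam b xs rule: ok.induct)
  case (2 lam b x a r)
  note i = assms(4) note iI = RI[OF i]
  have okr: "b < a" "x \<in> orb lam" "ach lam a x (nx lam r)" "ok lam a r" "nin u a r" "nin v a r"
    and bu: "u <= b \<or> a <= u" "v <= b \<or> a <= v" "0 <= b" using 2(2-5) by auto
  have a1: "a <= 1" using ok_le okr by blast
  have a0: "0 <= a" using bu okr by simp
  have uv: "u < v" "v <= 1" "m \<in> \<int>" "G u = m" "G v = m + 1" and
    F1: "!!t. 0 <= t ==> t <= u ==> m <= G t" and F2: "!!t t'. u <= t ==> t < t' ==> t' <= v ==> G t < G t'"
    using FS by (auto simp: FS_def)
  have Ga: "G a = G b + (a - b) * cor i x" using 2(6)[of a] pl_before[OF okr(4), of a] okr(1) a1 iI by simp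
  have Gr: "G t = G a + cor i (pl a r t)" if "a <= t" "t <= 1" for t
    using 2(6)[of t] Ga that okr(1) iI by simp
  have Gi: "G a - a * cor i (nx lam r) \<in> \<int>"
  proof -
    have "G a - a * cor i (nx lam r) = (G b - b * cor i x) + (a * cor i x - a * cor i (nx lam r))"
      unfolding Ga by (simp add: algebra_simps)
    thus ?thesis using 2(7) ach_cong[OF okr(3) i] unfolding nx.simps by (metis Ints_add)
  qed
  have Gix: "G a - a * cor i x \<in> \<int>" using 2(7) unfolding Ga by (simp add: algebra_simps)
  have IH: "ok lam a (flp i u v r)" using 2(1)[OF okr(4-6) a0 Gr Gi] .
  have nxp: "cor i (nx lam r) > 0" if ua: "u <= a" "a < v"
  proof -
    obtain y c r' where r: "r = (y, c) # r'" using ua okr(4) uv by (cases r) auto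
    have c: "a < c" "c <= v" "ok lam c r'" using okr r ua by auto
    have "G c = G a + (c - a) * cor i y" using Gr[of c] c uv r pl_before[OF c(3), of c] iI by simp
    moreover have "G a < G c" using F2 c ua by auto
    ultimately show ?thesis using c r by (auto simp: zero_less_mult_iff)
  qed
  have xp: "cor i x > 0" if "u < a" "a <= v"
  proof -
    have "G b < G a" using F2 that bu okr by auto
    thus ?thesis using Ga okr by (auto simp: zero_less_mult_iff)
  qed
  have ach: "ach lam a (if u < a & a <= v then s i x else x) (nx lam (flp i u v r))"
  proof -
    consider "a < u" | "a = u" | "u < a" "a < v" | "u < a" "a = v" | "v < a" by linarith
    thus ?thesis
    proof cases
      case aeq: 2
      have "m <= G b" using F1 bu okr aeq by auto
      hence "cor i x <= 0" using Ga uv aeq okr(1) by (auto simp: zero_le_mult_iff mult_le_0_iff)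
      thus ?thesis using ach_plus[OF okr(3) i] nxp aeq uv nx_flp[OF okr(4-6) uv(2), of i] by auto
    next
      case 3
      have "m < G a" "G a < m + 1" using F2[of u a] F2[of a v] 3 uv by auto
      hence nz: "G a \<notin> \<int>" using uv(3) by (auto elim!: Ints_cases)
      have "a * cor i (nx lam r) \<notin> \<int>"
      proof
        assume "a * cor i (nx lam r) \<in> \<int>"
        hence "G a - a * cor i (nx lam r) + a * cor i (nx lam r) \<in> \<int>" using Gi Ints_add by blast
        thus False using nz by simp
      qed
      thus ?thesis using ach_flip_pos[OF okr(3) i] xp nxp 3 nx_flp[OF okr(4-6) uv(2), of i] by auto
    next
      \<comment> \<open>The value m + 1 at v is an integer, so the new corner is bridged by one more
        admissible chain step, from s_i x to x.\<close>
      case 4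
      have "G a - (G a - a * cor i x) \<in> \<int>" using Gix uv 4 by (intro Ints_diff) auto
      hence "st lam a (s i x) x" using st_simple[OF okr(2) i] xp 4 bu okr by auto
      hence "ach lam a (s i x) (nx lam r)" using st_ach ach_trans okr(3) by blast
      thus ?thesis using 4 uv nx_flp[OF okr(4-6) uv(2), of i] by auto
    qed (use okr uv nx_flp[OF okr(4-6) uv(2), of i] in auto)
  qed
  show ?case using okr(1,2) IH ach orb_s[OF okr(2) i] by auto
qed auto

text \<open>The mirror image of \<open>ok_flp_FS\<close>. If v = 1, the direction following v is
  \<open>lam\<close> itself, whence the hypothesis \<open>cor i lam >= 0\<close>.\<close>

lemma ok_flp_ES:
  assumes "ok lam b xs" "nin u b xs" "nin v b xs" "i \<in> R" "0 <= b" "cor i lam >= 0" and ES: "ES G m u v"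
    and G: "!!t. b <= t ==> t <= 1 ==> G t = G b + cor i (pl b xs t)" "G b - b * cor i (nx lam xs) \<in> \<int>"
  shows "ok lam b (flp i u v xs)"
  using assms(1-3,5,6) G
proof (induction lam b xs rule: ok.induct)
  case (2 lam b x a r)
  note i = assms(4) note iI = RI[OF i]
  have okr: "b < a" "x \<in> orb lam" "ach lam a x (nx lam r)" "ok lam a r" "nin u a r" "nin v a r"
    and bu: "u <= b \<or> a <= u" "v <= b \<or> a <= v" "0 <= b" using 2(2-5) by auto
  have a1: "a <= 1" using ok_le okr by blast
  have a0: "0 <= a" using bu okr by simp
  have uv: "u < v" "v <= 1" "m \<in> \<int>" "G u = m + 1" "G v = m" and
    F1: "!!t. v <= t ==> t <= 1 ==> m <= G t" and F2: "!!t t'. u <= t ==> t < t' ==> t' <= v ==> G t' < G t"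
    using ES by (auto simp: ES_def)
  have Ga: "G a = G b + (a - b) * cor i x" using 2(7)[of a] pl_before[OF okr(4), of a] okr(1) a1 iI by simp
  have Gr: "G t = G a + cor i (pl a r t)" if "a <= t" "t <= 1" for t
    using 2(7)[of t] Ga that okr(1) iI by simp
  have Gi: "G a - a * cor i (nx lam r) \<in> \<int>"
  proof -
    have "G a - a * cor i (nx lam r) = (G b - b * cor i x) + (a * cor i x - a * cor i (nx lam r))"
      unfolding Ga by (simp add: algebra_simps)
    thus ?thesis using 2(8) ach_cong[OF okr(3) i] unfolding nx.simps by (metis Ints_add)
  qed
  have Gix: "G a - a * cor i x \<in> \<int>" using 2(8) unfolding Ga by (simp add: algebra_simps)
  have IH: "ok lam a (flp i u v r)" using 2(1)[OF okr(4-6) a0 2(6) Gr Gi] .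
  have nxs: "(nx lam r \<in> orb lam & (u <= a & a < v --> cor i (nx lam r) < 0) & (v <= a --> v = a --> cor i (nx lam r) >= 0))"
  proof (cases r)
    case Nil thus ?thesis using 2(6) okr(4) uv by (auto intro: Worbit.base)
  next
    case (Cons p r')
    then obtain y c where r: "r = (y, c) # r'" by (cases p) auto
    have c: "a < c" "ok lam c r'" "y \<in> orb lam" "v <= a \<or> c <= v" using okr r by auto
    have c1: "c <= 1" using ok_le c by blast
    have Gc: "G c = G a + (c - a) * cor i y" using Gr[of c] c c1 r pl_before[OF c(2), of c] iI by simp
    have "G c < G a" if "u <= a" "a < v" using F2 c that by auto
    hence 1: "cor i y < 0" if "u <= a" "a < v" using that Gc c by (auto simp: mult_less_0_iff)
    have "G a <= G c" if "v = a" using F1[of c] c c1 uv that by auto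
    hence "cor i y >= 0" if "v = a" using that Gc c by (auto simp: zero_le_mult_iff)
    thus ?thesis using 1 r c by auto
  qed
  have xp: "cor i x < 0" if "u < a" "a <= v"
  proof -
    have "G a < G b" using F2 that bu okr by auto
    thus ?thesis using Ga okr by (auto simp: mult_less_0_iff)
  qed
  have ach: "ach lam a (if u < a & a <= v then s i x else x) (nx lam (flp i u v r))"
  proof -
    consider "a < u" | "a = u" | "u < a" "a < v" | "u < a" "a = v" | "v < a" by linarith
    thus ?thesis
    proof cases
      case aeq: 2
      let ?y = "nx lam r"
      have "G a - (G a - a * cor i ?y) \<in> \<int>" using Gi uv aeq by (intro Ints_diff) auto
      hence "- (a * cor i ?y) \<in> \<int>" by simp
      hence "st lam a (s i (s i ?y)) (s i ?y)" using st_simple[of "s i ?y" lam i a] orb_s i nxs aeq uv okr bu cor_s[OF i] by auto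
      hence "ach lam a x (s i ?y)" using st_ach ach_trans okr(3) s_s[OF i] by metis
      thus ?thesis using aeq uv nx_flp[OF okr(4-6) uv(2), of i] by auto
    next
      case 3
      have "m < G a" "G a < m + 1" using F2[of u a] F2[of a v] 3 uv by auto
      hence nz: "G a \<notin> \<int>" using uv(3) by (auto elim!: Ints_cases)
      have "a * cor i x \<notin> \<int>"
      proof
        assume "a * cor i x \<in> \<int>"
        hence "G a - a * cor i x + a * cor i x \<in> \<int>" using Gix Ints_add by blast
        thus False using nz by simp
      qed
      thus ?thesis using ach_flip_neg[OF okr(3) i] xp nxs 3 nx_flp[OF okr(4-6) uv(2), of i] by auto
    next
      case 4
      thus ?thesis using ach_minus[OF okr(3) i] xp nxs uv nx_flp[OF okr(4-6) uv(2), of i] by auto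
    qed (use okr uv nx_flp[OF okr(4-6) uv(2), of i] in auto)
  qed
  show ?case using okr(1,2) IH ach orb_s[OF okr(2) i] by auto
qed auto

lemma GLS_split:
  assumes "p \<in> Bp lam"
  obtains xs where "p = path xs" "ok lam 0 xs" "nin u 0 xs" "nin v 0 xs"
proof -
  obtain xs where xs: "p = path xs" "ok lam 0 xs" using assms unfolding GLS_path by auto
  define ys where "ys = spl v 0 (spl u 0 xs)"
  have "ok lam 0 ys" "nin u 0 ys" "nin v 0 ys" using xs(2) ok_spl nin_spl unfolding ys_def by blast+
  moreover have "p = path ys" unfolding xs(1) path_def ys_def using pl_spl[OF xs(2)] pl_spl[OF ok_spl[OF xs(2)]] by simp
  ultimately show ?thesis using that by blast
qed

lemma letter_R: "i \<in> R ==> letter alpha cor i"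
  using lin_cor cor2 by unfold_locales (auto simp: R_def)

lemma Fmod_path:
  assumes F: "FS (%t. cor i (p t)) m u v" and i: "i \<in> I"
    and xs: "p = path xs" "ok lam 0 xs" "nin u 0 xs" "nin v 0 xs"
  shows "Fmod alpha cor i m u v p = path (flp i u v xs)"
proof (rule clamped_eqI)
  have uv: "0 <= u" "u < v" "v <= 1" "cor i (p u) = m" "cor i (p v) = m + 1" using F by (auto simp: FS_def)
  have eq: "p t = pl 0 xs t" if "0 <= t" "t <= 1" for t using that by (simp add: xs(1) path_def)
  show "clamped (Fmod alpha cor i m u v p)" by (rule Fmod_clamped)
  show "clamped (path (flp i u v xs))" by (rule path_clamped)
  fix t :: real assume t: "0 <= t" "t <= 1"
  have e: "path (flp i u v xs) t = p t - cor i (p (min t v) - p (min t u)) *\<^sub>R alpha i"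
    using t uv pl_flp[OF xs(2-4) _ i, of t] eq[of t] eq[of "min t u"] eq[of "min t v"] by (simp add: path_def)
  show "Fmod alpha cor i m u v p t = path (flp i u v xs) t"
    unfolding e Fmod_def Let_def using t uv i by auto
qed

lemma GLS_fstep:
  assumes "fstep alpha cor i p q" "p \<in> Bp lam" "i \<in> R"
  shows "q \<in> Bp lam"
proof -
  obtain m u v where F: "FS (%t. cor i (p t)) m u v" "q = Fmod alpha cor i m u v p"
    using assms(1) by (auto simp: fstep_def)
  obtain xs where xs: "p = path xs" "ok lam 0 xs" "nin u 0 xs" "nin v 0 xs" using GLS_split[OF assms(2)] by blast
  note iI = RI[OF assms(3)]
  have eq: "p t = pl 0 xs t" if "0 <= t" "t <= 1" for t using that by (simp add: xs(1) path_def)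
  have p0: "p 0 = 0" using GLS_0 assms(2) by blast
  have "ok lam 0 (flp i u v xs)"
    by (rule ok_flp_FS[OF xs(2-4) assms(3) order.refl F(1)]) (use eq p0 iI in auto)
  thus ?thesis unfolding F(2) Fmod_path[OF F(1) iI xs] GLS_path by blast
qed

lemma GLS_fstep_rev:
  assumes "fstep alpha cor i p q" "q \<in> Bp lam" "i \<in> R" "cor i lam >= 0"
  shows "p \<in> Bp lam"
proof -
  interpret letter alpha cor i by (rule letter_R[OF assms(3)])
  obtain m u v where F: "FS (%t. cor i (p t)) m u v" "q = Fmod alpha cor i m u v p" and c: "clamped p"
    using assms(1) by (auto simp: fstep_def)
  have E: "ES (%t. cor i (q t)) (m - 1) u v" using FS_ES[OF F(1)] F(2) by simp
  have pE: "p = Emod alpha cor i (m - 1) u v q" using Emod_Fmod[OF F(1) c] F(2) by simp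
  obtain xs where xs: "q = path xs" "ok lam 0 xs" "nin u 0 xs" "nin v 0 xs" using GLS_split[OF assms(2)] by blast
  note iI = RI[OF assms(3)]
  have uv: "0 <= u" "u < v" "v <= 1" "cor i (q u) = m" "cor i (q v) = m - 1" using E by (auto simp: ES_def)
  have eq: "q t = pl 0 xs t" if "0 <= t" "t <= 1" for t using that by (simp add: xs(1) path_def)
  have p0: "q 0 = 0" using GLS_0 assms(2) by blast
  have "ok lam 0 (flp i u v xs)"
    by (rule ok_flp_ES[OF xs(2-4) assms(3) order.refl assms(4) E]) (use eq p0 iI in auto)
  moreover have "p = path (flp i u v xs)"
  proof (rule clamped_eqI)
    show "clamped p" by fact
    show "clamped (path (flp i u v xs))" by (rule path_clamped)
    fix t :: real assume t: "0 <= t" "t <= 1"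
    have e: "path (flp i u v xs) t = q t - cor i (q (min t v) - q (min t u)) *\<^sub>R alpha i"
      using t uv pl_flp[OF xs(2-4) _ iI, of t] eq[of t] eq[of "min t u"] eq[of "min t v"] by (simp add: path_def)
    show "p t = path (flp i u v xs) t"
      unfolding e unfolding pE Emod_def Let_def using t uv iI by auto
  qed
  ultimately show ?thesis unfolding GLS_path by blast
qed

subsection \<open>Dominant and extremal paths\<close>

text \<open>For a positive real root beta the coroot would take the negative value - c on x, against
  \<open>coroot_nonneg\<close>. So the first chain step from a real-dominant weight is
  imaginary.\<close>

lemma st_dominant:
  assumes "st lam a x z" "!!i. i \<in> R ==> cor i x >= 0"
  shows "\<exists>c. cs lam x z c True & a * c = 1"
proof -
  obtain c im where c: "cs lam x z c im" "if im then a * c = 1 else a * c \<in> \<int> & a * c > 0" using assms by (auto simp: st_def)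
  have "im"
  proof (rule ccontr)
    assume "\<not> im"
    then obtain w j where w: "isroot w j" "j \<in> R" "c = cor j (W (rev w) z)" "0 < c" "x = z - c *\<^sub>R W w (alpha j)"
      using c unfolding cstep_def rr_iff by auto
    have sw: "set w \<subseteq> R" "set (rev w) \<subseteq> I" using w(1) R_subI by (auto simp: isroot_def)
    have "W (rev w) x = W (rev w) z - c *\<^sub>R alpha j" unfolding w(5) using W_lin[OF sw(2)] W_rev[OF sw(1)] by simp
    hence "cor j (W (rev w) x) = - c" using w(2,3) RI cor_aa by simp
    moreover have "cor j (W (rev w) x) >= 0" using coroot_nonneg[OF w(2) sw(1)] w(1,2) assms(2) by (auto simp: isroot_def)
    ultimately show False using w by simp
  qed
  thus ?thesis using c by auto
qed

lemma GLS_dominant_real: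
  assumes "I = R" "p \<in> Bp lam" "!!i t. i \<in> R ==> 0 <= t ==> t <= 1 ==> cor i (p t) >= 0"
  shows "p = pi_lam lam"
proof -
  have noim: False if "cs lam x z c True" for x z c
    using that assms(1) unfolding cstep_def rr_iff isroot_def by auto
  have step: "x = y" if "ach lam a x y" "!!i. i \<in> R ==> cor i x >= 0" for a x y
    using that(1) unfolding ach_iff
  proof (cases rule: converse_rtranclpE)
    case (step z) thus ?thesis using st_dominant[OF _ that(2)] noim by blast
  qed auto
  have all: "ok lam b xs ==> (!!i. i \<in> R ==> cor i (nx lam xs) >= 0) ==>
    nx lam xs = lam & (\<forall>t. b <= t & t <= 1 --> pl b xs t = (t - b) *\<^sub>R lam)" for b xs
  proof (induction xs arbitrary: b)
    case (Cons p xs)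
    obtain x a where p: "p = (x, a)" by (cases p)
    have okr: "b < a" "ach lam a x (nx lam xs)" "ok lam a xs" using Cons.prems p by auto
    have x: "x = nx lam xs" using step[OF okr(2)] Cons.prems(2) p by auto
    hence IH: "nx lam xs = lam" "!!t. a <= t ==> t <= 1 ==> pl a xs t = (t - a) *\<^sub>R lam"
      using Cons.IH[OF okr(3)] Cons.prems(2) p by auto
    have "pl b (p # xs) t = (t - b) *\<^sub>R lam" if "b <= t" "t <= 1" for t
    proof (cases "t <= a")
      case True thus ?thesis using pl_before[OF okr(3), of t] p x IH(1) that by simp
    next
      case False thus ?thesis using IH(2)[of t] p x IH(1) that okr(1) by (simp flip: scaleR_add_left)
    qed
    thus ?case using p x IH by simp
  qed auto
  obtain xs where xs: "p = path xs" "ok lam 0 xs" using assms(2) unfolding GLS_path by auto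
  then obtain x a r where xr: "xs = (x, a) # r" by (cases xs) auto
  have a: "0 < a" "a <= 1" "ok lam a r" using xs(2) xr ok_le by auto
  have "p a = a *\<^sub>R x" using xs(1) xr a pl_before[OF a(3), of a] by (simp add: path_def)
  hence "cor i x >= 0" if "i \<in> R" for i using assms(3)[OF that, of a] a RI[OF that] by (simp add: zero_le_mult_iff)
  hence "\<forall>t. 0 <= t & t <= 1 --> pl 0 xs t = (t - 0) *\<^sub>R lam" using all[OF xs(2)] unfolding xr nx.simps by blast
  thus ?thesis unfolding xs(1) path_def pi_lam_def by auto
qed

text \<open>After undoing w, each direction x gives an element lam - x of the cone. If the endpoint
  is w lam, the sum of these elements weighted by time is zero, and an element of the cone with
  height 0 vanishes.\<close>

lemma GLS_extremal:
  assumes "I = R" "!!i. i \<in> R ==> cor i lam >= 0" "p \<in> Bp lam" "set w \<subseteq> R" "p 1 = W w lam"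
  shows "p = pi_lam (W w lam)"
proof -
  have w: "set w \<subseteq> I" "set (rev w) \<subseteq> I" "set (rev w) \<subseteq> R" using assms(4) R_subI by auto
  have cn: "lam - W (rev w) x \<in> cone" if "x \<in> orb lam" for x
    using orb_ge[of lam "W (rev w) x"] assms Worbit_wact[OF w(2) that] ge_cone by auto
  have ind: "ok lam b xs ==> (1 - b) *\<^sub>R lam - W (rev w) (pl b xs 1) \<in> cone &
    (ht ((1 - b) *\<^sub>R lam - W (rev w) (pl b xs 1)) = 0 --> (\<forall>t. b <= t & t <= 1 --> pl b xs t = (t - b) *\<^sub>R W w lam))" for b xs
  proof (induction xs arbitrary: b)
    case Nil
    have "W (rev w) 0 = 0" using W_lin(2)[OF w(2), of 0 0] by simp
    thus ?case using Nil cone_zero by simp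
  next
    case (Cons p xs)
    obtain x a where p: "p = (x, a)" by (cases p)
    have okr: "b < a" "x \<in> orb lam" "ok lam a xs" using Cons.prems p by auto
    have a1: "a <= 1" using ok_le okr by blast
    note IH = Cons.IH[OF okr(3)]
    let ?A = "lam - W (rev w) x" and ?B = "(1 - a) *\<^sub>R lam - W (rev w) (pl a xs 1)"
    have e: "(1 - b) *\<^sub>R lam - W (rev w) (pl b (p # xs) 1) = (a - b) *\<^sub>R ?A + ?B"
      using p okr a1 by (simp add: W_lin[OF w(2)]) (simp add: algebra_simps)
    have c1: "(a - b) *\<^sub>R ?A \<in> cone" using cn okr cone_scale by simp
    have "pl b (p # xs) t = (t - b) *\<^sub>R W w lam" if z: "ht ((1 - b) *\<^sub>R lam - W (rev w) (pl b (p # xs) 1)) = 0" and t: "b <= t" "t <= 1" for t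
    proof -
      have "ht ((a - b) *\<^sub>R ?A) + ht ?B = 0" using z unfolding e by simp
      hence "ht ((a - b) *\<^sub>R ?A) = 0" "ht ?B = 0" using cone_ht[OF c1] cone_ht IH by (metis add_nonneg_eq_0_iff)+
      hence "(a - b) *\<^sub>R ?A = 0" using cone_ht_0[OF c1] by blast
      hence "W (rev w) x = lam" using okr by auto
      hence x: "x = W w lam" using W_rev'[OF assms(4), of x] by simp
      show ?thesis
      proof (cases "t <= a")
        case True thus ?thesis using pl_before[OF okr(3), of t] p x t by simp
      next
        case False thus ?thesis using IH \<open>ht ?B = 0\<close> p x t okr(1) by (simp flip: scaleR_add_left)
      qed
    qed
    thus ?case using cone_add[OF c1] IH e by auto
  qed
  obtain xs where xs: "p = path xs" "ok lam 0 xs" using assms(3) unfolding GLS_path by auto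
  have "pl 0 xs 1 = W w lam" using assms(5) xs by (simp add: path_def)
  hence "W (rev w) (pl 0 xs 1) = lam" using W_rev[OF assms(4)] by simp
  hence "\<forall>t. 0 <= t & t <= 1 --> pl 0 xs t = (t - 0) *\<^sub>R W w lam" using ind[OF xs(2)] by simp
  thus ?thesis unfolding xs(1) path_def pi_lam_def by auto
qed

end

section \<open>Imaginary simple roots\<close>

context rdat
begin

lemma rr_im_simple:
  assumes "i \<in> I" "i \<notin> R" "0 < cor i x"
  shows "rr (s i x) x (cor i x) True"
  unfolding rr_iff using assms by (intro exI[of _ "[]"] exI[of _ i]) (auto simp: isroot_def refl_def)

lemma isroot_I: "isroot w j ==> set w \<subseteq> R & set w \<subseteq> I & set (rev w) \<subseteq> I & j \<in> I"
  using R_subI by (auto simp: isroot_def)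

lemma rr_orb: "rr x' x c im ==> x \<in> orb lam ==> x' \<in> orb lam"
proof -
  assume "rr x' x c im" and x: "x \<in> orb lam"
  then obtain w i where w: "set w \<subseteq> I" "i \<in> I" "x' = W w (s i (W (rev w) x))" unfolding rrel_def by auto
  have "W (rev w) x \<in> orb lam" using Worbit_wact[OF _ x] w(1) by simp
  from Worbit.step[OF this w(2)] show ?thesis unfolding w(3) by (rule Worbit_wact[OF w(1)])
qed

lemma nx_orb: "ok lam b xs ==> nx lam xs \<in> orb lam"
  by (cases "(lam, b, xs)" rule: ok.cases) (auto intro: Worbit.base)

text \<open>A simple root spans an extreme ray of the cone.\<close>

lemma cone_line:
  assumes "x \<in> cone" "k *\<^sub>R alpha i - x \<in> cone" "i \<in> I"
  shows "x = co i x *\<^sub>R alpha i"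
proof -
  obtain F where F: "finite F" "F \<subseteq> I" "x = (\<Sum>j\<in>F. co j x *\<^sub>R alpha j)" "!!j. j \<in> I ==> 0 <= co j x"
    using assms(1) by (elim cone_coords) auto
  have "0 <= co j (k *\<^sub>R alpha i - x)" if "j \<in> I" for j using assms(2) that by (elim cone_coords) auto
  hence z: "co j x = 0" if "j \<in> I" "j \<noteq> i" for j using that F(4)[of j] assms(3) by (fastforce simp: co_alpha)
  have "(\<Sum>j\<in>F. co j x *\<^sub>R alpha j) = (\<Sum>j\<in>F. if j = i then co i x *\<^sub>R alpha i else 0)"
    by (rule sum.cong) (use z F(2) in auto)
  also have "... = co i x *\<^sub>R alpha i"
  proof (cases "i \<in> F")
    case False
    hence "(\<Sum>j\<in>F. co j x *\<^sub>R alpha j) = 0" by (intro sum.neutral) (use z F(2) in auto)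
    hence "x = 0" using F(3) by simp
    thus ?thesis using assms(3) False F(1) by simp
  qed (use F in simp)
  finally show ?thesis using F(3) by simp
qed

text \<open>Real roots have coefficient 0 at an imaginary index, and roots in the orbit of an
  imaginary alpha_j have coefficient 1 at j.\<close>

lemma root_line:
  assumes "isroot w j" "W w (alpha j) = k *\<^sub>R alpha i" "i \<in> I" "i \<notin> R"
  shows "j = i & k = 1"
proof -
  note wI = isroot_I[OF assms(1)]
  have k: "co i (W w (alpha j)) = k" using assms by (simp add: co_alpha)
  show ?thesis
  proof (cases "j \<in> R")
    case True
    have "co i (W v (alpha j)) = 0" if "set v \<subseteq> R" for v
      using that by (induction v) (use True assms RI in \<open>auto simp: co_alpha refl_def\<close>)
    hence "k = 0" using k wI by auto
    thus ?thesis using isroot_int(2)[OF assms(1)] assms(2) by simp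
  next
    case False
    hence "co j (W w (alpha j)) = 1" using Phi_im_co isroot_Phi[OF assms(1)] wI by auto
    hence "k * co j (alpha i) = 1" using assms wI by simp
    thus ?thesis using assms wI by (auto simp: co_alpha split: if_splits)
  qed
qed

text \<open>Anything between s_i x and x would be reached by first subtracting from x a multiple of
  a root on the ray of alpha_i. That root is alpha_i by \<open>root_line\<close>, so this step
  already leads to s_i x. It may be presented by a nontrivial word fixing alpha_i;
  \<open>inv\<close> says that the coefficient is the same for all presentations.\<close>

lemma cs_im_gen:
  assumes x: "x \<in> orb lam" and i: "i \<in> I" "i \<notin> R" and n: "0 < cor i x"
    and inv: "!!w. set w \<subseteq> R ==> W w (alpha i) = alpha i ==> cor i (W (rev w) x) = cor i x"
  shows "cs lam (s i x) x (cor i x) True"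
proof -
  have r: "rr (s i x) x (cor i x) True" using rr_im_simple i n by blast
  have o: "s i x \<in> orb lam" using Worbit.step[OF x i(1)] .
  have g: "gt lam (s i x) x" using r o x by (intro g1_gt) (auto simp: g1_def)
  have "False" if z: "gt lam (s i x) z" "gt lam z x" for z
  proof -
    obtain y where y: "ge lam z y" "g1 lam y x"
      using z(2) unfolding gt_g1 ge_def by (cases rule: tranclp.cases) auto
    then obtain w j c im where w: "isroot w j" "c = cor j (W (rev w) x)" "0 < c" "y = x - c *\<^sub>R W w (alpha j)"
      unfolding g1_def rr_iff by blast
    have "gt lam (s i x) y" using z y ge_gt by blast
    hence "y - s i x \<in> cone" using gt_cone by blast
    moreover have "y - s i x = cor i x *\<^sub>R alpha i - c *\<^sub>R W w (alpha j)" using w by (simp add: refl_def)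
    moreover have "c *\<^sub>R W w (alpha j) \<in> cone" using isroot_int(1)[OF w(1)] posQ_cone cone_scale w(3) by simp
    ultimately have "c *\<^sub>R W w (alpha j) = co i (c *\<^sub>R W w (alpha j)) *\<^sub>R alpha i" using cone_line i by metis
    hence "c *\<^sub>R W w (alpha j) = (c * co i (W w (alpha j))) *\<^sub>R alpha i" using i by simp
    hence "W w (alpha j) = co i (W w (alpha j)) *\<^sub>R alpha i" using w(3) by (metis (no_types) less_irrefl scaleR_left_imp_eq scaleR_scaleR)
    hence ji: "j = i" "W w (alpha i) = alpha i" using root_line[OF w(1) _ i] by (metis scaleR_one)+
    have wR: "set w \<subseteq> R" using isroot_I[OF w(1)] by auto
    have "c = cor i x" using inv[OF wR ji(2)] w ji by simp
    hence "y = s i x" using w ji by (simp add: refl_def)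
    thus False using \<open>gt lam (s i x) y\<close> gt_irrefl by auto
  qed
  thus ?thesis unfolding cstep_def using o x r g by blast
qed

end

text \<open>Kept apart from \<open>rdat\<close> because the auxiliary datum in
  \<open>cat_straight_good\<close> has an imaginary root with positive self-pairing and in general
  no symmetrizer, so that it is an instance of \<open>rdat\<close> only.\<close>

locale idat = rdat +
  assumes corZ_all: "i \<in> I ==> j \<in> I ==> cor i (alpha j) \<in> \<int>"
    and im_neg: "i \<in> I ==> A i i \<noteq> 2 ==> j \<in> I ==> cor i (alpha j) <= 0"
    and d_pos_all: "i \<in> I ==> d i > 0"
    and d_sym_all: "i \<in> I ==> j \<in> I ==> d i * cor i (alpha j) = d j * cor j (alpha i)"
    and cor_A: "i \<in> I ==> cor i (alpha i) = of_int (A i i)"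
begin

definition dom :: "'b => bool" where
  "dom lam \<longleftrightarrow> (\<forall>i\<in>I. cor i lam >= 0 & cor i lam \<in> \<int>)"

lemma dom_R: "dom lam ==> i \<in> R ==> cor i lam >= 0 & cor i lam \<in> \<int>"
  using RI by (auto simp: dom_def)

lemma im_cone: "i \<in> I ==> i \<notin> R ==> y \<in> cone ==> cor i y <= 0"
proof -
  assume i: "i \<in> I" "i \<notin> R" and "y \<in> cone"
  then obtain F where F: "finite F" "F \<subseteq> I" "y = (\<Sum>j\<in>F. co j y *\<^sub>R alpha j)" "!!j. j \<in> I ==> 0 <= co j y"
    by (elim cone_coords) auto
  have "cor i y = (\<Sum>j\<in>F. co j y * cor i (alpha j))"
    using i by (subst F(3)) (simp add: linear_sum[OF lin_cor])
  also have "... <= 0" using F i im_neg[of i] by (intro sum_nonpos) (auto simp: R_def mult_nonneg_nonpos subset_eq)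
  finally show ?thesis .
qed

lemma orb_ge_lam:
  assumes "dom lam" "x \<in> orb lam"
  shows "ge lam x lam"
proof (rule orb_ge)
  fix i x assume i: "i \<in> I" "i \<notin> R" "x \<in> orb lam" "ge lam x lam"
  have "cor i (lam - x) <= 0" using im_cone[OF i(1,2) ge_cone[OF i(4)]] .
  hence "cor i x >= 0" using assms(1) i by (fastforce simp: dom_def)
  thus "ge lam (s i x) x"
  proof (cases "cor i x = 0")
    case True thus ?thesis by (simp add: refl_def ge_refl)
  next
    case False
    hence "g1 lam (s i x) x" using rr_im_simple[of i x] i \<open>cor i x >= 0\<close> by (auto simp: g1_def intro: Worbit.step)
    thus ?thesis using g1_gt gt_ge by blast
  qed
qed (use assms dom_R in auto)

lemma orb_im:
  assumes "dom lam" "x \<in> orb lam" "i \<in> I" "i \<notin> R"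
  shows "cor i x >= 0"
  using im_cone[OF assms(3,4) ge_cone[OF orb_ge_lam[OF assms(1,2)]]] assms by (fastforce simp: dom_def)

lemma orb_int:
  assumes "dom lam" "x \<in> orb lam" "i \<in> I"
  shows "cor i x \<in> \<int>"
  using assms(2,3)
proof (induction arbitrary: i rule: Worbit.induct)
  case base thus ?case using assms by (auto simp: dom_def)
next
  case (step x j)
  have "cor i (s j x) = cor i x - cor j x * cor i (alpha j)" using step by (simp add: refl_def)
  thus ?case using step corZ_all by auto
qed

lemma W_int: "set w \<subseteq> I ==> j \<in> I ==> i \<in> I ==> cor i (W w (alpha j)) \<in> \<int>"
proof (induction w arbitrary: i)
  case (Cons k w)
  have "cor i (W (k # w) (alpha j)) = cor i (W w (alpha j)) - cor k (W w (alpha j)) * cor i (alpha k)"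
    using Cons by (simp add: refl_def)
  thus ?case using Cons corZ_all by auto
qed (auto simp: corZ_all)

lemma coroot_sym:
  assumes "isroot w j" "i \<in> I"
  shows "d j * cor j (W (rev w) (alpha i)) = d i * cor i (W w (alpha j))"
proof -
  note w = isroot_I[OF assms(1)]
  have j: "j \<in> I" and wR: "set w \<subseteq> R" using w by auto
  obtain F where F: "finite F" "F \<subseteq> insert j R" "W w (alpha j) = (\<Sum>l\<in>F. co l (W w (alpha j)) *\<^sub>R alpha l)"
    "!!x. d j * cor j (W (rev w) x) = (\<Sum>l\<in>F. co l (W w (alpha j)) * (d l * cor l x))"
    using coroot_expand_co[OF j _ wR] d_sym_all[OF j] RI by blast
  have "d i * cor i (W w (alpha j)) = (\<Sum>l\<in>F. d i * (co l (W w (alpha j)) * cor i (alpha l)))"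
    using assms(2) by (subst F(3)) (simp add: linear_sum[OF lin_cor] sum_distrib_left)
  also have "... = (\<Sum>l\<in>F. co l (W w (alpha j)) * (d l * cor l (alpha i)))"
  proof (rule sum.cong[OF refl])
    fix l assume "l \<in> F"
    hence "l \<in> I" using F(2) j RI by auto
    hence "d i * cor i (alpha l) = d l * cor l (alpha i)" using d_sym_all assms(2) by blast
    thus "d i * (co l (W w (alpha j)) * cor i (alpha l)) = co l (W w (alpha j)) * (d l * cor l (alpha i))"
      by (simp add: mult.left_commute)
  qed
  finally show ?thesis using F(4) by simp
qed

lemma ge_im_mono: "ge lam x y ==> i \<in> I ==> i \<notin> R ==> cor i y <= cor i x"
  using im_cone[of i "y - x"] ge_cone by fastforce

text \<open>Equal pairings with i mean that beta pairs to 0 with alpha_i^vee. By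
  \<open>coroot_sym\<close> alpha_i then pairs to 0 with beta^vee, so a translation along alpha_i
  leaves the coefficient c unchanged.\<close>

lemma rr_shift:
  assumes r: "rr x' x c im" and i: "i \<in> I" and e: "cor i x' = cor i x"
  shows "rr (x' + k *\<^sub>R alpha i) (x + k *\<^sub>R alpha i) c im"
proof -
  obtain w j where w: "isroot w j" "im \<longleftrightarrow> j \<notin> R" "c = cor j (W (rev w) x)" "0 < c" "x' = x - c *\<^sub>R W w (alpha j)"
    using r unfolding rr_iff by auto
  note wI = isroot_I[OF w(1)]
  have "cor i (W w (alpha j)) = 0" using e w i by simp
  hence "cor j (W (rev w) (alpha i)) = 0" using coroot_sym[OF w(1) i] d_pos_all[of j] wI by auto
  hence "cor j (W (rev w) (x + k *\<^sub>R alpha i)) = c" using W_lin wI w(3) by simp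
  thus ?thesis unfolding rr_iff using w by (intro exI[of _ w] exI[of _ j]) auto
qed

lemma gt_shift:
  assumes "gt lam x y" "i \<in> I" "i \<notin> R" "cor i x = cor i y" "y + k *\<^sub>R alpha i \<in> orb lam"
  shows "gt lam (x + k *\<^sub>R alpha i) (y + k *\<^sub>R alpha i)"
  using assms(1,4) unfolding gt_g1
proof (induction rule: converse_tranclp_induct)
  case (base x)
  then obtain c im where "rr x y c im" by (auto simp: g1_def)
  hence "rr (x + k *\<^sub>R alpha i) (y + k *\<^sub>R alpha i) c im" using rr_shift base assms(2) by blast
  hence "g1 lam (x + k *\<^sub>R alpha i) (y + k *\<^sub>R alpha i)" using rr_orb assms(5) by (auto simp: g1_def)
  thus ?case by blast
next
  case (step x b)
  have "cor i y <= cor i b" "cor i b <= cor i x" using ge_im_mono[OF gt_ge] assms step(1,2) g1_gt unfolding gt_g1[symmetric] by blast+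
  hence eq: "cor i b = cor i y" "cor i x = cor i b" using step by auto
  note IH = step(3)[OF eq(1)]
  have bo: "b + k *\<^sub>R alpha i \<in> orb lam" using gt_orb[of lam "b + k *\<^sub>R alpha i"] IH unfolding gt_g1 by blast
  obtain c im where "rr x b c im" using step by (auto simp: g1_def)
  hence "rr (x + k *\<^sub>R alpha i) (b + k *\<^sub>R alpha i) c im" using rr_shift eq assms(2) by blast
  hence "g1 lam (x + k *\<^sub>R alpha i) (b + k *\<^sub>R alpha i)" using rr_orb bo by (auto simp: g1_def)
  thus ?case using IH by (rule tranclp_into_tranclp2)
qed

text \<open>On a level set of \<open>cor i\<close> the imaginary reflection is a translation along
  alpha_i, and by \<open>ge_im_mono\<close> everything between two elements of a level set lies on
  it.\<close>

lemma cs_im_flip: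
  assumes c: "cs lam z' z c im" and i: "i \<in> I" "i \<notin> R" and e: "cor i z' = cor i z"
  shows "cs lam (s i z') (s i z) c im"
proof -
  have o: "z' \<in> orb lam" "z \<in> orb lam" and r: "rr z' z c im" and g: "gt lam z' z"
    and cov: "!!y. gt lam z' y ==> gt lam y z ==> False" using c by (auto simp: cstep_def)
  define n where "n = cor i z"
  have s: "s i z' = z' + (- n) *\<^sub>R alpha i" "s i z = z + (- n) *\<^sub>R alpha i" using e by (auto simp: refl_def n_def)
  have r': "rr (s i z') (s i z) c im" unfolding s using rr_shift[OF r i(1) e] by blast
  have o': "s i z' \<in> orb lam" "s i z \<in> orb lam" using Worbit.step[OF o(1) i(1)] Worbit.step[OF o(2) i(1)] .
  have g': "gt lam (s i z') (s i z)" using r' o' by (intro g1_gt) (auto simp: g1_def)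
  have "False" if y: "gt lam (s i z') y" "gt lam y (s i z)" for y
  proof -
    have c1: "cor i (s i z) <= cor i y" "cor i y <= cor i (s i z')" using ge_im_mono[OF gt_ge] y i by blast+
    have "cor i (s i z') = cor i (s i z)" using e i by (simp add: refl_def)
    hence c2: "cor i y = cor i (s i z)" "cor i (s i z') = cor i y" using c1 by auto
    have z2: "s i z + n *\<^sub>R alpha i = z" "s i z' + n *\<^sub>R alpha i = z'" unfolding s by simp_all
    have 1: "gt lam (y + n *\<^sub>R alpha i) z" using gt_shift[OF y(2) i c2(1), of n] z2 o by simp
    hence "y + n *\<^sub>R alpha i \<in> orb lam" using gt_orb by blast
    hence "gt lam z' (y + n *\<^sub>R alpha i)" using gt_shift[OF y(1) i c2(2), of n] z2 by simp
    thus False using cov 1 by blast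
  qed
  thus ?thesis unfolding cstep_def using o' r' g' by blast
qed

lemma cs_im:
  assumes "x \<in> orb lam" and i: "i \<in> I" "i \<notin> R" and "0 < cor i x"
  shows "cs lam (s i x) x (cor i x) True"
proof (rule cs_im_gen[OF assms])
  fix w assume w: "set w \<subseteq> R" "W w (alpha i) = alpha i"
  have "d i * cor i (W (rev w) x) = d i * cor i x"
    by (rule coroot_simple[OF i(1) _ w(1) i(1) w(2)]) (use d_sym_all i RI in auto)
  thus "cor i (W (rev w) x) = cor i x" using d_pos_all[OF i(1)] by auto
qed

lemma ach_im_int:
  assumes "ach lam a x y" "i \<in> I"
  shows "a * cor i x - a * cor i y \<in> \<int>"
  using assms(1) unfolding ach_iff
proof (induction rule: rtranclp_induct)
  case (step y z)
  obtain c im where c: "cs lam y z c im" "if im then a * c = 1 else a * c \<in> \<int> & a * c > 0" using step by (auto simp: st_def)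
  then obtain w j where w: "isroot w j" "y = z - c *\<^sub>R W w (alpha j)" unfolding cstep_def rr_iff by auto
  have "a * cor i y - a * cor i z = - (a * c) * cor i (W w (alpha j))" unfolding w(2) using assms(2) by (simp add: algebra_simps)
  moreover have "a * c \<in> \<int>" using c(2) by (auto split: if_splits)
  moreover have "cor i (W w (alpha j)) \<in> \<int>" using W_int isroot_I[OF w(1)] assms(2) by blast
  ultimately have "a * cor i y - a * cor i z \<in> \<int>" by simp
  hence "(a * cor i x - a * cor i y) + (a * cor i y - a * cor i z) \<in> \<int>" using step Ints_add by blast
  thus ?case by simp
qed auto

lemma ach_im_flip:
  assumes "ach lam a x y" "i \<in> I" "i \<notin> R" "cor i x = cor i y"
  shows "ach lam a (s i x) (s i y)"
  using assms(1,4) unfolding ach_iff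
proof (induction rule: rtranclp_induct)
  case (step y z)
  have "cor i y <= cor i x" "cor i z <= cor i y"
    using ge_im_mono[OF ach_ge] step(1) ge_im_mono[OF gt_ge[OF st_gt[OF step(2)]]] assms unfolding ach_iff by blast+
  hence e: "cor i x = cor i y" "cor i y = cor i z" using step by auto
  have "st lam a (s i y) (s i z)" using step(2) cs_im_flip[OF _ assms(2,3) e(2)] unfolding st_def by blast
  thus ?case using step(3)[OF e(1)] by auto
qed auto

text \<open>Along an a-chain the pairings with i weakly decrease, stay nonnegative and differ by
  multiples of 1/a. Starting below 1/a there is no room for a change.\<close>

lemma ach_im_same:
  assumes lam: "dom lam" and a: "ach lam a x y" and i: "i \<in> I" "i \<notin> R" and o: "x \<in> orb lam" "y \<in> orb lam"
    and lt: "0 <= a" "a * cor i x < 1" "0 < a"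
  shows "cor i y = cor i x"
proof (rule ccontr)
  assume ne: "cor i y \<noteq> cor i x"
  have "cor i y <= cor i x" using ge_im_mono[OF ach_ge[OF a] i] .
  hence 1: "0 < a * cor i x - a * cor i y" using ne lt by simp
  have "0 <= a * cor i y" using orb_im[OF lam o(2) i] lt by simp
  hence 2: "a * cor i x - a * cor i y < 1" using lt by simp
  have "a * cor i x - a * cor i y \<in> \<int>" using ach_im_int[OF a i(1)] .
  thus False using 1 2 by (auto elim!: Ints_cases)
qed

text \<open>At the breakpoint 1/n the reflected direction is followed by a covering with c = n, and
  (1/n) n = 1 is the chain condition for imaginary roots. At earlier breakpoints both directions
  pair to n by \<open>ach_im_same\<close>, and the chain is carried along by
  \<open>ach_im_flip\<close>.\<close>

lemma ok_flp_im:
  assumes lam: "dom lam" and i: "i \<in> I" "i \<notin> R" and n: "1 <= n"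
    and "ok lam b xs" "nin (1/n) b xs" "0 <= b" "cor i (nx lam xs) = n \<or> 1/n <= b"
  shows "ok lam b (flp i 0 (1/n) xs)"
  using assms(5-)
proof (induction xs arbitrary: b)
  case (Cons p r)
  obtain x a where p: "p = (x, a)" by (cases p)
  have okr: "b < a" "x \<in> orb lam" "ach lam a x (nx lam r)" "ok lam a r" "nin (1/n) a r" "1/n <= b \<or> a <= 1/n"
    and xn: "cor i x = n \<or> 1/n <= b" using Cons.prems p by auto
  have a0: "0 < a" "0 <= a" "nin 0 a r" using okr Cons.prems(3)
  proof -
    show "0 < a" "0 <= a" using okr Cons.prems(3) by auto
    have "ok lam c r' ==> 0 <= c ==> nin 0 c r'" for c r'
    proof (induction r' arbitrary: c)
      case (Cons q r') thus ?case by (cases q) auto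
    qed auto
    thus "nin 0 a r" using okr \<open>0 <= a\<close> by blast
  qed
  have n1: "1 / n <= 1" using n by simp
  note nxf = nx_flp[OF okr(4) a0(3) okr(5) n1, of i]
  consider "1/n < a" | "a = 1/n" | "a < 1/n" by linarith
  thus ?case
  proof cases
    case 1
    hence "ok lam a (flp i 0 (1/n) r)" using Cons.IH[OF okr(4,5) a0(2)] by simp
    thus ?thesis using 1 p okr nxf by auto
  next
    case 2
    have IH: "ok lam a (flp i 0 (1/n) r)" using Cons.IH[OF okr(4,5) a0(2)] 2 by simp
    have xn': "cor i x = n" using xn 2 okr by auto
    have "st lam a (s i x) x" unfolding st_def using cs_im[OF okr(2) i] xn' n 2 by (intro exI[of _ n] exI[of _ True]) auto
    hence "ach lam a (s i x) (nx lam r)" using st_ach ach_trans okr(3) by blast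
    thus ?thesis using 2 p okr IH nxf a0 Worbit.step[OF okr(2) i(1)] by auto
  next
    case 3
    hence xn': "cor i x = n" using xn okr by auto
    have "a * n < 1" using 3 n by (simp add: field_simps)
    hence e: "cor i (nx lam r) = n" using ach_im_same[OF lam okr(3) i okr(2) nx_orb[OF okr(4)] a0(2)] xn' a0 by simp
    have IH: "ok lam a (flp i 0 (1/n) r)" using Cons.IH[OF okr(4,5) a0(2)] e by simp
    have "ach lam a (s i x) (s i (nx lam r))" using ach_im_flip[OF okr(3) i] xn' e by simp
    thus ?thesis using 3 p okr IH nxf a0 Worbit.step[OF okr(2) i(1)] by auto
  qed
qed auto

text \<open>The directions have nonnegative pairings with an imaginary i, and these decrease along
  the path. The first one, multiplied by t, has to reach 1 before a change is possible, by
  \<open>ach_im_same\<close>.\<close>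

lemma ok_im_H:
  assumes lam: "dom lam" and i: "i \<in> I" "i \<notin> R"
    and "ok lam b xs"
  shows "(\<forall>t t'. b <= t & t <= t' & t' <= 1 --> cor i (pl b xs t) <= cor i (pl b xs t')) &
     (\<forall>t. b <= t & t <= 1 --> cor i (pl b xs t) <= (t - b) * cor i (nx lam xs)) &
     (\<forall>t. 0 <= b & b <= t & t <= 1 & t * cor i (nx lam xs) <= 1 --> cor i (pl b xs t) = (t - b) * cor i (nx lam xs))"
  using assms(4)
proof (induction xs arbitrary: b)
  case Nil
  have "cor i lam >= 0" using lam i by (auto simp: dom_def)
  thus ?case using Nil i by auto
next
  case (Cons p r)
  obtain x a where p: "p = (x, a)" by (cases p)
  have okr: "b < a" "x \<in> orb lam" "ach lam a x (nx lam r)" "ok lam a r" using Cons.prems p by auto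
  have a1: "a <= 1" using ok_le okr by blast
  have IH: "!!t t'. a <= t ==> t <= t' ==> t' <= 1 ==> cor i (pl a r t) <= cor i (pl a r t')"
     "!!t. a <= t ==> t <= 1 ==> cor i (pl a r t) <= (t - a) * cor i (nx lam r)"
     "!!t. 0 <= a ==> a <= t ==> t <= 1 ==> t * cor i (nx lam r) <= 1 ==> cor i (pl a r t) = (t - a) * cor i (nx lam r)"
    using Cons.IH[OF okr(4)] by auto
  have seg: "cor i (pl b (p # r) t) = (t - b) * cor i x" if "b <= t" "t <= a" for t
    using that pl_before[OF okr(4), of t] p i by simp
  have aft: "cor i (pl b (p # r) t) = (a - b) * cor i x + cor i (pl a r t)" if "a <= t" for t
    using that p i okr by simp
  have x0: "cor i x >= 0" using orb_im[OF lam okr(2) i] .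
  have xy: "cor i (nx lam r) <= cor i x" using ge_im_mono[OF ach_ge[OF okr(3)] i] .
  have mono: "cor i (pl b (p # r) t) <= cor i (pl b (p # r) t')" if t: "b <= t" "t <= t'" "t' <= 1" for t t'
  proof -
    consider "t' <= a" | "t <= a" "a <= t'" | "a <= t" by linarith
    thus ?thesis
    proof cases
      case 1 thus ?thesis using seg[of t] seg[of t'] t x0 by (simp add: mult_right_mono del: pl.simps)
    next
      case 2
      have "cor i (pl a r a) <= cor i (pl a r t')" using IH(1)[of a t'] 2 t by simp
      hence "0 <= cor i (pl a r t')" using pl_before[OF okr(4), of a] i by simp
      moreover have "(t - b) * cor i x <= (a - b) * cor i x" using 2 x0 by (intro mult_right_mono) auto
      ultimately show ?thesis using seg[of t] aft[of t'] 2 t by (simp del: pl.simps)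
    next
      case 3 thus ?thesis using aft[of t] aft[of t'] IH(1)[of t t'] t by (simp del: pl.simps)
    qed
  qed
  have ub: "cor i (pl b (p # r) t) <= (t - b) * cor i x" if t: "b <= t" "t <= 1" for t
  proof (cases "t <= a")
    case False
    have "cor i (pl a r t) <= (t - a) * cor i (nx lam r)" using IH(2) False t by simp
    also have "... <= (t - a) * cor i x" using xy False by (intro mult_left_mono) auto
    finally show ?thesis using aft[of t] False by (simp add: algebra_simps del: pl.simps)
  qed (use seg[of t] t in \<open>simp del: pl.simps\<close>)
  have eq: "cor i (pl b (p # r) t) = (t - b) * cor i x" if t: "0 <= b" "b <= t" "t <= 1" "t * cor i x <= 1" for t
  proof (cases "t <= a")
    case False
    have "cor i (nx lam r) = cor i x"
    proof (cases "cor i x = 0")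
      case True thus ?thesis using xy orb_im[OF lam nx_orb[OF okr(4)] i] by simp
    next
      case F2: False
      hence "a * cor i x < t * cor i x" using False x0 by simp
      thus ?thesis using ach_im_same[OF lam okr(3) i okr(2) nx_orb[OF okr(4)]] t okr(1) by simp
    qed
    thus ?thesis using IH(3)[of t] aft[of t] False t okr(1) by (simp add: algebra_simps del: pl.simps)
  qed (use seg[of t] t in \<open>simp del: pl.simps\<close>)
  show ?case using mono ub eq unfolding p nx.simps by blast
qed

text \<open>If the first direction pairs to n > 0, the height function starts with slope n, equals 1
  at time 1/n and never returns below 1, so f_i turns exactly on [0, 1/n]. If n = 0, the height
  function vanishes.\<close>

lemma im_f:
  assumes lam: "dom lam" and i: "i \<in> I" "i \<notin> R" and p: "p \<in> Bp lam"
  shows "(f_root alpha cor i p = None & (\<forall>t. 0 <= t & t <= 1 --> cor i (p t) = 0)) \<or>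
    (\<exists>n. n \<in> \<int> & 1 <= n & FS (%t. cor i (p t)) 0 0 (1/n) & (\<forall>t. 0 <= t & t <= 1/n --> cor i (p t) = n * t) & Fmod alpha cor i 0 0 (1/n) p \<in> Bp lam)"
proof -
  obtain xs0 where xs0: "p = path xs0" "ok lam 0 xs0" using p unfolding GLS_path by auto
  define n where "n = cor i (nx lam xs0)"
  have nZ: "n \<in> \<int>" "0 <= n" using orb_int[OF lam nx_orb[OF xs0(2)] i(1)] orb_im[OF lam nx_orb[OF xs0(2)] i] by (auto simp: n_def)
  have eq: "p t = pl 0 xs0 t" if "0 <= t" "t <= 1" for t using that by (simp add: xs0(1) path_def)
  note H = ok_im_H[OF lam i xs0(2), folded n_def]
  show ?thesis
  proof (cases "n = 0")
    case True
    have z: "cor i (p t) = 0" if "0 <= t" "t <= 1" for t using H True that eq[of t] by auto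
    have "f_root alpha cor i p = None" by (rule f_root_None[of 0]) (use z in auto)
    thus ?thesis using z by blast
  next
    case False
    hence n1: "1 <= n" using nZ by (auto elim!: Ints_cases)
    have Hn: "cor i (p t) = n * t" if "0 <= t" "t <= 1/n" for t
    proof -
      have "1/n <= 1" "t * n <= 1" using that n1 by (simp_all add: field_simps)
      hence "cor i (pl 0 xs0 t) = (t - 0) * n" using H that by auto
      thus ?thesis using eq[of t] that \<open>1/n <= 1\<close> by (simp add: mult.commute)
    qed
    have H1: "1 <= cor i (p t)" if "1/n <= t" "t <= 1" for t
    proof -
      have "cor i (pl 0 xs0 (1/n)) <= cor i (pl 0 xs0 t)" using H[THEN conjunct1, rule_format, of "1/n" t] that n1 by simp
      moreover have "0 < 1/n" using n1 by simp
      hence "0 <= t" using that by linarith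
      ultimately show ?thesis using Hn[of "1/n"] eq[of "1/n"] eq[of t] that n1 by auto
    qed
    have FS: "FS (%t. cor i (p t)) 0 0 (1/n)"
    proof -
      have "cor i (p t) < cor i (p t')" if "0 <= t" "t < t'" "t' <= 1/n" for t t' using Hn[of t] Hn[of t'] that n1 by simp
      moreover have "0 < 1/n" "1/n <= 1" "cor i (p 0) = 0" "cor i (p (1/n)) = 1" using n1 Hn[of 0] Hn[of "1/n"] by auto
      ultimately show ?thesis unfolding FS_def using H1 by (auto simp: order_antisym_conv)
    qed
    obtain xs where xs: "p = path xs" "ok lam 0 xs" "nin 0 0 xs" "nin (1/n) 0 xs" using GLS_split[OF p] by blast
    \<comment> \<open>The list with inserted breakpoints and the original one are compared at a time
      e at which both initial formulas hold; the summand 1 in \<open>1 / (m + 1)\<close> keeps the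
      quotient meaningful for m = 0.\<close>
    have "cor i (nx lam xs) = n"
    proof -
      define m where "m = cor i (nx lam xs)"
      have m0: "0 <= m" using orb_im[OF lam nx_orb[OF xs(2)] i] by (simp add: m_def)
      define e where "e = min (1/n) (1 / (m + 1))"
      have e: "0 < e" "e <= 1/n" "e * m <= 1" "e <= 1" using n1 m0 by (auto simp: e_def min_def field_simps)
      have "cor i (p e) = e * m" using ok_im_H[OF lam i xs(2), folded m_def] e by (simp add: xs(1) path_def)
      thus ?thesis using Hn[of e] e m_def by auto
    qed
    hence "ok lam 0 (flp i 0 (1/n) xs)" using ok_flp_im[OF lam i n1 xs(2,4)] by simp
    hence "Fmod alpha cor i 0 0 (1/n) p \<in> Bp lam" unfolding Fmod_path[OF FS i(1) xs] GLS_path by blast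
    thus ?thesis using nZ n1 FS Hn by blast
  qed
qed

lemma im_fstep_n:
  assumes lam: "dom lam" and i: "i \<in> I" "i \<notin> R" and q: "q \<in> Bp lam" and f: "fstep alpha cor i q p"
  obtains n where "n \<in> \<int>" "1 <= n" "!!t. 0 <= t ==> t <= 1/n ==> cor i (q t) = n * t"
    "!!t. 1/n <= t ==> t <= 1 ==> 1 <= cor i (q t)"
    "!!t. 0 <= t ==> t <= 1 ==> p t = q t - min (n * t) 1 *\<^sub>R alpha i" "p \<in> Bp lam"
proof -
  obtain m u v where F: "FS (%t. cor i (q t)) m u v" "p = Fmod alpha cor i m u v q" using f by (auto simp: fstep_def)
  have r: "f_root alpha cor i q = Some p" using FS_f_root[of cor i q m u v alpha] F by simp
  then obtain n where n: "n \<in> \<int>" "1 <= n" "FS (%t. cor i (q t)) 0 0 (1/n)" "\<forall>t. 0 <= t & t <= 1/n --> cor i (q t) = n * t" "Fmod alpha cor i 0 0 (1/n) q \<in> Bp lam"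
    using im_f[OF lam i q] by auto
  have pe: "p = Fmod alpha cor i 0 0 (1/n) q" using FS_f_root[of cor i q 0 0 "1/n" alpha] n r by simp
  have p: "p t = q t - min (n * t) 1 *\<^sub>R alpha i" if t: "0 <= t" "t <= 1" for t
  proof (cases "t <= 1/n")
    case True
    hence "n * t <= 1" using n(2) by (simp add: field_simps)
    thus ?thesis using n(4) True t unfolding pe by (auto simp: Fmod_def)
  next
    case False
    hence "n * t >= 1" using n(2) by (simp add: field_simps)
    moreover have "0 < 1 / n" using n(2) by simp
    hence "t > 0" using False by linarith
    ultimately show ?thesis using False t unfolding pe by (auto simp: Fmod_def)
  qed
  show ?thesis by (rule that[of n]) (use n p pe in \<open>auto simp: FS_def\<close>)
qed

subsection \<open>Generation from the straight path\<close>

text \<open>Suppose beta is not simple; then it pairs to at least 1 with some real l. Dominance of x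
  gives \<open>cor l z >= c\<close>. Conversely beta^vee is nonnegative on s_l z, because imaginary
  pairings are nonnegative on the orbit, and this gives b \<open>cor l z\<close> <= c for an integer
  b >= 1. Hence \<open>cor l x <= 0\<close> while \<open>cor l z > 0\<close>, and
  \<open>cs_turn\<close> would make the covering real.\<close>

lemma im_root_simple:
  assumes lam: "dom lam" and c: "cs lam x z c True" and dx: "!!l. l \<in> R ==> cor l x >= 0"
  shows "\<exists>i. i \<in> I & i \<notin> R & x = s i z & c = cor i z"
proof -
  have o: "x \<in> orb lam" "z \<in> orb lam" using c by (auto simp: cstep_def)
  obtain w j where w: "isroot w j" "j \<notin> R" "c = cor j (W (rev w) z)" "0 < c" "x = z - c *\<^sub>R W w (alpha j)"
    using c unfolding cstep_def rr_iff by auto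
  note wI = isroot_I[OF w(1)]
  define \<beta> where "\<beta> = W w (alpha j)"
  have "\<beta> \<in> Phi {j}" using isroot_Phi[OF w(1)] w(2) by (simp add: \<beta>_def)
  thus ?thesis
  proof (cases rule: Phi.cases)
    case (Phi_base b)
    hence e: "W w (alpha j) = alpha j" by (simp add: \<beta>_def)
    have "d j * cor j (W (rev w) z) = d j * cor j z"
      by (rule coroot_simple[OF _ _ _ _ e]) (use d_sym_all wI RI in auto)
    hence "c = cor j z" using w(3) d_pos_all[of j] wI by auto
    thus ?thesis using w e wI by (intro exI[of _ j]) (auto simp: refl_def)
  next
    case (Phi_step \<beta>' l)
    have lI: "l \<in> I" using RI Phi_step by auto
    have g: "cor l \<beta> > 0" using Phi_step cor_s by simp
    have gi: "cor l \<beta> \<in> \<int>" using isroot_int(3)[OF w(1)] Phi_step by (simp add: \<beta>_def)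
    have g1: "cor l \<beta> >= 1" using g gi by (auto elim!: Ints_cases)
    define b where "b = cor j (W (rev w) (alpha l))"
    have "d j * b = d l * cor l \<beta>" using coroot_sym[OF w(1) lI] by (simp add: b_def \<beta>_def)
    hence "b > 0" using g d_pos_all[OF lI] d_pos_all[of j] wI by (metis mult_pos_pos zero_less_mult_pos)
    moreover have "b \<in> \<int>" unfolding b_def using W_int wI lI by blast
    ultimately have b1: "b >= 1" by (auto elim!: Ints_cases)
    have "cor j (W (rev w) (s l z)) >= 0"
      using orb_im[OF lam Worbit_wact[of "rev w" I]] o wI w(2) Worbit.step[OF o(2) lI] by blast
    hence "c - cor l z * b >= 0" using W_lin wI w(3) by (simp add: refl_def b_def)
    moreover have zl: "cor l z = cor l x + c * cor l \<beta>" using w(5) lI by (simp add: \<beta>_def)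
    have "cor l x >= 0" using dx Phi_step by blast
    moreover have "c * cor l \<beta> >= c" using g1 w(4) by simp
    ultimately have z: "cor l z >= c" "cor l z * b <= c" "cor l z > 0" using zl w(4) by linarith+
    have "cor l z <= cor l z * b" using b1 z(3) by simp
    hence "cor l x <= 0" using z zl \<open>c * cor l \<beta> >= c\<close> by linarith
    thus ?thesis using cs_turn[OF c Phi_step(3) _ less_imp_le[OF z(3)]] z(3) by auto
  qed
qed

text \<open>The first direction x is real-dominant, so its chain begins with an imaginary simple
  reflection x = s_i z satisfying a c = 1. Putting z in place of x gives a path whose height
  function has initial slope c = 1/a, so f_i turns precisely its first segment.\<close>

lemma GLS_real_dominant:
  assumes lam: "dom lam" and p: "p \<in> Bp lam" "p \<noteq> pi_lam lam"
    and dp: "!!l t. l \<in> R ==> 0 <= t ==> t <= 1 ==> cor l (p t) >= 0"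
  shows "\<exists>i q. i \<in> I & i \<notin> R & q \<in> Bp lam & fstep alpha cor i q p"
proof -
  obtain ys where ys: "p = path ys" "ok lam 0 ys" using p unfolding GLS_path by auto
  then obtain xs where xs: "\<forall>t. pl 0 xs t = pl 0 ys t" "ok lam 0 xs" "adj xs" using normalise[of lam 0 ys] by blast
  hence xs: "p = path xs" "ok lam 0 xs" "adj xs" using ys(1) by (auto simp: path_def)
  then obtain x a r where xr: "xs = (x, a) # r" by (cases xs) auto
  have okr: "0 < a" "x \<in> orb lam" "ach lam a x (nx lam r)" "ok lam a r" using xs(2) xr by auto
  have a1: "a <= 1" using ok_le okr by blast
  have "p a = a *\<^sub>R x" using xs(1) xr a1 okr pl_before[OF okr(4), of a] by (simp add: path_def)
  hence dx: "cor l x >= 0" if "l \<in> R" for l using dp[OF that, of a] a1 okr RI[OF that] by (simp add: zero_le_mult_iff)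
  have ne: "x \<noteq> nx lam r"
  proof (cases r)
    case Nil
    thus ?thesis using p(2) xs(1) xr okr pi_path[of lam] by auto
  next
    case (Cons q r') thus ?thesis using xs(3) xr by (cases q) auto
  qed
  obtain z where z: "st lam a x z" "ach lam a z (nx lam r)"
    using okr(3) ne unfolding ach_iff by (auto elim: converse_rtranclpE)
  obtain c where c: "cs lam x z c True" "a * c = 1" using st_dominant[OF z(1) dx] by auto
  obtain i where i: "i \<in> I" "i \<notin> R" "x = s i z" "c = cor i z" using im_root_simple[OF lam c(1) dx] by auto
  have zo: "z \<in> orb lam" using c by (auto simp: cstep_def)
  define q where "q = path ((z, a) # r)"
  have okq: "ok lam 0 ((z, a) # r)" using okr zo z by simp
  hence q: "q \<in> Bp lam" unfolding q_def GLS_path by blast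
  have c0: "c > 0" using c(2) okr(1) by (metis zero_less_mult_pos zero_less_one)
  hence c1: "a = 1/c" using c(2) by (simp add: field_simps)
  have qa: "cor i (q a) = 1" using c(2) a1 okr i pl_before[OF okr(4), of a] by (simp add: q_def path_def)
  then obtain n where n: "n \<in> \<int>" "1 <= n" "FS (%t. cor i (q t)) 0 0 (1/n)" "!!t. 0 <= t ==> t <= 1/n ==> cor i (q t) = n * t"
    using im_f[OF lam i(1,2) q] okr a1 by force
  have nc: "n = c"
  proof -
    define e where "e = min a (1/n)"
    have e: "0 < e" "e <= 1/n" "e <= a" using okr n by (auto simp: e_def)
    have "cor i (q e) = e * c" using e a1 i pl_before[OF okr(4), of e] by (simp add: q_def path_def)
    thus ?thesis using n(4)[of e] e by auto
  qed
  have ni: "nin 0 0 ((z, a) # r)" "nin a 0 ((z, a) # r)"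
  proof -
    have "ok lam b r' ==> c <= b ==> nin c b r'" for b c r'
    proof (induction r' arbitrary: b)
      case (Cons q r') thus ?case by (cases q) auto
    qed auto
    thus "nin 0 0 ((z, a) # r)" "nin a 0 ((z, a) # r)" using okr by auto
  qed
  have fl: "flp i 0 a r = r"
  proof -
    have "ok lam b r' ==> a <= b ==> flp i 0 a r' = r'" for b r'
    proof (induction r' arbitrary: b)
      case (Cons q r') thus ?case by (cases q) force
    qed auto
    thus ?thesis using okr by blast
  qed
  have FS: "FS (%t. cor i (q t)) 0 0 a" using n(3) nc c1 by simp
  have "Fmod alpha cor i 0 0 a q = path (flp i 0 a ((z, a) # r))"
    by (rule Fmod_path[OF FS i(1) q_def okq ni])
  also have "... = p" using fl xs(1) xr i okr by simp
  finally have "fstep alpha cor i q p" unfolding fstep_def using FS GLS_clamped[OF q] by blast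
  thus ?thesis using i q by blast
qed

lemma fstep_end: "fstep alpha cor i p q ==> q 1 = p 1 - alpha i"
proof -
  assume "fstep alpha cor i p q"
  then obtain m u v where F: "FS (%t. cor i (p t)) m u v" "q = Fmod alpha cor i m u v p" by (auto simp: fstep_def)
  have "u < 1" "v = 1 ==> cor i (p 1) = m + 1" "v <= 1" using F(1) by (auto simp: FS_def)
  thus ?thesis using F(2) by (cases "v = 1") (auto simp: Fmod_def)
qed

lemma GLS_ht:
  assumes lam: "dom lam" and p: "p \<in> Bp lam"
  shows "lam - p 1 \<in> cone"
proof -
  have ind: "ok lam b xs ==> (1 - b) *\<^sub>R lam - pl b xs 1 \<in> cone" for b xs
  proof (induction xs arbitrary: b)
    case (Cons q xs)
    obtain x a where q: "q = (x, a)" by (cases q)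
    have okr: "b < a" "x \<in> orb lam" "ok lam a xs" using Cons.prems q by auto
    have a1: "a <= 1" using ok_le okr by blast
    have "(1 - b) *\<^sub>R lam - pl b (q # xs) 1 = (a - b) *\<^sub>R (lam - x) + ((1 - a) *\<^sub>R lam - pl a xs 1)"
      using q okr a1 by (simp add: algebra_simps)
    thus ?case using Cons.IH[OF okr(3)] cone_add cone_scale[OF ge_cone[OF orb_ge_lam[OF lam okr(2)]], of "a - b"] okr by simp
  qed (simp add: cone_zero)
  obtain xs where xs: "p = path xs" "ok lam 0 xs" using p unfolding GLS_path by auto
  thus ?thesis using ind[OF xs(2)] by (simp add: path_def)
qed

text \<open>Generation by the f_i: some real e_i acts, or the path is real-dominant and an imaginary
  letter comes off at the beginning.\<close>

lemma GLS_pred: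
  assumes lam: "dom lam" and p: "p \<in> Bp lam" "p \<noteq> pi_lam lam"
  shows "\<exists>i q. i \<in> I & q \<in> Bp lam & fstep alpha cor i q p"
proof (cases "\<exists>i\<in>R. mval cor i p \<noteq> 0")
  case True
  then obtain i where i: "i \<in> R" "mval cor i p \<noteq> 0" by auto
  interpret letter alpha cor i by (rule letter_R[OF i(1)])
  have L: "LI (%t. cor i (p t))" using GLS_LI[OF p(1) i(1)] dom_R[OF lam i(1)] by blast
  obtain q where q: "fstep alpha cor i q p" using LI_e[OF L GLS_clamped[OF p(1)]] i by auto
  thus ?thesis using GLS_fstep_rev[OF q p(1) i(1)] dom_R[OF lam i(1)] RI[OF i(1)] by blast
next
  case False
  have "cor i (p t) >= 0" if i: "i \<in> R" and t: "0 <= t" "t <= 1" for i t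
  proof -
    interpret letter alpha cor i by (rule letter_R[OF i])
    have L: "LI (%t. cor i (p t))" using GLS_LI[OF p(1) i] dom_R[OF lam i] by blast
    thus ?thesis using LI_mval(2)[OF L t] False i by auto
  qed
  thus ?thesis using GLS_real_dominant[OF lam p] by blast
qed

lemma GLS_induct [consumes 2, case_names base step]:
  assumes lam: "dom lam" and p: "p \<in> Bp lam"
    and b: "P (pi_lam lam)"
    and st: "!!q p i. q \<in> Bp lam ==> P q ==> i \<in> I ==> fstep alpha cor i q p ==> p \<in> Bp lam ==> P p"
  shows "P p"
  using p
proof (induction "nat \<lfloor>ht (lam - p 1)\<rfloor>" arbitrary: p rule: less_induct)
  case less
  show ?case
  proof (cases "p = pi_lam lam")
    case False
    then obtain i q where q: "i \<in> I" "q \<in> Bp lam" "fstep alpha cor i q p" using GLS_pred[OF lam less.prems] by auto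
    have "ht (lam - p 1) = ht (lam - q 1) + 1" using fstep_end[OF q(3)] q(1) by (simp add: ht_alpha)
    moreover have "ht (lam - q 1) >= 0" using cone_ht[OF GLS_ht[OF lam q(2)]] .
    ultimately have "nat \<lfloor>ht (lam - q 1)\<rfloor> < nat \<lfloor>ht (lam - p 1)\<rfloor>" by linarith
    thus ?thesis using less.hyps[of q] q st less.prems by blast
  qed (use b in simp)
qed

subsection \<open>The crystal operators\<close>

lemma GLS_f:
  assumes lam: "dom lam" and p: "p \<in> Bp lam" and i: "i \<in> I"
  shows "f_root alpha cor i p = Some q \<longleftrightarrow> fstep alpha cor i p q" "fstep alpha cor i p q ==> q \<in> Bp lam"
proof -
  have a: "fstep alpha cor i p q ==> f_root alpha cor i p = Some q" for q
    using FS_f_root[of cor i p _ _ _ alpha] by (auto simp: fstep_def)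
  have "(f_root alpha cor i p = None \<or> (\<exists>q. fstep alpha cor i p q)) & (\<forall>q. fstep alpha cor i p q --> q \<in> Bp lam)"
  proof (cases "i \<in> R")
    case True
    interpret letter alpha cor i by (rule letter_R[OF True])
    have L: "LI (%t. cor i (p t))" using GLS_LI[OF p True] dom_R[OF lam True] by blast
    show ?thesis using LI_f[OF L GLS_clamped[OF p]] GLS_fstep[OF _ p True] by blast
  next
    case False
    have "fstep alpha cor i p q ==> q \<in> Bp lam" for q using im_fstep_n[OF lam i False p] by metis
    moreover have "f_root alpha cor i p = None \<or> (\<exists>q. fstep alpha cor i p q)"
      using im_f[OF lam i False p] GLS_clamped[OF p] unfolding fstep_def by blast
    ultimately show ?thesis by blast
  qed
  thus "f_root alpha cor i p = Some q \<longleftrightarrow> fstep alpha cor i p q" "fstep alpha cor i p q ==> q \<in> Bp lam"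
    using a by force+
qed

lemma im_mono:
  assumes lam: "dom lam" and i: "i \<in> I" "i \<notin> R" and p: "p \<in> Bp lam" and t: "0 <= t" "t <= t'" "t' <= 1"
  shows "cor i (p t) <= cor i (p t')"
proof -
  obtain xs where xs: "p = path xs" "ok lam 0 xs" using p unfolding GLS_path by auto
  thus ?thesis using ok_im_H[OF lam i xs(2), THEN conjunct1, rule_format, of t t'] t by (simp add: path_def)
qed

lemma GLS_cont:
  assumes "p \<in> Bp lam" "i \<in> I"
  shows "continuous_on {0..1} (%t. cor i (p t))"
proof -
  obtain xs where xs: "p = path xs" using assms(1) unfolding GLS_path by auto
  have "continuous_on {0..1} (%t. cor i (pl 0 xs t))" using pl_cont[OF assms(2)] continuous_on_subset by blast
  thus ?thesis by (rule continuous_on_cong[THEN iffD1, rotated -1]) (auto simp: xs path_def)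
qed

text \<open>f_i subtracts \<open>min (n * t) 1\<close> times alpha_i, so with a = a_ii the height
  function of p is 1 - a times that of q until it reaches 1 - a at time 1/n. On this stretch the
  imaginary e_i divides by 1 - a. In the converse direction the slope n comes from q being a GLS
  path.\<close>

lemma im_e_root:
  assumes lam: "dom lam" and i: "i \<in> I" "i \<notin> R" and p: "p \<in> Bp lam" and q: "q \<in> Bp lam"
  shows "e_root_im A alpha cor i p = Some q \<longleftrightarrow> fstep alpha cor i q p"
proof -
  define a where "a = real_of_int (A i i)"
  have aa: "cor i (alpha i) = a" using cor_A[OF i(1)] by (simp add: a_def)
  have a0: "a <= 0" using im_neg[of i i] i aa by (simp add: R_def)
  have p0: "cor i (p 0) = 0" using GLS_0[OF p] i by simp
  have mv: "mval cor i p = 0" by (rule mval_eq) (use im_mono[OF lam i p, of 0] p0 in auto)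
  show ?thesis
  proof
    assume f: "fstep alpha cor i q p"
    obtain n where n: "1 <= n" "!!t. 0 <= t ==> t <= 1/n ==> cor i (q t) = n * t"
      "!!t. 1/n <= t ==> t <= 1 ==> 1 <= cor i (q t)"
      "!!t. 0 <= t ==> t <= 1 ==> p t = q t - min (n * t) 1 *\<^sub>R alpha i"
      using im_fstep_n[OF lam i q f] by metis
    have n1: "0 < 1/n" "1/n <= 1" using n(1) by auto
    have H1: "cor i (p t) = n * t * (1 - a)" if "0 <= t" "t <= 1/n" for t
    proof -
      have "n * t <= 1" using that n(1) by (simp add: field_simps)
      thus ?thesis using n(2)[OF that] n(4)[of t] that n1 i aa by (simp add: right_diff_distrib)
    qed
    have H2: "1 - a <= cor i (p t)" if "1/n <= t" "t <= 1" for t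
    proof -
      have "n * t >= 1" using that n(1) by (simp add: field_simps)
      thus ?thesis using n(3)[OF that] n(4)[of t] that n1 i aa by simp
    qed
    have em: "Sup {t \<in> {0..1}. cor i (p t) = 0} = 0"
    proof (rule cSup_eq_maximum)
      show "0 \<in> {t \<in> {0..1}. cor i (p t) = 0}" using p0 by simp
      fix t assume t: "t \<in> {t \<in> {0..1}. cor i (p t) = 0}"
      show "t <= 0"
      proof (cases "t <= 1/n")
        case True
        hence "n * t * (1 - a) = 0" using H1[of t] t by simp
        thus ?thesis using n(1) a0 by auto
      next
        case False
        thus ?thesis using H2[of t] t a0 by auto
      qed
    qed
    have ep: "Inf {t \<in> {0..1}. cor i (p t) = 1 - a} = 1/n"
    proof (rule cInf_eq_minimum)
      show "1/n \<in> {t \<in> {0..1}. cor i (p t) = 1 - a}" using H1[of "1/n"] n1 n(1) by simp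
      fix t assume t: "t \<in> {t \<in> {0..1}. cor i (p t) = 1 - a}"
      show "1/n <= t"
      proof (rule ccontr)
        assume "\<not> 1/n <= t"
        hence "n * t * (1 - a) = 1 * (1 - a)" "n * t < 1" using H1[of t] t n(1) by (auto simp: field_simps)
        thus False using a0 by auto
      qed
    qed
    have c1: "\<not> (\<forall>t\<in>{0..1}. cor i (p t) < 1 - a)"
      using H2[of 1] n1 by (auto intro!: bexI[of _ 1])
    have c2: "\<not> (\<exists>s\<in>{1/n..1}. cor i (p s) <= - a)" using H2 by fastforce
    have eq: "(%t0. let t = clamp t0 in if t <= 0 then p t else if t <= 1/n then p t + (cor i (p t) / (1 - a)) *\<^sub>R alpha i else p t + alpha i) = q" (is "?L = q")
    proof (rule clamped_eqI)
      show "clamped ?L" by (simp add: clamped_def)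
      show "clamped q" using GLS_clamped[OF q] .
      fix t :: real assume t: "0 <= t" "t <= 1"
      show "?L t = q t"
      proof (cases "t <= 1/n")
        case True
        have "n * t <= 1" using True n(1) by (simp add: field_simps)
        thus ?thesis using True t H1[OF t(1) True] n(4)[OF t] a0 by auto
      next
        case False
        have "n * t >= 1" using False n(1) by (simp add: field_simps)
        moreover have "t > 0" using False n1 by linarith
        ultimately show ?thesis using False t n(4)[OF t] by auto
      qed
    qed
    show "e_root_im A alpha cor i p = Some q"
    proof -
      have "Inf {t \<in> {0..1}. cor i (p t) = 0 + 1 - a} = 1/n" using ep by simp
      note this' = this
      have "\<not> (0 = (1::real) \<or> (\<forall>t\<in>{0..1}. cor i (p t) < 0 + 1 - a))" "\<not> (\<exists>s\<in>{1/n..1}. cor i (p s) <= 0 - a)"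
        using c1 c2 by auto
      thus ?thesis unfolding e_root_im_def Let_def mv a_def[symmetric] em this'
        using eq by (simp only: if_False diff_0_right Let_def)
    qed
  next
    assume e: "e_root_im A alpha cor i p = Some q"
    have c: "continuous_on {0..1} (%t. cor i (p t))" using GLS_cont[OF p i(1)] .
    have nz: "\<not> (\<forall>t. 0 <= t & t <= 1 --> cor i (p t) = 0)"
    proof
      assume z: "\<forall>t. 0 <= t & t <= 1 --> cor i (p t) = 0"
      have "Sup {t \<in> {0..1}. cor i (p t) = 0} = 1" by (rule cSup_eq_maximum) (use z in auto)
      thus False using e unfolding e_root_im_def Let_def mv by simp
    qed
    then obtain N where N: "1 <= N" "FS (%t. cor i (p t)) 0 0 (1/N)" using im_f[OF lam i p] by auto
    have em: "Sup {t \<in> {0..1}. cor i (p t) = 0} = 0"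
    proof (rule cSup_eq_maximum)
      show "0 \<in> {t \<in> {0..1}. cor i (p t) = 0}" using p0 by simp
      fix t assume t: "t \<in> {t \<in> {0..1}. cor i (p t) = 0}"
      show "t <= 0"
      proof (rule ccontr)
        assume "\<not> t <= 0"
        then consider "0 < t" "t <= 1/N" | "1/N <= t" by linarith
        thus False
        proof cases
          case 1 hence "cor i (p 0) < cor i (p t)" using N(2) unfolding FS_def by blast
          thus False using t p0 by simp
        next
          case 2 hence "0 + 1 <= cor i (p t)" using N(2) t unfolding FS_def by auto
          thus False using t by simp
        qed
      qed
    qed
    define ep where "ep = Inf {t \<in> {0..1}. cor i (p t) = 1 - a}"
    have nl: "\<not> (\<forall>t\<in>{0..1}. cor i (p t) < 1 - a)"
      and qe: "q = (%t0. let t = clamp t0 in if t <= 0 then p t else if t <= ep then p t + (cor i (p t) / (1 - a)) *\<^sub>R alpha i else p t + alpha i)"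
      using e unfolding e_root_im_def Let_def mv a_def[symmetric] em ep_def
      by (auto split: if_splits)
    obtain t0 where t0: "0 <= t0" "t0 <= 1" "1 - a <= cor i (p t0)" using nl by force
    have "continuous_on {0..t0} (%t. cor i (p t))" using continuous_on_subset[OF c] t0 by auto
    then obtain t1 where "0 <= t1" "t1 <= t0" "cor i (p t1) = 1 - a"
      using IVT'[of "%t. cor i (p t)" 0 "1 - a" t0] t0 p0 a0 by auto
    hence ne: "{t \<in> {0..1}. cor i (p t) = 1 - a} \<noteq> {}" using t0 by (auto intro!: exI[of _ t1])
    obtain e0 where e0: "e0 \<in> {t \<in> {0..1}. cor i (p t) = 1 - a}" "\<forall>t\<in>{t \<in> {0..1}. cor i (p t) = 1 - a}. e0 <= t"
      using compact_attains_inf[OF compact_level[OF c] ne] by blast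
    have "ep = e0" unfolding ep_def by (rule cInf_eq_minimum) (use e0 in auto)
    hence ep: "0 <= ep" "ep <= 1" "cor i (p ep) = 1 - a" "!!t. 0 <= t ==> t < ep ==> cor i (p t) \<noteq> 1 - a" using e0 by force+
    have ep0: "0 < ep" using ep p0 a0 by (cases "ep = 0") auto
    have lt: "cor i (p t) < 1 - a" if "0 <= t" "t < ep" for t
      using im_mono[OF lam i p, of t ep] ep that by (simp add: order_less_le)
    have Hq: "cor i (q t) = cor i (p t) / (1 - a)" if t: "0 <= t" "t <= ep" for t
    proof (cases "t = 0")
      case True thus ?thesis using p0 GLS_0[OF q] i by simp
    next
      case False
      hence "q t = p t + (cor i (p t) / (1 - a)) *\<^sub>R alpha i" unfolding qe using t ep by simp
      hence "cor i (q t) = cor i (p t) + cor i (p t) / (1 - a) * a" using i aa by simp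
      thus ?thesis using a0 by (simp add: field_simps)
    qed
    have q1: "cor i (q ep) = 1" using Hq[of ep] ep a0 by simp
    then obtain n where n: "1 <= n" "FS (%t. cor i (q t)) 0 0 (1/n)" "!!t. 0 <= t ==> t <= 1/n ==> cor i (q t) = n * t"
      using im_f[OF lam i q] ep by force
    have epn: "ep = 1/n"
    proof (rule linorder_cases[of ep "1/n"])
      assume l: "ep < 1/n"
      hence "n * ep = 1" using n(3)[of ep] ep q1 by simp
      thus ?thesis using n(1) by (simp add: field_simps)
    next
      assume g: "1/n < ep"
      have "cor i (q (1/n)) < 1" using Hq[of "1/n"] lt[of "1/n"] g n(1) a0 by simp
      thus ?thesis using n(3)[of "1/n"] n(1) by simp
    qed
    have "Fmod alpha cor i 0 0 (1/n) q = p"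
    proof (rule clamped_eqI[OF Fmod_clamped(1) GLS_clamped[OF p]])
      fix t :: real assume t: "0 <= t" "t <= 1"
      consider "t = 0" | "0 < t" "t <= ep" | "ep < t" using t by linarith
      thus "Fmod alpha cor i 0 0 (1/n) q t = p t"
      proof cases
        case 1 thus ?thesis using GLS_0[OF p] GLS_0[OF q] by (simp add: Fmod_def)
      next
        case 2
        hence "q t = p t + (cor i (p t) / (1 - a)) *\<^sub>R alpha i" unfolding qe using t by simp
        thus ?thesis using 2 Hq[of t] t epn by (simp add: Fmod_def)
      next
        case 3
        hence "q t = p t + alpha i" unfolding qe using t ep0 by simp
        moreover have "\<not> t <= 0" using 3 ep0 by linarith
        moreover have "clamp t = t" using t by simp
        moreover have "\<not> t <= 1/n" using 3 epn by simp
        ultimately show ?thesis by (simp add: Fmod_def)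
      qed
    qed
    thus "fstep alpha cor i q p" unfolding fstep_def using n(2) GLS_clamped[OF q] by blast
  qed
qed

lemma GLS_e:
  assumes lam: "dom lam" and p: "p \<in> Bp lam" and i: "i \<in> I"
  shows "cr_e A alpha cor (Bp lam) i p = Some q \<longleftrightarrow> q \<in> Bp lam & fstep alpha cor i q p"
proof (cases "i \<in> R")
  case True
  interpret letter alpha cor i by (rule letter_R[OF True])
  have L: "LI (%t. cor i (p t))" using GLS_LI[OF p True] dom_R[OF lam True] by blast
  have e: "cr_e A alpha cor (Bp lam) i p = e_root_re alpha cor i p" using True by (simp add: cr_e_def R_def)
  have rev: "fstep alpha cor i q p ==> q \<in> Bp lam" for q using GLS_fstep_rev[OF _ p True] dom_R[OF lam True] by blast
  from LI_e[OF L GLS_clamped[OF p]] show ?thesis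
  proof
    assume n: "e_root_re alpha cor i p = None & mval cor i p = 0"
    thus ?thesis unfolding e using fstep_facts(2)[of q p] by auto
  next
    assume "\<exists>q. fstep alpha cor i q p"
    thus ?thesis unfolding e using fstep_facts(2) rev by fastforce
  qed
next
  case False
  hence e: "cr_e A alpha cor (Bp lam) i p = Some q \<longleftrightarrow> e_root_im A alpha cor i p = Some q & q \<in> Bp lam"
    using i by (auto simp: cr_e_def R_def split: option.splits if_splits)
  show ?thesis unfolding e using im_e_root[OF lam i False p] by blast
qed

end

section \<open>Words of root operators\<close>

definition act1 :: "('j => 'w::real_vector) => ('j => 'w => real) => bool \<times> 'j => (real => 'w) => (real => 'w) option" where
  "act1 alpha cor a p = (if fst a then f_root alpha cor (snd a) p else e_root_re alpha cor (snd a) p)"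

fun act :: "('j => 'w::real_vector) => ('j => 'w => real) => (bool \<times> 'j) list => (real => 'w) => (real => 'w) option" where
  "act alpha cor [] p = Some p"
| "act alpha cor (a # u) p = Option.bind (act1 alpha cor a p) (act alpha cor u)"

lemma act_append: "act alpha cor (u @ v) p = Option.bind (act alpha cor u p) (act alpha cor v)"
  by (induction u arbitrary: p) (auto simp: Option.bind_assoc split: Option.bind_split)

definition integral_path :: "'j set => ('j => 'w::real_vector => real) => (real => 'w) => bool" where
  "integral_path J cor p \<longleftrightarrow> clamped p & p 0 = 0 & (\<forall>j\<in>J. LI (%t. cor j (p t)))"

text \<open>Integrality is demanded of everything reachable from p, so that \<open>LI_f\<close> and
  \<open>LI_e\<close> are available at each letter of a word.\<close>

definition good :: "'j set => ('j => 'w::real_vector) => ('j => 'w => real) => (real => 'w) => bool" where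
  "good J alpha cor p \<longleftrightarrow> (\<forall>u q. snd ` set u \<subseteq> J --> act alpha cor u p = Some q --> integral_path J cor q)"

text \<open>The crystals generated by p and p' agree, stated without a map: the same words vanish
  and the same words lead back to the start. Two words in the f_j reach the same path iff one
  followed by the reversal of the other leads back (\<open>act_loop\<close>), so stabilizers suffice
  to compare words.\<close>

definition Iso :: "'j set => ('j => 'w::real_vector) => ('j => 'w => real) => (real => 'w) => (real => 'w) => bool" where
  "Iso J alpha cor p p' \<longleftrightarrow> (\<forall>u. snd ` set u \<subseteq> J -->
     (act alpha cor u p = None \<longleftrightarrow> act alpha cor u p' = None) &
     (act alpha cor u p = Some p \<longleftrightarrow> act alpha cor u p' = Some p'))"

fun wtu :: "('j => 'w::real_vector) => (bool \<times> 'j) list => 'w" where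
  "wtu alpha [] = 0"
| "wtu alpha (a # u) = (if fst a then - alpha (snd a) else alpha (snd a)) + wtu alpha u"

lemma Iso_refl: "Iso J alpha cor p p" by (simp add: Iso_def)
lemma Iso_trans: "Iso J alpha cor p q ==> Iso J alpha cor q r ==> Iso J alpha cor p r" by (simp add: Iso_def)

lemma good_integral: "good J alpha cor p ==> integral_path J cor p"
  unfolding good_def by (metis act.simps(1) empty_subsetI image_empty list.set(1))

lemma good_act: "good J alpha cor p ==> act alpha cor u p = Some q ==> snd ` set u \<subseteq> J ==> good J alpha cor q"
  unfolding good_def
proof (intro allI impI)
  fix v r assume g: "\<forall>u q. snd ` set u \<subseteq> J --> act alpha cor u p = Some q --> integral_path J cor q"
    and q: "act alpha cor u p = Some q" "snd ` set u \<subseteq> J" and v: "snd ` set v \<subseteq> J" "act alpha cor v q = Some r"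
  have "act alpha cor (u @ v) p = Some r" using q v by (simp add: act_append)
  moreover have "snd ` set (u @ v) \<subseteq> J" using q v by auto
  ultimately show "integral_path J cor r" using g by blast
qed

lemma act_single [simp]: "act alpha cor [a] p = act1 alpha cor a p"
  by (cases "act1 alpha cor a p") auto

lemma good_act1: "good J alpha cor p ==> act1 alpha cor a p = Some q ==> snd a \<in> J ==> good J alpha cor q"
  using good_act[of J alpha cor p "[a]" q] by auto

locale lets =
  fixes J :: "'j set" and alpha :: "'j => 'w::real_vector" and cor :: "'j => 'w => real"
  assumes lt: "j \<in> J ==> letter alpha cor j"
begin

lemma act1_f:
  assumes "integral_path J cor p" "j \<in> J"
  shows "act1 alpha cor (True, j) p = Some q \<longleftrightarrow> fstep alpha cor j p q"
    "act1 alpha cor (True, j) p = None \<longleftrightarrow> cor j (p 1) = mval cor j p"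
proof -
  interpret letter alpha cor j by (rule lt[OF assms(2)])
  have L: "LI (%t. cor j (p t))" "clamped p" using assms by (auto simp: integral_path_def)
  have 1: "fstep alpha cor j p q ==> act1 alpha cor (True, j) p = Some q" for q using fstep_facts(1) by (simp add: act1_def)
  have 2: "fstep alpha cor j p q ==> cor j (p 1) \<noteq> mval cor j p" for q using fstep_facts(8)[of p q] by auto
  show "act1 alpha cor (True, j) p = Some q \<longleftrightarrow> fstep alpha cor j p q"
    using LI_f[OF L] 1 by (auto simp: act1_def)
  show "act1 alpha cor (True, j) p = None \<longleftrightarrow> cor j (p 1) = mval cor j p"
    using LI_f[OF L] 1 2 by (auto simp: act1_def)
qed

lemma act1_e:
  assumes "integral_path J cor p" "j \<in> J"
  shows "act1 alpha cor (False, j) p = Some q \<longleftrightarrow> fstep alpha cor j q p"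
    "act1 alpha cor (False, j) p = None \<longleftrightarrow> mval cor j p = 0"
proof -
  interpret letter alpha cor j by (rule lt[OF assms(2)])
  have L: "LI (%t. cor j (p t))" "clamped p" "p 0 = 0" using assms by (auto simp: integral_path_def)
  have 1: "fstep alpha cor j q p ==> act1 alpha cor (False, j) p = Some q" for q using fstep_facts(2) by (simp add: act1_def)
  have 2: "mval cor j p \<noteq> 0" if f: "fstep alpha cor j q p" for q
  proof -
    have "q 0 = 0" using fstep_facts(7)[OF f] L by simp
    hence "mval cor j q <= 0" using fstep_facts(10)[OF f, of 0] by simp
    thus ?thesis using fstep_facts(5)[OF f] by simp
  qed
  show "act1 alpha cor (False, j) p = Some q \<longleftrightarrow> fstep alpha cor j q p"
    using LI_e[OF L(1,2)] 1 by (auto simp: act1_def)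
  show "act1 alpha cor (False, j) p = None \<longleftrightarrow> mval cor j p = 0"
    using LI_e[OF L(1,2)] 1 2 by (auto simp: act1_def)
qed

lemma integral_mval:
  assumes "integral_path J cor p" "j \<in> J"
  shows "mval cor j p \<in> \<int>" "!!t. 0 <= t ==> t <= 1 ==> mval cor j p <= cor j (p t)" "mval cor j p <= 0"
    "\<exists>t. 0 <= t & t <= 1 & cor j (p t) = mval cor j p" "cor j (p 1) \<in> \<int>" "mval cor j p <= cor j (p 1)"
proof -
  interpret letter alpha cor j by (rule lt[OF assms(2)])
  have L: "LI (%t. cor j (p t))" "clamped p" "p 0 = 0" using assms by (auto simp: integral_path_def)
  show "mval cor j p \<in> \<int>" "!!t. 0 <= t ==> t <= 1 ==> mval cor j p <= cor j (p t)" "mval cor j p <= 0"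
    "\<exists>t. 0 <= t & t <= 1 & cor j (p t) = mval cor j p" using LI_mval[OF L(1)] by auto
  show "cor j (p 1) \<in> \<int>" using L by (simp add: LI_def)
  show "mval cor j p <= cor j (p 1)" using LI_mval(2)[OF L(1), of 1] by simp
qed

lemma act_end: "good J alpha cor p ==> snd ` set u \<subseteq> J ==> act alpha cor u p = Some q ==> q 1 = p 1 + wtu alpha u"
proof (induction u arbitrary: p)
  case (Cons a u)
  then obtain r where r: "act1 alpha cor a p = Some r" "act alpha cor u r = Some q" by (auto simp: bind_eq_Some_conv)
  obtain b j where a: "a = (b, j)" by (cases a)
  hence j: "j \<in> J" using Cons by auto
  interpret letter alpha cor j by (rule lt[OF j])
  have g: "good J alpha cor r" using good_act1[OF Cons.prems(1) r(1)] a j by simp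
  have "q 1 = r 1 + wtu alpha u" using Cons.IH[OF g _ r(2)] Cons.prems by simp
  moreover have "r 1 = p 1 + (if b then - alpha j else alpha j)"
    using r(1) act1_f(1)[OF good_integral[OF Cons.prems(1)] j, of r] act1_e(1)[OF good_integral[OF Cons.prems(1)] j, of r]
      fstep_facts(6)[of p r] fstep_facts(6)[of r p] a
    by (cases b) auto
  ultimately show ?case using a by simp
qed auto

lemma goodsetI:
  assumes "p \<in> B" "!!p. p \<in> B ==> integral_path J cor p"
    and "!!p q j. p \<in> B ==> j \<in> J ==> fstep alpha cor j p q ==> q \<in> B" "!!p q j. p \<in> B ==> j \<in> J ==> fstep alpha cor j q p ==> q \<in> B"
  shows "good J alpha cor p"
    "snd ` set u \<subseteq> J ==> act alpha cor u p = Some q ==> q \<in> B"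
proof -
  have *: "p \<in> B ==> snd ` set u \<subseteq> J ==> act alpha cor u p = Some q ==> q \<in> B" for u p q
  proof (induction u arbitrary: p)
    case (Cons a u)
    then obtain r where r: "act1 alpha cor a p = Some r" "act alpha cor u r = Some q" by (auto simp: bind_eq_Some_conv)
    obtain b j where a: "a = (b, j)" by (cases a)
    hence j: "j \<in> J" using Cons by auto
    have "r \<in> B" using r(1) act1_f(1)[OF assms(2)[OF Cons.prems(1)] j] act1_e(1)[OF assms(2)[OF Cons.prems(1)] j]
      assms(3)[OF Cons.prems(1) j] assms(4)[OF Cons.prems(1) j] a by (cases b) auto
    thus ?case using Cons.IH r(2) Cons.prems by auto
  qed auto
  thus "good J alpha cor p" unfolding good_def using assms(1,2) by blast
  show "snd ` set u \<subseteq> J ==> act alpha cor u p = Some q ==> q \<in> B" using * assms(1) by blast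
qed

lemma e_count:
  assumes "good J alpha cor p" "j \<in> J"
  shows "act alpha cor (replicate k (False, j)) p \<noteq> None \<longleftrightarrow> real k <= - mval cor j p"
  using assms(1)
proof (induction k arbitrary: p)
  case 0 thus ?case using integral_mval(3)[OF good_integral[OF 0] assms(2)] by simp
next
  case (Suc k)
  interpret letter alpha cor j by (rule lt[OF assms(2)])
  note g = good_integral[OF Suc.prems]
  show ?case
  proof (cases "act1 alpha cor (False, j) p")
    case None
    hence "mval cor j p = 0" using act1_e(2)[OF g assms(2)] by simp
    thus ?thesis using None by simp
  next
    case (Some q)
    hence "fstep alpha cor j q p" using act1_e(1)[OF g assms(2)] by simp
    hence "mval cor j p = mval cor j q - 1" using fstep_facts(5) by blast
    thus ?thesis using Some Suc.IH[OF good_act1[OF Suc.prems Some]] assms(2) by auto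
  qed
qed

lemma f_count:
  assumes "good J alpha cor p" "j \<in> J"
  shows "act alpha cor (replicate k (True, j)) p \<noteq> None \<longleftrightarrow> real k <= cor j (p 1) - mval cor j p"
  using assms(1)
proof (induction k arbitrary: p)
  case 0 thus ?case using integral_mval(6)[OF good_integral[OF 0] assms(2)] by simp
next
  case (Suc k)
  interpret letter alpha cor j by (rule lt[OF assms(2)])
  note g = good_integral[OF Suc.prems]
  show ?case
  proof (cases "act1 alpha cor (True, j) p")
    case None
    hence "cor j (p 1) = mval cor j p" using act1_f(2)[OF g assms(2)] by simp
    thus ?thesis using None by simp
  next
    case (Some q)
    hence f: "fstep alpha cor j p q" using act1_f(1)[OF g assms(2)] by simp
    hence "mval cor j q = mval cor j p - 1" "cor j (q 1) = cor j (p 1) - 2" using fstep_facts(5,6)[OF f] two by simp_all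
    thus ?thesis using Some Suc.IH[OF good_act1[OF Suc.prems Some]] assms(2) by auto
  qed
qed

lemma nat_le_eq:
  assumes "x \<in> \<int>" "y \<in> \<int>" "0 <= x" "0 <= (y::real)" "!!k::nat. real k <= x \<longleftrightarrow> real k <= y"
  shows "x = y"
proof -
  obtain m n where mn: "x = real m" "y = real n" using assms(1-4) by (metis Nats_altdef2 Nats_cases mem_Collect_eq)
  have "m = n" using assms(5)[of m] assms(5)[of n] mn by simp
  thus ?thesis using mn by simp
qed

text \<open>The numbers of possible applications of e_j and f_j are minus the minimum, and the
  endpoint value minus the minimum; they are visible from which words vanish.\<close>

lemma count_mval:
  assumes g: "good J alpha cor p" "good J alpha cor p'" and j: "j \<in> J"
    and e: "!!u. snd ` set u \<subseteq> J ==> act alpha cor u p = None \<longleftrightarrow> act alpha cor u p' = None"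
  shows "mval cor j p = mval cor j p'" "cor j (p 1) = cor j (p' 1)"
proof -
  note i = integral_mval[OF good_integral[OF g(1)] j] and i' = integral_mval[OF good_integral[OF g(2)] j]
  have r: "snd ` set (replicate k (b, j)) \<subseteq> J" for k b using j by auto
  have "- mval cor j p = - mval cor j p'"
    by (rule nat_le_eq) (use i(1,3) i'(1,3) e_count[OF g(1) j] e_count[OF g(2) j] e[OF r] in auto)
  moreover have "cor j (p 1) - mval cor j p = cor j (p' 1) - mval cor j p'"
    by (rule nat_le_eq) (use i(1,5,6) i'(1,5,6) f_count[OF g(1) j] f_count[OF g(2) j] e[OF r] in auto)
  ultimately show "mval cor j p = mval cor j p'" "cor j (p 1) = cor j (p' 1)" by auto
qed

end

subsection \<open>Concatenation\<close>

lemma Ints_less_add1: "x \<in> \<int> ==> y \<in> \<int> ==> x < y ==> x + 1 <= (y::real)"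
proof -
  assume "x \<in> \<int>" "y \<in> \<int>" "x < y"
  then obtain a b where ab: "x = of_int a" "y = of_int b" by (auto elim!: Ints_cases)
  hence "a + 1 <= b" using \<open>x < y\<close> by simp
  hence "of_int (a + 1) <= (of_int b :: real)" by (simp only: of_int_le_iff)
  thus ?thesis using ab by simp
qed

lemma conv_le1: "0 <= t ==> t <= 1 ==> 0 < c ==> c < 1 ==> c <= c + (1 - c) * t & c + (1 - c) * t <= (1::real)"
proof -
  assume a: "0 <= t" "t <= 1" "0 < c" "c < 1"
  have "(1 - c) * t <= 1 - c" using a by (simp add: mult_left_le)
  moreover have "0 <= (1 - c) * t" using a by simp
  ultimately show ?thesis by (intro conjI) linarith+
qed

definition cat :: "real => (real => 'w::real_vector) => (real => 'w) => real => 'w" where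
  "cat c p q = (%t0. let t = clamp t0 in if t <= c then p (t / c) else p 1 + q ((t - c) / (1 - c)))"

lemma cat_clamped: "clamped (cat c p q)" by (simp add: clamped_def cat_def)

lemma cat_left: "0 < c ==> c < 1 ==> 0 <= t ==> t <= c ==> cat c p q t = p (t / c)"
  by (simp add: cat_def)

lemma cat_right: "0 < c ==> c < 1 ==> q 0 = 0 ==> c <= t ==> t <= 1 ==> cat c p q t = p 1 + q ((t - c) / (1 - c))"
  by (cases "t = c") (auto simp: cat_def)

lemma cat_inj:
  assumes c: "0 < c" "c < 1" and q: "clamped p" "clamped p'" "clamped q" "clamped q'" "q 0 = 0" "q' 0 = 0"
  shows "cat c p q = cat c p' q' \<longleftrightarrow> p = p' & q = q'"
proof
  assume e: "cat c p q = cat c p' q'"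
  have p: "p t = p' t" if "0 <= t" "t <= 1" for t
  proof -
    have "0 <= c * t" "c * t <= c" using that c by (auto simp: mult_left_le)
    hence "p (c * t / c) = p' (c * t / c)" using cat_left[OF c, of "c * t"] e by metis
    thus ?thesis using c by simp
  qed
  have "q t = q' t" if t: "0 <= t" "t <= 1" for t
  proof -
    define s where "s = c + (1 - c) * t"
    have s: "c <= s" "s <= 1" "(s - c) / (1 - c) = t" using conv_le1[OF t c] c by (auto simp: s_def)
    have "p 1 + q ((s - c) / (1 - c)) = p' 1 + q' ((s - c) / (1 - c))"
      using cat_right[of c q s p, OF c q(5) s(1,2)] cat_right[of c q' s p', OF c q(6) s(1,2)] e by simp
    thus ?thesis using s p[of 1] by simp
  qed
  thus "p = p' & q = q'" using p q clamped_eqI by blast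
qed auto

text \<open>A local minimum away from the junction is one of G or of H, and the value
  \<open>G 1\<close> at the junction is an integer.\<close>

lemma LI_cat:
  assumes c: "0 < c" "c < 1" and L: "LI G" "LI H"
    and K: "!!t. 0 <= t ==> t <= c ==> K t = G (t / c)" "!!t. c <= t ==> t <= 1 ==> K t = G 1 + H ((t - c) / (1 - c))"
  shows "LI K"
proof -
  have cG: "continuous_on {0..1} G" and cH: "continuous_on {0..1} H" and z: "G 0 = 0" "H 0 = 0" "G 1 \<in> \<int>" "H 1 \<in> \<int>"
    using L by (auto simp: LI_def)
  have r1: "(t - c) / (1 - c) <= 1" if "t <= 1" for t using that c by simp
  have "continuous_on {0..c} (%t. G (t / c))"
    by (rule continuous_on_compose2[OF cG]) (use c in \<open>auto intro!: continuous_intros\<close>)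
  hence 1: "continuous_on {0..c} K" by (rule continuous_on_cong[THEN iffD1, rotated -1]) (auto simp: K(1))
  have "continuous_on {c..1} (%t. G 1 + H ((t - c) / (1 - c)))"
    by (intro continuous_intros continuous_on_compose2[OF cH]) (use c r1 in auto)
  hence 2: "continuous_on {c..1} K" by (rule continuous_on_cong[THEN iffD1, rotated -1]) (auto simp: K(2))
  have "continuous_on ({0..c} \<union> {c..1}) K" by (rule continuous_on_closed_Un[OF _ _ 1 2]) auto
  moreover have "{0..c} \<union> {c..1} = {0..1}" using c by auto
  ultimately have cK: "continuous_on {0..1} K" by simp
  have key: "K r \<in> \<int>" if r: "0 < e" "0 <= r - e" "r + e <= 1"
    and a: "!!t. r - e <= t ==> t <= r + e ==> K r <= K t"
    and st: "(\<forall>t. r < t & t <= r + e --> K r < K t) \<or> (\<forall>t. r - e <= t & t < r --> K r < K t)" for r e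
  proof -
    consider "r = c" | "r < c" | "c < r" by linarith
    thus ?thesis
    proof cases
      case 1 thus ?thesis using K(1)[of c] c z by simp
    next
      case 2
      define e' where "e' = min e (c - r) / c"
      have e': "0 < e'" "e' * c <= e" "e' * c <= c - r" using 2 r c by (auto simp: e'_def)
      have rr: "0 <= r / c - e'" "r / c + e' <= 1" using e' r c by (auto simp: field_simps)
      have G: "G t = K (t * c)" if "r / c - e' <= t" "t <= r / c + e'" for t
      proof -
        have "0 <= t" "t <= 1" using that rr by auto
        hence "0 <= t * c" "t * c <= c" using c by (auto simp: mult_left_le_one_le)
        thus ?thesis using K(1)[of "t * c"] c by simp
      qed
      have Gr: "G (r / c) = K r" using G[of "r / c"] e' c by simp
      have b1: "r - e <= t * c" "t * c <= r + e" if "r / c - e' <= t" "t <= r / c + e'" for t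
      proof -
        have "(r / c - e') * c <= t * c" "t * c <= (r / c + e') * c" using that c by (auto intro: mult_right_mono)
        thus "r - e <= t * c" "t * c <= r + e" using e' c by (auto simp: algebra_simps)
      qed
      have s1: "t * c < r \<longleftrightarrow> t < r / c" "r < t * c \<longleftrightarrow> r / c < t" for t using c by (auto simp: field_simps)
      have le: "G (r / c) <= G t" if "r / c - e' <= t" "t <= r / c + e'" for t
        using a[OF b1[OF that]] G[OF that] Gr by simp
      from st have "G (r / c) \<in> \<int>"
      proof
        assume s: "\<forall>t. r < t & t <= r + e --> K r < K t"
        have 1: "\<forall>t. r / c - e' <= t & t <= r / c --> G (r / c) <= G t" using le e' by auto
        have 2: "\<forall>t. r / c < t & t <= r / c + e' --> G (r / c) < G t" using s b1 s1 G Gr e' by auto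
        show ?thesis using L(1) e'(1) rr 1 2 unfolding LI_def by blast
      next
        assume s: "\<forall>t. r - e <= t & t < r --> K r < K t"
        have 1: "\<forall>t. r / c <= t & t <= r / c + e' --> G (r / c) <= G t" using le e' by auto
        have 2: "\<forall>t. r / c - e' <= t & t < r / c --> G (r / c) < G t" using s b1 s1 G Gr e' by auto
        show ?thesis using L(1) e'(1) rr 1 2 unfolding LI_def by blast
      qed
      thus ?thesis using Gr by simp
    next
      case 3
      define c' where "c' = 1 - c"
      have c': "0 < c'" using c by (simp add: c'_def)
      define r' where "r' = (r - c) / c'"
      define e' where "e' = min e (r - c) / c'"
      have e': "0 < e'" "e' * c' <= e" "e' * c' <= r - c" using 3 r c' by (auto simp: e'_def)
      have rr: "0 <= r' - e'" "r' + e' <= 1" using e' r c' by (auto simp: field_simps r'_def c'_def)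
      have G: "G 1 + H t = K (c + t * c')" if "r' - e' <= t" "t <= r' + e'" for t
      proof -
        have "0 <= t" "t <= 1" using that rr by auto
        hence "0 <= t * c'" "t * c' <= c'" using c' by (auto simp: mult_left_le_one_le)
        thus ?thesis using K(2)[of "c + t * c'"] c' by (simp add: c'_def)
      qed
      have cr: "c + r' * c' = r" using c' by (simp add: r'_def)
      have Gr: "G 1 + H r' = K r" using G[of r'] e' cr by simp
      have b1: "r - e <= c + t * c'" "c + t * c' <= r + e" if "r' - e' <= t" "t <= r' + e'" for t
      proof -
        have "(r' - e') * c' <= t * c'" "t * c' <= (r' + e') * c'" using that c' by (auto intro: mult_right_mono)
        thus "r - e <= c + t * c'" "c + t * c' <= r + e" using e' cr by (auto simp: algebra_simps)
      qed
      have s1: "c + t * c' < r \<longleftrightarrow> t < r'" "r < c + t * c' \<longleftrightarrow> r' < t" for t using c' by (auto simp: field_simps r'_def)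
      have le: "H r' <= H t" if "r' - e' <= t" "t <= r' + e'" for t
        using a[OF b1[OF that]] G[OF that] Gr by simp
      from st have "H r' \<in> \<int>"
      proof
        assume s: "\<forall>t. r < t & t <= r + e --> K r < K t"
        have 1: "\<forall>t. r' - e' <= t & t <= r' --> H r' <= H t" using le e' by auto
        have "H r' < H t" if "r' < t" "t <= r' + e'" for t
        proof -
          have t: "r' - e' <= t" using that e' by simp
          have "K r < K (c + t * c')" using s s1(2) b1(2)[OF t that(2)] that by blast
          thus ?thesis using G[OF t that(2)] Gr by simp
        qed
        hence 2: "\<forall>t. r' < t & t <= r' + e' --> H r' < H t" by blast
        show ?thesis using L(2) e'(1) rr 1 2 unfolding LI_def by blast
      next
        assume s: "\<forall>t. r - e <= t & t < r --> K r < K t"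
        have 1: "\<forall>t. r' <= t & t <= r' + e' --> H r' <= H t" using le e' by auto
        have "H r' < H t" if "r' - e' <= t" "t < r'" for t
        proof -
          have t: "t <= r' + e'" using that e' by simp
          have "K r < K (c + t * c')" using s s1(1) b1(1)[OF that(1) t] that by blast
          thus ?thesis using G[OF that(1) t] Gr by simp
        qed
        hence 2: "\<forall>t. r' - e' <= t & t < r' --> H r' < H t" by blast
        show ?thesis using L(2) e'(1) rr 1 2 unfolding LI_def by blast
      qed
      hence "G 1 + H r' \<in> \<int>" using z by simp
      thus ?thesis using Gr by simp
    qed
  qed
  have K0: "K 0 = 0" "K 1 \<in> \<int>" using K(1)[of 0] K(2)[of 1] c z by auto
  show ?thesis unfolding LI_def
  proof (intro conjI allI impI cK K0)
    fix r e assume h: "0 < e & 0 <= r - e & r + e <= 1" "\<forall>t. r - e <= t & t <= r --> K r <= K t" "\<forall>t. r < t & t <= r + e --> K r < K t"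
    show "K r \<in> \<int>"
    proof (rule key[of e r])
      fix t assume "r - e <= t" "t <= r + e" thus "K r <= K t" using h by (cases "t <= r") (auto intro: less_imp_le)
    qed (use h in auto)
  next
    fix r e assume h: "0 < e & 0 <= r - e & r + e <= 1" "\<forall>t. r - e <= t & t < r --> K r < K t" "\<forall>t. r <= t & t <= r + e --> K r <= K t"
    show "K r \<in> \<int>"
    proof (rule key[of e r])
      fix t assume "r - e <= t" "t <= r + e" thus "K r <= K t" using h by (cases "t < r") (auto intro: less_imp_le)
    qed (use h in auto)
  qed
qed

context lets
begin

lemma cat_cor:
  assumes "0 < c" "c < 1" "q 0 = 0" "j \<in> J"
  shows "!!t. 0 <= t ==> t <= c ==> cor j (cat c p q t) = cor j (p (t / c))"
    "!!t. c <= t ==> t <= 1 ==> cor j (cat c p q t) = cor j (p 1) + cor j (q ((t - c) / (1 - c)))"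
proof -
  interpret letter alpha cor j by (rule lt[OF assms(4)])
  show "!!t. 0 <= t ==> t <= c ==> cor j (cat c p q t) = cor j (p (t / c))" using cat_left assms by metis
  show "!!t. c <= t ==> t <= 1 ==> cor j (cat c p q t) = cor j (p 1) + cor j (q ((t - c) / (1 - c)))"
    using cat_right[where c=c and q=q and p=p, OF assms(1-3)] by simp
qed

lemma cat_integral:
  assumes c: "0 < c" "c < 1" and "integral_path J cor p" "integral_path J cor q"
  shows "integral_path J cor (cat c p q)"
proof -
  have "LI (%t. cor j (cat c p q t))" if j: "j \<in> J" for j
  proof (rule LI_cat[OF c])
    show "LI (%t. cor j (p t))" "LI (%t. cor j (q t))" using assms j by (auto simp: integral_path_def)
  qed (use cat_cor[OF c] assms(4) j in \<open>auto simp: integral_path_def\<close>)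
  thus ?thesis using cat_clamped assms c by (auto simp: integral_path_def cat_def)
qed

lemma cat_mval:
  assumes c: "0 < c" "c < 1" and i: "integral_path J cor p" "integral_path J cor q" and j: "j \<in> J"
  shows "mval cor j (cat c p q) = min (mval cor j p) (cor j (p 1) + mval cor j q)"
    "cor j (cat c p q 1) = cor j (p 1) + cor j (q 1)"
proof -
  have q0: "q 0 = 0" using i by (simp add: integral_path_def)
  note ip = integral_mval[OF i(1) j] and iq = integral_mval[OF i(2) j] and cc = cat_cor[where c=c and q=q and j=j and p=p, OF c q0 j]
  show "mval cor j (cat c p q) = min (mval cor j p) (cor j (p 1) + mval cor j q)"
  proof (rule mval_eq)
    show "min (mval cor j p) (cor j (p 1) + mval cor j q) \<in> \<int>" using ip(1,5) iq(1) by (auto simp: min_def)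
    fix t :: real assume t: "0 <= t" "t <= 1"
    show "min (mval cor j p) (cor j (p 1) + mval cor j q) <= cor j (cat c p q t)"
    proof (cases "t <= c")
      case True
      hence "mval cor j p <= cor j (p (t / c))" using ip(2)[of "t / c"] t c by simp
      thus ?thesis using cc(1)[of t] True t by simp
    next
      case False
      hence "mval cor j q <= cor j (q ((t - c) / (1 - c)))" using iq(2)[of "(t - c) / (1 - c)"] t c by simp
      thus ?thesis using cc(2)[of t] False t by simp
    qed
  next
    obtain a b where a: "0 <= a" "a <= 1" "cor j (p a) = mval cor j p" and b: "0 <= b" "b <= 1" "cor j (q b) = mval cor j q"
      using ip(4) iq(4) by auto
    have ca: "c * a <= c" using a c mult_left_le[of a c] by simp
    have ca1: "c * a <= 1" using ca c by linarith
    have ca0: "0 <= c * a" and cad: "c * a / c = a" using a c by auto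
    note 1 = ca0 ca ca1 cad
    have 3: "c <= c + (1 - c) * b" "c + (1 - c) * b <= 1" "(c + (1 - c) * b - c) / (1 - c) = b" using conv_le1[OF b(1,2) c] c by auto
    have "cor j (cat c p q (c * a)) = mval cor j p" using cc(1)[OF 1(1,2)] 1 a by simp
    moreover have "cor j (cat c p q (c + (1 - c) * b)) = cor j (p 1) + mval cor j q" using cc(2)[OF 3(1,2)] 3 b by simp
    ultimately show "\<exists>t. 0 <= t & t <= 1 & cor j (cat c p q t) = min (mval cor j p) (cor j (p 1) + mval cor j q)"
      using 1 3 c by (cases "mval cor j p <= cor j (p 1) + mval cor j q") (auto intro: exI[of _ "c * a"] exI[of _ "c + (1 - c) * b"])
  qed
  show "cor j (cat c p q 1) = cor j (p 1) + cor j (q 1)" using cc(2)[of 1] c by simp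
qed

lemma cat_fstep_left:
  assumes c: "0 < c" "c < 1" and i: "integral_path J cor p" "integral_path J cor q" and j: "j \<in> J"
    and f: "fstep alpha cor j p p'" and m: "mval cor j p < cor j (p 1) + mval cor j q"
  shows "fstep alpha cor j (cat c p q) (cat c p' q)"
proof -
  interpret letter alpha cor j by (rule lt[OF j])
  have q0: "q 0 = 0" using i by (simp add: integral_path_def)
  note ip = integral_mval[OF i(1) j] and iq = integral_mval[OF i(2) j] and cc = cat_cor[where c=c and q=q and j=j and p=p, OF c q0 j]
  obtain m u v where F: "FS (%t. cor j (p t)) m u v" "p' = Fmod alpha cor j m u v p" using f by (auto simp: fstep_def)
  have mm: "m = mval cor j p" using FS_mval[of cor j p m u v] F by simp
  have m1: "m + 1 <= cor j (p 1) + mval cor j q" unfolding mm using m ip(1,5) iq(1) by (intro Ints_less_add1) auto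
  have F': "m \<in> \<int>" "0 <= u" "u < v" "v <= 1" "cor j (p u) = m" "cor j (p v) = m + 1"
     "!!t. 0 <= t ==> t <= u ==> m <= cor j (p t)" "!!t t'. u <= t ==> t < t' ==> t' <= v ==> cor j (p t) < cor j (p t')"
     "!!t. v <= t ==> t <= 1 ==> m + 1 <= cor j (p t)" using F(1) unfolding FS_def by auto
  have cv: "c * v <= c" using F' c by (simp add: mult_left_le)
  have le: "t <= c * x \<longleftrightarrow> t / c <= x" "c * x <= t \<longleftrightarrow> x <= t / c" for t x using c by (auto simp: field_simps)
  have "FS (%t. cor j (cat c p q t)) m (c * u) (c * v)"
    unfolding FS_def
  proof (intro conjI allI impI)
    show "cor j (cat c p q (c * u)) = m" "cor j (cat c p q (c * v)) = m + 1"
      using cc(1)[of "c * u"] cc(1)[of "c * v"] F' c cv mult_left_le[of u c] by auto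
    show "c * v <= 1" using cv c by linarith
    show "0 <= c * u" "c * u < c * v" "m \<in> \<int>" using F'(1,2,3) c by auto
    fix t assume t: "0 <= t & t <= c * u"
    moreover have "c * u < c * v" using F'(3) c by simp
    ultimately have "t <= c" using cv by linarith
    thus "m <= cor j (cat c p q t)" using cc(1)[of t] F'(7)[of "t / c"] t c le by simp
  next
    fix t t' assume t: "c * u <= t & t < t' & t' <= c * v"
    have "0 <= c * u" using F' c by simp
    hence b: "0 <= t" "t <= c" "0 <= t'" "t' <= c" using t cv by auto
    have "cor j (p (t / c)) < cor j (p (t' / c))" using t c le by (intro F'(8)) (auto simp: divide_strict_right_mono)
    thus "cor j (cat c p q t) < cor j (cat c p q t')" using cc(1) b by simp
  next
    fix t assume t: "c * v <= t & t <= 1"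
    show "m + 1 <= cor j (cat c p q t)"
    proof (cases "t <= c")
      case True
      have "0 <= c * v" using F' c by simp
      hence "0 <= t" using t by linarith
      thus ?thesis using cc(1)[of t] F'(9)[of "t / c"] t c le True by simp
    next
      case False
      hence "mval cor j q <= cor j (q ((t - c) / (1 - c)))" using iq(2)[of "(t - c) / (1 - c)"] t c by simp
      thus ?thesis using cc(2)[of t] False t m1 by simp
    qed
  qed
  moreover have "Fmod alpha cor j m (c * u) (c * v) (cat c p q) = cat c p' q"
  proof (rule clamped_eqI[OF Fmod_clamped(1) cat_clamped])
    fix t :: real assume t: "0 <= t" "t <= 1"
    show "Fmod alpha cor j m (c * u) (c * v) (cat c p q) t = cat c p' q t"
    proof (cases "t <= c")
      case True
      hence "clamp (t / c) = t / c" using t c by simp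
      thus ?thesis using True t c le cat_left[OF c t(1) True, of p q] cat_left[OF c t(1) True, of p' q] unfolding F(2)
        by (simp add: Fmod_def Let_def)
    next
      case False
      moreover have "c * u < c * v" using F'(3) c by simp
      ultimately have "\<not> t <= c * v" "\<not> t <= c * u" using cv by linarith+
      hence "Fmod alpha cor j m (c * u) (c * v) (cat c p q) t = cat c p q t - alpha j" using t by (simp add: Fmod_def)
      thus ?thesis using False t cat_right[of c q t p, OF c q0] cat_right[of c q t p', OF c q0] fstep_facts(6)[OF f] by simp
    qed
  qed
  ultimately show ?thesis unfolding fstep_def using cat_clamped by metis
qed

lemma cat_fstep_right:
  assumes c: "0 < c" "c < 1" and i: "integral_path J cor p" "integral_path J cor q" and j: "j \<in> J"
    and f: "fstep alpha cor j q q'" and m: "cor j (p 1) + mval cor j q <= mval cor j p"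
  shows "fstep alpha cor j (cat c p q) (cat c p q')"
proof -
  interpret letter alpha cor j by (rule lt[OF j])
  have q0: "q 0 = 0" "q' 0 = 0" using i fstep_facts(7)[OF f] by (auto simp: integral_path_def)
  note ip = integral_mval[OF i(1) j] and iq = integral_mval[OF i(2) j] and cc = cat_cor[where c=c and q=q and j=j and p=p, OF c q0(1) j]
  obtain m u v where F: "FS (%t. cor j (q t)) m u v" "q' = Fmod alpha cor j m u v q" using f by (auto simp: fstep_def)
  have mm: "m = mval cor j q" using FS_mval[of cor j q m u v] F by simp
  have F': "m \<in> \<int>" "0 <= u" "u < v" "v <= 1" "cor j (q u) = m" "cor j (q v) = m + 1"
     "!!t. 0 <= t ==> t <= u ==> m <= cor j (q t)" "!!t t'. u <= t ==> t < t' ==> t' <= v ==> cor j (q t) < cor j (q t')"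
     "!!t. v <= t ==> t <= 1 ==> m + 1 <= cor j (q t)" using F(1) unfolding FS_def by auto
  define c' where "c' = 1 - c"
  have c': "0 < c'" using c by (simp add: c'_def)
  define h where "h x = c + c' * x" for x
  have "h v <= 1" using conv_le1[of v c] F'(2,3,4) c by (simp add: h_def c'_def)
  moreover have "h u < h v" "c <= h u" using F'(2,3) c' by (auto simp: h_def)
  ultimately have hv: "h v <= 1" "h u < h v" "c <= h u" by auto
  have le: "t <= h x \<longleftrightarrow> (t - c) / c' <= x" "h x <= t \<longleftrightarrow> x <= (t - c) / c'" for t x using c' by (auto simp: field_simps h_def)
  have hx: "(h x - c) / (1 - c) = x" for x using c' by (simp add: h_def c'_def)
  let ?M = "cor j (p 1) + m"
  have "FS (%t. cor j (cat c p q t)) ?M (h u) (h v)"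
    unfolding FS_def
  proof (intro conjI allI impI)
    show "cor j (cat c p q (h u)) = ?M" "cor j (cat c p q (h v)) = ?M + 1"
      using cc(2)[of "h u"] cc(2)[of "h v"] F' hv hx by auto
    show "0 <= h u" "h u < h v" "h v <= 1" "?M \<in> \<int>" using F' c hv ip by auto
    fix t assume t: "0 <= t & t <= h u"
    show "?M <= cor j (cat c p q t)"
    proof (cases "t <= c")
      case True
      hence "mval cor j p <= cor j (p (t / c))" using ip(2)[of "t / c"] t c by simp
      thus ?thesis using cc(1)[of t] True t m mm by simp
    next
      case False
      thus ?thesis using cc(2)[of t] F'(7)[of "(t - c) / (1 - c)"] t c hv le[unfolded c'_def] by simp
    qed
  next
    fix t t' assume t: "h u <= t & t < t' & t' <= h v"
    have "cor j (q ((t - c) / (1 - c))) < cor j (q ((t' - c) / (1 - c)))"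
      using t c le[unfolded c'_def] by (intro F'(8)) (auto simp: divide_strict_right_mono)
    thus "cor j (cat c p q t) < cor j (cat c p q t')" using cc(2) t hv by simp
  next
    fix t assume t: "h v <= t & t <= 1"
    thus "?M + 1 <= cor j (cat c p q t)" using cc(2)[of t] F'(9)[of "(t - c) / (1 - c)"] t c hv le[unfolded c'_def] by simp
  qed
  moreover have "Fmod alpha cor j ?M (h u) (h v) (cat c p q) = cat c p q'"
  proof (rule clamped_eqI[OF Fmod_clamped(1) cat_clamped])
    fix t :: real assume t: "0 <= t" "t <= 1"
    show "Fmod alpha cor j ?M (h u) (h v) (cat c p q) t = cat c p q' t"
    proof (cases "t <= c")
      case True
      hence "t <= h u" using hv by simp
      thus ?thesis using True t cat_left[OF c t(1) True, of p q] cat_left[OF c t(1) True, of p q'] by (simp add: Fmod_def)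
    next
      case False
      hence ct: "c <= t" by simp
      have cl: "clamp ((t - c) / (1 - c)) = (t - c) / (1 - c)" using t c ct by simp
      show ?thesis using t le[of t u] le[of t v] cat_right[of c q t p, OF c q0(1) ct t(2)] cat_right[of c q' t p, OF c q0(2) ct t(2)] cl
        unfolding F(2) c'_def by (simp add: Fmod_def Let_def)
    qed
  qed
  ultimately show ?thesis unfolding fstep_def using cat_clamped by metis
qed

text \<open>The tensor product rule. f acts where the minimum is attained last and e where it is
  attained first; on a tie f acts on the right factor and e on the left one.\<close>

lemma act1_cat:
  assumes c: "0 < c" "c < 1" and g: "good J alpha cor p" "good J alpha cor q" and j: "j \<in> J"
  shows "act1 alpha cor (b, j) (cat c p q) =
    (if (b & mval cor j p < cor j (p 1) + mval cor j q) \<or> (\<not> b & mval cor j p <= cor j (p 1) + mval cor j q)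
     then map_option (%p'. cat c p' q) (act1 alpha cor (b, j) p) else map_option (cat c p) (act1 alpha cor (b, j) q))"
proof -
  interpret letter alpha cor j by (rule lt[OF j])
  have i: "integral_path J cor p" "integral_path J cor q" using g good_integral by auto
  note ip = integral_mval[OF i(1) j] and iq = integral_mval[OF i(2) j]
  note ic = cat_integral[OF c i] and cm = cat_mval[OF c i j]
  note fp = act1_f[OF i(1) j] and fq = act1_f[OF i(2) j] and fc = act1_f[OF ic j]
  note ep = act1_e[OF i(1) j] and eq = act1_e[OF i(2) j] and ec = act1_e[OF ic j]
  show ?thesis
  proof (cases b)
    case True
    show ?thesis
    proof (cases "mval cor j p < cor j (p 1) + mval cor j q")
      case lt: True
      hence "cor j (p 1) \<noteq> mval cor j p" using iq(3) by auto
      then obtain p' where p': "act1 alpha cor (True, j) p = Some p'" using fp(2) by auto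
      hence "fstep alpha cor j (cat c p q) (cat c p' q)" using cat_fstep_left[OF c i j _ lt] fp(1) by blast
      thus ?thesis using True lt p' fc(1) by simp
    next
      case nlt: False
      show ?thesis
      proof (cases "act1 alpha cor (True, j) q")
        case None
        hence "cor j (cat c p q 1) = mval cor j (cat c p q)" using fq(2) cm nlt by simp
        thus ?thesis using True nlt None fc(2) by simp
      next
        case (Some q')
        hence "fstep alpha cor j (cat c p q) (cat c p q')" using cat_fstep_right[OF c i j] fq(1) nlt by simp
        thus ?thesis using True nlt Some fc(1) by simp
      qed
    qed
  next
    case False
    show ?thesis
    proof (cases "mval cor j p <= cor j (p 1) + mval cor j q")
      case le: True
      show ?thesis
      proof (cases "act1 alpha cor (False, j) p")
        case None
        hence "mval cor j (cat c p q) = 0" using ep(2) cm le by simp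
        thus ?thesis using False le None ec(2) by simp
      next
        case (Some p')
        hence f: "fstep alpha cor j p' p" using ep(1) by simp
        have "good J alpha cor p'" using good_act1[OF g(1) Some] j by simp
        hence i': "integral_path J cor p'" using good_integral by blast
        have "mval cor j p' < cor j (p' 1) + mval cor j q" using fstep_facts(5,6)[OF f] two le by simp
        hence "fstep alpha cor j (cat c p' q) (cat c p q)" using cat_fstep_left[OF c i' i(2) j f] by blast
        thus ?thesis using False le Some ec(1) by simp
      qed
    next
      case nle: False
      have "mval cor j q \<noteq> 0" using nle ip(6) by auto
      then obtain q' where q': "act1 alpha cor (False, j) q = Some q'" using eq(2) by auto
      hence f: "fstep alpha cor j q' q" using eq(1) by simp
      have "good J alpha cor q'" using good_act1[OF g(2) q'] j by simp
      hence i': "integral_path J cor q'" using good_integral by blast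
      have "cor j (p 1) + mval cor j q' <= mval cor j p" 
      proof -
        have 1: "mval cor j q' = mval cor j q + 1" using fstep_facts(5)[OF f] by simp
        have "cor j (p 1) + mval cor j q + 1 <= mval cor j p" using nle ip(1,5) iq(1) by (intro Ints_less_add1) auto
        thus ?thesis unfolding 1 by simp
      qed
      hence "fstep alpha cor j (cat c p q') (cat c p q)" using cat_fstep_right[OF c i(1) i' j f] by blast
      thus ?thesis using False nle q' ec(1) by simp
    qed
  qed
qed

lemma act_cat:
  assumes c: "0 < c" "c < 1"
  shows "good J alpha cor p ==> good J alpha cor q ==> snd ` set u \<subseteq> J ==> act alpha cor u (cat c p q) = Some r ==>
    \<exists>u1 u2 p' q'. snd ` set u1 \<subseteq> J & snd ` set u2 \<subseteq> J & act alpha cor u1 p = Some p' & act alpha cor u2 q = Some q' & r = cat c p' q'"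
proof (induction u arbitrary: p q)
  case Nil thus ?case by (intro exI[of _ "[]"]) auto
next
  case (Cons a u)
  obtain b j where a: "a = (b, j)" by (cases a)
  hence j: "j \<in> J" and u: "snd ` set u \<subseteq> J" using Cons by auto
  obtain r' where r': "act1 alpha cor (b, j) (cat c p q) = Some r'" "act alpha cor u r' = Some r" using Cons.prems a by (auto simp: bind_eq_Some_conv)
  then consider p' where "act1 alpha cor (b, j) p = Some p'" "r' = cat c p' q" | q' where "act1 alpha cor (b, j) q = Some q'" "r' = cat c p q'"
    using act1_cat[OF c Cons.prems(1,2) j, of b] by (auto split: if_splits)
  thus ?case
  proof cases
    case 1
    hence "good J alpha cor p'" using good_act1 Cons.prems j by fastforce
    then obtain u1 u2 p2 q2 where "snd ` set u1 \<subseteq> J" "snd ` set u2 \<subseteq> J" "act alpha cor u1 p' = Some p2" "act alpha cor u2 q = Some q2" "r = cat c p2 q2"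
      using Cons.IH[of p' q] Cons.prems u r' 1 by blast
    thus ?thesis using 1 j by (intro exI[of _ "(b, j) # u1"] exI[of _ u2] exI[of _ p2] exI[of _ q2]) auto
  next
    case 2
    hence "good J alpha cor q'" using good_act1 Cons.prems j by fastforce
    then obtain u1 u2 p2 q2 where "snd ` set u1 \<subseteq> J" "snd ` set u2 \<subseteq> J" "act alpha cor u1 p = Some p2" "act alpha cor u2 q' = Some q2" "r = cat c p2 q2"
      using Cons.IH[of p q'] Cons.prems u r' 2 by blast
    thus ?thesis using 2 j by (intro exI[of _ u1] exI[of _ "(b, j) # u2"] exI[of _ p2] exI[of _ q2]) auto
  qed
qed

lemma good_cat:
  assumes c: "0 < c" "c < 1" and g: "good J alpha cor p" "good J alpha cor q"
  shows "good J alpha cor (cat c p q)"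
  unfolding good_def
proof (intro allI impI)
  fix u r assume a: "snd ` set u \<subseteq> J" "act alpha cor u (cat c p q) = Some r"
  from act_cat[OF c g a] show "integral_path J cor r"
  proof (elim exE conjE)
    fix u1 u2 p' q' assume h: "snd ` set u1 \<subseteq> J" "snd ` set u2 \<subseteq> J" "act alpha cor u1 p = Some p'" "act alpha cor u2 q = Some q'" "r = cat c p' q'"
    show ?thesis unfolding h(5)
      by (rule cat_integral[OF c good_integral[OF good_act[OF g(1) h(3,1)]] good_integral[OF good_act[OF g(2) h(4,2)]]])
  qed
qed

text \<open>Which factor is acted on depends on p only through its minimum and its endpoint pairing,
  and these agree for p and p1 by \<open>count_mval\<close>. So a word splits into the same two
  words for both concatenations.\<close>

lemma act_cat_pair:
  assumes c: "0 < c" "c < 1"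
  shows "good J alpha cor p ==> good J alpha cor p1 ==> good J alpha cor q ==> snd ` set u \<subseteq> J ==>
    (\<forall>v. snd ` set v \<subseteq> J --> (act alpha cor v p = None \<longleftrightarrow> act alpha cor v p1 = None)) ==>
    (act alpha cor u (cat c p q) = None & act alpha cor u (cat c p1 q) = None) \<or>
    (\<exists>u1 u2 p' p1' q'. snd ` set u1 \<subseteq> J & snd ` set u2 \<subseteq> J & act alpha cor u1 p = Some p' & act alpha cor u1 p1 = Some p1' & act alpha cor u2 q = Some q' &
       act alpha cor u (cat c p q) = Some (cat c p' q') & act alpha cor u (cat c p1 q) = Some (cat c p1' q'))"
proof (induction u arbitrary: p p1 q)
  case Nil thus ?case by (intro disjI2 exI[of _ "[]"]) auto
next
  case (Cons a u)
  obtain b j where a: "a = (b, j)" by (cases a)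
  hence j: "j \<in> J" and u: "snd ` set u \<subseteq> J" using Cons by auto
  note N0 = Cons.prems(5)
  have N: "act alpha cor v p = None \<longleftrightarrow> act alpha cor v p1 = None" if "snd ` set v \<subseteq> J" for v using N0 that by blast
  have e: "mval cor j p = mval cor j p1" "cor j (p 1) = cor j (p1 1)" using count_mval[OF Cons.prems(1,2) j] N by auto
  define L where "L \<longleftrightarrow> (b & mval cor j p < cor j (p 1) + mval cor j q) \<or> (\<not> b & mval cor j p <= cor j (p 1) + mval cor j q)"
  have A: "act1 alpha cor (b, j) (cat c p q) = (if L then map_option (%p'. cat c p' q) (act1 alpha cor (b, j) p) else map_option (cat c p) (act1 alpha cor (b, j) q))"
    "act1 alpha cor (b, j) (cat c p1 q) = (if L then map_option (%p'. cat c p' q) (act1 alpha cor (b, j) p1) else map_option (cat c p1) (act1 alpha cor (b, j) q))"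
    using act1_cat[OF c Cons.prems(1,3) j] act1_cat[OF c Cons.prems(2,3) j] e by (simp_all add: L_def)
  have N1: "act1 alpha cor (b, j) p = None \<longleftrightarrow> act1 alpha cor (b, j) p1 = None" using N[of "[(b, j)]"] j by (simp del: act.simps)
  show ?case
  proof (cases L)
    case True
    show ?thesis
    proof (cases "act1 alpha cor (b, j) p")
      case None thus ?thesis using True A N1 a by simp
    next
      case (Some p2)
      then obtain p3 where p3: "act1 alpha cor (b, j) p1 = Some p3" using N1 by auto
      have g: "good J alpha cor p2" "good J alpha cor p3" using good_act1[OF Cons.prems(1) Some] good_act1[OF Cons.prems(2) p3] j by auto
      have N2: "\<forall>v. snd ` set v \<subseteq> J --> (act alpha cor v p2 = None \<longleftrightarrow> act alpha cor v p3 = None)"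
      proof (intro allI impI)
        fix v :: "(bool \<times> 'j) list" assume "snd ` set v \<subseteq> J"
        thus "act alpha cor v p2 = None \<longleftrightarrow> act alpha cor v p3 = None" using N[of "(b, j) # v"] j Some p3 by simp
      qed
      from Cons.IH[OF g Cons.prems(3) u N2] show ?thesis
      proof (elim disjE exE conjE)
        assume "act alpha cor u (cat c p2 q) = None" "act alpha cor u (cat c p3 q) = None"
        thus ?thesis using True A Some p3 a by simp
      next
        fix u1 u2 p' p1' q' assume h: "snd ` set u1 \<subseteq> J" "snd ` set u2 \<subseteq> J" "act alpha cor u1 p2 = Some p'" "act alpha cor u1 p3 = Some p1'" "act alpha cor u2 q = Some q'"
          "act alpha cor u (cat c p2 q) = Some (cat c p' q')" "act alpha cor u (cat c p3 q) = Some (cat c p1' q')"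
        thus ?thesis using True A Some p3 a j
          by (intro disjI2 exI[of _ "(b, j) # u1"] exI[of _ u2] exI[of _ p'] exI[of _ p1'] exI[of _ q']) simp
      qed
    qed
  next
    case False
    show ?thesis
    proof (cases "act1 alpha cor (b, j) q")
      case None thus ?thesis using False A a by simp
    next
      case (Some q2)
      have g: "good J alpha cor q2" using good_act1[OF Cons.prems(3) Some] j by auto
      from Cons.IH[OF Cons.prems(1,2) g u N0] show ?thesis
      proof (elim disjE exE conjE)
        assume "act alpha cor u (cat c p q2) = None" "act alpha cor u (cat c p1 q2) = None"
        thus ?thesis using False A Some a by simp
      next
        fix u1 u2 p' p1' q' assume h: "snd ` set u1 \<subseteq> J" "snd ` set u2 \<subseteq> J" "act alpha cor u1 p = Some p'" "act alpha cor u1 p1 = Some p1'" "act alpha cor u2 q2 = Some q'"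
          "act alpha cor u (cat c p q2) = Some (cat c p' q')" "act alpha cor u (cat c p1 q2) = Some (cat c p1' q')"
        thus ?thesis using False A Some a j
          by (intro disjI2 exI[of _ u1] exI[of _ "(b, j) # u2"] exI[of _ p'] exI[of _ p1'] exI[of _ q']) simp
      qed
    qed
  qed
qed

lemma Iso_cat:
  assumes c: "0 < c" "c < 1" and g: "good J alpha cor p" "good J alpha cor p1" "good J alpha cor q" and I: "Iso J alpha cor p p1"
  shows "Iso J alpha cor (cat c p q) (cat c p1 q)"
  unfolding Iso_def
proof (intro allI impI)
  fix u :: "(bool \<times> 'j) list" assume u: "snd ` set u \<subseteq> J"
  have N: "\<forall>v. snd ` set v \<subseteq> J --> (act alpha cor v p = None \<longleftrightarrow> act alpha cor v p1 = None)" using I unfolding Iso_def by blast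
  have ig: "integral_path J cor p" "integral_path J cor p1" "integral_path J cor q" using g good_integral by auto
  from act_cat_pair[OF c g u N] show "(act alpha cor u (cat c p q) = None \<longleftrightarrow> act alpha cor u (cat c p1 q) = None) &
     (act alpha cor u (cat c p q) = Some (cat c p q) \<longleftrightarrow> act alpha cor u (cat c p1 q) = Some (cat c p1 q))"
  proof (elim disjE exE conjE)
    fix u1 u2 p' p1' q' assume h: "snd ` set u1 \<subseteq> J" "snd ` set u2 \<subseteq> J" "act alpha cor u1 p = Some p'" "act alpha cor u1 p1 = Some p1'" "act alpha cor u2 q = Some q'"
      "act alpha cor u (cat c p q) = Some (cat c p' q')" "act alpha cor u (cat c p1 q) = Some (cat c p1' q')"
    have ig': "integral_path J cor p'" "integral_path J cor p1'" "integral_path J cor q'"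
      using good_integral[OF good_act[OF g(1) h(3,1)]] good_integral[OF good_act[OF g(2) h(4,1)]] good_integral[OF good_act[OF g(3) h(5,2)]] by auto
    have "act alpha cor u1 p = Some p \<longleftrightarrow> act alpha cor u1 p1 = Some p1" using I h(1) unfolding Iso_def by blast
    hence "p' = p \<longleftrightarrow> p1' = p1" using h by simp
    moreover have "cat c p' q' = cat c p q \<longleftrightarrow> p' = p & q' = q" "cat c p1' q' = cat c p1 q \<longleftrightarrow> p1' = p1 & q' = q"
      by (rule cat_inj[OF c]; use ig ig' in \<open>simp add: integral_path_def\<close>)+
    ultimately show ?thesis using h by simp
  qed simp
qed

end

subsection \<open>Stretching\<close>

definition str :: "nat => (real => 'w::real_vector) => real => 'w" where
  "str N p = (%t. real N *\<^sub>R p t)"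

definition strw :: "nat => (bool \<times> 'j) list => (bool \<times> 'j) list" where
  "strw N u = concat (map (replicate N) u)"

context lets
begin

lemma fstep_chain_act:
  assumes "j \<in> J" "P 0 = p" "!!k. k < N ==> fstep alpha cor j (P k) (P (Suc k))"
  shows "act alpha cor (replicate N (True, j)) p = Some (P N)" "act alpha cor (replicate N (False, j)) (P N) = Some p"
proof -
  interpret letter alpha cor j by (rule lt[OF assms(1)])
  have "act alpha cor (replicate N (True, j)) p = Some (P N) & act alpha cor (replicate N (False, j)) (P N) = Some p"
    using assms(3)
  proof (induction N)
    case 0 thus ?case using assms(2) by simp
  next
    case (Suc N)
    hence IH: "act alpha cor (replicate N (True, j)) p = Some (P N)" "act alpha cor (replicate N (False, j)) (P N) = Some p" by auto
    have f: "fstep alpha cor j (P N) (P (Suc N))" using Suc by auto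
    have "replicate (Suc N) (True, j) = replicate N (True, j) @ [(True, j)]" by (simp add: replicate_append_same)
    hence "act alpha cor (replicate (Suc N) (True, j)) p = Some (P (Suc N))"
      using IH(1) fstep_facts(1)[OF f] by (simp only: act_append) (simp add: act1_def)
    moreover have "act alpha cor (replicate (Suc N) (False, j)) (P (Suc N)) = Some p"
      using IH(2) fstep_facts(2)[OF f] by (simp add: act1_def)
    ultimately show ?case by blast
  qed
  thus "act alpha cor (replicate N (True, j)) p = Some (P N)" "act alpha cor (replicate N (False, j)) (P N) = Some p" by auto
qed

text \<open>Stretching turns the rise from m to m + 1 into a rise by N, and one operator into N
  operators that cut it at its integer values.\<close>

lemma str_chain:
  assumes p: "integral_path J cor p" and j: "j \<in> J" and f: "fstep alpha cor j p q" and N: "0 < N"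
  shows "\<exists>P. P 0 = str N p & P N = str N q & (\<forall>k<N. fstep alpha cor j (P k) (P (Suc k)))"
proof -
  interpret letter alpha cor j by (rule lt[OF j])
  obtain m u v where F: "FS (%t. cor j (p t)) m u v" "q = Fmod alpha cor j m u v p" using f by (auto simp: fstep_def)
  have F': "m \<in> \<int>" "0 <= u" "u < v" "v <= 1" "cor j (p u) = m" "cor j (p v) = m + 1"
     "!!t. 0 <= t ==> t <= u ==> m <= cor j (p t)" "!!t t'. u <= t ==> t < t' ==> t' <= v ==> cor j (p t) < cor j (p t')"
     "!!t. v <= t ==> t <= 1 ==> m + 1 <= cor j (p t)" using F(1) unfolding FS_def by auto
  have cp: "clamped p" and "continuous_on {0..1} (%t. cor j (p t))" using p j by (auto simp: integral_path_def LI_def)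
  hence cuv: "continuous_on {u..v} (%t. cor j (p t))" using F' by (auto intro: continuous_on_subset)
  \<comment> \<open>\<open>T k\<close> will be the time at which the function has risen by k/N above
    its minimum.\<close>
  have "\<exists>t. u <= t & t <= v & cor j (p t) = m + real k / real N" if "k <= N" for k
    using IVT'[of "%t. cor j (p t)" u "m + real k / real N" v] cuv F' that N by (auto simp: field_simps)
  then obtain T where T: "!!k. k <= N ==> u <= T k & T k <= v & cor j (p (T k)) = m + real k / real N" by metis
  have mono: "cor j (p t) <= cor j (p t')" if "u <= t" "t <= t'" "t' <= v" for t t'
    using F'(8)[of t t'] that by (cases "t = t'") auto
  have inj: "t < t'" if "u <= t'" "t <= v" "cor j (p t) < cor j (p t')" for t t'
  proof (rule ccontr)
    assume "\<not> t < t'" hence "cor j (p t') <= cor j (p t)" using mono[of t' t] that by auto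
    thus False using that by simp
  qed
  have Tlt: "T k < T (Suc k)" if "k < N" for k
    using inj[of "T (Suc k)" "T k"] T[of k] T[of "Suc k"] that N by (auto simp: divide_strict_right_mono)
  have T0: "T 0 = u"
  proof (rule ccontr)
    assume "T 0 \<noteq> u" hence "cor j (p u) < cor j (p (T 0))" using F'(8)[of u "T 0"] T[of 0] by auto
    thus False using T[of 0] F' by simp
  qed
  have TN: "T N = v"
  proof (rule ccontr)
    assume "T N \<noteq> v" hence "cor j (p (T N)) < cor j (p v)" using F'(8)[of "T N" v] T[of N] by auto
    thus False using T[of N] F' N by simp
  qed
  \<comment> \<open>The state after k of the N operators: reflected between u and
    \<open>T k\<close>, and shifted by k times alpha_j afterwards.\<close>
  define P where "P k = (%t0. let t = clamp t0 in if t <= u then real N *\<^sub>R p t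
     else if t <= T k then real N *\<^sub>R p t - (real N * (cor j (p t) - m)) *\<^sub>R alpha j else real N *\<^sub>R p t - real k *\<^sub>R alpha j)" for k
  have Pc: "clamped (P k)" for k by (simp add: P_def clamped_def)
  have HP: "cor j (P k t) = (if t <= u then real N * cor j (p t) else if t <= T k then 2 * real N * m - real N * cor j (p t) else real N * cor j (p t) - 2 * real k)"
    if "0 <= t" "t <= 1" for k t using that by (auto simp: P_def two algebra_simps)
  have "fstep alpha cor j (P k) (P (Suc k))" if k: "k < N" for k
  proof -
    define M where "M = real N * m - real k"
    have Tk: "u <= T k" "T k < T (Suc k)" "T (Suc k) <= v" using T[of k] T[of "Suc k"] Tlt[OF k] k by auto
    have HTk: "real N * cor j (p (T k)) = real N * m + real k" "real N * cor j (p (T (Suc k))) = real N * m + real k + 1"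
      using T[of k] T[of "Suc k"] k N by (auto simp: field_simps)
    have PT: "cor j (P k (T k)) = M"
      using HP[of "T k" k] F' Tk HTk T0 by (cases "k = 0") (auto simp: M_def split: if_splits)
    have right: "cor j (P k t) = real N * cor j (p t) - 2 * real k" if t: "T k <= t" "t <= 1" for t
    proof (cases "t = T k")
      case True thus ?thesis using PT HTk(1) by (simp add: M_def)
    next
      case False
      hence "u < t" "T k < t" "0 <= t" using t Tk F'(2) by linarith+
      thus ?thesis using HP[of t k] t by simp
    qed
    have FS: "FS (%t. cor j (P k t)) M (T k) (T (Suc k))"
      unfolding FS_def
    proof (intro conjI allI impI)
      show "M \<in> \<int>" "0 <= T k" "T k < T (Suc k)" "T (Suc k) <= 1" using F' Tk by (auto simp: M_def)
      show "cor j (P k (T k)) = M" by (rule PT)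
      show "cor j (P k (T (Suc k))) = M + 1"
        using HP[of "T (Suc k)" k] F' Tk HTk by (auto simp: M_def)
      fix t assume t: "0 <= t & t <= T k"
      hence t1: "t <= 1" using Tk F' by linarith
      show "M <= cor j (P k t)"
      proof (cases "t <= u")
        case True
        hence "real N * m <= real N * cor j (p t)" using F'(7) t by (intro mult_left_mono) auto
        thus ?thesis using HP[of t k] t t1 True by (simp add: M_def)
      next
        case False
        hence "cor j (p t) <= cor j (p (T k))" using mono[of t "T k"] t Tk by auto
        hence "real N * cor j (p t) <= real N * m + real k" using HTk(1) by (metis mult_left_mono of_nat_0_le_iff)
        moreover have "cor j (P k t) = 2 * (real N * m) - real N * cor j (p t)" using HP[of t k] t t1 False by auto
        ultimately show ?thesis unfolding M_def by linarith
      qed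
    next
      fix t t' assume t: "T k <= t & t < t' & t' <= T (Suc k)"
      hence tt: "0 <= t" "t <= 1" "0 <= t'" "t' <= 1" using Tk F' by linarith+
      have "cor j (p t) < cor j (p t')" using F'(8)[of t t'] t Tk by auto
      hence "real N * cor j (p t) < real N * cor j (p t')" using N by simp
      thus "cor j (P k t) < cor j (P k t')"
        using right[of t] right[of t'] t tt by simp
    next
      fix t assume t: "T (Suc k) <= t & t <= 1"
      hence t0: "0 <= t" "T k < t" "u < t" using Tk F' by linarith+
      have "real N * m + real k + 1 <= real N * cor j (p t)"
      proof (cases "t <= v")
        case True
        hence "cor j (p (T (Suc k))) <= cor j (p t)" using mono[of "T (Suc k)" t] t Tk by auto
        thus ?thesis using HTk(2) by (metis mult_left_mono of_nat_0_le_iff)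
      next
        case False
        hence "real N * (m + 1) <= real N * cor j (p t)" using F'(9) t by (intro mult_left_mono) auto
        thus ?thesis using k by (simp add: algebra_simps)
      qed
      thus "M + 1 <= cor j (P k t)" using HP[of t k] t t0 by (simp add: M_def)
    qed
    have "Fmod alpha cor j M (T k) (T (Suc k)) (P k) = P (Suc k)"
    proof (rule clamped_eqI[OF Fmod_clamped(1) Pc])
      fix t :: real assume t: "0 <= t" "t <= 1"
      consider "t <= u" | "u < t" "t <= T k" | "u < t" "T k < t" "t <= T (Suc k)" | "u < t" "T (Suc k) < t" by linarith
      thus "Fmod alpha cor j M (T k) (T (Suc k)) (P k) t = P (Suc k) t"
      proof cases
        case 3
        have Hk: "cor j (P k t) = real N * cor j (p t) - 2 * real k" using right[of t] 3 t by simp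
        have Pk: "P k t = real N *\<^sub>R p t - real k *\<^sub>R alpha j" "P (Suc k) t = real N *\<^sub>R p t - (real N * (cor j (p t) - m)) *\<^sub>R alpha j"
          using 3 t by (auto simp: P_def)
        have sc: "real N * (cor j (p t) - m) = real k + (real N * cor j (p t) - 2 * real k - M)" by (simp add: M_def algebra_simps)
        have "Fmod alpha cor j M (T k) (T (Suc k)) (P k) t = P k t - (cor j (P k t) - M) *\<^sub>R alpha j" using 3 t by (simp add: Fmod_def)
        thus ?thesis unfolding Hk unfolding Pk sc scaleR_left_distrib by (simp only: diff_diff_add)
      qed (use t Tk in \<open>auto simp: Fmod_def P_def Let_def scaleR_left_distrib\<close>)
    qed
    thus ?thesis unfolding fstep_def using FS Pc by metis
  qed
  moreover have "P 0 = str N p"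
  proof (rule clamped_eqI[OF Pc])
    show "clamped (str N p)" using cp by (simp add: clamped_def str_def)
    fix t :: real assume "0 <= t" "t <= 1" thus "P 0 t = str N p t" using T0 by (simp add: P_def str_def)
  qed
  moreover have "P N = str N q"
  proof (rule clamped_eqI[OF Pc])
    show "clamped (str N q)" using Fmod_clamped(1)[of alpha cor j m u v p] unfolding F(2) by (simp add: clamped_def str_def)
    fix t :: real assume "0 <= t" "t <= 1" thus "P N t = str N q t" using TN unfolding F(2) by (auto simp: P_def str_def Fmod_def algebra_simps)
  qed
  ultimately show ?thesis by blast
qed

lemma str_act1:
  assumes g: "good J alpha cor p" and a: "snd a \<in> J" and N: "0 < N"
  shows "act alpha cor (replicate N a) (str N p) = map_option (str N) (act1 alpha cor a p)"
proof -
  obtain b j where ab: "a = (b, j)" by (cases a)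
  hence j: "j \<in> J" using a by simp
  interpret letter alpha cor j by (rule lt[OF j])
  note ip = good_integral[OF g] and m = integral_mval[OF good_integral[OF g] j]
  have p0: "p 0 = 0" using ip by (simp add: integral_path_def)
  obtain N' where N': "N = Suc N'" using N by (cases N) auto
  show ?thesis
  proof (cases "act1 alpha cor a p")
    case None
    have "act1 alpha cor a (str N p) = None"
    proof (cases b)
      case True
      hence e: "cor j (p 1) = mval cor j p" using None act1_f(2)[OF ip j] ab by simp
      have "f_root alpha cor j (str N p) = None"
        by (rule f_root_None[of "real N * mval cor j p"]) (use m e in \<open>auto simp: str_def intro: mult_left_mono\<close>)
      thus ?thesis using True ab by (simp add: act1_def)
    next
      case False
      hence e: "mval cor j p = 0" using None act1_e(2)[OF ip j] ab by simp
      have "e_root_re alpha cor j (str N p) = None"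
        by (rule e_root_None) (use m(2) e p0 in \<open>auto simp: str_def\<close>)
      thus ?thesis using False ab by (simp add: act1_def)
    qed
    thus ?thesis using None N' by simp
  next
    case (Some q)
    show ?thesis
    proof (cases b)
      case True
      hence f: "fstep alpha cor j p q" using Some act1_f(1)[OF ip j] ab by simp
      obtain P where P: "P 0 = str N p" "P N = str N q" "\<forall>k<N. fstep alpha cor j (P k) (P (Suc k))" using str_chain[OF ip j f N] by blast
      thus ?thesis using fstep_chain_act(1)[of j P "str N p" N] j P Some True ab by simp
    next
      case False
      hence f: "fstep alpha cor j q p" using Some act1_e(1)[OF ip j] ab by simp
      have iq: "integral_path J cor q" using good_integral[OF good_act1[OF g Some a]] .
      obtain P where P: "P 0 = str N q" "P N = str N p" "\<forall>k<N. fstep alpha cor j (P k) (P (Suc k))" using str_chain[OF iq j f N] by blast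
      thus ?thesis using fstep_chain_act(2)[of j P "str N q" N] j P Some False ab by simp
    qed
  qed
qed

lemma str_act:
  assumes N: "0 < N"
  shows "good J alpha cor p ==> snd ` set u \<subseteq> J ==> act alpha cor (strw N u) (str N p) = map_option (str N) (act alpha cor u p)"
proof (induction u arbitrary: p)
  case Nil thus ?case by (simp add: strw_def)
next
  case (Cons a u)
  have a: "snd a \<in> J" "snd ` set u \<subseteq> J" using Cons.prems by auto
  have e: "act alpha cor (strw N (a # u)) (str N p) = Option.bind (map_option (str N) (act1 alpha cor a p)) (act alpha cor (strw N u))"
    using str_act1[OF Cons.prems(1) a(1) N] by (simp add: strw_def act_append)
  show ?case
  proof (cases "act1 alpha cor a p")
    case (Some q)
    thus ?thesis unfolding e using Cons.IH[OF good_act1[OF Cons.prems(1) Some a(1)] a(2)] by simp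
  qed (simp add: e)
qed

text \<open>Repeating each letter N times turns a word on p into one on the stretched path with the
  same vanishing and the same stabilizer.\<close>

lemma Iso_str:
  assumes N: "0 < N" and g: "good J alpha cor p" "good J alpha cor p'" and I: "Iso J alpha cor (str N p) (str N p')"
  shows "Iso J alpha cor p p'"
  unfolding Iso_def
proof (intro allI impI)
  fix u :: "(bool \<times> 'j) list" assume u: "snd ` set u \<subseteq> J"
  have "snd ` set (strw N u) \<subseteq> J" using u by (auto simp: strw_def)
  hence h: "act alpha cor (strw N u) (str N p) = None \<longleftrightarrow> act alpha cor (strw N u) (str N p') = None"
    "act alpha cor (strw N u) (str N p) = Some (str N p) \<longleftrightarrow> act alpha cor (strw N u) (str N p') = Some (str N p')"
    using I unfolding Iso_def by blast+
  have inj: "str N x = str N y \<longleftrightarrow> x = y" for x y :: "real => 'w" using N by (auto simp: str_def fun_eq_iff)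
  show "(act alpha cor u p = None \<longleftrightarrow> act alpha cor u p' = None) & (act alpha cor u p = Some p \<longleftrightarrow> act alpha cor u p' = Some p')"
    using h unfolding str_act[OF N g(1) u] str_act[OF N g(2) u]
    by (cases "act alpha cor u p"; cases "act alpha cor u p'") (auto simp: inj)
qed

end

subsection \<open>Reparametrisation\<close>

locale reparam =
  fixes ph ps :: "real => real"
  assumes ph0: "ph 0 = 0" and ph1: "ph 1 = 1" and ph_mono: "!!t t'. 0 <= t ==> t < t' ==> t' <= 1 ==> ph t < ph t'"
    and ph_cont: "continuous_on {0..1} ph"
    and ps: "!!t. 0 <= t ==> t <= 1 ==> 0 <= ps t & ps t <= 1 & ph (ps t) = t"
begin

definition rp :: "(real => 'w) => real => 'w" where "rp p = (%t. p (ph (clamp t)))"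

lemma rp_clamped: "clamped (rp p)" by (simp add: clamped_def rp_def)

lemma ph_le: "0 <= t ==> t <= 1 ==> 0 <= t' ==> t' <= 1 ==> ph t <= ph t' \<longleftrightarrow> t <= t'"
  using ph_mono[of t t'] ph_mono[of t' t] by (cases t t' rule: linorder_cases) auto

lemma ph_lt: "0 <= t ==> t <= 1 ==> 0 <= t' ==> t' <= 1 ==> ph t < ph t' \<longleftrightarrow> t < t'"
  using ph_mono[of t t'] ph_mono[of t' t] by (cases t t' rule: linorder_cases) auto

lemma ph_rng: "0 <= t ==> t <= 1 ==> 0 <= ph t & ph t <= 1"
  using ph_le[of 0 t] ph_le[of t 1] ph0 ph1 by auto

lemma FS_rp:
  assumes "FS H m u v"
  shows "FS (%t. H (ph (clamp t))) m (ps u) (ps v)"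
proof -
  have F': "m \<in> \<int>" "0 <= u" "u < v" "v <= 1" "H u = m" "H v = m + 1"
     "!!t. 0 <= t ==> t <= u ==> m <= H t" "!!t t'. u <= t ==> t < t' ==> t' <= v ==> H t < H t'"
     "!!t. v <= t ==> t <= 1 ==> m + 1 <= H t" using assms unfolding FS_def by auto
  have pu: "0 <= ps u" "ps u <= 1" "ph (ps u) = u" and pv: "0 <= ps v" "ps v <= 1" "ph (ps v) = v" using ps[of u] ps[of v] F' by auto
  have uv: "ps u < ps v" using ph_lt[OF pu(1,2) pv(1,2)] pu pv F' by simp
  show ?thesis unfolding FS_def
  proof (intro conjI allI impI)
    show "H (ph (clamp (ps u))) = m" "H (ph (clamp (ps v))) = m + 1" "m \<in> \<int>" "0 <= ps u" "ps u < ps v" "ps v <= 1" using F' pu pv uv by auto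
    fix t assume t: "0 <= t & t <= ps u"
    hence "0 <= ph t" "ph t <= u" "t <= 1" using ph_rng[of t] ph_le[of t "ps u"] pu by auto
    thus "m <= H (ph (clamp t))" using F'(7) t by simp
  next
    fix t t' assume t: "ps u <= t & t < t' & t' <= ps v"
    hence b: "0 <= t" "t <= 1" "0 <= t'" "t' <= 1" using pu pv by auto
    have "u <= ph t" "ph t < ph t'" "ph t' <= v" using ph_le[of "ps u" t] ph_le[of t' "ps v"] ph_mono[of t t'] b t pu pv by auto
    thus "H (ph (clamp t)) < H (ph (clamp t'))" using F'(8) b by simp
  next
    fix t assume t: "ps v <= t & t <= 1"
    hence b: "0 <= t" using pv by simp
    have "v <= ph t" "ph t <= 1" using ph_le[of "ps v" t] ph_rng[of t] b t pv by auto
    thus "m + 1 <= H (ph (clamp t))" using F'(9) t b by simp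
  qed
qed

lemma LI_rp:
  assumes L: "LI H"
  shows "LI (%t. H (ph (clamp t)))"
proof -
  let ?K = "%t. H (ph (clamp t))"
  have cH: "continuous_on {0..1} H" and H: "H 0 = 0" "H 1 \<in> \<int>" using L by (auto simp: LI_def)
  have "continuous_on {0..1} (%t. H (ph t))"
    by (rule continuous_on_compose2[OF cH ph_cont]) (use ph_rng in auto)
  hence c: "continuous_on {0..1} ?K" by (rule continuous_on_cong[THEN iffD1, rotated -1]) auto
  have psx: "\<exists>t. 0 <= t & t <= 1 & ph t = x" if "0 <= x" "x <= 1" for x using ps[OF that] by blast
  have key: "H (ph r) \<in> \<int>" if r: "0 < e" "0 <= r - e" "r + e <= 1"
    and a: "!!t. r - e <= t ==> t <= r + e ==> H (ph r) <= H (ph t)"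
    and st: "(\<forall>t. r < t & t <= r + e --> H (ph r) < H (ph t)) \<or> (\<forall>t. r - e <= t & t < r --> H (ph r) < H (ph t))" for r e
  proof -
    define e' where "e' = min (ph r - ph (r - e)) (ph (r + e) - ph r)"
    have e': "0 < e'" "ph (r - e) <= ph r - e'" "ph r + e' <= ph (r + e)"
      using ph_mono[of "r - e" r] ph_mono[of r "r + e"] r by (auto simp: e'_def)
    have b: "0 <= ph r - e'" "ph r + e' <= 1" using e' ph_rng[of "r - e"] ph_rng[of "r + e"] r by auto
    have get: "\<exists>t. r - e <= t & t <= r + e & ph t = x & (t < r \<longleftrightarrow> x < ph r) & (r < t \<longleftrightarrow> ph r < x)" if x: "ph r - e' <= x" "x <= ph r + e'" for x
    proof -
      obtain t where t: "0 <= t" "t <= 1" "ph t = x" using psx[of x] x b by auto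
      have "ph (r - e) <= ph t" "ph t <= ph (r + e)" using x e' t by auto
      hence "r - e <= t" "t <= r + e" using ph_le[of "r - e" t] ph_le[of t "r + e"] t r by auto
      thus ?thesis using ph_lt[of t r] ph_lt[of r t] t r by auto
    qed
    have le: "H (ph r) <= H x" if "ph r - e' <= x" "x <= ph r + e'" for x using get[OF that] a by auto
    from st show ?thesis
    proof
      assume s: "\<forall>t. r < t & t <= r + e --> H (ph r) < H (ph t)"
      have 1: "\<forall>t. ph r - e' <= t & t <= ph r --> H (ph r) <= H t" using le e' by auto
      have "H (ph r) < H x" if "ph r < x" "x <= ph r + e'" for x
        using get[of x] that e' s by auto
      hence 2: "\<forall>x. ph r < x & x <= ph r + e' --> H (ph r) < H x" by blast
      show ?thesis using L e'(1) b 1 2 unfolding LI_def by blast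
    next
      assume s: "\<forall>t. r - e <= t & t < r --> H (ph r) < H (ph t)"
      have 1: "\<forall>t. ph r <= t & t <= ph r + e' --> H (ph r) <= H t" using le e' by auto
      have "H (ph r) < H x" if "ph r - e' <= x" "x < ph r" for x
        using get[of x] that e' s by auto
      hence 2: "\<forall>x. ph r - e' <= x & x < ph r --> H (ph r) < H x" by blast
      show ?thesis using L e'(1) b 1 2 unfolding LI_def by blast
    qed
  qed
  show ?thesis unfolding LI_def
  proof (intro conjI allI impI c)
    show "?K 0 = 0" "?K 1 \<in> \<int>" using H ph0 ph1 by auto
  next
    fix r e assume h: "0 < e & 0 <= r - e & r + e <= 1" "\<forall>t. r - e <= t & t <= r --> ?K r <= ?K t" "\<forall>t. r < t & t <= r + e --> ?K r < ?K t"
    have cl: "clamp t = t" if "r - e <= t" "t <= r + e" for t using that h(1) by simp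
    have "H (ph r) \<in> \<int>"
    proof (rule key[of e r])
      fix t assume t: "r - e <= t" "t <= r + e"
      have "?K r <= ?K t" using h t by (cases "t <= r") (auto intro: less_imp_le)
      thus "H (ph r) <= H (ph t)" using cl[OF t] cl[of r] h(1) by simp
    next
      have "H (ph r) < H (ph t)" if "r < t" "t <= r + e" for t
        using h(1) h(3)[rule_format, of t] cl[of t] cl[of r] that by simp
      thus "(\<forall>t. r < t & t <= r + e --> H (ph r) < H (ph t)) \<or> (\<forall>t. r - e <= t & t < r --> H (ph r) < H (ph t))" by blast
    qed (use h in auto)
    thus "?K r \<in> \<int>" using cl[of r] h(1) by simp
  next
    fix r e assume h: "0 < e & 0 <= r - e & r + e <= 1" "\<forall>t. r - e <= t & t < r --> ?K r < ?K t" "\<forall>t. r <= t & t <= r + e --> ?K r <= ?K t"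
    have cl: "clamp t = t" if "r - e <= t" "t <= r + e" for t using that h(1) by simp
    have "H (ph r) \<in> \<int>"
    proof (rule key[of e r])
      fix t assume t: "r - e <= t" "t <= r + e"
      have "?K r <= ?K t" using h t by (cases "t < r") (auto intro: less_imp_le)
      thus "H (ph r) <= H (ph t)" using cl[OF t] cl[of r] h(1) by simp
    next
      have "H (ph r) < H (ph t)" if "r - e <= t" "t < r" for t
        using h(1) h(2)[rule_format, of t] cl[of t] cl[of r] that by simp
      thus "(\<forall>t. r < t & t <= r + e --> H (ph r) < H (ph t)) \<or> (\<forall>t. r - e <= t & t < r --> H (ph r) < H (ph t))" by blast
    qed (use h in auto)
    thus "?K r \<in> \<int>" using cl[of r] h(1) by simp
  qed
qed

lemma rp_fstep:
  assumes "fstep alpha cor j p q"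
  shows "fstep alpha cor j (rp p) (rp q)"
proof -
  obtain m u v where F: "FS (%t. cor j (p t)) m u v" "q = Fmod alpha cor j m u v p" using assms by (auto simp: fstep_def)
  have uv: "0 <= u" "u < v" "v <= 1" using F by (auto simp: FS_def)
  have "FS (%t. cor j (rp p t)) m (ps u) (ps v)" using FS_rp[OF F(1)] by (simp add: rp_def)
  moreover have "rp q = Fmod alpha cor j m (ps u) (ps v) (rp p)"
  proof (rule clamped_eqI[OF rp_clamped Fmod_clamped(1)])
    fix t :: real assume t: "0 <= t" "t <= 1"
    have "ph t <= u \<longleftrightarrow> t <= ps u" "ph t <= v \<longleftrightarrow> t <= ps v" using ps[of u] ps[of v] uv ph_le[of t "ps u"] ph_le[of t "ps v"] t by auto
    moreover have "clamp (ph t) = ph t" using ph_rng[OF t] by simp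
    ultimately show "rp q t = Fmod alpha cor j m (ps u) (ps v) (rp p) t" using t unfolding F(2) by (simp add: rp_def Fmod_def Let_def)
  qed
  ultimately show ?thesis unfolding fstep_def using rp_clamped by metis
qed

end

context lets
begin

lemma act1_map:
  assumes i: "integral_path J cor p" "integral_path J cor (T p)" and a: "snd a \<in> J"
    and m: "!!j. j \<in> J ==> mval cor j (T p) = mval cor j p" "!!j. j \<in> J ==> cor j (T p 1) = cor j (p 1)"
    and f: "!!j q. j \<in> J ==> fstep alpha cor j p q ==> fstep alpha cor j (T p) (T q)" "!!j q. j \<in> J ==> fstep alpha cor j q p ==> fstep alpha cor j (T q) (T p)"
  shows "act1 alpha cor a (T p) = map_option T (act1 alpha cor a p)"
proof -
  obtain b j where ab: "a = (b, j)" by (cases a)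
  hence j: "j \<in> J" using a by simp
  show ?thesis
  proof (cases "act1 alpha cor a p")
    case None
    hence "act1 alpha cor a (T p) = None"
      using act1_f(2)[OF i(1) j] act1_f(2)[OF i(2) j] act1_e(2)[OF i(1) j] act1_e(2)[OF i(2) j] m[OF j] ab by (cases b) auto
    thus ?thesis using None by simp
  next
    case (Some q)
    hence "act1 alpha cor a (T p) = Some (T q)"
      using act1_f(1)[OF i(1) j] act1_f(1)[OF i(2) j] act1_e(1)[OF i(1) j] act1_e(1)[OF i(2) j] f[OF j] ab by (cases b) auto
    thus ?thesis using Some by simp
  qed
qed

text \<open>Root operators commute with increasing changes of time, so a word acts on the
  reparametrised path as it does on p.\<close>

lemma good_rp:
  assumes r: "reparam ph ps" and g: "good J alpha cor p"
  shows "good J alpha cor (reparam.rp ph p)"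
proof -
  interpret reparam ph ps by (rule r)
  have ir: "integral_path J cor (rp p)" if "integral_path J cor p" for p
  proof -
    have "LI (%t. cor j (rp p t))" if "j \<in> J" for j
      using LI_rp[of "%t. cor j (p t)"] that \<open>integral_path J cor p\<close> by (simp add: integral_path_def rp_def)
    thus ?thesis using that rp_clamped ph0 by (auto simp: integral_path_def rp_def)
  qed
  have m: "mval cor j (rp p) = mval cor j p" if i: "integral_path J cor p" and j: "j \<in> J" for p j
  proof (rule mval_eq)
    note mm = integral_mval[OF i j]
    show "mval cor j p \<in> \<int>" using mm by simp
    show "mval cor j p <= cor j (rp p t)" if "0 <= t" "t <= 1" for t using mm(2)[of "ph t"] ph_rng[OF that] that by (simp add: rp_def)
    obtain t where t: "0 <= t" "t <= 1" "cor j (p t) = mval cor j p" using mm(4) by auto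
    thus "\<exists>t. 0 <= t & t <= 1 & cor j (rp p t) = mval cor j p" using ps[OF t(1,2)] by (intro exI[of _ "ps t"]) (simp add: rp_def)
  qed
  have rp1: "rp p 1 = p 1" for p :: "real => 'w" by (simp add: rp_def ph1)
  have a1: "act1 alpha cor a (rp p) = map_option rp (act1 alpha cor a p)" if i: "integral_path J cor p" and a: "snd a \<in> J" for p a
    by (rule act1_map[where T=rp and p=p and a=a, OF i ir[OF i] a]) (use m[OF i] rp_fstep rp1 in auto)
  have "good J alpha cor p ==> snd ` set u \<subseteq> J ==> act alpha cor u (rp p) = Some q ==> integral_path J cor q" for u p q
  proof (induction u arbitrary: p)
    case Nil thus ?case using ir good_integral by fastforce
  next
    case (Cons a u)
    have a: "snd a \<in> J" "snd ` set u \<subseteq> J" using Cons.prems by auto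
    obtain p' where p': "act1 alpha cor a p = Some p'" "act alpha cor u (rp p') = Some q"
      using Cons.prems a1[OF good_integral[OF Cons.prems(1)] a(1)] by (auto simp: bind_eq_Some_conv)
    thus ?case using Cons.IH[OF good_act1[OF Cons.prems(1) p'(1) a(1)] a(2)] by blast
  qed
  thus ?thesis unfolding good_def using g unfolding good_def by blast
qed

end

subsection \<open>Deformation\<close>

lemma int_const:
  fixes f :: "real => real"
  assumes c: "continuous_on {0..1} f" and z: "!!x. 0 <= x ==> x <= 1 ==> f x \<in> \<int>" and x: "0 <= x" "x <= 1"
  shows "f x = f 0"
proof (rule ccontr)
  assume ne: "f x \<noteq> f 0"
  have cx: "continuous_on {0..x} f" using c x by (auto intro: continuous_on_subset)
  have half: "f 0 + 1/2 \<notin> \<int>" "f x + 1/2 \<notin> \<int>"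
  proof -
    have "y + 1/2 \<notin> \<int>" if "y \<in> \<int>" for y :: real
    proof
      assume "y + 1/2 \<in> \<int>"
      hence "(y + 1/2) - y \<in> \<int>" using that Ints_diff by blast
      hence "(1/2 :: real) \<in> \<int>" by simp
      then obtain n :: int where "(1/2 :: real) = of_int n" by (auto elim: Ints_cases)
      hence "real_of_int (2 * n) = 1" by simp
      hence "2 * n = 1" by (metis of_int_eq_1_iff)
      thus False by presburger
    qed
    thus "f 0 + 1/2 \<notin> \<int>" "f x + 1/2 \<notin> \<int>" using z[of 0] z[OF x] by auto
  qed
  consider "f 0 < f x" | "f x < f 0" using ne by linarith
  thus False
  proof cases
    case 1
    hence "f 0 + 1 <= f x" using Ints_less_add1 z[of 0] z[OF x] by simp
    then obtain y where "0 <= y" "y <= x" "f y = f 0 + 1/2" using IVT'[of f 0 "f 0 + 1/2" x] cx x by auto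
    thus False using z[of y] half x by simp
  next
    case 2
    hence "f x + 1 <= f 0" using Ints_less_add1 z[of 0] z[OF x] by simp
    then obtain y where "0 <= y" "y <= x" "f y = f x + 1/2" using IVT2'[of f x "f x + 1/2" 0] cx x by auto
    thus False using z[of y] half x by simp
  qed
qed

definition near :: "('j => 'w => real) => 'j => real => (real => 'w) => (real => 'w) => bool" where
  "near cor j e p q \<longleftrightarrow> (\<forall>t. 0 <= t & t <= 1 --> \<bar>cor j (p t) - cor j (q t)\<bar> <= e)"

text \<open>The weight space carries no topology; a family of paths is called continuous when its
  pairings with the coroots in J vary continuously in x, uniformly in time. This is all the root
  operators can see.\<close>

definition CF :: "'j set => ('j => 'w => real) => (real => real => 'w) => bool" where
  "CF J cor P \<longleftrightarrow> (\<forall>j\<in>J. \<forall>x. 0 <= x & x <= 1 --> (\<forall>e>0. \<exists>d>0. \<forall>y. 0 <= y & y <= 1 & \<bar>y - x\<bar> < d --> near cor j e (P y) (P x)))"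

lemma CF_cont:
  assumes "CF J cor P" "j \<in> J" and f: "!!x y e. 0 <= x ==> x <= 1 ==> 0 <= y ==> y <= 1 ==> near cor j e (P y) (P x) ==> \<bar>f y - f x\<bar> <= (e::real)"
  shows "continuous_on {0..1} f"
  unfolding continuous_on_def tendsto_iff eventually_at
proof (intro ballI allI impI)
  fix x e :: real assume x: "x \<in> {0..1}" and e: "0 < e"
  then obtain d where d: "d > 0" "!!y. 0 <= y ==> y <= 1 ==> \<bar>y - x\<bar> < d ==> near cor j (e/2) (P y) (P x)"
    using assms(1,2) unfolding CF_def by (metis atLeastAtMost_iff half_gt_zero)
  have "dist (f y) (f x) < e" if "y \<in> {0..1}" "dist y x < d" for y
  proof -
    have "\<bar>f y - f x\<bar> <= e / 2" using f[of x y "e/2"] d(2)[of y] x that by (simp add: dist_real_def)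
    thus ?thesis using e by (simp add: dist_real_def)
  qed
  thus "\<exists>d>0. \<forall>y\<in>{0..1}. y \<noteq> x & dist y x < d --> dist (f y) (f x) < e" using d(1) by blast
qed

context lets
begin

text \<open>Minima depend continuously on the path and are integers, so they are constant along the
  family; likewise the pairings of the endpoints.\<close>

lemma CF_mval:
  assumes g: "\<forall>x. 0 <= x & x <= 1 --> good J alpha cor (P x)" and c: "CF J cor P" and j: "j \<in> J" and x: "0 <= x" "x <= 1"
  shows "mval cor j (P x) = mval cor j (P 0)" "cor j (P x 1) = cor j (P 0 1)"
proof -
  have i: "integral_path J cor (P x)" if "0 <= x" "x <= 1" for x using g that good_integral by blast
  have "continuous_on {0..1} (%x. mval cor j (P x))"
  proof (rule CF_cont[OF c j])
    fix x y e :: real assume b: "0 <= x" "x <= 1" "0 <= y" "y <= 1" and n: "near cor j e (P y) (P x)"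
    note mx = integral_mval[OF i[OF b(1,2)] j] and my = integral_mval[OF i[OF b(3,4)] j]
    obtain t t' where t: "0 <= t" "t <= 1" "cor j (P x t) = mval cor j (P x)" and t': "0 <= t'" "t' <= 1" "cor j (P y t') = mval cor j (P y)"
      using mx(4) my(4) by auto
    have "\<bar>cor j (P y t) - cor j (P x t)\<bar> <= e" "\<bar>cor j (P y t') - cor j (P x t')\<bar> <= e" using n t t' by (auto simp: near_def)
    thus "\<bar>mval cor j (P y) - mval cor j (P x)\<bar> <= e" using mx(2)[OF t'(1,2)] my(2)[OF t(1,2)] t(3) t'(3) by linarith
  qed
  thus "mval cor j (P x) = mval cor j (P 0)"
    using int_const[of "%x. mval cor j (P x)" x] integral_mval(1)[OF i j] x by blast
  have "continuous_on {0..1} (%x. cor j (P x 1))"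
    by (rule CF_cont[OF c j]) (auto simp: near_def)
  thus "cor j (P x 1) = cor j (P 0 1)"
    using int_const[of "%x. cor j (P x 1)" x] integral_mval(5)[OF i j] x by blast
qed

definition Kset :: "bool => real => real set" where "Kset b t = (if b then {t..1} else {0..t})"

text \<open>The cut-off functions of the root operators are minima over a half-interval, hence 1-Lipschitz in the sup norm.\<close>
lemma act1_cut:
  assumes i: "integral_path J cor p" and j: "j \<in> J" and a: "act1 alpha cor (b, j) p = Some q"
  shows "\<exists>g. \<forall>t. 0 <= t & t <= 1 --> q t = p t + (if b then 0 else 1) *\<^sub>R alpha j - g t *\<^sub>R alpha j &
     (\<forall>r\<in>Kset b t. g t <= min 1 (cor j (p r) - mval cor j p)) & (\<exists>r\<in>Kset b t. g t = min 1 (cor j (p r) - mval cor j p))"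
proof -
  interpret letter alpha cor j by (rule lt[OF j])
  show ?thesis
  proof (cases b)
    case True
    hence f: "fstep alpha cor j p q" using a act1_f(1)[OF i j] by simp
    obtain m u v where F: "FS (%t. cor j (p t)) m u v" "q = Fmod alpha cor j m u v p" using f by (auto simp: fstep_def)
    have mm: "mval cor j p = m" using FS_mval[of cor j p m u v] F by simp
    have F': "0 <= u" "u < v" "v <= 1" "cor j (p u) = m" "cor j (p v) = m + 1"
     "!!t t'. u <= t ==> t < t' ==> t' <= v ==> cor j (p t) < cor j (p t')"
     "!!t. v <= t ==> t <= 1 ==> m + 1 <= cor j (p t)" using F(1) unfolding FS_def by auto
    have mono: "cor j (p t) <= cor j (p t')" if "u <= t" "t <= t'" "t' <= v" for t t'
      using F'(6)[of t t'] that by (cases "t = t'") auto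
    have lb: "m <= cor j (p t)" if "0 <= t" "t <= 1" for t using FS_lb[OF F(1)] that by simp
    define g where "g t = (if t <= u then 0 else if t <= v then cor j (p t) - m else 1)" for t
    show ?thesis
    proof (intro exI[of _ g] allI impI conjI)
      fix t :: real assume t: "0 <= t & t <= 1"
      show "q t = p t + (if b then 0 else 1) *\<^sub>R alpha j - g t *\<^sub>R alpha j" using True t unfolding F(2) by (auto simp: Fmod_def g_def)
      show "\<forall>r\<in>Kset b t. g t <= min 1 (cor j (p r) - mval cor j p)"
      proof
        fix r assume "r \<in> Kset b t"
        hence r: "t <= r" "r <= 1" using True by (auto simp: Kset_def)
        have "g t <= 1" using mono[of t v] F' by (auto simp: g_def)
        moreover have "g t <= cor j (p r) - m"
        proof -
          consider "t <= u" | "u < t" "t <= v" "r <= v" | "u < t" "t <= v" "v <= r" | "v < t" by linarith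
          thus ?thesis
          proof cases
            case 1 thus ?thesis using lb[of r] r t by (simp add: g_def)
          next
            case 2 thus ?thesis using mono[of t r] r by (simp add: g_def)
          next
            case 3 thus ?thesis using mono[of t v] F'(5) F'(7)[of r] r by (simp add: g_def)
          next
            case 4 thus ?thesis using F'(7)[of r] F'(2) r by (simp add: g_def)
          qed
        qed
        ultimately show "g t <= min 1 (cor j (p r) - mval cor j p)" using mm by simp
      qed
      consider "t <= u" | "u < t" "t <= v" | "v < t" by linarith
      thus "\<exists>r\<in>Kset b t. g t = min 1 (cor j (p r) - mval cor j p)"
      proof cases
        case 1 thus ?thesis using True mm F' by (intro bexI[of _ u]) (auto simp: g_def Kset_def)
      next
        case 2 thus ?thesis using True mm F' mono[of t v] t by (intro bexI[of _ t]) (auto simp: g_def Kset_def)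
      next
        case 3 thus ?thesis using True mm F'(2) F'(7)[of t] t by (intro bexI[of _ t]) (auto simp: g_def Kset_def)
      qed
    qed
  next
    case False
    hence f: "fstep alpha cor j q p" using a act1_e(1)[OF i j] by simp
    then obtain m' u v where F0: "FS (%t. cor j (q t)) m' u v" "p = Fmod alpha cor j m' u v q" "clamped q" by (auto simp: fstep_def)
    define m where "m = m' - 1"
    have F: "ES (%t. cor j (p t)) m u v" using FS_ES[OF F0(1)] F0(2) by (simp add: m_def)
    have qe: "q = Emod alpha cor j m u v p" using Emod_Fmod[OF F0(1,3)] F0(2) by (simp add: m_def)
    have mm: "mval cor j p = m" using ES_mval[of cor j p m u v] F by simp
    have F': "0 <= u" "u < v" "v <= 1" "cor j (p u) = m + 1" "cor j (p v) = m"
     "!!t t'. u <= t ==> t < t' ==> t' <= v ==> cor j (p t') < cor j (p t)"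
     "!!t. 0 <= t ==> t <= u ==> m + 1 <= cor j (p t)" using F unfolding ES_def by auto
    have mono: "cor j (p t') <= cor j (p t)" if "u <= t" "t <= t'" "t' <= v" for t t'
      using F'(6)[of t t'] that by (cases "t = t'") auto
    have lb: "m <= cor j (p t)" if "0 <= t" "t <= 1" for t using ES_lb[OF F] that by simp
    define g where "g t = (if t <= u then 1 else if t <= v then cor j (p t) - m else 0)" for t
    show ?thesis
    proof (intro exI[of _ g] allI impI conjI)
      fix t :: real assume t: "0 <= t & t <= 1"
      show "q t = p t + (if b then 0 else 1) *\<^sub>R alpha j - g t *\<^sub>R alpha j"
        using False t unfolding qe by (auto simp: Emod_def g_def algebra_simps)
      show "\<forall>r\<in>Kset b t. g t <= min 1 (cor j (p r) - mval cor j p)"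
      proof
        fix r assume "r \<in> Kset b t"
        hence r: "0 <= r" "r <= t" using False by (auto simp: Kset_def)
        have "g t <= 1" using mono[of u t] F' by (auto simp: g_def)
        moreover have "g t <= cor j (p r) - m"
        proof -
          consider "v < t" | "u < t" "t <= v" "u <= r" | "u < t" "t <= v" "r <= u" | "t <= u" by linarith
          thus ?thesis
          proof cases
            case 1 thus ?thesis using lb[of r] r t F'(2) by (simp add: g_def)
          next
            case 2 thus ?thesis using mono[of r t] r by (simp add: g_def)
          next
            case 3 thus ?thesis using mono[of u t] F'(4) F'(7)[of r] r by (simp add: g_def)
          next
            case 4 thus ?thesis using F'(7)[of r] r by (simp add: g_def)
          qed
        qed
        ultimately show "g t <= min 1 (cor j (p r) - mval cor j p)" using mm by simp
      qed
      consider "t <= u" | "u < t" "t <= v" | "v < t" by linarith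
      thus "\<exists>r\<in>Kset b t. g t = min 1 (cor j (p r) - mval cor j p)"
      proof cases
        case 1 thus ?thesis using False mm F'(7)[of t] t by (intro bexI[of _ t]) (auto simp: g_def Kset_def)
      next
        case 2 thus ?thesis using False mm F' mono[of u t] t by (intro bexI[of _ t]) (auto simp: g_def Kset_def)
      next
        case 3 thus ?thesis using False mm F' t by (intro bexI[of _ v]) (auto simp: g_def Kset_def)
      qed
    qed
  qed
qed

text \<open>Vanishing of an operator is decided by the minimum and the endpoint pairing, both
  constant along the family. Otherwise the cut functions of nearby members are close by
  \<open>act1_cut\<close>, so the images form a continuous family again.\<close>

lemma deform1:
  assumes g: "\<forall>x. 0 <= x & x <= 1 --> good J alpha cor (P x)" and c: "CF J cor P" and a: "snd a \<in> J"
  shows "(\<forall>x. 0 <= x & x <= 1 --> act1 alpha cor a (P x) = None) \<or>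
    (\<exists>Q. (\<forall>x. 0 <= x & x <= 1 --> act1 alpha cor a (P x) = Some (Q x)) & CF J cor Q)"
proof -
  obtain b j where ab: "a = (b, j)" by (cases a)
  hence j: "j \<in> J" using a by simp
  have i: "integral_path J cor (P x)" if "0 <= x" "x <= 1" for x using g that good_integral by blast
  define m where "m = mval cor j (P 0)"
  have m: "mval cor j (P x) = m" "cor j (P x 1) = cor j (P 0 1)" if "0 <= x" "x <= 1" for x
    using CF_mval[OF g c j that] by (auto simp: m_def)
  define N where "N \<longleftrightarrow> (if b then cor j (P 0 1) = m else m = 0)"
  have N: "act1 alpha cor a (P x) = None \<longleftrightarrow> N" if "0 <= x" "x <= 1" for x
    using act1_f(2)[OF i[OF that] j] act1_e(2)[OF i[OF that] j] m[OF that] ab by (auto simp: N_def)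
  show ?thesis
  proof (cases N)
    case True thus ?thesis using N by blast
  next
    case False
    define Q where "Q x = the (act1 alpha cor a (P x))" for x
    have Q: "act1 alpha cor a (P x) = Some (Q x)" if "0 <= x" "x <= 1" for x using N[OF that] False by (auto simp: Q_def)
    have "\<exists>g. \<forall>t. 0 <= t & t <= 1 --> Q x t = P x t + (if b then 0 else 1) *\<^sub>R alpha j - g t *\<^sub>R alpha j &
       (\<forall>r\<in>Kset b t. g t <= min 1 (cor j (P x r) - m)) & (\<exists>r\<in>Kset b t. g t = min 1 (cor j (P x r) - m))" if "0 <= x" "x <= 1" for x
      using act1_cut[OF i[OF that] j, of b "Q x"] Q[OF that] ab m(1)[OF that] by simp
    then obtain G where G: "!!x t. 0 <= x ==> x <= 1 ==> 0 <= t ==> t <= 1 ==> Q x t = P x t + (if b then 0 else 1) *\<^sub>R alpha j - G x t *\<^sub>R alpha j &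
       (\<forall>r\<in>Kset b t. G x t <= min 1 (cor j (P x r) - m)) & (\<exists>r\<in>Kset b t. G x t = min 1 (cor j (P x r) - m))" by metis
    \<comment> \<open>The minimum defining \<open>G x\<close> is bounded by its value at the point
      where the one for \<open>G y\<close> is attained; exchanging x and y gives the other
      bound.\<close>
    have half: "G x t <= G y t + e" if xy: "0 <= x" "x <= 1" "0 <= y" "y <= 1" and n: "near cor j e (P y) (P x) \<or> near cor j e (P x) (P y)" and t: "0 <= t" "t <= 1" for x y e t
    proof -
      obtain r where r: "r \<in> Kset b t" "G y t = min 1 (cor j (P y r) - m)" using G[OF xy(3,4) t] by blast
      have "G x t <= min 1 (cor j (P x r) - m)" using G[OF xy(1,2) t] r(1) by blast
      moreover have "0 <= r" "r <= 1" using r(1) t by (auto simp: Kset_def split: if_splits)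
      hence "\<bar>cor j (P y r) - cor j (P x r)\<bar> <= e" using n by (auto simp: near_def abs_minus_commute)
      ultimately show ?thesis using r(2) by linarith
    qed
    have "CF J cor Q" unfolding CF_def
    proof (intro ballI allI impI)
      fix k and x e :: real assume k: "k \<in> J" and x: "0 <= x & x <= 1" and e: "0 < e"
      interpret K: letter alpha cor k by (rule lt[OF k])
      define A where "A = \<bar>cor k (alpha j)\<bar> + 1"
      have A: "0 < A" by (simp add: A_def)
      have "0 < e / 2" "0 < e / (2 * A)" using e A by auto
      then obtain d1 d2 where d: "d1 > 0" "d2 > 0"
        "!!y. 0 <= y ==> y <= 1 ==> \<bar>y - x\<bar> < d1 ==> near cor k (e/2) (P y) (P x)"
        "!!y. 0 <= y ==> y <= 1 ==> \<bar>y - x\<bar> < d2 ==> near cor j (e / (2 * A)) (P y) (P x)"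
        using c x k j unfolding CF_def by metis
      have "near cor k e (Q y) (Q x)" if y: "0 <= y" "y <= 1" "\<bar>y - x\<bar> < min d1 d2" for y
        unfolding near_def
      proof (intro allI impI)
        fix t :: real assume t: "0 <= t & t <= 1"
        have n: "near cor j (e / (2 * A)) (P y) (P x)" and n1: "near cor k (e/2) (P y) (P x)" using d y by auto
        have "\<bar>G y t - G x t\<bar> <= e / (2 * A)"
          using half[of x y "e / (2 * A)" t] half[of y x "e / (2 * A)" t] n x y t by linarith
        hence "\<bar>G y t - G x t\<bar> * \<bar>cor k (alpha j)\<bar> <= e / (2 * A) * A" by (intro mult_mono) (auto simp: A_def)
        hence g: "\<bar>(G y t - G x t) * cor k (alpha j)\<bar> <= e / 2" using A by (simp add: abs_mult)
        have "\<bar>cor k (P y t) - cor k (P x t)\<bar> <= e / 2" using n1 t by (auto simp: near_def)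
        moreover have "cor k (Q y t) - cor k (Q x t) = (cor k (P y t) - cor k (P x t)) - (G y t - G x t) * cor k (alpha j)"
          using G[of y t] G[of x t] x y t by (simp add: left_diff_distrib)
        ultimately show "\<bar>cor k (Q y t) - cor k (Q x t)\<bar> <= e" using g by linarith
      qed
      thus "\<exists>d>0. \<forall>y. 0 <= y & y <= 1 & \<bar>y - x\<bar> < d --> near cor k e (Q y) (Q x)" using d(1,2) by (intro exI[of _ "min d1 d2"]) auto
    qed
    thus ?thesis using Q by blast
  qed
qed

lemma deform:
  assumes "\<forall>x. 0 <= x & x <= 1 --> good J alpha cor (P x)" "CF J cor P" "snd ` set u \<subseteq> J"
  shows "(\<forall>x. 0 <= x & x <= 1 --> act alpha cor u (P x) = None) \<or>
    (\<exists>Q. (\<forall>x. 0 <= x & x <= 1 --> act alpha cor u (P x) = Some (Q x)) & CF J cor Q)"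
  using assms
proof (induction u arbitrary: P)
  case Nil thus ?case by auto
next
  case (Cons a u)
  have a: "snd a \<in> J" "snd ` set u \<subseteq> J" using Cons.prems by auto
  from deform1[OF Cons.prems(1,2) a(1)] show ?case
  proof (elim disjE exE conjE)
    assume "\<forall>x. 0 <= x & x <= 1 --> act1 alpha cor a (P x) = None" thus ?thesis by simp
  next
    fix Q assume Q: "\<forall>x. 0 <= x & x <= 1 --> act1 alpha cor a (P x) = Some (Q x)" "CF J cor Q"
    have "\<forall>x. 0 <= x & x <= 1 --> good J alpha cor (Q x)" using good_act1[OF _ _ a(1)] Cons.prems(1) Q(1) by blast
    from Cons.IH[OF this Q(2) a(2)] show ?thesis using Q(1) by simp
  qed
qed

text \<open>A word moves the endpoint by its weight at both ends of the family, and minima are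
  constant along it. So the moved path has minima 0 and the old endpoint at x = 0 iff it does at x =
  1. \<open>U0\<close> and \<open>U1\<close> say that these data single out the starting path among
  those reachable from it.\<close>

lemma deform_Iso:
  assumes g: "\<forall>x. 0 <= x & x <= 1 --> good J alpha cor (P x)" and c: "CF J cor P"
    and d: "!!j. j \<in> J ==> mval cor j (P 0) = 0"
    and U0: "!!u q. snd ` set u \<subseteq> J ==> act alpha cor u (P 0) = Some q ==> (!!j. j \<in> J ==> mval cor j q = 0) ==> q 1 = P 0 1 ==> q = P 0"
    and U1: "!!u q. snd ` set u \<subseteq> J ==> act alpha cor u (P 1) = Some q ==> (!!j. j \<in> J ==> mval cor j q = 0) ==> q 1 = P 1 1 ==> q = P 1"
  shows "Iso J alpha cor (P 0) (P 1)"
  unfolding Iso_def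
proof (intro allI impI)
  fix u :: "(bool \<times> 'j) list" assume u: "snd ` set u \<subseteq> J"
  from deform[OF g c u] show "(act alpha cor u (P 0) = None \<longleftrightarrow> act alpha cor u (P 1) = None) & (act alpha cor u (P 0) = Some (P 0) \<longleftrightarrow> act alpha cor u (P 1) = Some (P 1))"
  proof (elim disjE exE conjE)
    assume "\<forall>x. 0 <= x & x <= 1 --> act alpha cor u (P x) = None" thus ?thesis by simp
  next
    fix Q assume Q: "\<forall>x. 0 <= x & x <= 1 --> act alpha cor u (P x) = Some (Q x)" "CF J cor Q"
    have q: "act alpha cor u (P 0) = Some (Q 0)" "act alpha cor u (P 1) = Some (Q 1)" using Q(1) by auto
    have gQ: "\<forall>x. 0 <= x & x <= 1 --> good J alpha cor (Q x)" 
    proof (intro allI impI)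
      fix x assume x: "0 <= x & x <= (1::real)"
      show "good J alpha cor (Q x)" by (rule good_act[OF g[rule_format, OF x] Q(1)[rule_format, OF x] u])
    qed
    have m: "mval cor j (Q 1) = mval cor j (Q 0)" if "j \<in> J" for j using CF_mval(1)[OF gQ Q(2) that, of 1] by simp
    have m1: "mval cor j (P 1) = 0" if "j \<in> J" for j using CF_mval(1)[OF g c that, of 1] d[OF that] by simp
    have e: "Q 0 1 = P 0 1 + wtu alpha u" "Q 1 1 = P 1 1 + wtu alpha u" using act_end[OF _ u q(1)] act_end[OF _ u q(2)] g by auto
    have "Q 0 = P 0 \<longleftrightarrow> Q 1 = P 1"
    proof
      assume "Q 0 = P 0" thus "Q 1 = P 1" using U1[OF u q(2)] m d e by simp
    next
      assume "Q 1 = P 1" thus "Q 0 = P 0" using U0[OF u q(1)] m m1 e by simp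
    qed
    thus ?thesis using q by simp
  qed
qed

text \<open>The zero path has minimum and endpoint 0 and admits no operator, so every word acts on
  the left factor.\<close>

lemma Iso_cat_zero:
  assumes c: "0 < c" "c < 1" and g: "good J alpha cor p" and z: "good J alpha cor (%t. 0)"
  shows "Iso J alpha cor (cat c p (%t. 0)) p"
    "snd ` set u \<subseteq> J ==> act alpha cor u (cat c p (%t. 0)) = map_option (%q. cat c q (%t. 0)) (act alpha cor u p)"
proof -
  let ?z = "%t::real. 0 :: 'w"
  have A: "good J alpha cor p ==> snd ` set u \<subseteq> J ==> act alpha cor u (cat c p ?z) = map_option (%q. cat c q ?z) (act alpha cor u p)" for u p
  proof (induction u arbitrary: p)
    case (Cons a u)
    have a: "snd a \<in> J" "snd ` set u \<subseteq> J" using Cons.prems by auto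
    obtain b j where ab: "a = (b, j)" by (cases a)
    hence j: "j \<in> J" using a by simp
    interpret letter alpha cor j by (rule lt[OF j])
    note mp = integral_mval[OF good_integral[OF Cons.prems(1)] j] and mz = integral_mval[OF good_integral[OF z] j]
    have m0: "mval cor j ?z = 0" by (rule mval_eq) (auto intro: exI[of _ 0])
    have nz: "act1 alpha cor (True, j) ?z = None" using act1_f(2)[OF good_integral[OF z] j] m0 by simp
    have "act1 alpha cor a (cat c p ?z) = map_option (%q. cat c q ?z) (act1 alpha cor a p)"
    proof (cases "b & \<not> mval cor j p < cor j (p 1)")
      case True
      hence "act1 alpha cor (True, j) p = None" using act1_f(2)[OF good_integral[OF Cons.prems(1)] j] mp(6) by auto
      thus ?thesis using act1_cat[OF c Cons.prems(1) z j, of b] m0 nz ab True by simp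
    next
      case False
      thus ?thesis using act1_cat[OF c Cons.prems(1) z j, of b] m0 ab mp(6) by auto
    qed
    thus ?case using Cons.IH[OF good_act1[OF Cons.prems(1) _ a(1)] a(2)] by (cases "act1 alpha cor a p") auto
  qed simp
  thus "snd ` set u \<subseteq> J ==> act alpha cor u (cat c p ?z) = map_option (%q. cat c q ?z) (act alpha cor u p)" using g by blast
  show "Iso J alpha cor (cat c p ?z) p" unfolding Iso_def
  proof (intro allI impI)
    fix u :: "(bool \<times> 'j) list" assume u: "snd ` set u \<subseteq> J"
    show "(act alpha cor u (cat c p ?z) = None \<longleftrightarrow> act alpha cor u p = None) & (act alpha cor u (cat c p ?z) = Some (cat c p ?z) \<longleftrightarrow> act alpha cor u p = Some p)"
    proof (cases "act alpha cor u p")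
      case (Some q)
      have "clamped q" "clamped p" using good_integral[OF good_act[OF g Some u]] good_integral[OF g] by (auto simp: integral_path_def)
      hence "cat c q ?z = cat c p ?z \<longleftrightarrow> q = p" using cat_inj[OF c, of q p ?z ?z] by (simp add: clamped_def)
      thus ?thesis using A[OF g u] Some by simp
    qed (use A[OF g u] in simp)
  qed
qed

end

section \<open>Extremal weights and Kac--Moody data\<close>

context rdat
begin

text \<open>A letter with positive pairing prepends a chain step, for a = 1 admissible by
  integrality; a letter with negative pairing is absorbed by \<open>ach_minus\<close>.\<close>

lemma real_word:
  assumes lam: "!!i. i \<in> R ==> cor i lam >= 0 & cor i lam \<in> \<int>" and "set w \<subseteq> R"
  shows "W w lam \<in> orb lam & ach lam 1 (W w lam) lam & (\<forall>i\<in>R. cor i (W w lam) \<in> \<int>)"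
  using assms(2)
proof (induction w)
  case Nil thus ?case using lam ach_refl Worbit.base by auto
next
  case (Cons i w)
  define x where "x = W w lam"
  have i: "i \<in> R" and IH: "x \<in> orb lam" "ach lam 1 x lam" "!!j. j \<in> R ==> cor j x \<in> \<int>" using Cons by (auto simp: x_def)
  have "cor j (s i x) \<in> \<int>" if "j \<in> R" for j
  proof -
    have "cor j (s i x) = cor j x - cor i x * cor j (alpha i)" using RI[OF that] by (simp add: refl_def)
    moreover have "cor j (alpha i) \<in> \<int>" using that i corZ[of j i] by (simp add: R_def)
    ultimately show ?thesis using IH(3) that i by simp
  qed
  moreover consider "cor i x > 0" | "cor i x = 0" | "cor i x < 0" by linarith
  hence "ach lam 1 (s i x) lam"
  proof cases
    case 1
    hence "st lam 1 (s i x) x" using st_simple[OF IH(1) i] IH(3)[OF i] by auto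
    thus ?thesis using IH(2) st_ach ach_trans by blast
  next
    case 2 thus ?thesis using IH by (simp add: refl_def)
  next
    case 3 thus ?thesis using ach_minus IH(2) i lam by blast
  qed
  ultimately show ?case using orb_s[OF IH(1) i] by (simp add: x_def)
qed

end

locale kdat = rdat +
  assumes all_real: "i \<in> I ==> A i i = 2"
begin

lemma R_I: "R = I" using all_real by (auto simp: R_def)

end

sublocale kdat \<subseteq> idat
  by unfold_locales (use corZ all_real d_pos d_sym cor2 in auto)

sublocale kdat \<subseteq> L: lets I alpha cor
  by unfold_locales (use lin_cor cor2 all_real in auto)

context kdat
begin

lemma GLS_integral: "dom lam ==> p \<in> Bp lam ==> integral_path I cor p"
  unfolding integral_path_def using GLS_LI GLS_clamped GLS_0 R_I dom_R by auto

lemma GLS_good: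
  assumes "dom lam" "p \<in> Bp lam"
  shows "good I alpha cor p" "snd ` set u \<subseteq> I ==> act alpha cor u p = Some q ==> q \<in> Bp lam"
proof -
  have 1: "!!p q j. p \<in> Bp lam ==> j \<in> I ==> fstep alpha cor j p q ==> q \<in> Bp lam" using GLS_fstep R_I by blast
  have 2: "!!p q j. p \<in> Bp lam ==> j \<in> I ==> fstep alpha cor j q p ==> q \<in> Bp lam" using GLS_fstep_rev R_I dom_R[OF assms(1)] by blast
  show "good I alpha cor p" by (rule L.goodsetI(1)[OF assms(2) GLS_integral[OF assms(1)] 1 2])
  show "snd ` set u \<subseteq> I ==> act alpha cor u p = Some q ==> q \<in> Bp lam"
    by (rule L.goodsetI(2)[OF assms(2) GLS_integral[OF assms(1)] 1 2])
qed

lemma GLS_hw: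
  assumes "dom lam" "p \<in> Bp lam" "!!j. j \<in> I ==> mval cor j p = 0"
  shows "p = pi_lam lam"
proof (rule GLS_dominant_real)
  show "I = R" using R_I by simp
  fix i t assume "i \<in> R" "0 <= t" "t <= (1::real)"
  thus "cor i (p t) >= 0" using L.integral_mval(2)[OF GLS_integral[OF assms(1,2)], of i t] assms(3) R_I by simp
qed (use assms in auto)

lemma pi_mval: "dom lam ==> j \<in> I ==> mval cor j (pi_lam lam) = 0"
  by (rule mval_eq) (auto simp: dom_def pi_lam_def intro!: exI[of _ 0])

lemma dom_word: "dom z ==> set w \<subseteq> I ==> pi_lam (W w z) \<in> Bp z"
  using real_word[of z w] dom_R R_I by (auto intro!: pi_GLS)

lemma dom_zero: "dom 0" by (simp add: dom_def)

lemma good_zero: "good I alpha cor (%t. 0)"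
proof -
  have "pi_lam 0 = (%t. 0 :: 'b)" by (simp add: pi_lam_def fun_eq_iff)
  thus ?thesis using GLS_good(1)[OF dom_zero pi_lam_GLS] by simp
qed

end

subsection \<open>An auxiliary datum\<close>

definition pr1 :: "(real => 'w \<times> real) => real => 'w" where "pr1 p = (%t. fst (p t))"

text \<open>The letter neither sees nor changes the second coordinate, so it commutes with the
  projection.\<close>

lemma act1_fst:
  assumes al: "alpha' j' = (alpha j, 0 :: real)" and co: "!!v. cor' j' v = cor j (fst v)"
  shows "act1 alpha cor (b, j) (pr1 p) = map_option pr1 (act1 alpha' cor' (b, j') p)"
proof -
  have m: "mval cor j (pr1 p) = mval cor' j' p" by (simp add: mval_def co pr1_def)
  show ?thesis
    unfolding act1_def f_root_def e_root_re_def fst_conv snd_conv m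
    by (auto simp: co al Let_def fun_eq_iff pr1_def)
qed

lemma good_fst:
  fixes alpha' :: "'i option => 'w::real_vector \<times> real"
  assumes al: "!!j. j \<in> J ==> alpha' (Some j) = (alpha j, 0 :: real)" and co: "!!j v. j \<in> J ==> cor' (Some j) v = cor j (fst v)"
    and g: "good (Some ` J) alpha' cor' p"
  shows "good J alpha cor (pr1 p)"
proof -
  have ind: "snd ` set u \<subseteq> J ==> act alpha cor u (pr1 p) = map_option pr1 (act alpha' cor' (map (%(b, j). (b, Some j)) u) p)" for u p
  proof (induction u arbitrary: p)
    case (Cons a u)
    obtain b j where ab: "a = (b, j)" by (cases a)
    have j: "j \<in> J" "snd ` set u \<subseteq> J" using Cons.prems ab by auto
    have a1: "act1 alpha cor (b, j) (pr1 p) = map_option pr1 (act1 alpha' cor' (b, Some j) p)"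
      by (rule act1_fst) (use al[OF j(1)] co[OF j(1)] in auto)
    show ?case using Cons.IH[OF j(2)] unfolding ab by (cases "act1 alpha' cor' (b, Some j) p") (auto simp: a1)
  qed simp
  show ?thesis unfolding good_def
  proof (intro allI impI)
    fix u q assume u: "snd ` set u \<subseteq> J" and "act alpha cor u (pr1 p) = Some q"
    then obtain q' where q': "act alpha' cor' (map (%(b, j). (b, Some j)) u) p = Some q'" "q = pr1 q'" using ind[OF u] by auto
    have "snd ` set (map (%(b, j). (b, Some j)) u) \<subseteq> Some ` J" using u by force
    hence "integral_path (Some ` J) cor' q'" using g q'(1) unfolding good_def by blast
    thus "integral_path J cor q" unfolding q'(2) integral_path_def using co by (auto simp: clamped_def pr1_def)
  qed
qed

text \<open>A change of time that takes the corner c to x. The GLS path of parameter x has its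
  corner at time x, while the members of a deformation are compared at equal times and keep theirs
  at c.\<close>

lemma reparam_two:
  assumes c: "0 < c" "c < 1" and x: "0 < x" "x < 1"
  shows "reparam (%t. if t <= c then t * x / c else x + (t - c) / (1 - c) * (1 - x)) (%t. if t <= x then t * c / x else c + (t - x) / (1 - x) * (1 - c))"
    (is "reparam ?f ?g")
proof
  show "?f 0 = 0" "?f 1 = 1" using c by auto
  show "?f t < ?f t'" if "0 <= t" "t < t'" "t' <= 1" for t t'
  proof -
    consider "t' <= c" | "t <= c" "c < t'" | "c < t" using that by linarith
    thus ?thesis
    proof cases
      case 1 thus ?thesis using that c x by (simp add: divide_strict_right_mono)
    next
      case 2
      have "t * x / c <= x" using 2 c x by (simp add: field_simps)
      moreover have "0 < (t' - c) / (1 - c) * (1 - x)" using 2 c x by simp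
      ultimately show ?thesis using 2 by simp
    next
      case 3 thus ?thesis using that c x by (simp add: divide_strict_right_mono)
    qed
  qed
  have 1: "continuous_on {0..c} ?f"
  proof -
    have "continuous_on {0..c} (%t. t * x / c)" using c by (intro continuous_intros) auto
    thus ?thesis by (rule continuous_on_cong[THEN iffD1, rotated -1]) auto
  qed
  have 2: "continuous_on {c..1} ?f"
  proof -
    have "continuous_on {c..1} (%t. x + (t - c) / (1 - c) * (1 - x))" using c by (intro continuous_intros) auto
    thus ?thesis by (rule continuous_on_cong[THEN iffD1, rotated -1]) (use c in auto)
  qed
  have "continuous_on ({0..c} \<union> {c..1}) ?f" by (rule continuous_on_closed_Un[OF _ _ 1 2]) auto
  moreover have "{0..c} \<union> {c..1} = {0..1}" using c by auto
  ultimately show "continuous_on {0..1} ?f" by simp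
  show "0 <= ?g t & ?g t <= 1 & ?f (?g t) = t" if t: "0 <= t" "t <= 1" for t
  proof (cases "t <= x")
    case True
    hence "t * c / x <= c" using c x by (simp add: field_simps)
    moreover have "0 <= t * c / x" using t c x by simp
    moreover have "t * c / x * x / c = t" using c x by simp
    ultimately show ?thesis using True c by (simp only: if_True simp_thms)
  next
    case False
    hence a: "0 < (t - x) / (1 - x)" "(t - x) / (1 - x) <= 1" using t x by auto
    have b: "c + (t - x) / (1 - x) * (1 - c) <= 1" using conv_le1[of "(t - x) / (1 - x)" c] a c by (simp add: mult.commute)
    have b1: "0 < (t - x) / (1 - x) * (1 - c)" by (rule mult_pos_pos[OF a(1)]) (use c in simp)
    have e: "x + (c + (t - x) / (1 - x) * (1 - c) - c) / (1 - c) * (1 - x) = t"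
    proof -
      have "(c + (t - x) / (1 - x) * (1 - c) - c) / (1 - c) = (t - x) / (1 - x)" using c by simp
      thus ?thesis using x by simp
    qed
    have n: "\<not> c + (t - x) / (1 - x) * (1 - c) <= c" using b1 by linarith
    show ?thesis using False b b1 e n c by (simp only: if_False simp_thms)
  qed
qed

context kdat
begin

text \<open>Adding an imaginary simple root (- xi, 1), with coroot the second coordinate, turns the bent path into the projection of a GLS path of the larger datum.\<close>
lemma cat_straight_good:
  assumes xi: "dom xi" and ze: "dom ze" and w: "set w \<subseteq> I" and c: "0 < c" "c < 1" and x: "0 < x" "x < 1"
  defines "v \<equiv> W w ze"
  shows "good I alpha cor (cat c (pi_lam (xi + x *\<^sub>R v)) (pi_lam ((1 - x) *\<^sub>R v)))"
proof -
  define I' where "I' = insert None (Some ` I)"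
  define A' :: "'a option => 'a option => int" where "A' a b = (case a of None => 0 | Some i => 2)" for a b
  define alpha' where "alpha' a = (case a of None => (- xi, 1 :: real) | Some i => (alpha i, 0))" for a
  define cor' where "cor' a y = (case a of None => snd y | Some i => cor i (fst y))" for a and y :: "'b \<times> real"
  \<comment> \<open>Adding \<open>snd y\<close> times \<open>xi\<close> cancels the part -
    \<open>xi\<close> of the new root, so the old coordinates vanish on it; the height is corrected
    in the same way.\<close>
  define co' where "co' a y = (case a of None => snd y | Some i => co i (fst y + snd y *\<^sub>R xi))" for a and y :: "'b \<times> real"
  define ht' where "ht' y = ht (fst y + snd y *\<^sub>R xi) + snd y" for y :: "'b \<times> real"
  define d' where "d' a = (case a of None => 1 | Some i => d i)" for a
  have Ra: "\<exists>i\<in>I. a = Some i" if "a \<in> I'" "A' a a = 2" for a using that by (auto simp: A'_def I'_def)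
  have f1: "linear (cor' a)" if "a \<in> I'" for a by (rule linearI) (use that in \<open>auto simp: cor'_def I'_def split: option.split\<close>)
  have f2: "linear (co' a)" if "a \<in> I'" for a by (rule linearI) (use that in \<open>auto simp: co'_def I'_def algebra_simps split: option.split\<close>)
  have f3: "linear ht'" by (rule linearI) (auto simp: ht'_def algebra_simps)
  have f4: "co' a (alpha' b) = (if a = b then 1 else 0)" if "a \<in> I'" "b \<in> I'" for a b
    using that by (auto simp: co'_def alpha'_def I'_def co_alpha split: option.split)
  have f5: "ht' (alpha' a) = 1" if "a \<in> I'" for a using that by (auto simp: ht'_def alpha'_def I'_def ht_alpha split: option.split)
  have f6: "cor' a (alpha' a) = 2" if "a \<in> I'" "A' a a = 2" for a using Ra[OF that] cor2 all_real by (auto simp: cor'_def alpha'_def)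
  have f7: "cor' a (alpha' b) \<in> \<int>" if "a \<in> I'" "A' a a = 2" "b \<in> I'" for a b
    using Ra[OF that(1,2)] that(3) xi corZ_all by (auto simp: cor'_def alpha'_def I'_def dom_def)
  have f8: "cor' a (alpha' b) <= 0" if "a \<in> I'" "A' a a = 2" "b \<in> I'" "a \<noteq> b" for a b
    using Ra[OF that(1,2)] that(3,4) xi all_real by (auto simp: cor'_def alpha'_def I'_def dom_def intro!: corneg)
  have f9: "0 < d' a" if "a \<in> I'" "A' a a = 2" for a using Ra[OF that] d_pos_all by (auto simp: d'_def)
  have f10: "d' a * cor' a (alpha' b) = d' b * cor' b (alpha' a)" if "a \<in> I'" "A' a a = 2" "b \<in> I'" "A' b b = 2" for a b
    using Ra[OF that(1,2)] Ra[OF that(3,4)] d_sym_all by (auto simp: d'_def cor'_def alpha'_def)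
  have rd: "rdat I' A' alpha' cor' co' ht' d'"
    by (intro rdat.intro f1 f2 f3 f4 f5 f6 f7 f8 f9 f10)
  interpret O: rdat I' A' alpha' cor' co' ht' d' by (rule rd)
  have OR: "O.R = Some ` I" unfolding O.R_def by (auto simp: I'_def A'_def)
  have sO: "refl alpha' cor' (Some i) (y, l) = (refl alpha cor i y, l)" for i y l
    by (simp add: refl_def alpha'_def cor'_def)
  have WO: "wact alpha' cor' (map Some u) (y, l) = (W u y, l)" for u y l
    by (induction u) (auto simp: sO)
  have sndO: "snd (wact alpha' cor' u y) = snd y" if "set u \<subseteq> O.R" for u y
    using that by (induction u) (auto simp: OR refl_def alpha'_def)
  \<comment> \<open>The second coordinate is the pairing with the new coroot. The value 1/x makes
    the covering from \<open>y0\<close> to \<open>x0\<close> admissible at the breakpoint x, since x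
    (1/x) = 1.\<close>
  define Lam where "Lam = (ze, 1 / x)"
  have LamR: "cor' i Lam >= 0 & cor' i Lam \<in> \<int>" if "i \<in> O.R" for i using that ze by (auto simp: OR cor'_def Lam_def dom_def)
  define x0 where "x0 = (v, 1 / x)"
  define y0 where "y0 = (v + (1 / x) *\<^sub>R xi, 0 :: real)"
  have "set (map Some w) \<subseteq> O.R" using w OR by auto
  from O.real_word[OF LamR this] have x0: "x0 \<in> O.orb Lam" "O.ach Lam 1 x0 Lam" by (simp_all add: WO Lam_def x0_def v_def)
  have y0: "y0 = refl alpha' cor' None x0" by (simp add: refl_def alpha'_def cor'_def x0_def y0_def)
  have N: "None \<in> I'" "None \<notin> O.R" unfolding OR by (auto simp: I'_def)
  have y0o: "y0 \<in> O.orb Lam" unfolding y0 by (rule Worbit.step[OF x0(1) N(1)])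
  \<comment> \<open>Real reflections do not touch the second coordinate, which gives the
    independence of the presenting word required by \<open>cs_im_gen\<close>.\<close>
  have "O.cs Lam y0 x0 (cor' None x0) True"
    unfolding y0 by (rule O.cs_im_gen[OF x0(1) N]) (use x sndO in \<open>auto simp: cor'_def x0_def\<close>)
  hence "O.st Lam x y0 x0" unfolding O.st_def using x by (intro exI[of _ "1 / x"] exI[of _ True]) (auto simp: cor'_def x0_def)
  hence "O.ach Lam x y0 x0" by (rule O.st_ach)
  hence okp: "O.ok Lam 0 [(y0, x), (x0, 1)]" using x x0 y0o by simp
  define p0 where "p0 = path [(y0, x), (x0, 1)]"
  have p0: "p0 \<in> O.Bp Lam" unfolding O.GLS_path p0_def using okp by blast
  interpret LO: lets "Some ` I" alpha' cor' by (rule lets.intro) (use O.letter_R OR in auto)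
  have "good (Some ` I) alpha' cor' p0"
  proof (rule LO.goodsetI(1)[OF p0])
    fix p assume p: "p \<in> O.Bp Lam"
    thus "integral_path (Some ` I) cor' p" unfolding integral_path_def
      using O.GLS_LI[OF p] O.GLS_clamped[OF p] O.GLS_0[OF p] LamR OR by blast
    show "!!q j. j \<in> Some ` I ==> fstep alpha' cor' j p q ==> q \<in> O.Bp Lam" using O.GLS_fstep[OF _ p] OR by blast
    show "!!q j. j \<in> Some ` I ==> fstep alpha' cor' j q p ==> q \<in> O.Bp Lam" using O.GLS_fstep_rev[OF _ p] LamR OR by blast
  qed
  hence g: "good I alpha cor (pr1 p0)" by (rule good_fst[rotated -1]) (auto simp: alpha'_def cor'_def)
  let ?f = "%t. if t <= c then t * x / c else x + (t - c) / (1 - c) * (1 - x)"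
  note rep = reparam_two[OF c x]
  have "reparam.rp ?f (pr1 p0) = cat c (pi_lam (xi + x *\<^sub>R v)) (pi_lam ((1 - x) *\<^sub>R v))"
  proof (rule clamped_eqI[OF reparam.rp_clamped[OF rep] cat_clamped])
    fix t :: real assume t: "0 <= t" "t <= 1"
    have fp: "fst (p0 r) = min r x *\<^sub>R (v + (1 / x) *\<^sub>R xi) + min (max (r - x) 0) (1 - x) *\<^sub>R v" if "0 <= r" "r <= 1" for r
      using that x by (simp add: p0_def path_def y0_def x0_def)
    have fr: "0 <= ?f t" "?f t <= 1" using reparam.ph_rng[OF rep t] by auto
    have rpe: "reparam.rp ?f (pr1 p0) t = fst (p0 (?f t))" using t unfolding reparam.rp_def[OF rep] by (simp add: pr1_def)
    show "reparam.rp ?f (pr1 p0) t = cat c (pi_lam (xi + x *\<^sub>R v)) (pi_lam ((1 - x) *\<^sub>R v)) t"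
    proof (cases "t <= c")
      case True
      have e: "t * x / c <= x" using True c x by (simp add: field_simps)
      have "fst (p0 (?f t)) = (t * x / c) *\<^sub>R (v + (1 / x) *\<^sub>R xi)" using fp[OF fr] True e x by simp
      also have "... = (t / c) *\<^sub>R (xi + x *\<^sub>R v)" using x c by (simp add: algebra_simps)
      also have "... = cat c (pi_lam (xi + x *\<^sub>R v)) (pi_lam ((1 - x) *\<^sub>R v)) t"
        using cat_left[OF c t(1) True, of "pi_lam (xi + x *\<^sub>R v)"] t c True by (simp add: pi_lam_def)
      finally show ?thesis using rpe by simp
    next
      case False
      define r where "r = (t - c) / (1 - c)"
      have r: "0 < r" "r <= 1" using False t c by (auto simp: r_def)
      have r2: "0 < r * (1 - x)" "r * (1 - x) <= 1 - x" using r x by (auto simp: mult_left_le_one_le)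
      have ft: "?f t = x + r * (1 - x)" using False by (simp add: r_def)
      have "fst (p0 (?f t)) = x *\<^sub>R (v + (1 / x) *\<^sub>R xi) + (r * (1 - x)) *\<^sub>R v" using fp[OF fr] r2 unfolding ft by simp
      also have "... = xi + x *\<^sub>R v + r *\<^sub>R (1 - x) *\<^sub>R v" using x by (simp add: algebra_simps)
      also have "... = cat c (pi_lam (xi + x *\<^sub>R v)) (pi_lam ((1 - x) *\<^sub>R v)) t"
        using cat_right[of c "pi_lam ((1 - x) *\<^sub>R v)" t "pi_lam (xi + x *\<^sub>R v)"] c False t r by (simp add: pi_lam_def r_def)
      finally show ?thesis using rpe by simp
    qed
  qed
  thus ?thesis using L.good_rp[OF rep g] by simp
qed

text \<open>With v = w ze, the path P x runs straight to xi + x v and then adds the remaining (1 -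
  x) v. P 0 is the bent path and P 1 is the straight one followed by a zero path;
  \<open>deform_Iso\<close> joins the two.\<close>

lemma cat_straight_Iso:
  assumes xi: "dom xi" and ze: "dom ze" and w: "set w \<subseteq> I" and c: "0 < c" "c < 1" and xv: "dom (xi + W w ze)"
  shows "Iso I alpha cor (cat c (pi_lam xi) (pi_lam (W w ze))) (pi_lam (xi + W w ze))"
proof -
  define v where "v = W w ze"
  define P where "P x = cat c (pi_lam (xi + x *\<^sub>R v)) (pi_lam ((1 - x) *\<^sub>R v))" for x
  have p0: "pi_lam (0::'b) = (%t. 0)" by (simp add: pi_lam_def fun_eq_iff)
  have P0: "P 0 = cat c (pi_lam xi) (pi_lam v)" and P1: "P 1 = cat c (pi_lam (xi + v)) (%t. 0)" by (simp_all add: P_def p0)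
  have vB: "pi_lam v \<in> Bp ze" unfolding v_def by (rule dom_word[OF ze w])
  have gx: "good I alpha cor (pi_lam xi)" "good I alpha cor (pi_lam v)" "good I alpha cor (pi_lam (xi + v))"
    using GLS_good(1)[OF xi pi_lam_GLS] GLS_good(1)[OF ze vB] GLS_good(1)[OF xv pi_lam_GLS] by (auto simp: v_def)
  have good: "\<forall>x. 0 <= x & x <= 1 --> good I alpha cor (P x)"
  proof (intro allI impI)
    fix x :: real assume x: "0 <= x & x <= 1"
    consider "x = 0" | "x = 1" | "0 < x" "x < 1" using x by linarith
    thus "good I alpha cor (P x)"
    proof cases
      case 1 thus ?thesis using L.good_cat[OF c gx(1,2)] P0 by simp
    next
      case 2 thus ?thesis using L.good_cat[OF c gx(3) good_zero] P1 by simp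
    next
      case 3 thus ?thesis using cat_straight_good[OF xi ze w c 3] by (simp add: P_def v_def)
    qed
  qed
  have "CF I cor P" unfolding CF_def
  proof (intro ballI allI impI)
    fix j and x e :: real assume j: "j \<in> I" and x: "0 <= x & x <= 1" and e: "0 < e"
    \<comment> \<open>A Lipschitz constant in x, uniform in t; the summand 1 makes it positive even
      if v pairs to 0 with j.\<close>
    define B where "B = 2 * \<bar>cor j v\<bar> + 1"
    have B: "0 < B" by (simp add: B_def)
    have "near cor j e (P y) (P x)" if y: "0 <= y" "y <= 1" "\<bar>y - x\<bar> < e / B" for y
      unfolding near_def
    proof (intro allI impI)
      fix t :: real assume t: "0 <= t & t <= 1"
      have Bd: "\<bar>y - x\<bar> * B <= e" using y(3) B by (simp add: field_simps)
      have "\<bar>cor j (P y t) - cor j (P x t)\<bar> <= \<bar>y - x\<bar> * (2 * \<bar>cor j v\<bar>)"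
      proof (cases "t <= c")
        case True
        have r: "0 <= t / c" "t / c <= 1" using t True c by auto
        have H: "cor j (P z t) = (t / c) * (cor j xi + z * cor j v)" for z
          using cat_left[OF c _ True, of "pi_lam (xi + z *\<^sub>R v)"] t j r by (simp add: P_def pi_lam_def)
        have "cor j (P y t) - cor j (P x t) = (t / c) * ((y - x) * cor j v)" unfolding H by (simp add: algebra_simps diff_divide_distrib)
        hence "\<bar>cor j (P y t) - cor j (P x t)\<bar> = (t / c) * (\<bar>y - x\<bar> * \<bar>cor j v\<bar>)" using r by (simp only: abs_mult abs_of_nonneg)
        also have "... <= \<bar>y - x\<bar> * \<bar>cor j v\<bar>" using r by (intro mult_left_le_one_le) auto
        also have "... <= \<bar>y - x\<bar> * (2 * \<bar>cor j v\<bar>)" by (intro mult_left_mono) auto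
        finally show ?thesis .
      next
        case False
        define r where "r = (t - c) / (1 - c)"
        have r: "0 <= r" "r <= 1" using t False c by (auto simp: r_def)
        have H: "cor j (P z t) = (cor j xi + z * cor j v) + r * ((1 - z) * cor j v)" for z
          using cat_right[of c "pi_lam ((1 - z) *\<^sub>R v)" t "pi_lam (xi + z *\<^sub>R v)"] c False t j r by (simp add: P_def pi_lam_def r_def)
        have "cor j (P y t) - cor j (P x t) = (1 - r) * ((y - x) * cor j v)" unfolding H by (simp add: algebra_simps)
        hence "\<bar>cor j (P y t) - cor j (P x t)\<bar> = (1 - r) * (\<bar>y - x\<bar> * \<bar>cor j v\<bar>)" using r by (simp add: abs_mult)
        also have "... <= \<bar>y - x\<bar> * \<bar>cor j v\<bar>" using r by (intro mult_left_le_one_le) auto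
        also have "... <= \<bar>y - x\<bar> * (2 * \<bar>cor j v\<bar>)" by (intro mult_left_mono) auto
        finally show ?thesis .
      qed
      also have "... <= \<bar>y - x\<bar> * B" by (intro mult_left_mono) (auto simp: B_def)
      finally show "\<bar>cor j (P y t) - cor j (P x t)\<bar> <= e" using Bd by linarith
    qed
    thus "\<exists>d>0. \<forall>y. 0 <= y & y <= 1 & \<bar>y - x\<bar> < d --> near cor j e (P y) (P x)"
      using e B by (intro exI[of _ "e / B"]) auto
  qed
  note CF = this
  \<comment> \<open>The minimum is evaluated at x = 1, where the path is straight to a dominant
    weight, and is the same at x = 0.\<close>
  have mvP: "mval cor j (P 0) = 0" if j: "j \<in> I" for j
  proof -
    have "mval cor j (P 1) = 0"
    proof -
      have "mval cor j (%t. 0 :: 'b) = 0" using pi_mval[OF dom_zero j] p0 by simp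
      thus ?thesis
        using L.cat_mval(1)[OF c good_integral[OF gx(3)] good_integral[OF good_zero] j] pi_mval[OF xv j] xv j P1
        by (simp add: v_def pi_lam_def dom_def)
    qed
    thus ?thesis using L.CF_mval(1)[OF good CF j, of 1] by simp
  qed
  have "Iso I alpha cor (P 0) (P 1)"
  proof (rule L.deform_Iso[OF good CF mvP])
    fix u q assume u: "snd ` set u \<subseteq> I" and q: "act alpha cor u (P 0) = Some q" and m: "!!j. j \<in> I ==> mval cor j q = 0" and e: "q 1 = P 0 1"
    \<comment> \<open>If no e_j acts on a concatenation, none acts on its left factor, which is
      therefore straight. The endpoint then determines the right factor by
      \<open>GLS_extremal\<close>.\<close>
    from L.act_cat[OF c gx(1,2) u q[unfolded P0]] show "q = P 0"
    proof (elim exE conjE)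
      fix u1 u2 p' q' assume h: "snd ` set u1 \<subseteq> I" "snd ` set u2 \<subseteq> I" "act alpha cor u1 (pi_lam xi) = Some p'" "act alpha cor u2 (pi_lam v) = Some q'" "q = cat c p' q'"
      have p': "p' \<in> Bp xi" using GLS_good(2)[OF xi pi_lam_GLS h(1,3)] .
      have q': "q' \<in> Bp ze" using GLS_good(2)[OF ze vB h(2,4)] .
      have ip: "integral_path I cor p'" "integral_path I cor q'" using GLS_integral xi ze p' q' by auto
      have "mval cor j p' = 0" if j: "j \<in> I" for j
      proof -
        have "0 <= mval cor j p'" using m[OF j] L.cat_mval(1)[OF c ip j] h(5) by simp
        thus ?thesis using L.integral_mval(3)[OF ip(1) j] by simp
      qed
      hence pe: "p' = pi_lam xi" using GLS_hw[OF xi p'] by blast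
      have "q' 0 = 0" "q 1 = p' 1 + q' 1" using ip(2) cat_right[of c q' 1 p'] c h(5) by (auto simp: integral_path_def)
      moreover have "P 0 1 = pi_lam xi 1 + pi_lam v 1" unfolding P0 using cat_right[of c "pi_lam v" 1 "pi_lam xi"] c by (simp add: pi_lam_def)
      ultimately have "q' 1 = v" using e pe by (simp add: pi_lam_def)
      hence "q' = pi_lam v" using GLS_extremal[of ze q' w] R_I dom_R[OF ze] q' w v_def by simp
      thus ?thesis using pe h(5) P0 by simp
    qed
  next
    fix u q assume u: "snd ` set u \<subseteq> I" and q: "act alpha cor u (P 1) = Some q" and m: "!!j. j \<in> I ==> mval cor j q = 0"
    obtain p' where p': "act alpha cor u (pi_lam (xi + v)) = Some p'" "q = cat c p' (%t. 0)"
      using q L.Iso_cat_zero(2)[OF c gx(3) good_zero u] unfolding P1 by auto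
    have pB: "p' \<in> Bp (xi + v)" using GLS_good(2)[OF _ pi_lam_GLS u p'(1)] xv v_def by simp
    have ip: "integral_path I cor p'" using GLS_integral pB xv v_def by simp
    have "mval cor j p' = 0" if j: "j \<in> I" for j
    proof -
      have "0 <= mval cor j p'" using m[OF j] L.cat_mval(1)[OF c ip good_integral[OF good_zero] j] p'(2) by simp
      thus ?thesis using L.integral_mval(3)[OF ip j] by simp
    qed
    hence "p' = pi_lam (xi + v)" using GLS_hw pB xv v_def by blast
    thus "q = P 1" using p'(2) P1 by simp
  qed
  thus ?thesis using Iso_trans[OF _ L.Iso_cat_zero(1)[OF c gx(3) good_zero]] P0 P1 by (simp add: v_def)
qed

end

subsection \<open>Dominant paths\<close>

lemma good_mono: "good I alpha cor p ==> J \<subseteq> I ==> good J alpha cor p"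
  unfolding good_def
proof (intro allI impI)
  fix u q assume g: "\<forall>u q. snd ` set u \<subseteq> I --> act alpha cor u p = Some q --> integral_path I cor q" and J: "J \<subseteq> I"
    and u: "snd ` set u \<subseteq> J" and q: "act alpha cor u p = Some q"
  have "integral_path I cor q" by (rule g[rule_format, OF subset_trans[OF u J] q])
  thus "integral_path J cor q" using J by (auto simp: integral_path_def)
qed

context kdat
begin

lemma kdat_sub:
  assumes "J \<subseteq> I"
  shows "kdat J A alpha cor co ht d"
proof -
  have s: "j \<in> J ==> j \<in> I" for j using assms by blast
  show ?thesis
    by (intro kdat.intro rdat.intro kdat_axioms.intro lin_cor lin_co lin_ht co_alpha ht_alpha cor2 corZ corneg d_pos d_sym all_real s)
qed

text \<open>Reflecting where the pairing is negative lowers the height of lam - x by a positive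
  integer, and this height stays nonnegative.\<close>

lemma conj_dominant:
  assumes lam: "dom lam" and J: "J \<subseteq> I" and x: "x \<in> orb lam"
  shows "\<exists>w z. set w \<subseteq> J & x = W w z & (\<forall>j\<in>J. cor j z >= 0 & cor j z \<in> \<int>)"
  using x
proof (induction "nat \<lfloor>ht (lam - x)\<rfloor>" arbitrary: x rule: less_induct)
  case less
  show ?case
  proof (cases "\<forall>j\<in>J. cor j x >= 0")
    case True thus ?thesis using orb_int[OF lam less.prems] J by (intro exI[of _ "[]"] exI[of _ x]) auto
  next
    case False
    then obtain j where j: "j \<in> J" "cor j x < 0" by force
    hence jI: "j \<in> I" "j \<in> R" using J R_I by auto
    have o: "s j x \<in> orb lam" using orb_s[OF less.prems jI(2)] .
    have "cor j x \<in> \<int>" using orb_int[OF lam less.prems jI(1)] .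
    hence "cor j x + 1 <= 0" using Ints_less_add1[of "cor j x" 0] j by simp
    moreover have "ht (lam - s j x) = ht (lam - x) + cor j x" using jI by (simp add: refl_def ht_alpha)
    moreover have "0 <= ht (lam - s j x)" using cone_ht[OF ge_cone[OF orb_ge_lam[OF lam o]]] .
    ultimately have "nat \<lfloor>ht (lam - s j x)\<rfloor> < nat \<lfloor>ht (lam - x)\<rfloor>" by linarith
    from less.hyps[OF this o] obtain w z where wz: "set w \<subseteq> J" "s j x = W w z" "\<forall>j\<in>J. cor j z >= 0 & cor j z \<in> \<int>" by auto
    hence "x = W (j # w) z" using s_s[OF jI(2), of x] by simp
    thus ?thesis using wz j(1) by (intro exI[of _ "j # w"] exI[of _ z]) auto
  qed
qed

text \<open>The pairing c is a positive integer on the orbit, and a c is an integer, so c clears the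
  denominator of a.\<close>

lemma st_rational:
  assumes lam: "dom lam" and s: "st lam a x y" and a: "0 < a"
  shows "\<exists>n::nat. 0 < n & real n * a \<in> \<int>"
proof -
  obtain c im where c: "cs lam x y c im" "if im then a * c = 1 else a * c \<in> \<int> & a * c > 0" using s by (auto simp: st_def)
  then obtain w j where w: "isroot w j" "c = cor j (W (rev w) y)" "0 < c" unfolding cstep_def rr_iff by auto
  have "y \<in> orb lam" using c by (auto simp: cstep_def)
  hence "W (rev w) y \<in> orb lam" using Worbit_wact isroot_I[OF w(1)] by blast
  hence "c \<in> \<int>" using orb_int[OF lam] isroot_I[OF w(1)] w(2) by blast
  then obtain k where "c = of_int k" by (auto elim: Ints_cases)
  hence n: "c = real (nat k)" using w(3) by simp
  have "a * c \<in> \<int>" using c(2) by (auto split: if_splits)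
  thus ?thesis using n w(3) by (intro exI[of _ "nat k"]) (auto simp: mult.commute)
qed

lemma ok_rational:
  assumes lam: "dom lam"
  shows "ok lam b xs ==> adj xs ==> 0 <= b ==> \<exists>n::nat. 0 < n & (\<forall>(x, a)\<in>set xs. real n * a \<in> \<int>)"
proof (induction xs arbitrary: b)
  case (Cons q r)
  obtain x a where q: "q = (x, a)" by (cases q)
  have okr: "b < a" "ach lam a x (nx lam r)" "ok lam a r" "adj r" "r = [] \<or> nx x r \<noteq> x" using Cons.prems q by auto
  then obtain n :: nat where n: "0 < n" "\<forall>(x, a)\<in>set r. real n * a \<in> \<int>" using Cons.IH[of a] Cons.prems by force
  have "\<exists>k::nat. 0 < k & real k * a \<in> \<int>"
  proof (cases "r = []")
    case True thus ?thesis using okr by (intro exI[of _ 1]) auto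
  next
    case False
    hence "nx lam r \<noteq> x" using okr(5) by (cases r) auto
    then obtain y where "st lam a x y" using okr(2) unfolding ach_iff by (metis converse_rtranclpE)
    thus ?thesis using st_rational[OF lam] okr(1) Cons.prems(3) by simp
  qed
  then obtain k :: nat where k: "0 < k" "real k * a \<in> \<int>" by auto
  have "real (k * n) * c \<in> \<int>" if "(y, c) \<in> set (q # r)" for y c
  proof (cases "(y, c) = q")
    case True
    hence e: "real (k * n) * c = real n * (real k * a)" using q by simp
    show ?thesis unfolding e using k(2) by (metis Ints_mult Ints_of_nat)
  next
    case False
    hence "real n * c \<in> \<int>" using that n(2) by auto
    moreover have "real (k * n) * c = real k * (real n * c)" by simp
    ultimately show ?thesis by (metis Ints_mult Ints_of_nat)
  qed
  thus ?case using k n by (intro exI[of _ "k * n"]) auto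
qed auto

lemma ok_piece:
  assumes N: "0 < (N::nat)"
  shows "ok lam b xs ==> (\<forall>(x, a)\<in>set xs. real N * a \<in> \<int>) ==> b <= real k / real N ==> k < N ==>
    \<exists>x\<in>orb lam. \<forall>t. real k / real N <= t & t <= real (Suc k) / real N --> pl b xs t = pl b xs (real k / real N) + (t - real k / real N) *\<^sub>R x"
proof (induction xs arbitrary: b)
  case Nil
  have "real k / real N < 1" using Nil N by simp
  thus ?case using Nil by simp
next
  case (Cons q r)
  obtain x a where q: "q = (x, a)" by (cases q)
  have okr: "b < a" "x \<in> orb lam" "ok lam a r" "real N * a \<in> \<int>" using Cons.prems q by auto
  let ?k = "real k / real N" and ?k1 = "real (Suc k) / real N"
  have kk: "?k <= ?k1" using N by (simp add: divide_right_mono)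
  show ?case
  proof (cases "?k < a")
    case True
    hence "real k < real N * a" using N by (simp add: field_simps)
    hence "real k + 1 <= real N * a" using okr(4) by (intro Ints_less_add1) auto
    hence k1: "?k1 <= a" using N by (simp add: field_simps)
    have e: "pl b (q # r) t = (t - b) *\<^sub>R x" if "b <= t" "t <= a" for t using that pl_before[OF okr(3), of t] q by simp
    have "pl b (q # r) t = pl b (q # r) ?k + (t - ?k) *\<^sub>R x" if "?k <= t" "t <= ?k1" for t
    proof -
      have "b <= t" "t <= a" using that k1 Cons.prems(3) by linarith+
      hence "pl b (q # r) t = (t - b) *\<^sub>R x" by (rule e)
      moreover have "pl b (q # r) ?k = (?k - b) *\<^sub>R x" using e True Cons.prems(3) by simp
      ultimately show ?thesis by (simp only: scaleR_left_distrib[symmetric]) simp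
    qed
    thus ?thesis using okr(2) by blast
  next
    case False
    then obtain y where y: "y \<in> orb lam" "!!t. ?k <= t ==> t <= ?k1 ==> pl a r t = pl a r ?k + (t - ?k) *\<^sub>R y"
      using Cons.IH[OF okr(3) _ _ Cons.prems(4)] Cons.prems(2) by (auto simp del: of_nat_Suc)
    have e: "pl b (q # r) t = (a - b) *\<^sub>R x + pl a r t" if "a <= t" for t using that q okr by simp
    have "pl b (q # r) t = pl b (q # r) ?k + (t - ?k) *\<^sub>R y" if "?k <= t" "t <= ?k1" for t
      using e[of t] e[of ?k] y(2)[OF that] False that by (simp only: not_less) simp
    thus ?thesis using y(1) by blast
  qed
qed

text \<open>Let N clear the denominators of the breakpoints. Then N p consists of N straight pieces,
  each a conjugate under J of a J-dominant integral weight. The partial endpoints N p(k/N) are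
  J-dominant because p is, so \<open>cat_straight_Iso\<close> replaces the straight path to one of
  them followed by the next piece by the straight path to the next endpoint. Induction on k treats N
  p, and \<open>Iso_str\<close> divides by N.\<close>

lemma dominant_Iso:
  assumes lam: "dom lam" and J: "J \<subseteq> I" and p: "p \<in> Bp lam"
    and dp: "!!j t. j \<in> J ==> 0 <= t ==> t <= 1 ==> cor j (p t) >= 0"
  shows "Iso J alpha cor p (pi_lam (p 1))"
proof -
  interpret K: kdat J A alpha cor co ht d by (rule kdat_sub[OF J])
  obtain ys where ys: "p = path ys" "ok lam 0 ys" using p unfolding GLS_path by auto
  then obtain xs where "\<forall>t. pl 0 xs t = pl 0 ys t" and xs: "ok lam 0 xs" "adj xs" using normalise[of lam 0 ys] by blast
  hence px: "p = path xs" using ys(1) by (simp add: path_def)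
  obtain N :: nat where N: "0 < N" "\<forall>(x, a)\<in>set xs. real N * a \<in> \<int>" using ok_rational[OF lam xs] by auto
  have eq: "p t = pl 0 xs t" if "0 <= t" "t <= 1" for t using that by (simp add: px path_def)
  have piece: "\<exists>x\<in>orb lam. \<forall>t. real k / real N <= t & t <= real (Suc k) / real N --> p t = p (real k / real N) + (t - real k / real N) *\<^sub>R x" if k: "k < N" for k
  proof -
    have le: "0 <= real k / real N" "real (Suc k) / real N <= 1" using k N by auto
    obtain x where x: "x \<in> orb lam" "\<forall>t. real k / real N <= t & t <= real (Suc k) / real N --> pl 0 xs t = pl 0 xs (real k / real N) + (t - real k / real N) *\<^sub>R x"
      using ok_piece[OF N(1) xs(1) N(2) le(1) k] by blast
    have "p t = p (real k / real N) + (t - real k / real N) *\<^sub>R x" if t: "real k / real N <= t" "t <= real (Suc k) / real N" for t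
    proof -
      have "0 <= t" "t <= 1" "real k / real N <= 1" using t le by linarith+
      thus ?thesis using eq[of t] eq[of "real k / real N"] le x(2)[rule_format, of t] t by simp
    qed
    thus ?thesis using x(1) by blast
  qed
  \<comment> \<open>The first k of the N pieces, spread over the whole of [0, 1].\<close>
  define Q where "Q k = (%t. real N *\<^sub>R p (real k * clamp t / real N))" for k :: nat
  have Qc: "clamped (Q k)" for k by (simp add: Q_def clamped_def)
  have p0: "p 0 = 0" using GLS_0[OF p] .
  have step: "\<exists>w z. set w \<subseteq> J & K.dom z & real N *\<^sub>R p (real (Suc k) / real N) = real N *\<^sub>R p (real k / real N) + W w z &
     (\<forall>t. 0 <= t & t <= 1 --> real N *\<^sub>R p ((real k + t) / real N) = real N *\<^sub>R p (real k / real N) + t *\<^sub>R W w z)" if k: "k < N" for k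
  proof -
    obtain x where x: "x \<in> orb lam" "\<forall>t. real k / real N <= t & t <= real (Suc k) / real N --> p t = p (real k / real N) + (t - real k / real N) *\<^sub>R x"
      using piece[OF k] by blast
    obtain w z where wz: "set w \<subseteq> J" "x = W w z" "\<forall>j\<in>J. cor j z >= 0 & cor j z \<in> \<int>" using conj_dominant[OF lam J x(1)] by blast
    have t: "real N *\<^sub>R p ((real k + t) / real N) = real N *\<^sub>R p (real k / real N) + t *\<^sub>R W w z" if t: "0 <= t" "t <= 1" for t
    proof -
      have "real k / real N <= (real k + t) / real N" "(real k + t) / real N <= real (Suc k) / real N" using t N by (auto intro!: divide_right_mono)
      hence "p ((real k + t) / real N) = p (real k / real N) + ((real k + t) / real N - real k / real N) *\<^sub>R x" using x(2) by blast
      moreover have "(real k + t) / real N - real k / real N = t / real N" by (simp add: diff_divide_distrib[symmetric])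
      ultimately show ?thesis using N wz(2) by (simp add: scaleR_right_distrib)
    qed
    have "real N *\<^sub>R p (real (Suc k) / real N) = real N *\<^sub>R p (real k / real N) + W w z" using t[of 1] by (simp add: add.commute)
    thus ?thesis using t wz by (intro exI[of _ w] exI[of _ z]) (auto simp: K.dom_def)
  qed
  have Wint: "cor j (W w z) \<in> \<int>" if "set w \<subseteq> J" "K.dom z" "j \<in> J" for w z j
    using K.real_word[of z w] K.dom_R[OF that(2)] K.R_I that by auto
  have domQ: "K.dom (real N *\<^sub>R p (real k / real N))" if "k <= N" for k
    using that
  proof (induction k)
    case 0 thus ?case using p0 K.dom_zero by simp
  next
    case (Suc k)
    then obtain w z where wz: "set w \<subseteq> J" "K.dom z" "real N *\<^sub>R p (real (Suc k) / real N) = real N *\<^sub>R p (real k / real N) + W w z" using step[of k] by auto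
    show ?case unfolding K.dom_def
    proof (intro ballI conjI)
      fix j assume j: "j \<in> J"
      have "cor j (p (real (Suc k) / real N)) >= 0" using dp[OF j, of "real (Suc k) / real N"] Suc.prems N by simp
      thus "0 <= cor j (real N *\<^sub>R p (real (Suc k) / real N))" using K.cor_simps(3)[OF j] by simp
      have "cor j (real N *\<^sub>R p (real k / real N)) \<in> \<int>" using Suc j by (auto simp: K.dom_def)
      thus "cor j (real N *\<^sub>R p (real (Suc k) / real N)) \<in> \<int>" unfolding wz(3) using K.cor_simps(1)[OF j] Wint[OF wz(1,2) j] by simp
    qed
  qed
  have main: "good J alpha cor (Q (Suc k)) & Iso J alpha cor (Q (Suc k)) (pi_lam (real N *\<^sub>R p (real (Suc k) / real N)))" if "Suc k <= N" for k
    using that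
  proof (induction k)
    case 0
    obtain w z where wz: "set w \<subseteq> J" "K.dom z" "real N *\<^sub>R p (real (Suc 0) / real N) = real N *\<^sub>R p (real 0 / real N) + W w z"
      "!!t. 0 <= t ==> t <= 1 ==> real N *\<^sub>R p ((real 0 + t) / real N) = real N *\<^sub>R p (real 0 / real N) + t *\<^sub>R W w z" using step[of 0] 0 by auto
    have "Q (Suc 0) = pi_lam (real N *\<^sub>R p (real (Suc 0) / real N))"
      using wz(3) wz(4)[of "clamp _"] p0 by (auto simp: Q_def pi_lam_def fun_eq_iff)
    thus ?case using K.GLS_good(1)[OF domQ K.pi_lam_GLS] 0 Iso_refl by metis
  next
    case (Suc k)
    define m where "m = Suc k"
    have IH: "good J alpha cor (Q m)" "Iso J alpha cor (Q m) (pi_lam (real N *\<^sub>R p (real m / real N)))" using Suc by (auto simp: m_def)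
    have mN: "m < N" using Suc.prems by (simp add: m_def)
    then obtain w z where wz: "set w \<subseteq> J" "K.dom z" "real N *\<^sub>R p (real (Suc m) / real N) = real N *\<^sub>R p (real m / real N) + W w z"
      "!!t. 0 <= t ==> t <= 1 ==> real N *\<^sub>R p ((real m + t) / real N) = real N *\<^sub>R p (real m / real N) + t *\<^sub>R W w z" using step[of m] by auto
    \<comment> \<open>The first m of m + 1 pieces of equal duration end at this time.\<close>
    define c where "c = real m / real (Suc m)"
    have c: "0 < c" "c < 1" by (auto simp: c_def m_def)
    have gv: "good J alpha cor (pi_lam (W w z))" using K.GLS_good(1)[OF wz(2) K.dom_word[OF wz(2,1)]] .
    have gx: "good J alpha cor (pi_lam (real N *\<^sub>R p (real m / real N)))" using K.GLS_good(1)[OF domQ K.pi_lam_GLS] mN by simp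
    have cat: "Q (Suc m) = cat c (Q m) (pi_lam (W w z))"
    proof (rule clamped_eqI[OF Qc cat_clamped])
      fix t :: real assume t: "0 <= t" "t <= 1"
      show "Q (Suc m) t = cat c (Q m) (pi_lam (W w z)) t"
      proof (cases "t <= c")
        case True
        hence r: "0 <= t / c" "t / c <= 1" using t c by auto
        have "real m * (t / c) = real (Suc m) * t" by (simp add: c_def m_def)
        thus ?thesis using cat_left[OF c t(1) True, of "Q m" "pi_lam (W w z)"] t r by (simp add: Q_def)
      next
        case False
        define r where "r = (t - c) / (1 - c)"
        have r: "0 <= r" "r <= 1" using False t c by (auto simp: r_def)
        have c1: "1 - c = 1 / real (Suc m)" by (simp add: c_def field_simps)
        have cm: "real (Suc m) * c = real m" by (simp add: c_def)
        have "r = real (Suc m) * (t - c)" unfolding r_def c1 by simp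
        hence "real m + r = real (Suc m) * t" using cm by (simp only: right_diff_distrib)
        moreover have "Q m 1 = real N *\<^sub>R p (real m / real N)" by (simp add: Q_def)
        ultimately show ?thesis using cat_right[of c "pi_lam (W w z)" t "Q m"] c False t wz(4)[OF r] r by (simp add: Q_def pi_lam_def r_def)
      qed
    qed
    have g: "good J alpha cor (Q (Suc m))" unfolding cat by (rule K.L.good_cat[OF c IH(1) gv])
    have i1: "Iso J alpha cor (Q (Suc m)) (cat c (pi_lam (real N *\<^sub>R p (real m / real N))) (pi_lam (W w z)))"
      unfolding cat by (rule K.L.Iso_cat[OF c IH(1) gx gv IH(2)])
    have d1: "K.dom (real N *\<^sub>R p (real m / real N))" using domQ mN by simp
    have d2: "K.dom (real N *\<^sub>R p (real m / real N) + W w z)" using domQ[of "Suc m"] mN wz(3) by simp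
    have "Iso J alpha cor (Q (Suc m)) (pi_lam (real N *\<^sub>R p (real m / real N) + W w z))"
      by (rule Iso_trans[OF i1 K.cat_straight_Iso[OF d1 wz(2,1) c d2]])
    thus ?case using g wz(3) by (simp add: m_def)
  qed
  obtain N' where N': "N = Suc N'" using N(1) by (cases N) auto
  have QN: "Q N = str N p"
  proof
    fix t
    have "p (clamp t) = p t" using GLS_clamped[OF p] by (simp add: clamped_def)
    thus "Q N t = str N p t" using N by (simp add: Q_def str_def)
  qed
  have pN: "pi_lam (real N *\<^sub>R p (real N / real N)) = str N (pi_lam (p 1))" using N by (auto simp: pi_lam_def str_def fun_eq_iff)
  have "Iso J alpha cor (str N p) (str N (pi_lam (p 1)))" using main[of N'] N' QN pN by simp
  moreover have "good J alpha cor p" using good_mono[OF GLS_good(1)[OF lam p] J] .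
  moreover have "good J alpha cor (pi_lam (p 1))"
  proof -
    have "K.dom (p 1)" unfolding K.dom_def
    proof (intro ballI conjI)
      fix j assume j: "j \<in> J"
      show "0 <= cor j (p 1)" using dp[OF j] by simp
      show "cor j (p 1) \<in> \<int>" using L.integral_mval(5)[OF GLS_integral[OF lam p]] j J by blast
    qed
    thus ?thesis using K.GLS_good(1)[OF _ K.pi_lam_GLS] by blast
  qed
  ultimately show ?thesis using K.L.Iso_str[OF N(1)] by blast
qed

end

subsection \<open>Cut functions\<close>

text \<open>The multiple of the simple root that f_i has subtracted by time t. A path and its lift
  lose the same function, so it is separated from the root.\<close>

definition cutg :: "(real => real) => real => real => real => real => real" where
  "cutg H m u v t = (if t <= u then 0 else if t <= v then H t - m else 1)"

lemma Fmod_cutg: "clamped p ==> Fmod alpha cor i m u v p t = p t - cutg (%t. cor i (p t)) m u v (clamp t) *\<^sub>R alpha i"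
proof -
  assume "clamped p"
  hence "p (clamp t) = p t" by (simp add: clamped_def)
  thus ?thesis by (auto simp: Fmod_def cutg_def Let_def)
qed

lemma cutg_mono:
  assumes F: "FS H m u v" and t: "0 <= t" "t <= t'" "t' <= 1"
  shows "cutg H m u v t <= cutg H m u v t'"
proof -
  have F': "u < v" "H u = m" "H v = m + 1" "!!t t'. u <= t ==> t < t' ==> t' <= v ==> H t < H t'" using F unfolding FS_def by auto
  have mono: "H t <= H t'" if "u <= t" "t <= t'" "t' <= v" for t t' using F'(4)[of t t'] that by (cases "t = t'") auto
  consider "t' <= u" | "t <= u" "u < t'" "t' <= v" | "t <= u" "v < t'" | "u < t" "t' <= v" | "u < t" "t <= v" "v < t'" | "v < t" by linarith
  thus ?thesis
  proof cases
    case 2 thus ?thesis using mono[of u t'] F' by (simp add: cutg_def)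
  next
    case 4 thus ?thesis using mono[of t t'] t by (simp add: cutg_def)
  next
    case 5 thus ?thesis using mono[of t v] F' by (simp add: cutg_def)
  qed (use t F' in \<open>auto simp: cutg_def\<close>)
qed

lemma cutg_nonneg:
  assumes F: "FS H m u v" and t: "0 <= t" "t <= 1"
  shows "0 <= cutg H m u v t"
proof -
  have "0 <= u" using F by (simp add: FS_def)
  thus ?thesis using cutg_mono[OF F, of 0 t] t by (simp add: cutg_def)
qed

lemma FS_unique:
  assumes F: "FS H m u v" and G: "FS H m' u' v'"
  shows "m = m'" "u = u'" "v = v'"
proof -
  have f: "0 <= u" "u < v" "v <= 1" "H u = m" "H v = m + 1" "!!t t'. u <= t ==> t < t' ==> t' <= v ==> H t < H t'" "!!t. v <= t ==> t <= 1 ==> m + 1 <= H t"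
    and g: "0 <= u'" "u' < v'" "v' <= 1" "H u' = m'" "H v' = m' + 1" "!!t t'. u' <= t ==> t < t' ==> t' <= v' ==> H t < H t'" "!!t. v' <= t ==> t <= 1 ==> m' + 1 <= H t"
    using F G unfolding FS_def by auto
  have "m <= m'" using FS_lb[OF F, of u'] g by simp
  moreover have "m' <= m" using FS_lb[OF G, of u] f by simp
  ultimately show m: "m = m'" by simp
  show u: "u = u'"
  proof (rule linorder_cases[of u u'])
    assume l: "u < u'"
    show ?thesis
    proof (cases "u' <= v")
      case True hence "H u < H u'" using f(6)[of u u'] l by simp
      thus ?thesis using f g m by simp
    next
      case False thus ?thesis using f(7)[of u'] g m by simp
    qed
  next
    assume l: "u' < u"
    show ?thesis
    proof (cases "u <= v'")
      case True hence "H u' < H u" using g(6)[of u' u] l by simp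
      thus ?thesis using f g m by simp
    next
      case False thus ?thesis using g(7)[of u] f m by simp
    qed
  qed
  show "v = v'"
  proof (rule linorder_cases[of v v'])
    assume "v < v'" hence "H v < H v'" using g(6)[of v v'] f u by simp
    thus ?thesis using f g m by simp
  next
    assume "v' < v" hence "H v' < H v" using f(6)[of v' v] g u by simp
    thus ?thesis using f g m by simp
  qed
qed

text \<open>The least slope is read off from the first time at which all summands are saturated.\<close>
lemma min_sums_eq:
  fixes ns ns' :: "real list"
  assumes "sorted ns" "sorted ns'" "\<forall>n\<in>set ns. 1 <= n" "\<forall>n\<in>set ns'. 1 <= n"
    and "!!t. 0 <= t ==> t <= 1 ==> (\<Sum>n\<leftarrow>ns. min (n * t) 1) = (\<Sum>n\<leftarrow>ns'. min (n * t) 1)"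
  shows "ns = ns'"
  using assms
proof (induction ns arbitrary: ns')
  case Nil
  have one: "(\<Sum>n\<leftarrow>xs. min (n * 1) (1::real)) = length xs" if "\<forall>n\<in>set xs. 1 <= n" for xs :: "real list"
    using that by (induction xs) auto
  show ?case using Nil(5)[of 1] one[OF Nil(4)] by simp
next
  case (Cons n ns)
  have one: "(\<Sum>n\<leftarrow>xs. min (n * t) (1::real)) = length xs" if "\<forall>n\<in>set xs. 1 <= n * t" for xs :: "real list" and t
    using that by (induction xs) auto
  have le: "(\<Sum>n\<leftarrow>xs. min (n * t) (1::real)) <= length xs" for xs :: "real list" and t
    by (induction xs) auto
  have l: "length (n # ns) = length ns'" using Cons.prems(5)[of 1] one[of "n # ns" 1] one[of ns' 1] Cons.prems(3,4) by simp
  then obtain n' ns'' where n': "ns' = n' # ns''" by (cases ns') auto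
  have first: "n' <= n" if "sorted (n' # ns'')" "\<forall>n\<in>set (n' # ns''). 1 <= n" "1 <= n" "length ns'' = length ns"
    "(\<Sum>n\<leftarrow>n # ns. min (n * (1/n')) 1) = (\<Sum>n\<leftarrow>n' # ns''. min (n * (1/n')) 1)" for n n' :: real and ns ns'' :: "real list"
  proof -
    have n'1: "1 <= n'" using that by simp
    have "(\<Sum>n\<leftarrow>n' # ns''. min (n * (1/n')) 1) = length (n' # ns'')"
      by (rule one) (use that(1) n'1 in auto)
    hence "min (n * (1/n')) 1 + (\<Sum>n\<leftarrow>ns. min (n * (1/n')) 1) = 1 + length ns" using that(4,5) by simp
    hence "1 <= n * (1/n')" using le[where xs=ns and t="1/n'"] by linarith
    thus ?thesis using n'1 by (simp add: field_simps)
  qed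
  have b: "0 <= 1/n'" "1/n' <= 1" "0 <= 1/n" "1/n <= 1" using Cons.prems(3,4) n' by auto
  have "n' <= n" by (rule first[OF _ _ _ _ Cons.prems(5)[OF b(1,2), unfolded n']]) (use Cons.prems(2,3,4) n' l in auto)
  moreover have "n <= n'"
    by (rule first[OF _ _ _ _ Cons.prems(5)[OF b(3,4), unfolded n', symmetric]]) (use Cons.prems(1,3,4) n' l in auto)
  ultimately have e: "n = n'" by simp
  have "ns = ns''"
  proof (rule Cons.IH)
    fix t :: real assume "0 <= t" "t <= 1"
    thus "(\<Sum>n\<leftarrow>ns. min (n * t) 1) = (\<Sum>n\<leftarrow>ns''. min (n * t) 1)" using Cons.prems(5)[of t] e n' by simp
  qed (use Cons.prems n' in auto)
  thus ?case using e n' by simp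
qed

lemma sum_index_list: "(\<Sum>k<length ns. f (ns ! k)) = (\<Sum>n\<leftarrow>ns. f n)"
  by (simp add: sum_list_sum_nth atLeast0LessThan)

lemma Fw_simps [simp]: "Fw al cr [] p = Some p" "Fw al cr (i # ws) p = Option.bind (f_root al cr i p) (Fw al cr ws)"
proof -
  have N: "fold (%i q. Option.bind q (f_root al cr i)) ws None = None" for ws by (induction ws) auto
  show "Fw al cr [] p = Some p" by (simp add: Fw_def)
  show "Fw al cr (i # ws) p = Option.bind (f_root al cr i p) (Fw al cr ws)"
    by (cases "f_root al cr i p") (auto simp: Fw_def N)
qed

lemma Fw_act: "Fw al cr ws p = act al cr (map (Pair True) ws) p"
  by (induction ws arbitrary: p) (auto simp: act1_def split: Option.bind_split)

subsection \<open>Lifting to the Kac--Moody datum\<close>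

locale pair = idat I A alpha cor co ht d + T: kdat "Itilde I A" "Atilde A" alphat cort cot htt dt
  for I :: "'i set" and A alpha cor co ht d alphat cort cot htt dt +
  assumes cA: "i \<in> I ==> j \<in> I ==> cor i (alpha j) = of_int (A i j)"
    and cAt: "x \<in> Itilde I A ==> y \<in> Itilde I A ==> cort x (alphat y) = of_int (Atilde A x y)"
    and A_zero: "i \<in> I ==> j \<in> I ==> A i j = 0 \<longleftrightarrow> A j i = 0"
begin

abbreviation It :: "('i \<times> nat) set" where "It \<equiv> Itilde I A"

lemma It_iff: "(j, m) \<in> It \<longleftrightarrow> j \<in> I & (if A j j = 2 then m = 1 else m >= 1)"
  by (auto simp: Itilde_def)

lemma It_fst: "x \<in> It ==> fst x \<in> I" by (cases x) (simp add: It_iff)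

lemma R_iff: "j \<in> I ==> j \<in> R \<longleftrightarrow> A j j = 2" by (simp add: R_def)

definition lbl :: "('i => nat) => 'i list => 'i => 'i \<times> nat" where
  "lbl c ws i = (i, if A i i = 2 then 1 else c i + count_list ws i + 1)"

lemma lbl_It: "i \<in> I ==> lbl c ws i \<in> It" by (simp add: lbl_def It_iff)

text \<open>The last argument records, for each imaginary index, the slopes of the letters used so far; c counts the labels that are already taken when the word starts.\<close>
inductive LR :: "'a => 'b => ('i => nat) => 'i list => (real => 'a) => (real => 'b) => ('i => real list) => bool"
  for mu mut c where
  LR_base: "LR mu mut c [] (pi_lam mu) (pi_lam mut) (%i. [])"
| LR_step: "LR mu mut c ws p q ns ==> i \<in> I ==> FS (%t. cor i (p t)) m u v ==>
    LR mu mut c (ws @ [i]) (Fmod alpha cor i m u v p) (Fmod alphat cort (lbl c ws i) m u v q)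
      (if A i i = 2 then ns else ns(i := ns i @ [1 / v]))"

text \<open>The two weights have to agree only at copies not yet used. In this form the condition
  also holds at the endpoints of a path and its dominant lift, with c the letter counts, so that the
  Levi datum can start there.\<close>

definition bas :: "'a => 'b => ('i => nat) => bool" where
  "bas mu mut c \<longleftrightarrow> dom mu & T.dom mut & (\<forall>j m. (j, m) \<in> It & (A j j = 2 \<or> c j < m) --> cort (j, m) mut = cor j mu)"

definition stp :: "(real => 'a) => (real => 'a) => bool" where
  "stp p p' \<longleftrightarrow> (\<exists>j\<in>I. fstep alpha cor j p p')"

text \<open>Coefficient of the simple root labelled by x in the lifted path.\<close>
definition G :: "'a => ('i => nat) => (real => 'a) => ('i => real list) => 'i \<times> nat => real => real" where
  "G mu c p ns x t = (case x of (j, m) => if A j j = 2 then co j (clamp t *\<^sub>R mu - p t)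
     else if c j < m & m <= c j + length (ns j) then min (ns j ! (m - c j - 1) * clamp t) 1 else 0)"

text \<open>I may be infinite, so the sums extend over a finite F outside of which all coefficients
  vanish. Path and lift have the same coefficients; the copies of j are merged into alpha_j in p and
  kept apart in q.\<close>

definition rep :: "'a => 'b => ('i => nat) => (real => 'a) => (real => 'b) => ('i => real list) => ('i \<times> nat) set => bool" where
  "rep mu mut c p q ns F \<longleftrightarrow> finite F & F \<subseteq> It & (\<forall>x\<in>It - F. \<forall>t. G mu c p ns x t = 0) &
     (\<forall>t. p t = clamp t *\<^sub>R mu - (\<Sum>x\<in>F. G mu c p ns x t *\<^sub>R alpha (fst x))) &
     (\<forall>t. q t = clamp t *\<^sub>R mut - (\<Sum>x\<in>F. G mu c p ns x t *\<^sub>R alphat x))"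

text \<open>The slope n stems from an application of f_j in the past of p, namely from p0 to p1,
  after which other letters led from p1 to p.\<close>

definition hist :: "'a => (real => 'a) => 'i => real => bool" where
  "hist mu p j n \<longleftrightarrow> 1 <= n & (\<exists>p0 p1. p0 \<in> Bp mu & fstep alpha cor j p0 p1 & p1 \<in> Bp mu & (\<forall>t. 0 <= t & t <= 1/n --> cor j (p0 t) = n * t) &
     (\<forall>t. 1/n <= t & t <= 1 --> 1 <= cor j (p0 t)) & (\<forall>t. 0 <= t & t <= 1 --> p1 t = p0 t - min (n * t) 1 *\<^sub>R alpha j) & stp\<^sup>*\<^sup>* p1 p)"

lemma rep_cor:
  assumes b: "bas mu mut c" and r: "rep mu mut c p q ns F" and x: "(j, m) \<in> It" "A j j = 2 \<or> c j < m"
  shows "cort (j, m) (q t) = cor j (p t) - (2 - of_int (A j j)) * G mu c p ns (j, m) t"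
proof -
  have jI: "j \<in> I" using x It_iff by auto
  have F: "finite F" "F \<subseteq> It" "!!y. y \<in> It - F ==> G mu c p ns y t = 0" using r by (auto simp: rep_def)
  let ?g = "%y. G mu c p ns y t"
  have q: "q t = clamp t *\<^sub>R mut - (\<Sum>y\<in>F. ?g y *\<^sub>R alphat y)" and p: "p t = clamp t *\<^sub>R mu - (\<Sum>y\<in>F. ?g y *\<^sub>R alpha (fst y))"
    using r by (auto simp: rep_def)
  have 1: "cort (j, m) (q t) = clamp t * cor j mu - (\<Sum>y\<in>F. ?g y * of_int (Atilde A (j, m) y))"
  proof -
    have "cort (j, m) (\<Sum>y\<in>F. ?g y *\<^sub>R alphat y) = (\<Sum>y\<in>F. ?g y * of_int (Atilde A (j, m) y))"
      unfolding linear_sum[OF T.lin_cor[OF x(1)]] by (rule sum.cong) (use x F(2) cAt in \<open>auto\<close>)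
    thus ?thesis unfolding q using b x by (auto simp: bas_def)
  qed
  have 2: "cor j (p t) = clamp t * cor j mu - (\<Sum>y\<in>F. ?g y * of_int (A j (fst y)))"
  proof -
    have "cor j (\<Sum>y\<in>F. ?g y *\<^sub>R alpha (fst y)) = (\<Sum>y\<in>F. ?g y * of_int (A j (fst y)))"
      unfolding linear_sum[OF lin_cor[OF jI]] by (rule sum.cong) (use jI F(2) It_fst cA in \<open>auto\<close>)
    thus ?thesis unfolding p using jI by simp
  qed
  have "(\<Sum>y\<in>F. ?g y * of_int (Atilde A (j, m) y)) - (\<Sum>y\<in>F. ?g y * of_int (A j (fst y))) = (\<Sum>y\<in>F. if y = (j, m) then ?g (j, m) * (2 - of_int (A j j)) else 0)"
    unfolding sum_subtractf[symmetric] by (rule sum.cong) (auto simp: Atilde_def right_diff_distrib)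
  also have "... = (if (j, m) \<in> F then ?g (j, m) * (2 - of_int (A j j)) else 0)" using F(1) by simp
  also have "... = (2 - of_int (A j j)) * ?g (j, m)" using F(3)[of "(j, m)"] x by (auto simp: mult.commute)
  finally show ?thesis using 1 2 by simp
qed

text \<open>Each f_k subtracts a nonnegative multiple of alpha_k, which pairs nonpositively with an
  imaginary coroot.\<close>

lemma stp_mono:
  assumes mu: "dom mu" and "stp\<^sup>*\<^sup>* p p'" "p \<in> Bp mu" and j: "j \<in> I" "j \<notin> R"
  shows "p' \<in> Bp mu & (\<forall>t. 0 <= t & t <= 1 --> cor j (p t) <= cor j (p' t))"
  using assms(2)
proof (induction rule: rtranclp_induct)
  case base thus ?case using assms by simp
next
  case (step y z)
  then obtain k where k: "k \<in> I" "fstep alpha cor k y z" by (auto simp: stp_def)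
  then obtain m u v where F: "FS (%t. cor k (y t)) m u v" "z = Fmod alpha cor k m u v y" "clamped y" by (auto simp: fstep_def)
  have "z \<in> Bp mu" using GLS_f(2)[OF mu _ k(1,2)] step by blast
  moreover have "cor j (y t) <= cor j (z t)" if t: "0 <= t" "t <= 1" for t
  proof -
    have "cor j (z t) = cor j (y t) - cutg (%t. cor k (y t)) m u v t * cor j (alpha k)" unfolding F(2) Fmod_cutg[OF F(3)] using t j by simp
    moreover have "cutg (%t. cor k (y t)) m u v t * cor j (alpha k) <= 0" using cutg_nonneg[OF F(1) t] im_neg[of j k] j k R_iff by (simp add: mult_nonneg_nonpos)
    ultimately show ?thesis by simp
  qed
  ultimately show ?case using step by force
qed

text \<open>When the letter was applied, the height function was at least
  \<open>min (n * t) 1\<close>. The letter itself added - a_jj times this, and later letters only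
  raised the function further.\<close>

lemma hist_bound:
  assumes mu: "dom mu" and h: "hist mu p j n" and j: "j \<in> I" "j \<notin> R" and t: "0 <= t" "t <= 1"
  shows "(1 - of_int (A j j)) * min (n * t) 1 <= cor j (p t)" "min (n * t) 1 <= cor j (p t)"
proof -
  obtain p0 p1 where n: "1 <= n" and h': "p0 \<in> Bp mu" "p1 \<in> Bp mu" "!!t. 0 <= t ==> t <= 1/n ==> cor j (p0 t) = n * t"
    "!!t. 1/n <= t ==> t <= 1 ==> 1 <= cor j (p0 t)" "!!t. 0 <= t ==> t <= 1 ==> p1 t = p0 t - min (n * t) 1 *\<^sub>R alpha j" "stp\<^sup>*\<^sup>* p1 p"
    using h unfolding hist_def by blast
  have a: "real_of_int (A j j) <= 0" using im_neg[of j j] j R_iff cor_A[OF j(1)] by simp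
  have "cor j (p1 t) <= cor j (p t)" using stp_mono[OF mu h'(6,2) j] t by blast
  moreover have "cor j (p1 t) = cor j (p0 t) - min (n * t) 1 * of_int (A j j)" using h'(5)[OF t] j cor_A[OF j(1)] by simp
  moreover have p0: "min (n * t) 1 <= cor j (p0 t)"
  proof (cases "t <= 1/n")
    case True thus ?thesis using h'(3)[OF t(1) True] by simp
  next
    case False thus ?thesis using h'(4)[of t] t by simp
  qed
  ultimately show "(1 - of_int (A j j)) * min (n * t) 1 <= cor j (p t)" by (simp add: algebra_simps)
  have "min (n * t) 1 * of_int (A j j) <= 0" using a n t by (simp add: mult_nonneg_nonpos)
  thus "min (n * t) 1 <= cor j (p t)" using \<open>cor j (p1 t) <= cor j (p t)\<close> \<open>cor j (p1 t) = _\<close> p0 by linarith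
qed

lemma im_FS:
  assumes mu: "dom mu" and p: "p \<in> Bp mu" and i: "i \<in> I" "i \<notin> R" and F: "FS (%t. cor i (p t)) m u v"
  shows "m = 0" "u = 0" "1 <= 1 / v" "!!t. 0 <= t ==> t <= 1 ==> cutg (%t. cor i (p t)) m u v t = min (1 / v * t) 1"
    "!!t. 0 <= t ==> t <= v ==> cor i (p t) = 1 / v * t" "!!t. v <= t ==> t <= 1 ==> 1 <= cor i (p t)"
proof -
  have "f_root alpha cor i p \<noteq> None" using FS_f_root[of cor i p m u v alpha] F by simp
  then obtain n where n: "1 <= n" "FS (%t. cor i (p t)) 0 0 (1/n)" "!!t. 0 <= t ==> t <= 1/n ==> cor i (p t) = n * t"
    using im_f[OF mu i p] by auto
  note e = FS_unique[OF F n(2)]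
  have vn: "1 / v = n" using e(3) n(1) by simp
  show "m = 0" "u = 0" "1 <= 1 / v" using e n vn by auto
  show H: "cor i (p t) = 1 / v * t" if "0 <= t" "t <= v" for t using n(3)[of t] that e(3) vn by simp
  show H1: "1 <= cor i (p t)" if "v <= t" "t <= 1" for t using F that e unfolding FS_def by auto
  show "cutg (%t. cor i (p t)) m u v t = min (1 / v * t) 1" if t: "0 <= t" "t <= 1" for t
  proof -
    have v0: "0 < v" using F e unfolding FS_def by simp
    consider "t = 0" | "0 < t" "t <= v" | "v < t" using t by linarith
    thus ?thesis
    proof cases
      case 1 thus ?thesis using e by (simp add: cutg_def)
    next
      case 2
      hence "1 / v * t <= 1" using v0 by (simp add: field_simps)
      thus ?thesis using 2 e H[of t] by (simp add: cutg_def)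
    next
      case 3
      hence "1 <= 1 / v * t" "0 < t" using v0 by (auto simp: field_simps)
      thus ?thesis using 3 e by (simp add: cutg_def)
    qed
  qed
qed

text \<open>At a fresh copy the lift has the same height function as p, so the same m, u, v serve
  both operators and both paths lose the same cut function. The slopes come out sorted because the
  height function already lies above \<open>min (n * t) 1\<close> for every earlier n.\<close>

lemma LR_inv:
  assumes b: "bas mu mut c" and l: "LR mu mut c ws p q ns"
  shows "p \<in> Bp mu & q \<in> T.Bp mut & (\<forall>j\<in>I. j \<notin> R --> length (ns j) = count_list ws j & sorted (ns j) & (\<forall>n\<in>set (ns j). hist mu p j n)) &
    (\<exists>F. rep mu mut c p q ns F) & set ws \<subseteq> I"
  using l
proof (induction rule: LR.induct)
  case LR_base
  have "rep mu mut c (pi_lam mu) (pi_lam mut) (%i. []) {}"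
    by (auto simp: rep_def G_def pi_lam_def It_iff)
  thus ?case using pi_lam_GLS T.pi_lam_GLS by auto
next
  case (LR_step ws p q ns i m u v)
  define x where "x = lbl c ws i"
  define p' where "p' = Fmod alpha cor i m u v p"
  define q' where "q' = Fmod alphat cort x m u v q"
  define ns' where "ns' = (if A i i = 2 then ns else ns(i := ns i @ [1 / v]))"
  define g where "g t = cutg (%t. cor i (p t)) m u v (clamp t)" for t
  have mu: "dom mu" "T.dom mut" using b by (auto simp: bas_def)
  have pB: "p \<in> Bp mu" and qB: "q \<in> T.Bp mut" using LR_step.IH by auto
  have wsI: "set ws \<subseteq> I" using LR_step.IH by blast
  obtain F where F: "rep mu mut c p q ns F" using LR_step.IH by blast
  have nsl: "length (ns j) = count_list ws j" "sorted (ns j)" "!!n. n \<in> set (ns j) ==> hist mu p j n" if "j \<in> I" "j \<notin> R" for j using LR_step.IH that by auto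
  have iI: "i \<in> I" by fact
  have xI: "x \<in> It" unfolding x_def by (rule lbl_It[OF iI])
  \<comment> \<open>For a real letter the factor 2 - a_ii is 0; a fresh imaginary copy has a number
    beyond the recorded slopes, so its coefficient is 0.\<close>
  have Gx: "(2 - of_int (A i i)) * G mu c p ns x t = 0" for t
  proof (cases "A i i = 2")
    case False
    hence "x = (i, c i + length (ns i) + 1)" using nsl(1)[OF iI] R_iff[OF iI] by (simp add: x_def lbl_def)
    thus ?thesis using False by (simp add: G_def)
  qed simp
  have cx: "cort x (q t) = cor i (p t)" for t
  proof -
    obtain mm where xm: "x = (i, mm)" "A i i = 2 \<or> c i < mm" by (auto simp: x_def lbl_def)
    thus ?thesis using rep_cor[OF b F, of i mm t] xI Gx[of t] by simp
  qed
  have FSq: "FS (%t. cort x (q t)) m u v" using LR_step.hyps(3) cx by simp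
  have fp: "fstep alpha cor i p p'" unfolding fstep_def p'_def using LR_step.hyps(3) GLS_clamped[OF pB] by blast
  have fq: "fstep alphat cort x q q'" unfolding fstep_def q'_def using FSq T.GLS_clamped[OF qB] by blast
  have p'B: "p' \<in> Bp mu" using GLS_f(2)[OF mu(1) pB iI fp] .
  have q'B: "q' \<in> T.Bp mut" using T.GLS_f(2)[OF mu(2) qB xI fq] .
  have pt: "p' t = p t - g t *\<^sub>R alpha i" for t unfolding p'_def g_def by (rule Fmod_cutg[OF GLS_clamped[OF pB]])
  have qt: "q' t = q t - g t *\<^sub>R alphat x" for t unfolding q'_def g_def using Fmod_cutg[OF T.GLS_clamped[OF qB], of alphat cort x m u v t] cx by simp
  have stp: "stp p p'" using fp iI by (auto simp: stp_def)
  have G': "G mu c p' ns' y t = G mu c p ns y t + (if y = x then g t else 0)" if y: "y \<in> It" for y t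
  proof -
    obtain j k where jk: "y = (j, k)" by (cases y)
    have jI: "j \<in> I" using y jk It_iff by auto
    show ?thesis
    proof (cases "A j j = 2")
      case True
      have "(y = x) = (j = i)" using True y jk It_iff by (auto simp: x_def lbl_def)
      thus ?thesis using True jk jI iI by (simp add: G_def pt co_alpha algebra_simps)
    next
      case jim: False
      show ?thesis
      proof (cases "j = i")
        case ne: False
        hence "y \<noteq> x" "ns' j = ns j" using jk by (auto simp: x_def lbl_def ns'_def)
        thus ?thesis using jim jk by (simp add: G_def)
      next
        case eq: True
        hence iR: "i \<notin> R" using jim R_iff iI by auto
        have ns'i: "ns' i = ns i @ [1 / v]" using jim eq by (simp add: ns'_def)
        have x: "x = (i, c i + length (ns i) + 1)" using nsl(1)[OF iI iR] jim eq by (simp add: x_def lbl_def)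
        have gm: "g t = min (1 / v * clamp t) 1" unfolding g_def by (rule im_FS(4)[OF mu(1) pB iI iR LR_step.hyps(3)]) auto
        show ?thesis
        proof (cases "y = x")
          case True thus ?thesis using x jk eq jim ns'i gm by (simp add: G_def nth_append)
        next
          case False
          hence "k \<noteq> c i + length (ns i) + 1" using x jk eq by auto
          thus ?thesis using False jk eq jim ns'i by (auto simp: G_def nth_append)
        qed
      qed
    qed
  qed
  have "rep mu mut c p' q' ns' (insert x F)"
    unfolding rep_def
  proof (intro conjI allI ballI)
    have Fr: "finite F" "F \<subseteq> It" "!!y t. y \<in> It - F ==> G mu c p ns y t = 0"
      "!!t. p t = clamp t *\<^sub>R mu - (\<Sum>x\<in>F. G mu c p ns x t *\<^sub>R alpha (fst x))" "!!t. q t = clamp t *\<^sub>R mut - (\<Sum>x\<in>F. G mu c p ns x t *\<^sub>R alphat x)"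
      using F unfolding rep_def by blast+
    show "finite (insert x F)" "insert x F \<subseteq> It" using Fr xI by auto
    show "G mu c p' ns' y t = 0" if "y \<in> It - insert x F" for y t using G'[of y t] Fr(3)[of y t] that by auto
    have xF: "x \<notin> F ==> G mu c p ns x t = 0" for t using Fr(3)[of x t] xI by auto
    have S: "(\<Sum>y\<in>insert x F. G mu c p' ns' y t *\<^sub>R h y) = (\<Sum>y\<in>F. G mu c p ns y t *\<^sub>R h y) + g t *\<^sub>R h x" for h :: "'i \<times> nat => 'c::real_vector" and t
    proof -
      have "(\<Sum>y\<in>insert x F. G mu c p' ns' y t *\<^sub>R h y) = (\<Sum>y\<in>insert x F. G mu c p ns y t *\<^sub>R h y + (if y = x then g t *\<^sub>R h x else 0))"
        by (rule sum.cong) (use G' Fr(2) xI in \<open>auto simp: scaleR_left_distrib\<close>)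
      also have "... = (\<Sum>y\<in>insert x F. G mu c p ns y t *\<^sub>R h y) + g t *\<^sub>R h x" using Fr(1) by (simp add: sum.distrib)
      also have "(\<Sum>y\<in>insert x F. G mu c p ns y t *\<^sub>R h y) = (\<Sum>y\<in>F. G mu c p ns y t *\<^sub>R h y)"
        using Fr(1) xF by (cases "x \<in> F") (auto simp: insert_absorb)
      finally show ?thesis .
    qed
    have fx: "fst x = i" by (simp add: x_def lbl_def)
    show "p' t = clamp t *\<^sub>R mu - (\<Sum>x\<in>insert x F. G mu c p' ns' x t *\<^sub>R alpha (fst x))" for t
      using S[of t "%y. alpha (fst y)"] pt[of t] Fr(4)[of t] fx by simp
    show "q' t = clamp t *\<^sub>R mut - (\<Sum>x\<in>insert x F. G mu c p' ns' x t *\<^sub>R alphat x)" for t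
      using S[of t alphat] qt[of t] Fr(5)[of t] by simp
  qed
  moreover have "length (ns' j) = count_list (ws @ [i]) j & sorted (ns' j) & (\<forall>n\<in>set (ns' j). hist mu p' j n)" if j: "j \<in> I" "j \<notin> R" for j
  proof -
    have keep: "hist mu p' j n" if "hist mu p j n" for n
    proof -
      have "stp\<^sup>*\<^sup>* p1 p ==> stp\<^sup>*\<^sup>* p1 p'" for p1 using rtranclp.rtrancl_into_rtrancl[of stp p1 p p'] stp by blast
      thus ?thesis using that unfolding hist_def by blast
    qed
    show ?thesis
    proof (cases "j = i")
      case False
      hence "ns' j = ns j" by (simp add: ns'_def)
      thus ?thesis using nsl[OF j] keep False by auto
    next
      case True
      hence iR: "i \<notin> R" "A i i \<noteq> 2" using j R_iff by auto
      hence ns'i: "ns' i = ns i @ [1 / v]" by (simp add: ns'_def)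
      note im = im_FS[OF mu(1) pB iI iR(1) LR_step.hyps(3)]
      have v0: "0 < v" "v <= 1" using LR_step.hyps(3) unfolding FS_def by auto
      have gm: "p' t = p t - min (1 / v * t) 1 *\<^sub>R alpha i" if "0 <= t" "t <= 1" for t using pt[of t] im(4)[OF that] that by (simp add: g_def)
      have "hist mu p' i (1 / v)" unfolding hist_def
        using im(3,5,6) pB p'B fp gm by (intro conjI exI[of _ p] exI[of _ p']) auto
      moreover have "n <= 1 / v" if "n \<in> set (ns i)" for n
      proof -
        have h: "hist mu p i n" using nsl(3)[OF iI iR(1) that] .
        hence n1: "1 <= n" by (simp add: hist_def)
        \<comment> \<open>A positive time at which neither of the two slopes is saturated, so that
          they can be compared.\<close>
        define t where "t = min v (1/n)"
        have t: "0 < t" "t <= v" "t <= 1/n" "t <= 1" using v0 n1 by (auto simp: t_def)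
        have "n * t <= 1" using t n1 by (simp add: field_simps)
        hence "n * t <= 1 / v * t" using hist_bound(2)[OF mu(1) h iI iR(1), of t] im(5)[of t] t by simp
        thus ?thesis using t(1) by (meson mult_le_cancel_right_pos)
      qed
      ultimately show ?thesis using True ns'i nsl[OF iI iR(1)] keep by (auto simp: sorted_append)
    qed
  qed
  ultimately show ?case using p'B q'B wsI iI unfolding p'_def[symmetric] q'_def[symmetric] x_def[symmetric] ns'_def[symmetric] by auto
qed

text \<open>All copies of j carry the same simple root, so its coefficient in p is the sum of their
  contributions. This is the sum that \<open>min_sums_eq\<close> inverts.\<close>

lemma rep_co_im:
  assumes r: "rep mu mut c p q ns F" and j: "j \<in> I" "j \<notin> R"
  shows "co j (clamp t *\<^sub>R mu - p t) = (\<Sum>n\<leftarrow>ns j. min (n * clamp t) 1)"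
proof -
  have F: "finite F" "F \<subseteq> It" "!!y. y \<in> It - F ==> G mu c p ns y t = 0" using r by (auto simp: rep_def)
  have jA: "A j j \<noteq> 2" using j R_iff by auto
  let ?g = "%y. G mu c p ns y t"
  have p: "p t = clamp t *\<^sub>R mu - (\<Sum>y\<in>F. ?g y *\<^sub>R alpha (fst y))" using r by (auto simp: rep_def)
  have "co j (clamp t *\<^sub>R mu - p t) = (\<Sum>y\<in>F. ?g y * co j (alpha (fst y)))"
    unfolding p using j by (simp add: linear_sum[OF lin_co[OF j(1)]])
  also have "... = (\<Sum>y\<in>F. if fst y = j then ?g y else 0)"
    by (rule sum.cong) (use j F(2) It_fst in \<open>auto simp: co_alpha\<close>)
  also have "... = (\<Sum>y\<in>(%k. (j, c j + k + 1)) ` {..<length (ns j)}. ?g y)"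
  proof -
    let ?L = "(%k. (j, c j + k + 1)) ` {..<length (ns j)}"
    have "(\<Sum>y\<in>F. if fst y = j then ?g y else 0) = (\<Sum>y\<in>F \<union> ?L. if fst y = j then ?g y else 0)"
      by (rule sum.mono_neutral_left) (use F j jA in \<open>auto simp: It_iff\<close>)
    also have "... = (\<Sum>y\<in>?L. if fst y = j then ?g y else 0)"
    proof (rule sum.mono_neutral_right)
      show "\<forall>y\<in>(F \<union> ?L) - ?L. (if fst y = j then ?g y else 0) = 0"
      proof
        fix y assume y: "y \<in> (F \<union> ?L) - ?L"
        obtain k m where km: "y = (k, m)" by (cases y)
        have "\<not> (c j < m & m <= c j + length (ns j))" if "k = j"
        proof
          assume "c j < m & m <= c j + length (ns j)"
          hence "y = (j, c j + (m - c j - 1) + 1)" "m - c j - 1 < length (ns j)" using km that by auto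
          thus False using y by blast
        qed
        thus "(if fst y = j then ?g y else 0) = 0" using km jA by (auto simp: G_def)
      qed
    qed (use F in auto)
    also have "... = (\<Sum>y\<in>?L. ?g y)" by (rule sum.cong) auto
    finally show ?thesis .
  qed
  also have "... = (\<Sum>k<length (ns j). ?g (j, c j + k + 1))"
    by (subst sum.reindex) (auto simp: inj_on_def)
  also have "... = (\<Sum>k<length (ns j). min (ns j ! k * clamp t) 1)"
    by (rule sum.cong) (use jA in \<open>auto simp: G_def\<close>)
  finally show ?thesis using sum_index_list[of "%n. min (n * clamp t) 1" "ns j"] by simp
qed

lemma rep_sum_cong:
  fixes h :: "'i \<times> nat => 'c::real_vector"
  assumes "finite F" "F \<subseteq> It" "!!x. x \<in> It - F ==> g x = (0::real)" "finite F'" "F' \<subseteq> It" "!!x. x \<in> It - F' ==> g' x = 0" "!!x. x \<in> It ==> g x = g' x"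
  shows "(\<Sum>x\<in>F. g x *\<^sub>R h x) = (\<Sum>x\<in>F'. g' x *\<^sub>R h x)"
proof -
  have "(\<Sum>x\<in>F. g x *\<^sub>R h x) = (\<Sum>x\<in>F \<union> F'. g x *\<^sub>R h x)" by (rule sum.mono_neutral_left) (use assms in auto)
  also have "... = (\<Sum>x\<in>F \<union> F'. g' x *\<^sub>R h x)" by (rule sum.cong) (use assms in auto)
  also have "... = (\<Sum>x\<in>F'. g' x *\<^sub>R h x)" by (rule sum.mono_neutral_right) (use assms in auto)
  finally show ?thesis .
qed

text \<open>The coordinates of p at imaginary indices determine the sorted slopes, and those at real
  indices the remaining coefficients. So the lift depends on p and not on the word.\<close>

lemma LR_determined:
  assumes b: "bas mu mut c" and l: "LR mu mut c ws p q ns" "LR mu mut c ws' p q' ns'"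
  shows "q = q'"
proof -
  note i = LR_inv[OF b l(1)] and i' = LR_inv[OF b l(2)]
  obtain F F' where F: "rep mu mut c p q ns F" "rep mu mut c p q' ns' F'" using i i' by blast
  have ns: "ns j = ns' j" if j: "j \<in> I" "j \<notin> R" for j
  proof (rule min_sums_eq)
    show "sorted (ns j)" "sorted (ns' j)" using i i' j by auto
    show "\<forall>n\<in>set (ns j). 1 <= n" "\<forall>n\<in>set (ns' j). 1 <= n" using i i' j by (auto simp: hist_def)
    fix t :: real assume "0 <= t" "t <= 1"
    thus "(\<Sum>n\<leftarrow>ns j. min (n * t) 1) = (\<Sum>n\<leftarrow>ns' j. min (n * t) 1)"
      using rep_co_im[OF F(1) j, of t] rep_co_im[OF F(2) j, of t] by simp
  qed
  have g: "G mu c p ns x t = G mu c p ns' x t" if "x \<in> It" for x t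
    using that ns R_iff by (cases x) (auto simp: G_def It_iff split: if_splits)
  show ?thesis
  proof
    fix t
    have "(\<Sum>x\<in>F. G mu c p ns x t *\<^sub>R alphat x) = (\<Sum>x\<in>F'. G mu c p ns' x t *\<^sub>R alphat x)"
      by (rule rep_sum_cong) (use F g in \<open>auto simp: rep_def\<close>)
    thus "q t = q' t" using F by (simp add: rep_def)
  qed
qed

lemma rep_cot:
  assumes r: "rep mu mut c p q ns F" and x: "x \<in> It"
  shows "G mu c p ns x t = cot x (clamp t *\<^sub>R mut - q t)"
proof -
  have F: "finite F" "F \<subseteq> It" "!!y. y \<in> It - F ==> G mu c p ns y t = 0" using r by (auto simp: rep_def)
  let ?g = "%y. G mu c p ns y t"
  have q: "q t = clamp t *\<^sub>R mut - (\<Sum>y\<in>F. ?g y *\<^sub>R alphat y)" using r by (auto simp: rep_def)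
  have "cot x (clamp t *\<^sub>R mut - q t) = (\<Sum>y\<in>F. ?g y * cot x (alphat y))"
    unfolding q using x by (simp add: linear_sum[OF T.lin_co[OF x]])
  also have "... = (\<Sum>y\<in>F. if y = x then ?g x else 0)"
    by (rule sum.cong) (use x F(2) in \<open>auto simp: T.co_alpha\<close>)
  also have "... = ?g x" using F x by auto
  finally show ?thesis by simp
qed

text \<open>The coordinates of the lift are the individual coefficients, from which p is
  assembled.\<close>

lemma LR_injective:
  assumes b: "bas mu mut c" and l: "LR mu mut c ws p q ns" "LR mu mut c ws' p' q ns'"
  shows "p = p'"
proof -
  obtain F F' where F: "rep mu mut c p q ns F" "rep mu mut c p' q ns' F'" using LR_inv[OF b l(1)] LR_inv[OF b l(2)] by blast
  have g: "G mu c p ns x t = G mu c p' ns' x t" if "x \<in> It" for x t using rep_cot[OF F(1) that] rep_cot[OF F(2) that] by simp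
  show ?thesis
  proof
    fix t
    have "(\<Sum>x\<in>F. G mu c p ns x t *\<^sub>R alpha (fst x)) = (\<Sum>x\<in>F'. G mu c p' ns' x t *\<^sub>R alpha (fst x))"
      by (rule rep_sum_cong) (use F g in \<open>auto simp: rep_def\<close>)
    thus "p t = p' t" using F by (simp add: rep_def)
  qed
qed

lemma LR_cor:
  assumes b: "bas mu mut c" and l: "LR mu mut c ws p q ns" and x: "(j, m) \<in> It" "A j j = 2 \<or> c j + count_list ws j < m"
  shows "cort (j, m) (q t) = cor j (p t)"
proof -
  note i = LR_inv[OF b l]
  obtain F where F: "rep mu mut c p q ns F" using i by blast
  have j: "j \<in> I" using x It_iff by auto
  have "(2 - of_int (A j j)) * G mu c p ns (j, m) t = 0"
    using x i j R_iff by (cases "A j j = 2") (auto simp: G_def)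
  thus ?thesis using rep_cor[OF b F x(1), of t] x(2) by auto
qed

lemma LR_lbl: "bas mu mut c ==> LR mu mut c ws p q ns ==> i \<in> I ==> cort (lbl c ws i) (q t) = cor i (p t)"
  using LR_cor[of mu mut c ws p q ns i "snd (lbl c ws i)" t] lbl_It[of i c ws] by (auto simp: lbl_def)

lemma LR_step_f:
  assumes b: "bas mu mut c" and l: "LR mu mut c ws p q ns" and i: "i \<in> I" and f: "f_root alpha cor i p = Some p'"
  shows "\<exists>q' ns'. LR mu mut c (ws @ [i]) p' q' ns' & f_root alphat cort (lbl c ws i) q = Some q'"
proof -
  have mu: "dom mu" using b by (simp add: bas_def)
  have pB: "p \<in> Bp mu" using LR_inv[OF b l] by blast
  have "fstep alpha cor i p p'" using GLS_f(1)[OF mu pB i, of p'] f by blast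
  then obtain m u v where F: "FS (%t. cor i (p t)) m u v" "p' = Fmod alpha cor i m u v p" by (auto simp: fstep_def)
  have "FS (%t. cort (lbl c ws i) (q t)) m u v" using F(1) LR_lbl[OF b l i] by simp
  hence "f_root alphat cort (lbl c ws i) q = Some (Fmod alphat cort (lbl c ws i) m u v q)" using FS_f_root[of cort "lbl c ws i" q m u v alphat] by simp
  thus ?thesis using LR_step[OF l i F(1)] F(2) by blast
qed

lemma LR_step_ft:
  assumes b: "bas mu mut c" and l: "LR mu mut c ws p q ns" and i: "i \<in> I" and f: "f_root alphat cort (lbl c ws i) q = Some q'"
  shows "\<exists>p' ns'. LR mu mut c (ws @ [i]) p' q' ns' & f_root alpha cor i p = Some p'"
proof -
  have mu: "T.dom mut" using b by (simp add: bas_def)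
  have qB: "q \<in> T.Bp mut" using LR_inv[OF b l] by blast
  have "fstep alphat cort (lbl c ws i) q q'" using T.GLS_f(1)[OF mu qB lbl_It[OF i]] f by simp
  then obtain m u v where F: "FS (%t. cort (lbl c ws i) (q t)) m u v" "q' = Fmod alphat cort (lbl c ws i) m u v q" by (auto simp: fstep_def)
  have F1: "FS (%t. cor i (p t)) m u v" using F(1) LR_lbl[OF b l i] by simp
  hence "f_root alpha cor i p = Some (Fmod alpha cor i m u v p)" using FS_f_root[of cor i p m u v alpha] by simp
  thus ?thesis using LR_step[OF l i F1] F(2) by blast
qed

fun lw :: "('i => nat) => 'i list => 'i list => ('i \<times> nat) list" where
  "lw c ws0 [] = []"
| "lw c ws0 (i # ws) = lbl c ws0 i # lw c (ws0 @ [i]) ws"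

lemma lw_It: "set ws \<subseteq> I ==> set (lw c ws0 ws) \<subseteq> It"
  by (induction ws arbitrary: ws0) (auto simp: lbl_It)

lemma lw_shift: "lw (%i. c i + count_list us i) ws0 ws = lw c (us @ ws0) ws"
  by (induction ws arbitrary: ws0) (auto simp: lbl_def)

lemma LR_word:
  assumes b: "bas mu mut c"
  shows "LR mu mut c ws0 p q ns ==> set ws \<subseteq> I ==> Fw alpha cor ws p = Some r ==> \<exists>y ns'. LR mu mut c (ws0 @ ws) r y ns' & Fw alphat cort (lw c ws0 ws) q = Some y"
proof (induction ws arbitrary: ws0 p q ns)
  case (Cons i ws)
  obtain p' where p': "f_root alpha cor i p = Some p'" "Fw alpha cor ws p' = Some r" using Cons.prems(3) by (auto simp: bind_eq_Some_conv)
  obtain q' ns' where q': "LR mu mut c (ws0 @ [i]) p' q' ns'" "f_root alphat cort (lbl c ws0 i) q = Some q'"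
    using LR_step_f[OF b Cons.prems(1) _ p'(1)] Cons.prems(2) by auto
  show ?case using Cons.IH[OF q'(1) _ p'(2)] Cons.prems(2) q'(2) by auto
qed auto

lemma LR_wordt:
  assumes b: "bas mu mut c"
  shows "LR mu mut c ws0 p q ns ==> set ws \<subseteq> I ==> Fw alphat cort (lw c ws0 ws) q = Some y ==> \<exists>r ns'. LR mu mut c (ws0 @ ws) r y ns' & Fw alpha cor ws p = Some r"
proof (induction ws arbitrary: ws0 p q ns)
  case (Cons i ws)
  obtain q' where q': "f_root alphat cort (lbl c ws0 i) q = Some q'" "Fw alphat cort (lw c (ws0 @ [i]) ws) q' = Some y" using Cons.prems(3) by (auto simp: bind_eq_Some_conv)
  obtain p' ns' where p': "LR mu mut c (ws0 @ [i]) p' q' ns'" "f_root alpha cor i p = Some p'"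
    using LR_step_ft[OF b Cons.prems(1) _ q'(1)] Cons.prems(2) by auto
  show ?case using Cons.IH[OF p'(1) _ q'(2)] Cons.prems(2) p'(2) by auto
qed auto

lemma lw_mseq: "lw (%_. 0) [] ws = mseq A ws"
proof -
  have "lw (%_. 0) ws0 ws = map (%k. (ws ! k, if A (ws ! k) (ws ! k) = 2 then 1 else count_list (ws0 @ take (Suc k) ws) (ws ! k))) [0..<length ws]" for ws0
  proof (induction ws arbitrary: ws0)
    case (Cons i ws)
    have u: "[0..<length (i # ws)] = 0 # map Suc [0..<length ws]" by (simp add: map_Suc_upt upt_conv_Cons del: upt_Suc)
    show ?case unfolding u using Cons.IH[of "ws0 @ [i]"] by (simp add: lbl_def)
  qed simp
  from this[of "[]"] show ?thesis by (simp add: mseq_def)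
qed

lemma Bp_word:
  assumes "dom mu" "p \<in> Bp mu"
  shows "\<exists>ws. set ws \<subseteq> I & Fw alpha cor ws (pi_lam mu) = Some p"
  using assms
proof (induction rule: GLS_induct)
  case base thus ?case by (intro exI[of _ "[]"]) auto
next
  case (step q p i)
  obtain ws where ws: "set ws \<subseteq> I" "Fw alpha cor ws (pi_lam mu) = Some q" using step by auto
  have "f_root alpha cor i q = Some p" using GLS_f(1)[OF assms(1), of q i p] step by blast
  hence "Fw alpha cor (ws @ [i]) (pi_lam mu) = Some p" using ws by (simp add: Fw_def)
  thus ?case using ws step by (intro exI[of _ "ws @ [i]"]) auto
qed

text \<open>The path chosen inside \<open>tmap\<close> is only known to come from some word. That is
  enough, as every word gives the same lift by \<open>LR_determined\<close>.\<close>

lemma tmap_LR: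
  assumes b: "bas mu mut (%_. 0)" and p: "p \<in> Bp mu"
  shows "\<exists>ws ns. LR mu mut (%_. 0) ws p (tmap I A alpha cor mu alphat cort mut p) ns"
proof -
  have mu: "dom mu" using b by (simp add: bas_def)
  let ?P = "%q. \<exists>ws. set ws \<subseteq> I & Fw alpha cor ws (pi_lam mu) = Some p & Fw alphat cort (mseq A ws) (pi_lam mut) = Some q"
  obtain ws where ws: "set ws \<subseteq> I" "Fw alpha cor ws (pi_lam mu) = Some p" using Bp_word[OF mu p] by auto
  have "\<exists>q. ?P q" using LR_word[OF b LR_base ws] ws unfolding lw_mseq by auto
  hence "?P (tmap I A alpha cor mu alphat cort mut p)" unfolding tmap_def by (rule someI_ex)
  then obtain ws where ws: "set ws \<subseteq> I" "Fw alpha cor ws (pi_lam mu) = Some p" "Fw alphat cort (mseq A ws) (pi_lam mut) = Some (tmap I A alpha cor mu alphat cort mut p)" by auto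
  thus ?thesis using LR_word[OF b LR_base ws(1,2)] unfolding lw_mseq by auto
qed

subsection \<open>Removing an imaginary letter\<close>

definition addp :: "'i => real => (real => 'a) => real => 'a" where
  "addp i n p = (%t. p t + min (n * clamp t) 1 *\<^sub>R alpha i)"

text \<open>If the height function of i still has at 1/n the least value 1 - a_ii that the letter
  forces, no later letter has changed it on [0, 1/n]. So a later letter j either has a_ij = 0, or it
  turns only after 1/n, where removing the letter i shifts its height function by the constant a_ji.
  In both cases f_j subtracts the same function from the path without the letter.\<close>

lemma drop_letter:
  assumes mu: "dom mu" and i: "i \<in> I" "i \<notin> R" and n: "1 <= n" and p0: "p0 \<in> Bp mu" and p1: "p1 \<in> Bp mu"
    and H: "!!t. 0 <= t ==> t <= 1/n ==> cor i (p0 t) = n * t"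
    and e: "!!t. 0 <= t ==> t <= 1 ==> p1 t = p0 t - min (n * t) 1 *\<^sub>R alpha i" and s: "stp\<^sup>*\<^sup>* p1 p"
    and le: "cor i (p (1/n)) <= 1 - of_int (A i i)"
  shows "p \<in> Bp mu & addp i n p \<in> Bp mu & (\<forall>t. 0 <= t & t <= 1/n --> cor i (p t) = (1 - of_int (A i i)) * (n * t))"
  using s le
proof (induction rule: rtranclp_induct)
  case base
  have n1: "1/n <= 1" using n by simp
  have ap: "addp i n p1 = p0"
  proof (rule clamped_eqI)
    show "clamped p0" using GLS_clamped[OF p0] .
    show "clamped (addp i n p1)" using GLS_clamped[OF p1] by (simp add: clamped_def addp_def)
    fix t :: real assume "0 <= t" "t <= 1" thus "addp i n p1 t = p0 t" using e by (simp add: addp_def)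
  qed
  have "cor i (p1 t) = (1 - of_int (A i i)) * (n * t)" if t: "0 <= t" "t <= 1/n" for t
  proof -
    have "n * t <= 1" using t n by (simp add: field_simps)
    moreover have "cor i (p1 t) = cor i (p0 t) - min (n * t) 1 * of_int (A i i)" using e[of t] t n1 i cor_A[OF i(1)] by simp
    ultimately show ?thesis using H[of t] t by (simp add: algebra_simps min_def)
  qed
  thus ?case using ap p0 p1 by simp
next
  case (step y z)
  then obtain j where j: "j \<in> I" "fstep alpha cor j y z" by (auto simp: stp_def)
  then obtain m u v where F: "FS (%t. cor j (y t)) m u v" "z = Fmod alpha cor j m u v y" "clamped y" by (auto simp: fstep_def)
  let ?g = "cutg (%t. cor j (y t)) m u v"
  have n1: "0 <= 1/n" "0 < 1/n" "1/n <= 1" using n by auto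
  have zt: "z t = y t - ?g (clamp t) *\<^sub>R alpha j" for t unfolding F(2) by (rule Fmod_cutg[OF F(3)])
  have aij: "cor i (alpha j) = of_int (A i j)" "of_int (A i j) <= (0::real)" using cA[OF i(1) j(1)] im_neg[of i j] i j R_iff by auto
  have zi: "cor i (z t) = cor i (y t) - ?g t * of_int (A i j)" if "0 <= t" "t <= 1" for t using zt[of t] that i aij by simp
  have g0: "0 <= ?g t" if "0 <= t" "t <= 1" for t using cutg_nonneg[OF F(1) that] .
  have "?g (1/n) * of_int (A i j) <= 0" using g0[of "1/n"] n1 aij by (simp add: mult_nonneg_nonpos)
  hence "cor i (y (1/n)) <= 1 - of_int (A i i)" using zi[of "1/n"] n1 step.prems by linarith
  hence IH: "y \<in> Bp mu" "addp i n y \<in> Bp mu" "!!t. 0 <= t ==> t <= 1/n ==> cor i (y t) = (1 - of_int (A i i)) * (n * t)" using step.IH by auto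
  have zB: "z \<in> Bp mu" using GLS_f(2)[OF mu IH(1) j] .
  have "cor i (y (1/n)) = 1 - of_int (A i i)" using IH(3)[of "1/n"] n1 n by simp
  hence "- (?g (1/n) * of_int (A i j)) <= 0" using zi[of "1/n"] n1 step.prems by linarith
  hence gz: "?g (1/n) * of_int (A i j) = 0" using \<open>?g (1/n) * of_int (A i j) <= 0\<close> by linarith
  have gz': "?g t * of_int (A i j) = 0" if "0 <= t" "t <= 1/n" for t
  proof (cases "A i j = 0")
    case False
    hence "?g (1/n) = 0" using gz by simp
    moreover have "?g t <= ?g (1/n)" using cutg_mono[OF F(1), of t "1/n"] that n1 by simp
    ultimately have "?g t = 0" using g0[of t] that n1 by linarith
    thus ?thesis by simp
  qed simp
  have Hz: "cor i (z t) = (1 - of_int (A i i)) * (n * t)" if "0 <= t" "t <= 1/n" for t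
    using zi[of t] gz'[OF that] IH(3)[OF that] that n1 by simp
  define M where "M t = min (n * clamp t) 1" for t
  have M: "0 <= M t" "M t <= 1" for t using n by (auto simp: M_def)
  have ya: "cor j (addp i n y t) = cor j (y t) + M t * of_int (A j i)" for t
    using j i cA[OF j(1) i(1)] by (simp add: addp_def M_def)
  have ay: "clamped (addp i n y)" using GLS_clamped[OF IH(2)] .
  have "fstep alpha cor j (addp i n y) (addp i n z)"
  proof (cases "A i j = 0")
    case True
    hence "A j i = 0" using A_zero[OF i(1) j(1)] by simp
    hence eq: "cor j (addp i n y t) = cor j (y t)" for t using ya by simp
    have "FS (%t. cor j (addp i n y t)) m u v" using F(1) eq by simp
    moreover have "Fmod alpha cor j m u v (addp i n y) t = addp i n z t" for t
      unfolding Fmod_cutg[OF ay] eq by (simp add: addp_def zt)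
    ultimately show ?thesis unfolding fstep_def using ay by (metis ext)
  next
    case False
    hence g0': "?g (1/n) = 0" using gz by simp
    \<comment> \<open>The cut function of j vanishes at 1/n, although it is positive as soon as the
      turning has begun.\<close>
    have u: "1/n <= u"
    proof (rule ccontr)
      assume c: "\<not> 1/n <= u"
      have F': "u < v" "cor j (y u) = m" "!!t t'. u <= t ==> t < t' ==> t' <= v ==> cor j (y t) < cor j (y t')" using F(1) unfolding FS_def by auto
      show False using g0' c F'(2) F'(3)[of u "1/n"] by (auto simp: cutg_def split: if_splits)
    qed
    \<comment> \<open>An imaginary letter turns from time 0 on, which is before 1/n.\<close>
    have jR: "j \<in> R"
    proof (rule ccontr)
      assume "j \<notin> R"
      hence "u = 0" using im_FS(2)[OF mu IH(1) j(1) _ F(1)] by blast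
      thus False using u n1 by simp
    qed
    have ne: "j \<noteq> i" using jR i by auto
    have aji: "of_int (A j i) <= (0::real)" using corneg[of j i] jR i ne cA[OF j(1) i(1)] j R_iff by simp
    define m' where "m' = m + of_int (A j i)"
    have Mu: "M t = 1" if "1/n <= t" "t <= 1" for t
    proof -
      have "0 <= t" using that n1 by linarith
      moreover have "1 <= n * t" using that(1) n by (simp add: field_simps)
      ultimately show ?thesis using that by (simp add: M_def)
    qed
    have F': "m \<in> \<int>" "0 <= u" "u < v" "v <= 1" "cor j (y u) = m" "cor j (y v) = m + 1"
     "!!t. 0 <= t ==> t <= u ==> m <= cor j (y t)" "!!t t'. u <= t ==> t < t' ==> t' <= v ==> cor j (y t) < cor j (y t')"
     "!!t. v <= t ==> t <= 1 ==> m + 1 <= cor j (y t)" using F(1) unfolding FS_def by auto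
    have sh: "cor j (addp i n y t) = cor j (y t) + of_int (A j i)" if "u <= t" "t <= 1" for t using ya[of t] Mu[of t] that u by simp
    have "FS (%t. cor j (addp i n y t)) m' u v" unfolding FS_def
    proof (intro conjI allI impI)
      show "m' \<in> \<int>" using F'(1) by (simp add: m'_def)
      show "0 <= u" "u < v" "v <= 1" using F' by auto
      show "cor j (addp i n y u) = m'" "cor j (addp i n y v) = m' + 1" using sh[of u] sh[of v] F' by (auto simp: m'_def)
      fix t assume t: "0 <= t & t <= u"
      have "of_int (A j i) <= M t * of_int (A j i)" using aji M[of t] mult_right_mono_neg[of "M t" 1 "of_int (A j i)"] by simp
      thus "m' <= cor j (addp i n y t)" using F'(7)[of t] t ya[of t] by (simp add: m'_def)
    next
      fix t t' assume t: "u <= t & t < t' & t' <= v"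
      thus "cor j (addp i n y t) < cor j (addp i n y t')" using F'(8)[of t t'] sh[of t] sh[of t'] F'(4) by simp
    next
      fix t assume t: "v <= t & t <= 1"
      thus "m' + 1 <= cor j (addp i n y t)" using F'(9)[of t] sh[of t] F'(3) by (simp add: m'_def)
    qed
    moreover have "Fmod alpha cor j m' u v (addp i n y) t = addp i n z t" for t
    proof -
      have "cutg (%t. cor j (addp i n y t)) m' u v (clamp t) = ?g (clamp t)"
        using sh[of "clamp t"] by (auto simp: cutg_def m'_def)
      thus ?thesis unfolding Fmod_cutg[OF ay] by (simp add: addp_def zt)
    qed
    ultimately show ?thesis unfolding fstep_def using ay by (metis ext)
  qed
  hence "addp i n z \<in> Bp mu" using GLS_f(2)[OF mu IH(2) j(1)] by blast
  thus ?case using zB Hz by blast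
qed

lemma highest_dominant:
  assumes b: "bas mu mut (%_. 0)" and l: "LR mu mut (%_. 0) ws p q ns" and S: "S \<subseteq> I"
    and hw: "!!i r. i \<in> S ==> r \<in> Bp mu ==> \<not> fstep alpha cor i r p"
  shows "tdominant (Stilde S A) cort q"
  unfolding tdominant_def
proof (intro ballI)
  fix x t assume x: "x \<in> Stilde S A" and "t \<in> {0..1::real}"
  hence t: "0 <= t" "t <= 1" by auto
  note inv = LR_inv[OF b l]
  have mu: "dom mu" "T.dom mut" using b by (auto simp: bas_def)
  have pB: "p \<in> Bp mu" and qB: "q \<in> T.Bp mut" using inv by auto
  obtain i m where im: "x = (i, m)" "i \<in> S" "i \<in> I" "(i, m) \<in> It" using x S by (auto simp: Stilde_def It_iff)
  show "0 <= cort x (q t)"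
  proof (cases "A i i = 2")
    case True
    hence iR: "i \<in> R" using im R_iff by simp
    interpret LL: letter alpha cor i by (rule letter_R[OF iR])
    have L: "LI (%t. cor i (p t))" using GLS_LI[OF pB iR] dom_R[OF mu(1) iR] by blast
    have "\<not> fstep alpha cor i r p" for r
      using hw[OF im(2), of r] GLS_fstep_rev[OF _ pB iR] dom_R[OF mu(1) iR] by blast
    hence "mval cor i p = 0" using LL.LI_e[OF L GLS_clamped[OF pB]] by blast
    hence "0 <= cor i (p t)" using LL.LI_mval(2)[OF L t] by simp
    thus ?thesis using LR_cor[OF b l im(4)] True im(1) by simp
  next
    case False
    hence iR: "i \<notin> R" using im R_iff by simp
    show ?thesis
    proof (cases "count_list ws i < m")
      case True
      have "0 <= cor i (p t)" using im_mono[OF mu(1) im(3) iR pB, of 0 t] t GLS_0[OF pB] im(3) by simp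
      thus ?thesis using LR_cor[OF b l im(4), of t] True im(1) by simp
    next
      case ml: False
      have m1: "1 <= m" using im(4) False by (simp add: It_iff)
      \<comment> \<open>Copies are numbered from 1, list positions from 0.\<close>
      define n where "n = ns i ! (m - 1)"
      have len: "length (ns i) = count_list ws i" using inv im(3) iR by blast
      have "n \<in> set (ns i)" unfolding n_def using ml m1 len by (intro nth_mem) simp
      hence h: "hist mu p i n" using inv im(3) iR by blast
      have n1: "1 <= n" using h by (simp add: hist_def)
      have nn: "0 < 1/n" "1/n <= 1" using n1 by auto
      define a where "a = real_of_int (A i i)"
      obtain F where F: "rep mu mut (%_. 0) p q ns F" using inv by blast
      have Hx: "cort x (q r) = cor i (p r) - (2 - a) * min (n * r) 1" if "0 <= r" "r <= 1" for r
        using rep_cor[OF b F im(4), of r] m1 ml len False im(1) that by (simp add: G_def n_def a_def)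
      have lb: "(1 - a) * min (n * r) 1 <= cor i (p r)" if "0 <= r" "r <= 1" for r using hist_bound(1)[OF mu(1) h im(3) iR that] by (simp add: a_def)
      have lb1: "- min (n * r) 1 <= cort x (q r)" if "0 <= r" "r <= 1" for r using Hx[OF that] lb[OF that] by (simp add: algebra_simps)
      show ?thesis
      proof (rule ccontr)
        assume neg: "\<not> 0 <= cort x (q t)"
        have xI: "x \<in> It" using im by simp
        note mv = T.L.integral_mval[OF T.GLS_integral[OF mu(2) qB] xI]
        obtain r where r: "0 <= r" "r <= 1" "cort x (q r) = mval cort x q" using mv(4) by auto
        have "mval cort x q < 0" using mv(2)[OF t] neg by linarith
        hence "mval cort x q + 1 <= 0" using Ints_less_add1[OF mv(1), of 0] by simp
        hence "cort x (q r) <= - 1" using r by simp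
        hence mn: "min (n * r) 1 = 1" using lb1[OF r(1,2)] by linarith
        hence "cor i (p r) <= 1 - a" using Hx[OF r(1,2)] \<open>cort x (q r) <= - 1\<close> by simp
        have "1/n <= r" using mn n1 by (simp add: field_simps min_def split: if_splits)
        hence le: "cor i (p (1/n)) <= 1 - a" using im_mono[OF mu(1) im(3) iR pB, of "1/n" r] nn r \<open>cor i (p r) <= 1 - a\<close> by simp
        obtain p0 p1 where h': "p0 \<in> Bp mu" "p1 \<in> Bp mu" "!!t. 0 <= t ==> t <= 1/n ==> cor i (p0 t) = n * t"
          "!!t. 0 <= t ==> t <= 1 ==> p1 t = p0 t - min (n * t) 1 *\<^sub>R alpha i" "stp\<^sup>*\<^sup>* p1 p"
          using h unfolding hist_def by blast
        have D: "addp i n p \<in> Bp mu" "!!t. 0 <= t ==> t <= 1/n ==> cor i (p t) = (1 - a) * (n * t)"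
          using drop_letter[OF mu(1) im(3) iR n1 h' le[unfolded a_def]] by (auto simp: a_def)
        define p' where "p' = addp i n p"
        have Hp': "cor i (p' r) = cor i (p r) + min (n * r) 1 * a" if "0 <= r" "r <= 1" for r
          using that im(3) cor_A[OF im(3)] by (simp add: p'_def addp_def a_def)
        have H1: "cor i (p' r) = n * r" if "0 <= r" "r <= 1/n" for r
        proof -
          have "n * r <= 1" using that n1 by (simp add: field_simps)
          thus ?thesis using Hp'[of r] D(2)[OF that] that nn by (simp add: algebra_simps)
        qed
        have H2: "1 <= cor i (p' r)" if r: "1/n <= r" "r <= 1" for r
        proof -
          have "1 <= n * r" using r(1) n1 by (simp add: field_simps)
          moreover have "cor i (p (1/n)) <= cor i (p r)" using im_mono[OF mu(1) im(3) iR pB, of "1/n" r] nn r by simp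
          moreover have "cor i (p (1/n)) = 1 - a" using D(2)[of "1/n"] nn n1 by simp
          ultimately show ?thesis using Hp'[of r] nn r by simp
        qed
        have FS: "FS (%t. cor i (p' t)) 0 0 (1/n)"
        proof -
          have "cor i (p' t) < cor i (p' t')" if "0 <= t" "t < t'" "t' <= 1/n" for t t' using H1[of t] H1[of t'] that n1 by simp
          moreover have "cor i (p' 0) = 0" "cor i (p' (1/n)) = 1" using H1[of 0] H1[of "1/n"] nn n1 by auto
          ultimately show ?thesis unfolding FS_def using H2 nn by (auto simp: order_antisym_conv)
        qed
        have cp': "clamped p'" using GLS_clamped[OF D(1)] by (simp add: p'_def)
        have "Fmod alpha cor i 0 0 (1/n) p' = p"
        proof
          fix t
          have "cutg (%t. cor i (p' t)) 0 0 (1/n) (clamp t) = min (n * clamp t) 1"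
          proof -
            have ct: "0 <= clamp t" "clamp t <= 1" by auto
            consider "clamp t = 0" | "0 < clamp t" "clamp t <= 1/n" | "1/n < clamp t" using ct by linarith
            thus ?thesis
            proof cases
              case 1 thus ?thesis using n1 by (simp add: cutg_def)
            next
              case 2
              hence "n * clamp t <= 1" using n1 by (simp add: field_simps)
              thus ?thesis using 2 H1[of "clamp t"] by (simp add: cutg_def)
            next
              case 3
              hence "1 <= n * clamp t" using n1 by (simp add: field_simps)
              moreover have "\<not> clamp t <= 0" using 3 nn by linarith
              ultimately show ?thesis using 3 by (simp add: cutg_def)
            qed
          qed
          thus "Fmod alpha cor i 0 0 (1/n) p' t = p t" unfolding Fmod_cutg[OF cp'] by (simp add: p'_def addp_def)
        qed
        hence "fstep alpha cor i p' p" unfolding fstep_def using FS cp' by metis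
        thus False using hw[OF im(2), of p'] D(1) by (simp add: p'_def)
      qed
    qed
  qed
qed

end

section \<open>Comparing two words of lowering operators\<close>

context lets
begin

lemma act_back:
  assumes "good J alpha cor p" "good J alpha cor q" "set u \<subseteq> J"
  shows "act alpha cor (map (Pair False) (rev u)) q = Some p \<longleftrightarrow> act alpha cor (map (Pair True) u) p = Some q"
  using assms
proof (induction u arbitrary: p)
  case (Cons j u)
  have j: "j \<in> J" "set u \<subseteq> J" using Cons.prems by auto
  let ?e = "map (Pair False) (rev u)"
  have s: "snd ` set ?e \<subseteq> J" using j by auto
  have "act alpha cor (map (Pair False) (rev (j # u))) q = Some p \<longleftrightarrow> (\<exists>r. act alpha cor ?e q = Some r & act1 alpha cor (False, j) r = Some p)"
    by (auto simp: act_append bind_eq_Some_conv)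
  also have "... \<longleftrightarrow> (\<exists>r. act1 alpha cor (True, j) p = Some r & act alpha cor (map (Pair True) u) r = Some q)"
  proof -
    have "act alpha cor ?e q = Some r & act1 alpha cor (False, j) r = Some p \<longleftrightarrow> act1 alpha cor (True, j) p = Some r & act alpha cor (map (Pair True) u) r = Some q" for r
    proof (cases "good J alpha cor r")
      case True
      thus ?thesis using Cons.IH[OF True Cons.prems(2) j(2)] act1_f(1)[OF good_integral[OF Cons.prems(1)] j(1), of r] act1_e(1)[OF good_integral[OF True] j(1), of p] by auto
    next
      case False
      thus ?thesis using good_act[OF Cons.prems(2) _ s, of r] good_act1[OF Cons.prems(1), of "(True, j)" r] j by auto
    qed
    thus ?thesis by blast
  qed
  also have "... \<longleftrightarrow> act alpha cor (map (Pair True) (j # u)) p = Some q" by (simp add: bind_eq_Some_conv)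
  finally show ?case .
qed auto

text \<open>e_j inverts f_j, so two words meet iff running the first forward and the second backward
  ends at the start of the second. Equality of paths becomes a statement about one word, which
  \<open>Iso\<close> can transport.\<close>

lemma act_loop:
  assumes g: "good J alpha cor p" and u: "set u \<subseteq> J" "set v \<subseteq> J"
    and a: "act alpha cor (map (Pair True) u) p = Some y" "act alpha cor (map (Pair True) v) p' = Some z" and g': "good J alpha cor p'"
  shows "act alpha cor (map (Pair True) u @ map (Pair False) (rev v)) p = Some p' \<longleftrightarrow> y = z"
proof -
  have gy: "good J alpha cor y" by (rule good_act[OF g a(1)]) (use u in auto)
  show ?thesis using act_back[OF g' gy u(2)] a by (auto simp: act_append)
qed

end

context idat
begin

lemma Fw_end:
  assumes "dom mu"
  shows "p \<in> Bp mu ==> set ws \<subseteq> I ==> Fw alpha cor ws p = Some b ==> b \<in> Bp mu & b 1 = p 1 - (\<Sum>i\<leftarrow>ws. alpha i)"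
proof (induction ws arbitrary: p)
  case (Cons i ws)
  obtain r where r: "f_root alpha cor i p = Some r" "Fw alpha cor ws r = Some b" using Cons.prems by (auto simp: bind_eq_Some_conv)
  have i: "i \<in> I" using Cons.prems by simp
  have f: "fstep alpha cor i p r" using GLS_f(1)[OF assms Cons.prems(1) i, of r] r(1) by blast
  show ?case using Cons.IH[OF GLS_f(2)[OF assms Cons.prems(1) i f] _ r(2)] Cons.prems(2) fstep_end[OF f] by simp
qed auto

end

lemma Fw_snoc: "Fw al cr (ws @ [i]) p = Option.bind (Fw al cr ws p) (f_root al cr i)"
  by (simp add: Fw_def)

lemma Stilde_Itilde: "Stilde S A = Itilde S A" by (simp add: Stilde_def Itilde_def)

lemma (in pair) pair_sub:
  assumes "S \<subseteq> I"
  shows "pair S A alpha cor co ht d alphat cort cot htt dt"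
proof -
  have s: "j \<in> S ==> j \<in> I" for j using assms by blast
  have J: "Itilde S A \<subseteq> Itilde I A" using assms by (auto simp: Itilde_def)
  show ?thesis
    by (intro pair.intro idat.intro rdat.intro idat_axioms.intro pair_axioms.intro T.kdat_sub[OF J] lin_cor lin_co lin_ht co_alpha ht_alpha cor2 corZ corneg d_pos d_sym
        corZ_all im_neg d_pos_all d_sym_all cor_A cA cAt A_zero s subsetD[OF J])
qed

section \<open>The decomposition for the Levi part\<close>

locale levi = pair I A alpha cor co ht d alphat cort cot htt dt
  for I :: "'i set" and A alpha cor co ht d alphat cort cot htt dt +
  fixes S :: "'i set" and lam lamt
  assumes SI: "S \<subseteq> I" and bas: "bas lam lamt (%_. 0)"

sublocale levi \<subseteq> V: pair S A alpha cor co ht d alphat cort cot htt dt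
  by (rule pair_sub[OF SI])

context levi
begin

abbreviation J :: "('i \<times> nat) set" where "J \<equiv> Itilde S A"
abbreviation tm where "tm \<equiv> tmap I A alpha cor lam alphat cort lamt"
abbreviation lr where "lr \<equiv> LR lam lamt (%_. 0)"

definition hw where "hw p \<longleftrightarrow> p \<in> Bp lam & tdominant J cort (tm p)"

lemma lamd: "dom lam" "T.dom lamt" using bas by (auto simp: bas_def)
lemma JI: "J \<subseteq> It" using SI by (auto simp: Itilde_def)

text \<open>The endpoint of the lift agrees with p 1 only at copies not consumed by the word leading
  to p; hence the letter counts of this word in \<open>V.bas\<close>.\<close>

lemma hw_facts:
  assumes "hw p"
  obtains ws ns where "lr ws p (tm p) ns" "V.bas (p 1) (tm p 1) (count_list ws)" "Iso J alphat cort (tm p) (pi_lam (tm p 1))"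
    "good J alphat cort (tm p)" "good J alphat cort (pi_lam (tm p 1))" "tm p \<in> T.Bp lamt" "V.dom (p 1)" "V.T.dom (tm p 1)"
    "!!j. j \<in> J ==> mval cort j (tm p) = 0"
proof -
  have p: "p \<in> Bp lam" and td: "!!x t. x \<in> J ==> 0 <= t ==> t <= 1 ==> cort x (tm p t) >= 0" using assms by (auto simp: hw_def tdominant_def)
  obtain ws ns where l: "lr ws p (tm p) ns" using tmap_LR[OF bas p] by blast
  have q: "tm p \<in> T.Bp lamt" using LR_inv[OF bas l] by blast
  note mv = T.L.integral_mval[OF T.GLS_integral[OF lamd(2) q]]
  have d: "V.T.dom (tm p 1)" unfolding V.T.dom_def using td[of _ 1] mv(5) JI by auto
  have c: "cort (j, m) (tm p t) = cor j (p t)" if "(j, m) \<in> J" "A j j = 2 \<or> count_list ws j < m" for j m t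
    using LR_cor[OF bas l, of j m t] that JI by auto
  have d': "V.dom (p 1)" unfolding V.dom_def
  proof
    fix i assume i: "i \<in> S"
    \<comment> \<open>A copy of i in J on which path and lift have equal pairings, so dominance of
      the lift passes to p 1.\<close>
    define x where "x = (i, if A i i = 2 then 1 else count_list ws i + 1)"
    have "x \<in> J" using i by (simp add: x_def V.It_iff)
    thus "0 <= cor i (p 1) & cor i (p 1) \<in> \<int>" using d c[of i "snd x" 1] unfolding V.T.dom_def by (auto simp: x_def split: if_splits)
  qed
  have b: "V.bas (p 1) (tm p 1) (count_list ws)" unfolding V.bas_def using d d' c by auto
  have g: "good J alphat cort (tm p)" by (rule good_mono[OF T.GLS_good(1)[OF lamd(2) q] JI])
  have iso: "Iso J alphat cort (tm p) (pi_lam (tm p 1))" by (rule T.dominant_Iso[OF lamd(2) JI q td])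
  have m0: "mval cort j (tm p) = 0" if j: "j \<in> J" for j
  proof -
    have jI: "j \<in> It" using j JI by blast
    obtain t where "0 <= t" "t <= 1" "cort j (tm p t) = mval cort j (tm p)" using mv(4)[OF jI] by auto
    thus ?thesis using td[OF j, of t] mv(3)[OF jI] by simp
  qed
  show thesis by (rule that[OF l b iso g V.T.GLS_good(1)[OF d V.T.pi_lam_GLS] q d' d m0])
qed

lemma lw_J: "set ws \<subseteq> S ==> set (lw c ws0 ws) \<subseteq> J" by (rule V.lw_It)

text \<open>The word is labelled once, continuing the count of \<open>ws0\<close>. The same labelled
  word lifts its action on p and its action on the straight path to p 1, so \<open>Iso\<close> can
  compare the two.\<close>

lemma hw_word:
  assumes h: "lr ws0 p (tm p) ns" "V.bas (p 1) (tm p 1) (count_list ws0)" "Iso J alphat cort (tm p) (pi_lam (tm p 1))"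
    and ws: "set ws \<subseteq> S"
  defines "u \<equiv> lw (%_. 0) ws0 ws"
  shows "Fw alpha cor ws p = Some b ==> \<exists>y ns'. lr (ws0 @ ws) b y ns' & act alphat cort (map (Pair True) u) (tm p) = Some y"
    "Fw alpha cor ws (pi_lam (p 1)) = Some q ==> \<exists>z ns'. V.LR (p 1) (tm p 1) (count_list ws0) ws q z ns' & act alphat cort (map (Pair True) u) (pi_lam (tm p 1)) = Some z"
    "Fw alpha cor ws p = None \<longleftrightarrow> Fw alpha cor ws (pi_lam (p 1)) = None"
proof -
  have wI: "set ws \<subseteq> I" using ws SI by blast
  \<comment> \<open>Starting afresh with \<open>count_list ws0\<close> labels already taken gives
    the same labels as continuing after \<open>ws0\<close>.\<close>
  have u: "lw (count_list ws0) [] ws = u" using lw_shift[of "%_. 0" ws0 "[]" ws] by (simp add: u_def)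
  have uJ: "snd ` set (map (Pair True) u) \<subseteq> J" using lw_J[OF ws, of "%_. 0" ws0] by (auto simp: u_def)
  show 1: "Fw alpha cor ws p = Some b ==> \<exists>y ns'. lr (ws0 @ ws) b y ns' & act alphat cort (map (Pair True) u) (tm p) = Some y" for b
    using LR_word[OF bas h(1) wI, of b] by (auto simp: u_def Fw_act)
  show 2: "Fw alpha cor ws (pi_lam (p 1)) = Some q ==> \<exists>z ns'. V.LR (p 1) (tm p 1) (count_list ws0) ws q z ns' & act alphat cort (map (Pair True) u) (pi_lam (tm p 1)) = Some z" for q
    using V.LR_word[OF h(2) V.LR_base ws, of q] by (auto simp: u Fw_act)
  have 3: "Fw alpha cor ws p \<noteq> None" if "act alphat cort (map (Pair True) u) (tm p) = Some y" for y
    using LR_wordt[OF bas h(1) wI, of y] that by (auto simp: u_def Fw_act)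
  have 4: "Fw alpha cor ws (pi_lam (p 1)) \<noteq> None" if "act alphat cort (map (Pair True) u) (pi_lam (tm p 1)) = Some y" for y
    using V.LR_wordt[OF h(2) V.LR_base ws, of y] that by (auto simp: u Fw_act)
  have "act alphat cort (map (Pair True) u) (tm p) = None \<longleftrightarrow> act alphat cort (map (Pair True) u) (pi_lam (tm p 1)) = None"
    using h(3) uJ unfolding Iso_def by blast
  thus "Fw alpha cor ws p = None \<longleftrightarrow> Fw alpha cor ws (pi_lam (p 1)) = None"
    using 1 2 3 4 by (metis not_None_eq)
qed

lemma hw_def_iff: "hw p ==> set ws \<subseteq> S ==> Fw alpha cor ws p = None \<longleftrightarrow> Fw alpha cor ws (pi_lam (p 1)) = None"
  by (elim hw_facts) (rule hw_word(3))

text \<open>Equality of paths is equality of lifts, and this is a stabilizer condition by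
  \<open>act_loop\<close>; \<open>Iso\<close> carries it to the straight path, where the two
  translations are undone.\<close>

lemma hw_eq_iff:
  assumes p: "hw p" and w: "set ws \<subseteq> S" "set ws' \<subseteq> S" and b: "Fw alpha cor ws p = Some b" "Fw alpha cor ws' p = Some b'"
    and q: "Fw alpha cor ws (pi_lam (p 1)) = Some q" "Fw alpha cor ws' (pi_lam (p 1)) = Some q'"
  shows "b = b' \<longleftrightarrow> q = q'"
proof -
  obtain ws0 ns where h: "lr ws0 p (tm p) ns" "V.bas (p 1) (tm p 1) (count_list ws0)" "Iso J alphat cort (tm p) (pi_lam (tm p 1))"
    "good J alphat cort (tm p)" "good J alphat cort (pi_lam (tm p 1))" using hw_facts[OF p] by metis
  define u u' where "u = lw (%_. 0) ws0 ws" and "u' = lw (%_. 0) ws0 ws'"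
  obtain y n1 where y: "lr (ws0 @ ws) b y n1" "act alphat cort (map (Pair True) u) (tm p) = Some y" using hw_word(1)[OF h(1-3) w(1) b(1)] u_def by auto
  obtain y' n2 where y': "lr (ws0 @ ws') b' y' n2" "act alphat cort (map (Pair True) u') (tm p) = Some y'" using hw_word(1)[OF h(1-3) w(2) b(2)] u'_def by auto
  obtain z n3 where z: "V.LR (p 1) (tm p 1) (count_list ws0) ws q z n3" "act alphat cort (map (Pair True) u) (pi_lam (tm p 1)) = Some z" using hw_word(2)[OF h(1-3) w(1) q(1)] u_def by auto
  obtain z' n4 where z': "V.LR (p 1) (tm p 1) (count_list ws0) ws' q' z' n4" "act alphat cort (map (Pair True) u') (pi_lam (tm p 1)) = Some z'" using hw_word(2)[OF h(1-3) w(2) q(2)] u'_def by auto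
  have uJ: "set u \<subseteq> J" "set u' \<subseteq> J" using lw_J w by (auto simp: u_def u'_def)
  let ?w = "map (Pair True) u @ map (Pair False) (rev u')"
  have wJ: "snd ` set ?w \<subseteq> J" using uJ by auto
  have "b = b' \<longleftrightarrow> y = y'" using LR_determined[OF bas y(1)] LR_injective[OF bas y(1)] y'(1) by blast
  also have "... \<longleftrightarrow> act alphat cort ?w (tm p) = Some (tm p)" using V.T.L.act_loop[OF h(4) uJ y(2) y'(2) h(4)] by simp
  also have "... \<longleftrightarrow> act alphat cort ?w (pi_lam (tm p 1)) = Some (pi_lam (tm p 1))" using h(3) wJ unfolding Iso_def by blast
  also have "... \<longleftrightarrow> z = z'" using V.T.L.act_loop[OF h(5) uJ z(2) z'(2) h(5)] by simp
  also have "... \<longleftrightarrow> q = q'" using V.LR_determined[OF h(2) z(1)] V.LR_injective[OF h(2) z(1)] z'(1) by blast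
  finally show ?thesis .
qed

text \<open>The word W0 leads from the lift of p to that of p'. Applied to the straight path it
  gives a path on which no e_j acts, because none acts on the lift of p'; so it gives the straight
  path again. Hence W0 fixes the straight path and, by \<open>Iso\<close>, also the lift of p, which
  therefore equals that of p'.\<close>

lemma hw_unique:
  assumes p: "hw p" "hw p'" and w: "set ws \<subseteq> S" "set ws' \<subseteq> S" and b: "Fw alpha cor ws p = Some b" "Fw alpha cor ws' p' = Some b"
  shows "p = p'"
proof -
  obtain ws0 ns where h: "lr ws0 p (tm p) ns" "V.bas (p 1) (tm p 1) (count_list ws0)" "Iso J alphat cort (tm p) (pi_lam (tm p 1))"
    "good J alphat cort (tm p)" "good J alphat cort (pi_lam (tm p 1))" "V.T.dom (tm p 1)" using hw_facts[OF p(1)] by metis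
  obtain ws0' ns' where h': "lr ws0' p' (tm p') ns'" "V.bas (p' 1) (tm p' 1) (count_list ws0')" "Iso J alphat cort (tm p') (pi_lam (tm p' 1))"
    "good J alphat cort (tm p')" "!!j. j \<in> J ==> mval cort j (tm p') = 0" using hw_facts[OF p(2)] by metis
  define u u' where "u = lw (%_. 0) ws0 ws" and "u' = lw (%_. 0) ws0' ws'"
  obtain y n1 where y: "lr (ws0 @ ws) b y n1" "act alphat cort (map (Pair True) u) (tm p) = Some y" using hw_word(1)[OF h(1-3) w(1) b(1)] u_def by auto
  obtain y' n2 where y': "lr (ws0' @ ws') b y' n2" "act alphat cort (map (Pair True) u') (tm p') = Some y'" using hw_word(1)[OF h'(1-3) w(2) b(2)] u'_def by auto
  have uJ: "set u \<subseteq> J" "set u' \<subseteq> J" using lw_J w by (auto simp: u_def u'_def)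
  define W0 where "W0 = map (Pair True) u @ map (Pair False) (rev u')"
  have wJ: "snd ` set W0 \<subseteq> J" using uJ by (auto simp: W0_def)
  have "y = y'" using LR_determined[OF bas y(1) y'(1)] .
  hence a: "act alphat cort W0 (tm p) = Some (tm p')" unfolding W0_def using V.T.L.act_loop[OF h(4) uJ y(2) y'(2) h'(4)] by simp
  then obtain z where z: "act alphat cort W0 (pi_lam (tm p 1)) = Some z" using h(3) wJ unfolding Iso_def by (metis option.distinct(1) not_None_eq)
  have zB: "z \<in> V.T.Bp (tm p 1)" by (rule V.T.GLS_good(2)[OF h(6) V.T.pi_lam_GLS wJ z])
  have gz: "good J alphat cort z" by (rule good_act[OF h(5) z wJ])
  have e: "act alphat cort v (tm p') = None \<longleftrightarrow> act alphat cort v z = None" if "snd ` set v \<subseteq> J" for v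
  proof -
    have "snd ` set (W0 @ v) \<subseteq> J" using that wJ by auto
    hence "act alphat cort (W0 @ v) (tm p) = None \<longleftrightarrow> act alphat cort (W0 @ v) (pi_lam (tm p 1)) = None" using h(3) unfolding Iso_def by blast
    thus ?thesis using a z by (simp add: act_append)
  qed
  have "mval cort j z = 0" if "j \<in> J" for j using V.T.L.count_mval(1)[OF h'(4) gz that e] h'(5)[OF that] by simp
  hence "z = pi_lam (tm p 1)" using V.T.GLS_hw[OF h(6) zB] by blast
  hence "act alphat cort W0 (tm p) = Some (tm p)" using z h(3) wJ unfolding Iso_def by blast
  hence "tm p = tm p'" using a by simp
  thus ?thesis using LR_injective[OF bas h(1)] h'(1) by metis
qed

text \<open>The graph of the isomorphism, b to (p, q), with the word left open; that the choice of
  the word does not matter is \<open>rel_unique\<close>.\<close>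

definition rel where
  "rel b p q \<longleftrightarrow> hw p & (\<exists>ws. set ws \<subseteq> S & Fw alpha cor ws p = Some b & Fw alpha cor ws (pi_lam (p 1)) = Some q)"

lemma rel_unique: "rel b p q ==> rel b p' q' ==> p = p' & q = q'"
  unfolding rel_def using hw_unique hw_eq_iff by metis

lemma rel_inj: "rel b p q ==> rel b' p q ==> b = b'"
  unfolding rel_def using hw_eq_iff by metis

lemma rel_mem:
  assumes "rel b p q"
  shows "b \<in> Bp lam" "q \<in> V.Bp (p 1)" "V.dom (p 1)" "hw p" "q 1 = b 1"
proof -
  obtain ws where ws: "hw p" "set ws \<subseteq> S" "Fw alpha cor ws p = Some b" "Fw alpha cor ws (pi_lam (p 1)) = Some q" using assms by (auto simp: rel_def)
  have d: "V.dom (p 1)" using hw_facts[OF ws(1)] by metis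
  have "set ws \<subseteq> I" using ws SI by blast
  hence 1: "b \<in> Bp lam" "b 1 = p 1 - (\<Sum>i\<leftarrow>ws. alpha i)" using Fw_end[OF lamd(1) _ _ ws(3)] ws(1) by (auto simp: hw_def)
  have 2: "q \<in> V.Bp (p 1)" "q 1 = pi_lam (p 1) 1 - (\<Sum>i\<leftarrow>ws. alpha i)" using V.Fw_end[OF d V.pi_lam_GLS ws(2,4)] by auto
  show "b \<in> Bp lam" "q \<in> V.Bp (p 1)" "V.dom (p 1)" "hw p" "q 1 = b 1" using 1 2 d ws(1) by (auto simp: pi_lam_def)
qed

lemma rel_f:
  assumes r: "rel b p q" and i: "i \<in> S"
  shows "f_root alpha cor i b = Some b' ==> \<exists>q'. f_root alpha cor i q = Some q' & rel b' p q'"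
    "f_root alpha cor i q = Some q' ==> \<exists>b'. f_root alpha cor i b = Some b' & rel b' p q'"
proof -
  obtain ws where ws: "hw p" "set ws \<subseteq> S" "Fw alpha cor ws p = Some b" "Fw alpha cor ws (pi_lam (p 1)) = Some q" using r by (auto simp: rel_def)
  have s: "set (ws @ [i]) \<subseteq> S" using ws i by auto
  have e: "Fw alpha cor (ws @ [i]) p = f_root alpha cor i b" "Fw alpha cor (ws @ [i]) (pi_lam (p 1)) = f_root alpha cor i q" using ws by (auto simp: Fw_snoc)
  have n: "f_root alpha cor i b = None \<longleftrightarrow> f_root alpha cor i q = None" using hw_def_iff[OF ws(1) s] e by simp
  have r': "rel b' p q'" if "f_root alpha cor i b = Some b'" "f_root alpha cor i q = Some q'" for b' q'
    unfolding rel_def using ws(1) s e that by metis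
  show "f_root alpha cor i b = Some b' ==> \<exists>q'. f_root alpha cor i q = Some q' & rel b' p q'" using n r' by (cases "f_root alpha cor i q") auto
  show "f_root alpha cor i q = Some q' ==> \<exists>b'. f_root alpha cor i b = Some b' & rel b' p q'" using n r' by (cases "f_root alpha cor i b") auto
qed

text \<open>Strip off letters of S as long as possible. Where none can be removed, the lift is
  dominant by \<open>highest_dominant\<close>, and the path is the head of its own
  component.\<close>

lemma rel_total: "b \<in> Bp lam ==> \<exists>p q. rel b p q"
proof (induction "nat \<lfloor>ht (lam - b 1)\<rfloor>" arbitrary: b rule: less_induct)
  case less
  show ?case
  proof (cases "\<exists>i\<in>S. \<exists>r\<in>Bp lam. fstep alpha cor i r b")
    case True
    then obtain i r where r: "i \<in> S" "r \<in> Bp lam" "fstep alpha cor i r b" by blast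
    have iI: "i \<in> I" using r SI by blast
    have "ht (lam - b 1) = ht (lam - r 1) + 1" using fstep_end[OF r(3)] iI by (simp add: ht_alpha)
    moreover have "ht (lam - r 1) >= 0" using cone_ht[OF GLS_ht[OF lamd(1) r(2)]] .
    ultimately have "nat \<lfloor>ht (lam - r 1)\<rfloor> < nat \<lfloor>ht (lam - b 1)\<rfloor>" by linarith
    then obtain p q where "rel r p q" using less.hyps r(2) by blast
    moreover have "f_root alpha cor i r = Some b" using GLS_f(1)[OF lamd(1) r(2) iI] r(3) by blast
    ultimately show ?thesis using rel_f(1) r(1) by blast
  next
    case False
    obtain ws ns where l: "lr ws b (tm b) ns" using tmap_LR[OF bas less.prems] by blast
    have "tdominant (Stilde S A) cort (tm b)" by (rule highest_dominant[OF bas l SI]) (use False in blast)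
    hence "hw b" using less.prems by (simp add: hw_def Stilde_Itilde)
    hence "rel b b (pi_lam (b 1))" unfolding rel_def by (auto intro!: exI[of _ "[]"])
    thus ?thesis by blast
  qed
qed

lemma rel_surj:
  assumes "hw p" "q \<in> V.Bp (p 1)"
  shows "\<exists>b. rel b p q"
proof -
  have d: "V.dom (p 1)" using hw_facts[OF assms(1)] by metis
  obtain ws where ws: "set ws \<subseteq> S" "Fw alpha cor ws (pi_lam (p 1)) = Some q" using V.Bp_word[OF d assms(2)] by blast
  thus ?thesis using hw_def_iff[OF assms(1) ws(1)] assms(1) by (auto simp: rel_def)
qed

text \<open>Compatibility with e_i follows from that with f_i: a predecessor on either side has a
  partner by \<open>rel_total\<close> or \<open>rel_surj\<close>, and f_i leads from the partner to
  the given element because the relation is unique in both directions.\<close>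

lemma rel_e:
  assumes r: "rel b p q" and i: "i \<in> S"
  shows "b' \<in> Bp lam ==> fstep alpha cor i b' b ==> \<exists>q'. q' \<in> V.Bp (p 1) & fstep alpha cor i q' q & rel b' p q'"
    "q' \<in> V.Bp (p 1) ==> fstep alpha cor i q' q ==> \<exists>b'. b' \<in> Bp lam & fstep alpha cor i b' b & rel b' p q'"
proof -
  have iI: "i \<in> I" using i SI by blast
  note m = rel_mem[OF r]
  show "\<exists>q'. q' \<in> V.Bp (p 1) & fstep alpha cor i q' q & rel b' p q'" if b': "b' \<in> Bp lam" "fstep alpha cor i b' b"
  proof -
    obtain p' q' where r': "rel b' p' q'" using rel_total b' by blast
    have "f_root alpha cor i b' = Some b" using GLS_f(1)[OF lamd(1) b'(1) iI, of b] b'(2) by blast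
    then obtain q'' where q'': "f_root alpha cor i q' = Some q''" "rel b p' q''" using rel_f(1)[OF r' i] by blast
    have e: "p' = p" "q'' = q" using rel_unique[OF q''(2) r] by auto
    have "fstep alpha cor i q' q" using V.GLS_f(1)[OF rel_mem(3,2)[OF r'] i, of q] q''(1) e by blast
    thus ?thesis using rel_mem(2)[OF r'] r' e by blast
  qed
  show "\<exists>b'. b' \<in> Bp lam & fstep alpha cor i b' b & rel b' p q'" if q': "q' \<in> V.Bp (p 1)" "fstep alpha cor i q' q"
  proof -
    obtain b' where r': "rel b' p q'" using rel_surj[OF m(4) q'(1)] by blast
    have "f_root alpha cor i q' = Some q" using V.GLS_f(1)[OF m(3) q'(1) i, of q] q'(2) by blast
    then obtain b'' where b'': "f_root alpha cor i b' = Some b''" "rel b'' p q" using rel_f(2)[OF r' i] by blast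
    have "b'' = b" using rel_inj[OF b''(2) r] .
    hence "fstep alpha cor i b' b" using GLS_f(1)[OF lamd(1) rel_mem(1)[OF r'] iI, of b] b''(1) by blast
    thus ?thesis using rel_mem(1)[OF r'] r' by blast
  qed
qed

text \<open>Minus the minimum counts the possible applications of e_i, and \<open>rel_e\<close>
  transports each of them.\<close>

lemma rel_mval:
  assumes r: "rel b p q" and i: "i \<in> S" "A i i = 2"
  shows "mval cor i b = mval cor i q"
proof -
  have iR: "i \<in> R" "i \<in> V.R" using i SI by (auto simp: R_def V.R_def)
  interpret L: letter alpha cor i by (rule letter_R[OF iR(1)])
  have Lb: "LI (%t. cor i (b t))" if "b \<in> Bp lam" for b using GLS_LI[OF that iR(1)] dom_R[OF lamd(1) iR(1)] by blast
  have Lq: "LI (%t. cor i (q t))" if "q \<in> V.Bp x" "V.dom x" for q x using V.GLS_LI[OF that(1) iR(2)] V.dom_R[OF that(2) iR(2)] by blast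
  have ind: "rel b p q ==> mval cor i b = - real n ==> mval cor i q = - real n" for n b q
  proof (induction n arbitrary: b q)
    case 0
    note m = rel_mem[OF 0(1)]
    show ?case
    proof (rule ccontr)
      assume "mval cor i q \<noteq> - real 0"
      then obtain q' where q': "fstep alpha cor i q' q" using L.LI_e[OF Lq[OF m(2,3)] V.GLS_clamped[OF m(2)]] by auto
      hence "q' \<in> V.Bp (p 1)" using V.GLS_fstep_rev[OF q' m(2) iR(2)] V.dom_R[OF m(3) iR(2)] by blast
      then obtain b' where b': "b' \<in> Bp lam" "fstep alpha cor i b' b" using rel_e(2)[OF 0(1) i(1) _ q'] by blast
      show False using L.fstep_facts(5)[OF b'(2)] L.LI_mval(3)[OF Lb[OF b'(1)]] 0(2) by simp
    qed
  next
    case (Suc n)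
    note m = rel_mem[OF Suc.prems(1)]
    obtain b' where b': "fstep alpha cor i b' b" using L.LI_e[OF Lb[OF m(1)] GLS_clamped[OF m(1)]] Suc.prems(2) by auto
    hence b'B: "b' \<in> Bp lam" using GLS_fstep_rev[OF b' m(1) iR(1)] dom_R[OF lamd(1) iR(1)] by blast
    then obtain q' where q': "fstep alpha cor i q' q" "rel b' p q'" using rel_e(1)[OF Suc.prems(1) i(1) b'B b'] by blast
    have "mval cor i b' = - real n" using L.fstep_facts(5)[OF b'] Suc.prems(2) by simp
    thus ?case using Suc.IH[OF q'(2)] L.fstep_facts(5)[OF q'(1)] by simp
  qed
  have "mval cor i b \<in> \<int>" "mval cor i b <= 0" using L.LI_mval(1,3)[OF Lb[OF rel_mem(1)[OF r]]] by auto
  then obtain k :: int where k: "mval cor i b = of_int k" "k <= 0" by (auto elim!: Ints_cases)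
  hence "mval cor i b = - real (nat (- k))" by simp
  thus ?thesis using ind[OF r] by metis
qed

theorem levi_iso:
  "crystal_iso_on S (Bp lam) (cr_e A alpha cor (Bp lam)) (cr_f alpha cor) (cr_eps A cor) (cr_phi A cor) cr_wt
     (Uset I S A alpha cor lam alphat cort lamt) (U_e S A alpha cor) (U_f alpha cor)
     (%i x. cr_eps A cor i (snd x)) (%i x. cr_phi A cor i (snd x)) (%x. cr_wt (snd x))"
proof -
  define Ph where "Ph b = (SOME x. rel b (fst x) (snd x))" for b
  have Ph: "rel b (fst (Ph b)) (snd (Ph b))" if "b \<in> Bp lam" for b
    unfolding Ph_def by (rule someI_ex) (use rel_total[OF that] in auto)
  have PhI: "Ph b = (p, q)" if "rel b p q" for b p q
    using rel_unique[OF Ph[OF rel_mem(1)[OF that]] that] by (simp add: prod_eq_iff)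
  have U: "x \<in> Uset I S A alpha cor lam alphat cort lamt \<longleftrightarrow> hw (fst x) & snd x \<in> V.Bp (fst x 1)" for x
    by (cases x) (auto simp: Uset_def hw_def Stilde_Itilde)
  have bij: "bij_betw Ph (Bp lam) (Uset I S A alpha cor lam alphat cort lamt)"
  proof (rule bij_betwI')
    fix b b' assume b: "b \<in> Bp lam" "b' \<in> Bp lam"
    show "Ph b = Ph b' \<longleftrightarrow> b = b'" using rel_inj[OF Ph[OF b(1)], of b'] Ph[OF b(2)] by auto
  next
    fix b assume "b \<in> Bp lam"
    thus "Ph b \<in> Uset I S A alpha cor lam alphat cort lamt" unfolding U using rel_mem(2,4)[OF Ph] by blast
  next
    fix x assume "x \<in> Uset I S A alpha cor lam alphat cort lamt"
    then obtain b where b: "rel b (fst x) (snd x)" unfolding U using rel_surj by blast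
    thus "\<exists>b\<in>Bp lam. x = Ph b" using PhI[OF b] rel_mem(1)[OF b] by auto
  qed
  have mor: "cr_wt (snd (Ph b)) = cr_wt b & (\<forall>i\<in>S. cr_eps A cor i (snd (Ph b)) = cr_eps A cor i b & cr_phi A cor i (snd (Ph b)) = cr_phi A cor i b &
      U_e S A alpha cor i (Ph b) = map_option Ph (cr_e A alpha cor (Bp lam) i b) & U_f alpha cor i (Ph b) = map_option Ph (cr_f alpha cor i b))"
    if b: "b \<in> Bp lam" for b
  proof -
    obtain p q where pq: "Ph b = (p, q)" and r: "rel b p q" using Ph[OF b] by (cases "Ph b") auto
    note m = rel_mem[OF r]
    have 1: "cr_eps A cor i q = cr_eps A cor i b & cr_phi A cor i q = cr_phi A cor i b" if "i \<in> S" for i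
      using rel_mval[OF r that] m(5) by (simp add: cr_eps_def cr_phi_def)
    have 2: "U_f alpha cor i (Ph b) = map_option Ph (cr_f alpha cor i b)" if i: "i \<in> S" for i
    proof (cases "f_root alpha cor i b")
      case None
      hence "f_root alpha cor i q = None" using rel_f(2)[OF r i] by (cases "f_root alpha cor i q") auto
      thus ?thesis using None pq by (simp add: U_f_def cr_f_def)
    next
      case (Some b')
      then obtain q' where q': "f_root alpha cor i q = Some q'" "rel b' p q'" using rel_f(1)[OF r i] by blast
      thus ?thesis using Some pq PhI[OF q'(2)] by (simp add: U_f_def cr_f_def)
    qed
    have 3: "U_e S A alpha cor i (Ph b) = map_option Ph (cr_e A alpha cor (Bp lam) i b)" if i: "i \<in> S" for i
    proof -
      have iI: "i \<in> I" using i SI by blast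
      note eb = GLS_e[OF lamd(1) b iI] and eq = V.GLS_e[OF m(3,2) i]
      show ?thesis
      proof (cases "cr_e A alpha cor (Bp lam) i b")
        case None
        have "cr_e A alpha cor (V.Bp (p 1)) i q = None"
        proof (cases "cr_e A alpha cor (V.Bp (p 1)) i q")
          case (Some q')
          hence "q' \<in> V.Bp (p 1)" "fstep alpha cor i q' q" using eq[of q'] by auto
          thus ?thesis using rel_e(2)[OF r i] None eb by fastforce
        qed simp
        thus ?thesis using None pq by (simp add: U_e_def)
      next
        case (Some b')
        hence "b' \<in> Bp lam" "fstep alpha cor i b' b" using eb[of b'] by auto
        then obtain q' where q': "q' \<in> V.Bp (p 1)" "fstep alpha cor i q' q" "rel b' p q'" using rel_e(1)[OF r i] by blast
        hence "cr_e A alpha cor (V.Bp (p 1)) i q = Some q'" using eq[of q'] by blast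
        thus ?thesis using Some pq PhI[OF q'(3)] by (simp add: U_e_def)
      qed
    qed
    show ?thesis using 1 2 3 pq m(5) by (simp add: cr_wt_def)
  qed
  show ?thesis unfolding crystal_iso_on_def using bij mor by blast
qed

end

section \<open>Dual functionals, and the theorem for a given datum\<close>

text \<open>The simple roots are independent, so any values prescribed on them extend to a linear
  functional on the whole space; this supplies \<open>co\<close> and \<open>ht\<close>.\<close>

lemma dual_functionals:
  fixes alpha :: "'i => 'v::real_vector"
  assumes li: "\<forall>F c. finite F --> F \<subseteq> I --> (\<Sum>i\<in>F. c i *\<^sub>R alpha i) = 0 --> (\<forall>i\<in>F. c i = 0)"
  shows "\<exists>(co :: 'i => 'v => real) ht. (\<forall>i. linear (co i)) & linear ht & (\<forall>i\<in>I. \<forall>j\<in>I. co i (alpha j) = (if i = j then 1 else 0)) & (\<forall>i\<in>I. ht (alpha i) = (1::real))"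
proof -
  have inj: "inj_on alpha I"
  proof (rule inj_onI, rule ccontr)
    fix i j assume ij: "i \<in> I" "j \<in> I" "alpha i = alpha j" "i \<noteq> j"
    show False using li[rule_format, of "{i, j}" "%k. if k = i then 1 else -1" i] ij by simp
  qed
  have ind: "independent (alpha ` I)"
    unfolding independent_explicit_module
  proof (intro allI impI)
    fix t u v assume t: "finite t" "t \<subseteq> alpha ` I" "(\<Sum>v\<in>t. u v *\<^sub>R v) = 0" "v \<in> t"
    obtain F where F: "F \<subseteq> I" "t = alpha ` F" "inj_on alpha F" using t(2) inj by (metis subset_imageE inj_on_subset)
    have "(\<Sum>i\<in>F. u (alpha i) *\<^sub>R alpha i) = 0" using t(3) F(3) by (simp add: F(2) sum.reindex)
    moreover have "finite F" using t(1) F(2,3) by (simp add: finite_image_iff)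
    ultimately show "u v = 0" using li[rule_format, of F "%i. u (alpha i)"] F(1,2) t(4) by auto
  qed
  have ex: "\<exists>g :: 'v => real. linear g & (\<forall>i\<in>I. g (alpha i) = f i)" for f
  proof -
    obtain g :: "'v => real" where g: "linear g" "\<forall>x\<in>alpha ` I. g x = f (inv_into I alpha x)" using linear_independent_extend[OF ind, of "%x. f (inv_into I alpha x)"] by blast
    thus ?thesis using inj by (intro exI[of _ g]) auto
  qed
  have "\<forall>i. \<exists>g :: 'v => real. linear g & (\<forall>j\<in>I. g (alpha j) = (if i = j then 1 else 0))" by (intro allI ex)
  then obtain co :: "'i => 'v => real" where "\<forall>i. linear (co i) & (\<forall>j\<in>I. co i (alpha j) = (if i = j then 1 else 0))" by metis
  moreover obtain ht :: "'v => real" where "linear ht & (\<forall>i\<in>I. ht (alpha i) = 1)" using ex[of "%_. 1"] by blast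
  ultimately show ?thesis by blast
qed

theorem theorem7p2p2:
  fixes I S :: "'i set" and A :: "'i \<Rightarrow> 'i \<Rightarrow> int"
    and alpha :: "'i \<Rightarrow> 'v::real_vector" and cor :: "'i \<Rightarrow> 'v \<Rightarrow> real" and P :: "'v set"
    and alphat :: "'i \<times> nat \<Rightarrow> 'w::real_vector" and cort :: "'i \<times> nat \<Rightarrow> 'w \<Rightarrow> real"
    and Pt :: "'w set" and lam :: 'v and lamt :: 'w
  assumes datum: "BC_datum I A alpha cor P"
    and symm: "symmetrizable I A"
    and ev: "even_datum I A"
    and tdatum: "BC_datum (Itilde I A) (Atilde A) alphat cort Pt"
    and lam: "lam \<in> Pplus I cor P"
    and lamt: "lamt \<in> Pt"
    and lamt_cor: "\<forall>x\<in>Itilde I A. cort x lamt = cor (fst x) lam"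
    and S: "S \<subseteq> I"
  shows "crystal_iso_on S
           (GLS I A alpha cor lam)
           (cr_e A alpha cor (GLS I A alpha cor lam)) (cr_f alpha cor)
           (cr_eps A cor) (cr_phi A cor) cr_wt
           (Uset I S A alpha cor lam alphat cort lamt)
           (U_e S A alpha cor) (U_f alpha cor)
           (\<lambda>i x. cr_eps A cor i (snd x)) (\<lambda>i x. cr_phi A cor i (snd x)) (\<lambda>x. cr_wt (snd x))"
proof -
  have D: "!!i. i \<in> I ==> A i i = 2 \<or> A i i <= 0" "!!i j. i \<in> I ==> j \<in> I ==> i \<noteq> j ==> A i j <= 0" "!!i j. i \<in> I ==> j \<in> I ==> A i j = 0 \<longleftrightarrow> A j i = 0"
    "!!i. i \<in> I ==> linear (cor i)" "!!i j. i \<in> I ==> j \<in> I ==> cor i (alpha j) = of_int (A i j)"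
    "\<forall>F c. finite F --> F \<subseteq> I --> (\<Sum>i\<in>F. c i *\<^sub>R alpha i) = 0 --> (\<forall>i\<in>F. c i = 0)" "!!i x. i \<in> I ==> x \<in> P ==> cor i x \<in> \<int>"
    using datum by (simp_all add: BC_datum_def)
  have E: "!!x y. x \<in> Itilde I A ==> y \<in> Itilde I A ==> x \<noteq> y ==> Atilde A x y <= 0"
    "!!x. x \<in> Itilde I A ==> linear (cort x)" "!!x y. x \<in> Itilde I A ==> y \<in> Itilde I A ==> cort x (alphat y) = of_int (Atilde A x y)"
    "\<forall>F c. finite F --> F \<subseteq> Itilde I A --> (\<Sum>i\<in>F. c i *\<^sub>R alphat i) = 0 --> (\<forall>i\<in>F. c i = 0)"
    using tdatum by (simp_all add: BC_datum_def)
  obtain d :: "'i => real" where d: "!!i. i \<in> I ==> d i > 0" "!!i j. i \<in> I ==> j \<in> I ==> d i * A i j = d j * A j i"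
    using symm unfolding symmetrizable_def by blast
  obtain co :: "'i => 'v => real" and ht :: "'v => real" where c: "!!i. linear (co i)" "linear ht"
    "!!i j. i \<in> I ==> j \<in> I ==> co i (alpha j) = (if i = j then 1 else 0)" "!!i. i \<in> I ==> ht (alpha i) = 1"
    using dual_functionals[OF D(6)] by blast
  obtain cot :: "'i \<times> nat => 'w => real" and htt :: "'w => real" where ct: "!!i. linear (cot i)" "linear htt"
    "!!i j. i \<in> Itilde I A ==> j \<in> Itilde I A ==> cot i (alphat j) = (if i = j then 1 else 0)" "!!i. i \<in> Itilde I A ==> htt (alphat i) = 1"
    using dual_functionals[OF E(4)] by blast
  have It: "x \<in> Itilde I A ==> fst x \<in> I" for x by (auto simp: Itilde_def)
  have T2: "Atilde A x x = 2" for x by (simp add: Atilde_def)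
  interpret idat I A alpha cor co ht d
  proof (intro idat.intro rdat.intro idat_axioms.intro, goal_cases)
    case (12 i j) thus ?case using D(1)[of i] D(2)[of i j] D(5) by (cases "i = j") auto
  qed (simp_all add: D c d)
  \<comment> \<open>Off the diagonal \<open>Atilde\<close> has entries of A, so the symmetrizer of A
    pulled back along \<open>fst\<close> serves for it.\<close>
  interpret T: kdat "Itilde I A" "Atilde A" alphat cort cot htt "%x. d (fst x)"
  proof (intro kdat.intro rdat.intro kdat_axioms.intro, goal_cases)
    case (10 x y) thus ?case using d(2)[OF It It, of x y] by (simp add: E(3) Atilde_def)
  qed (simp_all add: E ct d(1) It T2)
  interpret pair I A alpha cor co ht d alphat cort cot htt "%x. d (fst x)"
    by unfold_locales (use D(3,5) E(3) in auto)
  have dl: "dom lam" unfolding dom_def using lam D(7) by (auto simp: Pplus_def)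
  have "T.dom lamt" unfolding T.dom_def using dl lamt_cor It by (auto simp: dom_def)
  then interpret levi I A alpha cor co ht d alphat cort cot htt "%x. d (fst x)" S lam lamt
    by unfold_locales (use S dl lamt_cor in \<open>auto simp: bas_def\<close>)
  show ?thesis by (rule levi_iso)
qed

end
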